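(* Let $Q\to X$ be a continuous principal $G$-bundle over a compact metric space $X$, with projection $\pi:\mathbb{E}\to X$ of its maximal flag bundle, let $\phi$ be a continuous automorphism of $Q$, and let $\nu$ be an ergodic $\phi$-invariant probability measure on $X$. Given $w\in\mathcal{W}$ there exists an invariant ergodic measure $\mu^w$ on $\mathbb{E}$ with $\pi_*\mu^w=\nu$ such that $$\int q\,d\mu^w=w^{-1}H_{\mathrm{Ly}}$$ and $\mu^w(\mathrm{st}(w))=1$.
   Context: Lie notation. $G$ is a noncompact semi-simple Lie group, or more generally a reductive Lie group with noncompact semi-simple component, with Lie algebra $\mathfrak{g}$. Fix a Cartan decomposition $\mathfrak{g}=\mathfrak{k}\oplus\mathfrak{s}$, a maximal abelian $\mathfrak{a}\subset\mathfrak{s}$, the set $\Pi$ of roots of $(\mathfrak{g},\mathfrak{a})$ with root spaces $\mathfrak{g}_\alpha$, positive roots $\Pi^+$ and simple roots $\Sigma$. Put $\mathfrak{n}=\sum_{\alpha\in\Pi^+}\mathfrak{g}_\alpha$, $\mathfrak{a}^+=\{H\in\mathfrak{a}:\alpha(H)>0,\ \alpha\in\Sigma\}$ with closure $\mathrm{cl}\,\mathfrak{a}^+$, $K=\exp\mathfrak{k}$ (maximal compact), $A=\exp\mathfrak{a}$, $N=\exp\mathfrak{n}$, $S=\exp\mathfrak{s}$; $G=KAN=KS=K(\mathrm{cl}\exp\mathfrak{a}^+)K$. $\mathcal{W}$ is the Weyl group (normalizer modulo centralizer of $\mathfrak{a}$ in $K$); for $\Theta\subset\Sigma$, $\langle\Theta\rangle$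 is the set of roots spanned over $\mathbb{Z}$ by $\Theta$. $P$ is the minimal parabolic subgroup (normalizer in $G$ of $\mathfrak{m}\oplus\mathfrak{a}\oplus\mathfrak{n}$, $\mathfrak{m}$ the centralizer of $\mathfrak{a}$ in $\mathfrak{k}$) and $\mathbb{F}=G/P$ is the maximal flag manifold, with origin $b_0$. For $H\in\mathrm{cl}\,\mathfrak{a}^+$: $\Theta(H)=\{\alpha\in\Sigma:\alpha(H)=0\}$, $Z_H=\{g\in G:\mathrm{Ad}(g)H=H\}$, $K_H=Z_H\cap K$, $N_H^-=\exp\sum_{\alpha\in\Pi^+\setminus\langle\Theta(H)\rangle}\mathfrak{g}_{-\alpha}$. For $D=\mathrm{Ad}(g)H$, $w\in\mathcal{W}$: $\mathrm{st}(D,w)=gN_H^-K_H\cdot wb_0\subset\mathbb{F}$. Bundles and flow. $\phi$ generates a discrete-time flow $\phi_n$ on $Q$; the induced flows on $X$ and on associated bundles are also denoted $\phi$. $\mathbb{E}=Q\times_G\mathbb{F}$ is the maximal flag bundle. Fix a continuous $K$-subbundle $R\subset Q$. For $r\in R$ write $\phi_n(r)=r'\cdot hn'$ with $r'\in R$, $h\in A$, $n'\in N$, and put $\mathsf{a}(n,r)=\log h\in\mathfrak{a}$; this factors through $R\to\mathbb{E}$, $r\mapsto r\cdot b_0$, to an additive cocycle $\mathsf{a}(n,\xi)$ over the flow on $\mathbb{E}$. Put $q(\xi)=\mathsf{a}(1,\xi)$. Also write $\phi_n(r)=r''\cdot s$, $r''\in R$, $s\in S$, $s=k\exp(\mathsf{a}^+(n,r))k^{-1}$,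 $k\in K$, $\mathsf{a}^+(n,r)\in\mathrm{cl}\,\mathfrak{a}^+$. Multiplicative Ergodic Theorem (known). There are a set $\Omega\subset X$ of full $\nu$-measure, $H_{\mathrm{Ly}}=H_{\mathrm{Ly}}(\nu)\in\mathrm{cl}\,\mathfrak{a}^+$ (polar exponent) with $\lim_k\frac1k\mathsf{a}^+(k,r)=H_{\mathrm{Ly}}$ for $r\in R$ above $\Omega$, and a measurable $\phi$-invariant section $\chi_{\mathrm{Ly}}$ over $\Omega$ of $Q\times_G\mathrm{Ad}(G)H_{\mathrm{Ly}}$ with $\lim_{k\to+\infty}\frac1k\mathsf{a}(k,\xi)=w^{-1}H_{\mathrm{Ly}}$ for $\xi\in\mathrm{st}(\chi_{\mathrm{Ly}}(x),w)$, $x\in\Omega$, where $\mathrm{st}(\chi_{\mathrm{Ly}}(x),w)=p\cdot\mathrm{st}(D,w)$ if $\chi_{\mathrm{Ly}}(x)=p\cdot D$, $p\in Q$. $\mathrm{st}(w)=\bigcup_{x\in\Omega}\mathrm{st}(\chi_{\mathrm{Ly}}(x),w)$. *)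

theory Defs
  imports
    "HOL-Probability.Probability"
    "HOL-Algebra.Coset"
    "HOL-Algebra.Left_Coset"
    "HOL-Algebra.Generated_Groups"
begin

section \<open>Borel sets, quotients, ergodic measures\<close>

definition borel_of :: "'a topology \<Rightarrow> 'a measure" where
  "borel_of T = sigma (topspace T) {U. openin T U}"

definition quotient_top :: "'a topology \<Rightarrow> ('a \<Rightarrow> 'b) \<Rightarrow> 'b topology" where
  "quotient_top T p =
     topology (\<lambda>U. U \<subseteq> p ` topspace T \<and> openin T {x \<in> topspace T. p x \<in> U})"

lemma openin_quotient_top:
  "openin (quotient_top T p) U \<longleftrightarrow>
     U \<subseteq> p ` topspace T \<and> openin T {x \<in> topspace T. p x \<in> U}"
proof -
  have "istopology (\<lambda>U. U \<subseteq> p ` topspace T \<and> openin T {x \<in> topspace T. p x \<in> U})"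
    unfolding istopology_def
  proof (rule conjI; safe)
    fix U V
    assume "openin T {x \<in> topspace T. p x \<in> U}" "openin T {x \<in> topspace T. p x \<in> V}"
    then have "openin T ({x \<in> topspace T. p x \<in> U} \<inter> {x \<in> topspace T. p x \<in> V})"
      by (rule openin_Int)
    moreover have "{x \<in> topspace T. p x \<in> U} \<inter> {x \<in> topspace T. p x \<in> V}
        = {x \<in> topspace T. p x \<in> U \<inter> V}" by blast
    ultimately show "openin T {x \<in> topspace T. p x \<in> U \<inter> V}" by simp
  next
    fix \<K> assume K: "\<forall>U\<in>\<K>. U \<subseteq> p ` topspace T \<and> openin T {x \<in> topspace T. p x \<in> U}"
    have "openin T (\<Union>U\<in>\<K>. {x \<in> topspace T. p x \<in> U})"
      using K by (intro openin_Union) auto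
    moreover have "(\<Union>U\<in>\<K>. {x \<in> topspace T. p x \<in> U}) = {x \<in> topspace T. p x \<in> \<Union>\<K>}"
      by blast
    ultimately show "openin T {x \<in> topspace T. p x \<in> \<Union>\<K>}" by simp
  qed blast+
  then show ?thesis
    unfolding quotient_top_def by (simp add: topology_inverse')
qed

definition ergodic_measure :: "'a topology \<Rightarrow> ('a \<Rightarrow> 'a) \<Rightarrow> 'a measure \<Rightarrow> bool" where
  "ergodic_measure T f M \<longleftrightarrow>
     prob_space M \<and> sets M = sets (borel_of T) \<and>
     f \<in> M \<rightarrow>\<^sub>M M \<and> distr M M f = M \<and>
     (\<forall>A\<in>sets M. f -` A \<inter> space M = A \<longrightarrow> measure M A \<in> {0, 1})"

section \<open>Lie groups\<close>

text \<open>For open \<open>S\<close>: all iterated directional derivatives exist and are continuous.\<close>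

primrec C_k_on :: "nat \<Rightarrow> 'a::euclidean_space set \<Rightarrow> ('a \<Rightarrow> 'b::real_normed_vector) \<Rightarrow> bool" where
  "C_k_on 0 = (\<lambda>S f. continuous_on S f)"
| "C_k_on (Suc k) = (\<lambda>S f. f differentiable_on S \<and>
      (\<forall>v. C_k_on k S (\<lambda>x. frechet_derivative f (at x) v)))"

definition smooth_on :: "'a::euclidean_space set \<Rightarrow> ('a \<Rightarrow> 'b::real_normed_vector) \<Rightarrow> bool" where
  "smooth_on S f \<longleftrightarrow> (\<forall>k. C_k_on k S f)"

text \<open>A chart is a pair of its domain and its coordinate map. The coordinate space \<open>'l\<close> also
  serves as the Lie algebra: a tangent vector at the identity is identified with its coordinates
  in the chart \<open>chart_one\<close>.\<close>

record ('g, 'l) lie_data = "'g monoid" +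
  topol :: "'g topology"
  atlas :: "('g set \<times> ('g \<Rightarrow> 'l)) set"
  chart_one :: "'g set \<times> ('g \<Rightarrow> 'l)"
  expo :: "'l \<Rightarrow> 'g"

definition is_chart :: "'g topology \<Rightarrow> 'g set \<Rightarrow> ('g \<Rightarrow> 'l::euclidean_space) \<Rightarrow> bool" where
  "is_chart T U c \<longleftrightarrow> openin T U \<and> open (c ` U) \<and>
     homeomorphic_map (subtopology T U) (top_of_set (c ` U)) c"

definition smooth_atlas :: "'g topology \<Rightarrow> ('g set \<times> ('g \<Rightarrow> 'l::euclidean_space)) set \<Rightarrow> bool" where
  "smooth_atlas T \<A> \<longleftrightarrow>
     (\<forall>(U, c)\<in>\<A>. is_chart T U c) \<and> (\<Union>(U, c)\<in>\<A>. U) = topspace T \<and>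
     (\<forall>(U, c)\<in>\<A>. \<forall>(V, d)\<in>\<A>. smooth_on (c ` (U \<inter> V)) (d \<circ> inv_into U c))"

definition is_exponential :: "('g, 'l::euclidean_space, 'm) lie_data_scheme \<Rightarrow> bool" where
  "is_exponential G \<longleftrightarrow> (\<forall>X.
     continuous_map euclideanreal (topol G) (\<lambda>t. expo G (t *\<^sub>R X)) \<and>
     (\<forall>s t. expo G ((s + t) *\<^sub>R X) = expo G (s *\<^sub>R X) \<otimes>\<^bsub>G\<^esub> expo G (t *\<^sub>R X)) \<and>
     ((\<lambda>t. snd (chart_one G) (expo G (t *\<^sub>R X))) has_vector_derivative X) (at 0))"

definition lie_group :: "('g, 'l::euclidean_space, 'm) lie_data_scheme \<Rightarrow> bool" where
  "lie_group G \<longleftrightarrow>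
     group G \<and> topspace (topol G) = carrier G \<and>
     Hausdorff_space (topol G) \<and> second_countable (topol G) \<and>
     continuous_map (prod_topology (topol G) (topol G)) (topol G) (\<lambda>(x, y). x \<otimes>\<^bsub>G\<^esub> y) \<and>
     continuous_map (topol G) (topol G) (\<lambda>x. inv\<^bsub>G\<^esub> x) \<and>
     smooth_atlas (topol G) (atlas G) \<and>
     (\<forall>(U, c)\<in>atlas G. \<forall>(V, d)\<in>atlas G. \<forall>(W, e)\<in>atlas G.
        smooth_on {(c x, d y) | x y. x \<in> U \<and> y \<in> V \<and> x \<otimes>\<^bsub>G\<^esub> y \<in> W}
          (\<lambda>(a, b). e (inv_into U c a \<otimes>\<^bsub>G\<^esub> inv_into V d b))) \<and>
     (\<forall>(U, c)\<in>atlas G. \<forall>(V, d)\<in>atlas G.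
        smooth_on {c x | x. x \<in> U \<and> inv\<^bsub>G\<^esub> x \<in> V} (\<lambda>a. d (inv\<^bsub>G\<^esub> (inv_into U c a)))) \<and>
     chart_one G \<in> atlas G \<and> \<one>\<^bsub>G\<^esub> \<in> fst (chart_one G) \<and>
     is_exponential G"

definition Ad :: "('g, 'l::euclidean_space, 'm) lie_data_scheme \<Rightarrow> 'g \<Rightarrow> 'l \<Rightarrow> 'l" where
  "Ad G g X = vector_derivative
     (\<lambda>t. snd (chart_one G) (g \<otimes>\<^bsub>G\<^esub> expo G (t *\<^sub>R X) \<otimes>\<^bsub>G\<^esub> inv\<^bsub>G\<^esub> g)) (at 0)"

text \<open>The bracket is \<open>[X, Y] = ad(X) Y\<close> with \<open>ad\<close> the differential of \<open>Ad\<close> at the identity.\<close>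

definition bracket :: "('g, 'l::euclidean_space, 'm) lie_data_scheme \<Rightarrow> 'l \<Rightarrow> 'l \<Rightarrow> 'l" where
  "bracket G X Y = vector_derivative (\<lambda>t. Ad G (expo G (t *\<^sub>R X)) Y) (at 0)"

definition lie_ideal :: "('g, 'l::euclidean_space, 'm) lie_data_scheme \<Rightarrow> 'l set \<Rightarrow> bool" where
  "lie_ideal G I \<longleftrightarrow> subspace I \<and> (\<forall>X. \<forall>Y\<in>I. bracket G X Y \<in> I)"

definition reductive_lie_algebra :: "('g, 'l::euclidean_space, 'm) lie_data_scheme \<Rightarrow> bool" where
  "reductive_lie_algebra G \<longleftrightarrow>
     (\<forall>I. lie_ideal G I \<longrightarrow>
        (\<exists>J. lie_ideal G J \<and> I \<inter> J = {0} \<and> {X + Y | X Y. X \<in> I \<and> Y \<in> J} = UNIV))"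

definition derived_algebra :: "('g, 'l::euclidean_space, 'm) lie_data_scheme \<Rightarrow> 'l set" where
  "derived_algebra G = span {bracket G X Y | X Y. True}"

section \<open>Reductive groups, roots, parabolic subgroup, Weyl group\<close>

text \<open>Fields: the summands of the Cartan decomposition, the invariant bilinear form (for
  instance the Killing form in the semisimple case), the maximal abelian subspace, and the
  positive roots. A linear functional on \<open>aa\<close> is represented by its extension by \<open>0\<close> off \<open>aa\<close>.\<close>

record ('g, 'l) cartan_data = "('g, 'l) lie_data" +
  kk :: "'l set"
  ss :: "'l set"
  bform :: "'l \<Rightarrow> 'l \<Rightarrow> real"
  aa :: "'l set"
  pos_roots :: "('l \<Rightarrow> real) set"

definition grp_K :: "('g, 'l, 'm) cartan_data_scheme \<Rightarrow> 'g set" where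
  "grp_K G = expo G ` kk G"

definition grp_A :: "('g, 'l, 'm) cartan_data_scheme \<Rightarrow> 'g set" where
  "grp_A G = expo G ` aa G"

definition grp_S :: "('g, 'l, 'm) cartan_data_scheme \<Rightarrow> 'g set" where
  "grp_S G = expo G ` ss G"

text \<open>The Cartan decomposition and the group conditions in the definition of a reductive Lie
  group (Knapp, Lie Groups Beyond an Introduction, VII.2). Since \<open>K = exp kk\<close>, the group is
  connected, so Knapp's condition that each \<open>Ad(g)\<close> be inner on the complexification is
  automatic; maximality of \<open>K\<close> among compact subgroups follows from the polar decomposition.\<close>

definition cartan_decomposition :: "('g, 'l::euclidean_space, 'm) cartan_data_scheme \<Rightarrow> bool" where
  "cartan_decomposition G \<longleftrightarrow>
     subspace (kk G) \<and> subspace (ss G) \<and>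
     kk G \<inter> ss G = {0} \<and> {X + Y | X Y. X \<in> kk G \<and> Y \<in> ss G} = UNIV \<and>
     (\<forall>X\<in>kk G. \<forall>Y\<in>kk G. bracket G X Y \<in> kk G) \<and>
     (\<forall>X\<in>kk G. \<forall>Y\<in>ss G. bracket G X Y \<in> ss G) \<and>
     (\<forall>X\<in>ss G. \<forall>Y\<in>ss G. bracket G X Y \<in> kk G) \<and>
     bilinear (bform G) \<and> (\<forall>X Y. bform G X Y = bform G Y X) \<and>
     (\<forall>g\<in>carrier G. \<forall>X Y. bform G (Ad G g X) (Ad G g Y) = bform G X Y) \<and>
     (\<forall>X\<in>kk G. \<forall>Y\<in>ss G. bform G X Y = 0) \<and>
     (\<forall>X\<in>kk G. X \<noteq> 0 \<longrightarrow> bform G X X < 0) \<and>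
     (\<forall>X\<in>ss G. X \<noteq> 0 \<longrightarrow> bform G X X > 0) \<and>
     subgroup (grp_K G) G \<and> compactin (topol G) (grp_K G) \<and>
     homeomorphic_map (prod_topology (subtopology (topol G) (grp_K G)) (top_of_set (ss G)))
       (topol G) (\<lambda>(k, X). k \<otimes>\<^bsub>G\<^esub> expo G X)"

definition maximal_abelian :: "('g, 'l::euclidean_space, 'm) cartan_data_scheme \<Rightarrow> bool" where
  "maximal_abelian G \<longleftrightarrow>
     (let abel = (\<lambda>V. subspace V \<and> V \<subseteq> ss G \<and> (\<forall>X\<in>V. \<forall>Y\<in>V. bracket G X Y = 0))
      in abel (aa G) \<and> (\<forall>V. abel V \<and> aa G \<subseteq> V \<longrightarrow> V = aa G))"

definition root_space ::
    "('g, 'l::euclidean_space, 'm) cartan_data_scheme \<Rightarrow> ('l \<Rightarrow> real) \<Rightarrow> 'l set" where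
  "root_space G \<alpha> = {X. \<forall>H\<in>aa G. bracket G H X = \<alpha> H *\<^sub>R X}"

text \<open>Linearity on \<open>aa\<close> is automatic once the root space is nonzero.\<close>

definition roots :: "('g, 'l::euclidean_space, 'm) cartan_data_scheme \<Rightarrow> ('l \<Rightarrow> real) set" where
  "roots G = {\<alpha>. (\<forall>X. X \<notin> aa G \<longrightarrow> \<alpha> X = 0) \<and> \<alpha> \<noteq> (\<lambda>X. 0) \<and> root_space G \<alpha> \<noteq> {0}}"

definition positive_system :: "('g, 'l::euclidean_space, 'm) cartan_data_scheme \<Rightarrow> bool" where
  "positive_system G \<longleftrightarrow>
     pos_roots G \<subseteq> roots G \<and>
     (\<forall>\<alpha>\<in>roots G. \<alpha> \<in> pos_roots G \<longleftrightarrow> (\<lambda>H. - \<alpha> H) \<notin> pos_roots G) \<and>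
     (\<forall>\<alpha>\<in>pos_roots G. \<forall>\<beta>\<in>pos_roots G.
        (\<lambda>H. \<alpha> H + \<beta> H) \<in> roots G \<longrightarrow> (\<lambda>H. \<alpha> H + \<beta> H) \<in> pos_roots G)"

definition simple_roots :: "('g, 'l, 'm) cartan_data_scheme \<Rightarrow> ('l \<Rightarrow> real) set" where
  "simple_roots G = {\<alpha> \<in> pos_roots G.
     \<not> (\<exists>\<beta>\<in>pos_roots G. \<exists>\<gamma>\<in>pos_roots G. \<alpha> = (\<lambda>H. \<beta> H + \<gamma> H))}"

definition root_lattice_span ::
    "('g, 'l::euclidean_space, 'm) cartan_data_scheme \<Rightarrow> ('l \<Rightarrow> real) set \<Rightarrow> ('l \<Rightarrow> real) set" where
  "root_lattice_span G \<Theta> = {\<alpha> \<in> roots G.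
     \<exists>c :: ('l \<Rightarrow> real) \<Rightarrow> int. \<forall>H. \<alpha> H = (\<Sum>\<beta>\<in>\<Theta>. of_int (c \<beta>) * \<beta> H)}"

definition weyl_chamber :: "('g, 'l, 'm) cartan_data_scheme \<Rightarrow> 'l set" where
  "weyl_chamber G = {H \<in> aa G. \<forall>\<alpha>\<in>simple_roots G. \<alpha> H > 0}"

definition nn :: "('g, 'l::euclidean_space, 'm) cartan_data_scheme \<Rightarrow> 'l set" where
  "nn G = span (\<Union>\<alpha>\<in>pos_roots G. root_space G \<alpha>)"

definition grp_N :: "('g, 'l::euclidean_space, 'm) cartan_data_scheme \<Rightarrow> 'g set" where
  "grp_N G = expo G ` nn G"

definition iwasawa_decomposition :: "('g, 'l::euclidean_space, 'm) cartan_data_scheme \<Rightarrow> bool" where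
  "iwasawa_decomposition G \<longleftrightarrow>
     subgroup (grp_A G) G \<and> subgroup (grp_N G) G \<and>
     homeomorphic_map
       (prod_topology (subtopology (topol G) (grp_K G))
         (prod_topology (top_of_set (aa G)) (subtopology (topol G) (grp_N G))))
       (topol G) (\<lambda>(k, H, n). k \<otimes>\<^bsub>G\<^esub> expo G H \<otimes>\<^bsub>G\<^esub> n)"

text \<open>The last conjunct says that the semisimple component, i.e. the connected subgroup with Lie
  algebra \<open>[\<gg>, \<gg>]\<close>, is not compact.\<close>

definition reductive_lie_group :: "('g, 'l::euclidean_space, 'm) cartan_data_scheme \<Rightarrow> bool" where
  "reductive_lie_group G \<longleftrightarrow>
     lie_group G \<and> reductive_lie_algebra G \<and> cartan_decomposition G \<and>
     maximal_abelian G \<and> positive_system G \<and>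
     \<not> compactin (topol G) (generate G (expo G ` derived_algebra G))"

definition mm :: "('g, 'l::euclidean_space, 'm) cartan_data_scheme \<Rightarrow> 'l set" where
  "mm G = {X \<in> kk G. \<forall>H\<in>aa G. bracket G X H = 0}"

definition min_parabolic :: "('g, 'l::euclidean_space, 'm) cartan_data_scheme \<Rightarrow> 'g set" where
  "min_parabolic G =
     (let p = {X + H + Y | X H Y. X \<in> mm G \<and> H \<in> aa G \<and> Y \<in> nn G}
      in {g \<in> carrier G. Ad G g ` p = p})"

definition weyl_group :: "('g, 'l::euclidean_space, 'm) cartan_data_scheme \<Rightarrow> 'g set monoid" where
  "weyl_group G =
     G\<lparr>carrier := {k \<in> grp_K G. Ad G k ` aa G = aa G}\<rparr> Mod {k \<in> grp_K G. \<forall>H\<in>aa G. Ad G k H = H}"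

definition weyl_act ::
    "('g, 'l::euclidean_space, 'm) cartan_data_scheme \<Rightarrow> 'g set \<Rightarrow> 'l \<Rightarrow> 'l" where
  "weyl_act G w H = Ad G (SOME k. k \<in> w) H"

text \<open>The flag manifold \<open>G/P\<close>. Its origin \<open>b\<^sub>0\<close> is the coset \<open>P = min_parabolic G\<close>; for a Weyl
  group element \<open>w = kM\<close> the point \<open>w b\<^sub>0\<close> is the coset \<open>wP = kP\<close>.\<close>

definition flag_top :: "('g, 'l::euclidean_space, 'm) cartan_data_scheme \<Rightarrow> 'g set topology" where
  "flag_top G = quotient_top (topol G) (\<lambda>g. g <#\<^bsub>G\<^esub> min_parabolic G)"

definition weyl_point ::
    "('g, 'l::euclidean_space, 'm) cartan_data_scheme \<Rightarrow> 'g set \<Rightarrow> 'g set" where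
  "weyl_point G w = w <#>\<^bsub>G\<^esub> min_parabolic G"

definition theta_of ::
    "('g, 'l, 'm) cartan_data_scheme \<Rightarrow> 'l \<Rightarrow> ('l \<Rightarrow> real) set" where
  "theta_of G H = {\<alpha> \<in> simple_roots G. \<alpha> H = 0}"

definition Z_of ::
    "('g, 'l::euclidean_space, 'm) cartan_data_scheme \<Rightarrow> 'l \<Rightarrow> 'g set" where
  "Z_of G H = {g \<in> carrier G. Ad G g H = H}"

definition K_of ::
    "('g, 'l::euclidean_space, 'm) cartan_data_scheme \<Rightarrow> 'l \<Rightarrow> 'g set" where
  "K_of G H = Z_of G H \<inter> grp_K G"

definition N_minus_of ::
    "('g, 'l::euclidean_space, 'm) cartan_data_scheme \<Rightarrow> 'l \<Rightarrow> 'g set" where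
  "N_minus_of G H = expo G `
     span (\<Union>\<alpha>\<in>pos_roots G - root_lattice_span G (theta_of G H). root_space G (\<lambda>X. - \<alpha> X))"

definition Ad_orbit ::
    "('g, 'l::euclidean_space, 'm) cartan_data_scheme \<Rightarrow> 'l \<Rightarrow> 'l set" where
  "Ad_orbit G H = (\<lambda>g. Ad G g H) ` carrier G"

text \<open>\<open>st(D, w)\<close> for \<open>D = Ad(g) H\<close>; the set \<open>g N\<^sup>-\<^sub>H K\<^sub>H w b\<^sub>0\<close> is the same for every such \<open>g\<close>.\<close>

definition st_set ::
    "('g, 'l::euclidean_space, 'm) cartan_data_scheme \<Rightarrow> 'l \<Rightarrow> 'l \<Rightarrow> 'g set \<Rightarrow> 'g set set" where
  "st_set G H D w =
     {(g \<otimes>\<^bsub>G\<^esub> n \<otimes>\<^bsub>G\<^esub> k) <#\<^bsub>G\<^esub> weyl_point G w | g n k.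
        g \<in> carrier G \<and> Ad G g H = D \<and> n \<in> N_minus_of G H \<and> k \<in> K_of G H}"

section \<open>Principal and associated bundles\<close>

record ('x, 'q, 'g) bundle_data =
  base :: "'x topology"
  total :: "'q topology"
  ract :: "'q \<Rightarrow> 'g \<Rightarrow> 'q"
  proj :: "'q \<Rightarrow> 'x"

definition principal_bundle ::
    "('g, 'm) monoid_scheme \<Rightarrow> 'g topology \<Rightarrow> ('x, 'q, 'g) bundle_data \<Rightarrow> bool" where
  "principal_bundle G T Q \<longleftrightarrow>
     continuous_map (prod_topology (total Q) T) (total Q) (\<lambda>(p, g). ract Q p g) \<and>
     (\<forall>p\<in>topspace (total Q). ract Q p \<one>\<^bsub>G\<^esub> = p) \<and>
     (\<forall>p\<in>topspace (total Q). \<forall>g\<in>carrier G. \<forall>h\<in>carrier G.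
        ract Q p (g \<otimes>\<^bsub>G\<^esub> h) = ract Q (ract Q p g) h) \<and>
     continuous_map (total Q) (base Q) (proj Q) \<and>
     (\<forall>x\<in>topspace (base Q). \<exists>U \<psi>. openin (base Q) U \<and> x \<in> U \<and>
        homeomorphic_map (prod_topology (subtopology (base Q) U) T)
          (subtopology (total Q) {p \<in> topspace (total Q). proj Q p \<in> U}) \<psi> \<and>
        (\<forall>u\<in>U. \<forall>g\<in>carrier G. proj Q (\<psi> (u, g)) = u \<and>
           (\<forall>h\<in>carrier G. \<psi> (u, g \<otimes>\<^bsub>G\<^esub> h) = ract Q (\<psi> (u, g)) h)))"

definition K_subbundle ::
    "('g, 'l, 'm) cartan_data_scheme \<Rightarrow> ('x, 'q, 'g) bundle_data \<Rightarrow> 'q set \<Rightarrow> bool" where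
  "K_subbundle G Q R \<longleftrightarrow> R \<subseteq> topspace (total Q) \<and>
     principal_bundle (G\<lparr>carrier := grp_K G\<rparr>) (subtopology (topol G) (grp_K G))
       (Q\<lparr>total := subtopology (total Q) R\<rparr>)"

definition bundle_automorphism ::
    "('g, 'm) monoid_scheme \<Rightarrow> ('x, 'q, 'g) bundle_data \<Rightarrow> ('q \<Rightarrow> 'q) \<Rightarrow> bool" where
  "bundle_automorphism G Q \<phi> \<longleftrightarrow>
     homeomorphic_map (total Q) (total Q) \<phi> \<and>
     (\<forall>p\<in>topspace (total Q). \<forall>g\<in>carrier G. \<phi> (ract Q p g) = ract Q (\<phi> p) g)"

definition base_map :: "('x, 'q, 'g) bundle_data \<Rightarrow> ('q \<Rightarrow> 'q) \<Rightarrow> 'x \<Rightarrow> 'x" where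
  "base_map Q \<phi> x = proj Q (\<phi> (SOME p. p \<in> topspace (total Q) \<and> proj Q p = x))"

text \<open>For a left action \<open>act\<close> of \<open>G\<close> on \<open>F\<close>, the point \<open>p \<cdot> f\<close> of \<open>Q \<times>\<^sub>G F\<close> is the class of
  \<open>(p, f)\<close> under \<open>(p, f) ~ (p g, g\<^sup>-\<^sup>1 f)\<close>.\<close>

definition assoc_pt ::
    "('g, 'm) monoid_scheme \<Rightarrow> ('x, 'q, 'g) bundle_data \<Rightarrow> ('g \<Rightarrow> 'f \<Rightarrow> 'f) \<Rightarrow> 'q \<Rightarrow> 'f \<Rightarrow> ('q \<times> 'f) set" where
  "assoc_pt G Q act p f = (\<lambda>g. (ract Q p g, act (inv\<^bsub>G\<^esub> g) f)) ` carrier G"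

definition assoc_top ::
    "('g, 'm) monoid_scheme \<Rightarrow> ('x, 'q, 'g) bundle_data \<Rightarrow> 'f topology \<Rightarrow> ('g \<Rightarrow> 'f \<Rightarrow> 'f) \<Rightarrow>
      ('q \<times> 'f) set topology" where
  "assoc_top G Q TF act =
     quotient_top (prod_topology (total Q) TF) (\<lambda>(p, f). assoc_pt G Q act p f)"

definition assoc_proj :: "('x, 'q, 'g) bundle_data \<Rightarrow> ('q \<times> 'f) set \<Rightarrow> 'x" where
  "assoc_proj Q \<xi> = the_elem ((\<lambda>(p, f). proj Q p) ` \<xi>)"

definition assoc_map :: "('q \<Rightarrow> 'q) \<Rightarrow> ('q \<times> 'f) set \<Rightarrow> ('q \<times> 'f) set" where
  "assoc_map \<phi> \<xi> = (\<lambda>(p, f). (\<phi> p, f)) ` \<xi>"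

definition flag_pt ::
    "('g, 'l::euclidean_space, 'm) cartan_data_scheme \<Rightarrow> ('x, 'q, 'g) bundle_data \<Rightarrow>
      'q \<Rightarrow> 'g set \<Rightarrow> ('q \<times> 'g set) set" where
  "flag_pt G Q p b = assoc_pt G Q (\<lambda>g b. g <#\<^bsub>G\<^esub> b) p b"

definition flag_bundle ::
    "('g, 'l::euclidean_space, 'm) cartan_data_scheme \<Rightarrow> ('x, 'q, 'g) bundle_data \<Rightarrow>
      ('q \<times> 'g set) set topology" where
  "flag_bundle G Q = assoc_top G Q (flag_top G) (\<lambda>g b. g <#\<^bsub>G\<^esub> b)"

definition adjoint_orbit_bundle ::
    "('g, 'l::euclidean_space, 'm) cartan_data_scheme \<Rightarrow> ('x, 'q, 'g) bundle_data \<Rightarrow> 'l \<Rightarrow>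
      ('q \<times> 'l) set topology" where
  "adjoint_orbit_bundle G Q H = assoc_top G Q (top_of_set (Ad_orbit G H)) (Ad G)"

section \<open>The Iwasawa cocycle, the polar exponent and the Lyapunov section\<close>

definition a_comp ::
    "('g, 'l::euclidean_space, 'm) cartan_data_scheme \<Rightarrow> ('x, 'q, 'g) bundle_data \<Rightarrow> ('q \<Rightarrow> 'q) \<Rightarrow>
      'q set \<Rightarrow> nat \<Rightarrow> 'q \<Rightarrow> 'l" where
  "a_comp G Q \<phi> R n r =
     (THE H. H \<in> aa G \<and> (\<exists>r'\<in>R. \<exists>n'\<in>grp_N G. (\<phi> ^^ n) r = ract Q r' (expo G H \<otimes>\<^bsub>G\<^esub> n')))"

definition a_plus ::
    "('g, 'l::euclidean_space, 'm) cartan_data_scheme \<Rightarrow> ('x, 'q, 'g) bundle_data \<Rightarrow> ('q \<Rightarrow> 'q) \<Rightarrow>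
      'q set \<Rightarrow> nat \<Rightarrow> 'q \<Rightarrow> 'l" where
  "a_plus G Q \<phi> R n r =
     (THE H. H \<in> closure (weyl_chamber G) \<and>
        (\<exists>r'\<in>R. \<exists>s\<in>grp_S G. \<exists>k\<in>grp_K G.
           (\<phi> ^^ n) r = ract Q r' s \<and> s = k \<otimes>\<^bsub>G\<^esub> expo G H \<otimes>\<^bsub>G\<^esub> inv\<^bsub>G\<^esub> k))"

text \<open>\<open>aE\<close> is the map on the flag bundle through which \<open>a_comp\<close> factors along \<open>r \<mapsto> r \<cdot> b\<^sub>0\<close>.\<close>

definition iwasawa_cocycle ::
    "('g, 'l::euclidean_space, 'm) cartan_data_scheme \<Rightarrow> ('x, 'q, 'g) bundle_data \<Rightarrow> ('q \<Rightarrow> 'q) \<Rightarrow>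
      'q set \<Rightarrow> (nat \<Rightarrow> ('q \<times> 'g set) set \<Rightarrow> 'l) \<Rightarrow> bool" where
  "iwasawa_cocycle G Q \<phi> R aE \<longleftrightarrow>
     (\<forall>n. \<forall>r\<in>R. aE n (flag_pt G Q r (min_parabolic G)) = a_comp G Q \<phi> R n r)"

text \<open>For a point \<open>\<eta> = p \<cdot> D\<close> of the adjoint orbit bundle, the set \<open>p \<cdot> st(D, w)\<close>. All pairs
  \<open>(p, D)\<close> in the class \<open>\<eta>\<close> give the same set.\<close>

definition st_fiber ::
    "('g, 'l::euclidean_space, 'm) cartan_data_scheme \<Rightarrow> ('x, 'q, 'g) bundle_data \<Rightarrow> 'l \<Rightarrow>
      ('q \<times> 'l) set \<Rightarrow> 'g set \<Rightarrow> ('q \<times> 'g set) set set" where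
  "st_fiber G Q H \<eta> w = (\<Union>(p, D)\<in>\<eta>. flag_pt G Q p ` st_set G H D w)"

definition st_total ::
    "('g, 'l::euclidean_space, 'm) cartan_data_scheme \<Rightarrow> ('x, 'q, 'g) bundle_data \<Rightarrow> 'x set \<Rightarrow> 'l \<Rightarrow>
      ('x \<Rightarrow> ('q \<times> 'l) set) \<Rightarrow> 'g set \<Rightarrow> ('q \<times> 'g set) set set" where
  "st_total G Q \<Omega> H chi w = (\<Union>x\<in>\<Omega>. st_fiber G Q H (chi x) w)"

text \<open>The objects provided by the Multiplicative Ergodic Theorem for \<open>\<nu>\<close>: the set \<open>\<Omega>\<close> of full
  measure, the polar exponent \<open>H\<close> and the Lyapunov .\<close>

definition lyapunov_data ::
    "('g, 'l::euclidean_space, 'm) cartan_data_scheme \<Rightarrow> ('x, 'q, 'g) bundle_data \<Rightarrow> ('q \<Rightarrow> 'q) \<Rightarrow>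
      'q set \<Rightarrow> (nat \<Rightarrow> ('q \<times> 'g set) set \<Rightarrow> 'l) \<Rightarrow> 'x measure \<Rightarrow>
      'x set \<Rightarrow> 'l \<Rightarrow> ('x \<Rightarrow> ('q \<times> 'l) set) \<Rightarrow> bool" where
  "lyapunov_data G Q \<phi> R aE \<nu> \<Omega> H chi \<longleftrightarrow>
     \<Omega> \<in> sets \<nu> \<and> measure \<nu> \<Omega> = 1 \<and> base_map Q \<phi> ` \<Omega> = \<Omega> \<and>
     H \<in> closure (weyl_chamber G) \<and>
     (\<forall>r\<in>R. proj Q r \<in> \<Omega> \<longrightarrow> (\<lambda>k. (1 / real k) *\<^sub>R a_plus G Q \<phi> R k r) \<longlonglongrightarrow> H) \<and>
     chi \<in> restrict_space \<nu> \<Omega> \<rightarrow>\<^sub>M borel_of (adjoint_orbit_bundle G Q H) \<and>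
     (\<forall>x\<in>\<Omega>. assoc_proj Q (chi x) = x \<and> chi (base_map Q \<phi> x) = assoc_map \<phi> (chi x)) \<and>
     (\<forall>x\<in>\<Omega>. \<forall>w\<in>carrier (weyl_group G). \<forall>\<xi>\<in>st_fiber G Q H (chi x) w.
        (\<lambda>k. (1 / real k) *\<^sub>R aE k \<xi>) \<longlonglongrightarrow> weyl_act G (inv\<^bsub>weyl_group G\<^esub> w) H)"

end

theory Submission imports Defs
begin

text \<open>Let \<open>H = w\<^sup>-\<^sup>1 H_Ly\<close>. Over \<open>x \<in> \<Omega>\<close> the frames \<open>p \<in> Q\<close> with \<open>p \<cdot> H = chi x\<close> form a coset
  \<open>p Z\<^sub>H\<close>, these cosets are permuted by \<open>\<phi>\<close>, and \<open>p \<mapsto> p \<cdot> b\<^sub>0\<close> maps them into \<open>st(chi x, w)\<close>. So it suffices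
  to lift \<open>\<nu>\<close> to an ergodic measure on \<open>Q\<close>, defined on a suitable \<open>\<sigma>\<close>-algebra, that is concentrated on
  these cosets, and to push it forward to the flag bundle.

  The cosets are not compact, but \<open>Z\<^sub>H = K\<^sub>H (Z\<^sub>H \<inter> P)\<close> with \<open>K\<^sub>H\<close> compact. Hence the continuous bounded
  functions \<open>f\<close> on \<open>Q\<close> that are invariant under \<open>Z\<^sub>H \<inter> P\<close> satisfy Dini's theorem on them. On these
  functions the integral over \<open>\<nu>\<close> of the fibrewise supremum is sublinear; its infimum over all
  \<open>f + g - g \<circ> \<phi>\<close> dominates only invariant linear functionals. An extreme one exists by Zorn's lemma, the
  Daniell-Stone theorem represents it by a measure, and extremality together with the ergodicity of
  \<open>\<nu>\<close> makes it ergodic.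

  Finally the integral of \<open>aE k / k\<close> does not depend on \<open>k\<close>, since the measure is invariant and \<open>aE\<close> is
  an additive cocycle. As \<open>aE k / k\<close> is bounded and converges almost everywhere to the constant
  \<open>w\<^sup>-\<^sup>1 H_Ly\<close>, dominated convergence evaluates the integral; no ergodic theorem is needed.\<close>

section \<open>Extreme linear functionals dominated by a sublinear one\<close>

text \<open>The obstacle is that \<open>chi\<close> is only measurable, while functionals and
  measures are built from continuous functions. On the flag bundle the compact sets
  \<open>p K_H b0\<close> with \<open>p \<cdot> H = chi x\<close> cannot in general be singled out
  by continuous functions, and a limit of measures carried by them may escape. On \<open>Q\<close>
  the condition is \<open>p \<cdot> H = chi x\<close> itself, whose left side is continuous in
  \<open>p\<close>: countably many functions of \<open>p \<cdot> H\<close>, each constant on every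
  coset, detect the cosets. Functions of \<open>p \<cdot> H\<close> are invariant under
  \<open>Z_H\<close> and functions of \<open>p \<cdot> b0\<close> under \<open>P\<close>; invariance
  under the intersection admits both kinds, so one function space serves to locate the fibres and to
  reach the flag bundle. Domination by the integrated supremum avoids any measurable selection in
  the fibres. It also fixes the projection to \<nu>, because the supremum is linear on functions
  that are constant on each coset. Measurability of the supremum and of \<open>st(w)\<close> asks
  for images of sets under projections. The sets projected here are \<sigma>-compact, so their
  images in Hausdorff spaces are Borel.\<close>

definition fun_subspace :: "('a \<Rightarrow> real) set \<Rightarrow> bool" where
  "fun_subspace V \<longleftrightarrow> (\<lambda>x. 0) \<in> V \<and> (\<forall>f\<in>V. \<forall>g\<in>V. (\<lambda>x. f x + g x) \<in> V) \<and>
     (\<forall>f\<in>V. \<forall>c. (\<lambda>x. c * f x) \<in> V)"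

definition sublinear_on :: "('a \<Rightarrow> real) set \<Rightarrow> (('a \<Rightarrow> real) \<Rightarrow> real) \<Rightarrow> bool" where
  "sublinear_on V p \<longleftrightarrow> (\<forall>f\<in>V. \<forall>g\<in>V. p (\<lambda>x. f x + g x) \<le> p f + p g) \<and>
     (\<forall>f\<in>V. \<forall>c\<ge>0. p (\<lambda>x. c * f x) = c * p f)"

definition functional_on :: "('a \<Rightarrow> real) set \<Rightarrow> (('a \<Rightarrow> real) \<Rightarrow> real) \<Rightarrow> bool" where
  "functional_on V L \<longleftrightarrow> (\<forall>f\<in>V. \<forall>g\<in>V. L (\<lambda>x. f x + g x) = L f + L g) \<and>
     (\<forall>f\<in>V. \<forall>c. L (\<lambda>x. c * f x) = c * L f)"

lemma sublinear_onD:
  assumes "sublinear_on V p" "f \<in> V"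
  shows "g \<in> V \<Longrightarrow> p (\<lambda>x. f x + g x) \<le> p f + p g" "c \<ge> 0 \<Longrightarrow> p (\<lambda>x. c * f x) = c * p f"
  using assms unfolding sublinear_on_def by blast+

lemma fun_subspaceD:
  assumes "fun_subspace V"
  shows "(\<lambda>x. 0) \<in> V" "f \<in> V \<Longrightarrow> g \<in> V \<Longrightarrow> (\<lambda>x. f x + g x) \<in> V" "f \<in> V \<Longrightarrow> (\<lambda>x. c * f x) \<in> V"
    "f \<in> V \<Longrightarrow> (\<lambda>x. - f x) \<in> V" "f \<in> V \<Longrightarrow> g \<in> V \<Longrightarrow> (\<lambda>x. f x - g x) \<in> V"
proof -
  show 1: "(\<lambda>x. 0) \<in> V" "f \<in> V \<Longrightarrow> g \<in> V \<Longrightarrow> (\<lambda>x. f x + g x) \<in> V" "f \<in> V \<Longrightarrow> (\<lambda>x. c * f x) \<in> V"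
    for f g c using assms unfolding fun_subspace_def by blast+
  show 2: "f \<in> V \<Longrightarrow> (\<lambda>x. - f x) \<in> V" for f using 1(3)[of f "-1"] by simp
  show "f \<in> V \<Longrightarrow> g \<in> V \<Longrightarrow> (\<lambda>x. f x - g x) \<in> V" using 1(2)[OF _ 2, of f g] by simp
qed

lemma functional_onD:
  assumes "functional_on V L" "f \<in> V"
  shows "g \<in> V \<Longrightarrow> L (\<lambda>x. f x + g x) = L f + L g" "L (\<lambda>x. c * f x) = c * L f"
    "L (\<lambda>x. - f x) = - L f" "L (\<lambda>x. 0) = 0"
    "g \<in> V \<Longrightarrow> (\<lambda>x. - g x) \<in> V \<Longrightarrow> L (\<lambda>x. f x - g x) = L f - L g"
proof -
  have 1: "g \<in> V \<Longrightarrow> L (\<lambda>x. f x + g x) = L f + L g" "h \<in> V \<Longrightarrow> L (\<lambda>x. c * h x) = c * L h" for c g h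
    using assms unfolding functional_on_def by blast+
  show "g \<in> V \<Longrightarrow> L (\<lambda>x. f x + g x) = L f + L g" by (rule 1(1))
  show 2: "L (\<lambda>x. c * f x) = c * L f" using 1(2)[OF assms(2)] .
  show 3: "L (\<lambda>x. - f x) = - L f" using 1(2)[OF assms(2), of "-1"] by simp
  show "L (\<lambda>x. 0) = 0" using 1(2)[OF assms(2), of "0"] by simp
  show "L (\<lambda>x. f x - g x) = L f - L g" if "g \<in> V" "(\<lambda>x. - g x) \<in> V"
    using 1(1)[OF that(2)] 1(2)[OF that(1), of "-1"] by simp
qed

lemma sublinear_on_neg_le:
  assumes "fun_subspace V" "sublinear_on V q" "f \<in> V"
  shows "q (\<lambda>x. 0) = 0" "- q (\<lambda>x. - f x) \<le> q f"
proof -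
  show 0: "q (\<lambda>x. 0) = 0"
    using sublinear_onD(2)[OF assms(2,3), of 0] by simp
  show "- q (\<lambda>x. - f x) \<le> q f"
    using sublinear_onD(1)[OF assms(2,3) fun_subspaceD(4)[OF assms(1,3)]] 0 by simp
qed

text \<open>A minimal sublinear functional among the ``faces'' of the dominating one is linear and extreme:
  the directional derivative \<open>g \<mapsto> INF t\<ge>0. q (g + t f) - t * q f\<close> of a face is again a face.
  This combines the Hahn-Banach and the Krein-Milman theorem.\<close>

lemma exists_extreme_functional:
  assumes V: "fun_subspace V" and P: "sublinear_on V P"
  shows "\<exists>L. functional_on V L \<and> (\<forall>f\<in>V. L f \<le> P f) \<and>
    (\<forall>L1 L2 t. functional_on V L1 \<and> functional_on V L2 \<and> (\<forall>f\<in>V. L1 f \<le> P f) \<and>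
       (\<forall>f\<in>V. L2 f \<le> P f) \<and> 0 < t \<and> t < 1 \<and> (\<forall>f\<in>V. L f = t * L1 f + (1 - t) * L2 f) \<longrightarrow>
       (\<forall>f\<in>V. L1 f = L f))"
proof -
  \<comment> \<open>\<open>ext q\<close> says that the functionals below \<open>q\<close> form a
    face of those below \<open>P\<close>: if a proper convex combination of two functionals below
    \<open>P\<close> lies below \<open>q\<close>, so does the first, and by exchanging
    \<open>t\<close> with \<open>1 - t\<close> also the second.\<close>
  define ext where "ext q \<longleftrightarrow> (\<forall>L1 L2 t. functional_on V L1 \<and> functional_on V L2 \<and>
      (\<forall>f\<in>V. L1 f \<le> P f) \<and> (\<forall>f\<in>V. L2 f \<le> P f) \<and> 0 < t \<and> t < 1 \<and>
      (\<forall>f\<in>V. t * L1 f + (1 - t) * L2 f \<le> q f) \<longrightarrow> (\<forall>f\<in>V. L1 f \<le> q f))" for q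
  have ext2: "L2 f \<le> q f" if "ext q" "functional_on V L1" "functional_on V L2"
      "\<forall>f\<in>V. L1 f \<le> P f" "\<forall>f\<in>V. L2 f \<le> P f" "0 < t" "t < 1"
      "\<forall>f\<in>V. t * L1 f + (1 - t) * L2 f \<le> q f" "f \<in> V" for q L1 L2 t f
  proof -
    have "\<forall>f\<in>V. (1 - t) * L2 f + (1 - (1 - t)) * L1 f \<le> q f" using that(8) by (simp add: algebra_simps)
    then show ?thesis using that(1)[unfolded ext_def, rule_format, of L2 L1 "1 - t" f] that by auto
  qed
  \<comment> \<open>Values off \<open>V\<close> are set to 0, so that two members that agree on
    \<open>V\<close> are equal and minimality for the pointwise order yields an equation.\<close>
  define A where "A = {q. sublinear_on V q \<and> (\<forall>f. f \<notin> V \<longrightarrow> q f = 0) \<and> (\<forall>f\<in>V. q f \<le> P f) \<and> ext q}"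
  have AD: "sublinear_on V q" "\<And>f. f \<notin> V \<Longrightarrow> q f = 0" "\<And>f. f \<in> V \<Longrightarrow> q f \<le> P f" "ext q"
    if "q \<in> A" for q using that unfolding A_def by auto
  define P0 where "P0 f = (if f \<in> V then P f else 0)" for f
  have P0: "P0 \<in> A"
    using P V unfolding A_def P0_def ext_def sublinear_on_def fun_subspace_def by simp blast
  have lower: "- P (\<lambda>x. - f x) \<le> q f" if "q \<in> A" "f \<in> V" for q f
    using sublinear_on_neg_le(2)[OF V AD(1)[OF that(1)] that(2)]
      AD(3)[OF that(1) fun_subspaceD(4)[OF V that(2)]] by simp
  \<comment> \<open>Zorn's lemma is applied to the reversed pointwise order, so a chain needs a
    lower bound; for a nonempty chain it is the pointwise infimum \<open>u\<close>.\<close>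
  have "\<exists>m\<in>A. \<forall>a\<in>A. a \<le> m \<longrightarrow> a = m"
  proof (rule predicate_Zorn)
    show "partial_order_on A (relation_of (\<lambda>a b. b \<le> a) A)"
      by (rule partial_order_on_relation_ofI) auto
    fix C assume C: "C \<in> Chains (relation_of (\<lambda>a b. b \<le> a) A)"
    have CA: "C \<subseteq> A" and lin: "\<And>a b. a \<in> C \<Longrightarrow> b \<in> C \<Longrightarrow> a \<le> b \<or> b \<le> a"
      using C unfolding Chains_def relation_of_def by auto
    show "\<exists>u\<in>A. \<forall>a\<in>C. u \<le> a"
    proof (cases "C = {}")
      case True then show ?thesis using P0 by auto
    next
      case False
      define u where "u f = (if f \<in> V then (INF q\<in>C. q f) else 0)" for f
      have bdd: "bdd_below ((\<lambda>q. q f) ` C)" if "f \<in> V" for f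
        using lower[OF _ that] CA by (intro bdd_belowI2) auto
      have ule: "u f \<le> q f" if "q \<in> C" "f \<in> V" for q f
        unfolding u_def using that bdd[OF that(2)] by (auto intro: cINF_lower)
      have ugr: "c \<le> u f" if "\<And>q. q \<in> C \<Longrightarrow> c \<le> q f" "f \<in> V" for c f
        unfolding u_def using that False by (auto intro: cINF_greatest)
      have sub: "u (\<lambda>x. f x + g x) \<le> u f + u g" if f: "f \<in> V" and g: "g \<in> V" for f g
      proof -
        have fg: "(\<lambda>x. f x + g x) \<in> V" by (rule fun_subspaceD(2)[OF V f g])
        \<comment> \<open>An infimum of sublinear functionals need not be subadditive. Along a chain
          it is, because the smaller of \<open>q1\<close> and \<open>q2\<close> can be used in both
          terms.\<close>
        have 1: "u (\<lambda>x. f x + g x) \<le> q1 f + q2 g" if q: "q1 \<in> C" "q2 \<in> C" for q1 q2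
        proof -
          obtain q where q': "q \<in> C" "q \<le> q1" "q \<le> q2" using lin[OF q] q by auto
          have "u (\<lambda>x. f x + g x) \<le> q (\<lambda>x. f x + g x)" using ule[OF q'(1) fg] .
          also have "\<dots> \<le> q f + q g" using sublinear_onD(1)[OF AD(1) f g] q'(1) CA by blast
          finally show ?thesis using q'(2,3) by (smt (verit) le_funD)
        qed
        have "u (\<lambda>x. f x + g x) - q1 f \<le> u g" if "q1 \<in> C" for q1
          by (rule ugr[OF _ g]) (use 1[OF that] in \<open>simp add: algebra_simps\<close>)
        then have "u (\<lambda>x. f x + g x) - u g \<le> u f" by (intro ugr[OF _ f]) (simp add: algebra_simps)
        then show ?thesis by simp
      qed
      have hom1: "u (\<lambda>x. c * f x) \<le> c * u f" if f: "f \<in> V" and c: "c > 0" for f c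
      proof -
        have "u (\<lambda>x. c * f x) / c \<le> u f"
        proof (rule ugr[OF _ f])
          fix q assume q: "q \<in> C"
          have "u (\<lambda>x. c * f x) \<le> c * q f"
            using ule[OF q fun_subspaceD(3)[OF V f]] sublinear_onD(2)[OF AD(1) f] q CA c
            by (metis less_le subset_iff)
          then show "u (\<lambda>x. c * f x) / c \<le> q f" using c by (simp add: field_simps)
        qed
        then show ?thesis using c by (simp add: field_simps)
      qed
      have hom: "u (\<lambda>x. c * f x) = c * u f" if f: "f \<in> V" and c: "c \<ge> 0" for f c
      proof (cases "c = 0")
        case True
        have "u (\<lambda>x. 0) = Inf ((\<lambda>q. q (\<lambda>x. 0)) ` C)"
          by (simp only: u_def fun_subspaceD(1)[OF V] if_True)
        also have "(\<lambda>q. q (\<lambda>x. 0)) ` C = (\<lambda>q. 0) ` C"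
        proof (rule image_cong[OF refl])
          fix q assume "q \<in> C"
          then have "q \<in> A" using CA by blast
          then show "q (\<lambda>x. 0) = 0" by (rule sublinear_on_neg_le(1)[OF V AD(1) f])
        qed
        also have "Inf ((\<lambda>q. 0) ` C) = (0::real)" using \<open>C \<noteq> {}\<close> by simp
        finally have "u (\<lambda>x. 0) = 0" .
        then show ?thesis using True by (simp only: mult_zero_left)
      next
        case False
        then have c0: "c > 0" using c by simp
        have "u (\<lambda>x. (1/c) * (c * f x)) \<le> (1/c) * u (\<lambda>x. c * f x)"
          by (rule hom1[OF fun_subspaceD(3)[OF V f]]) (use c0 in simp)
        then have "c * u f \<le> u (\<lambda>x. c * f x)" using c0 by (simp add: field_simps)
        then show ?thesis using hom1[OF f c0] by simp
      qed
      have "ext u"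
        unfolding ext_def
      proof (intro allI impI ballI ugr; elim conjE)
        fix L1 L2 t f q assume *: "q \<in> C" "functional_on V L1" "functional_on V L2"
          "\<forall>f\<in>V. L1 f \<le> P f" "\<forall>f\<in>V. L2 f \<le> P f" "0 < t" "t < 1" "f \<in> V"
          "\<forall>f\<in>V. t * L1 f + (1 - t) * L2 f \<le> u f"
        have "\<forall>f\<in>V. t * L1 f + (1 - t) * L2 f \<le> q f" 
          using *(9) ule[OF *(1)] by (auto intro: order_trans)
        moreover have "ext q" using AD(4) *(1) CA by blast
        ultimately show "L1 f \<le> q f" using * unfolding ext_def by blast
      qed
      moreover have "u f \<le> P f" if "f \<in> V" for f
        using False ule[OF _ that] AD(3)[OF _ that] CA by (meson ex_in_conv order_trans subset_iff)
      ultimately have "u \<in> A" unfolding A_def sublinear_on_def using sub hom by (auto simp: u_def)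
      moreover have "u \<le> q" if "q \<in> C" for q
        using ule[OF that] AD(2)[of q] that CA by (intro le_funI) (metis order_refl subset_iff u_def)
      ultimately show ?thesis by blast
    qed
  qed
  then obtain m where m: "m \<in> A" and min: "\<And>a. a \<in> A \<Longrightarrow> a \<le> m \<Longrightarrow> a = m" by blast
  note msub = AD(1)[OF m]
  have neg: "m (\<lambda>x. - f x) = - m f" if f: "f \<in> V" for f
  proof -
    define d where "d g = (if g \<in> V then (INF t\<in>{0..}. m (\<lambda>x. g x + t * f x) - t * m f) else 0)" for g
    have V1: "(\<lambda>x. g x + t * f x) \<in> V" if "g \<in> V" for g t
      by (rule fun_subspaceD(2)[OF V that fun_subspaceD(3)[OF V f]])
    \<comment> \<open>Subadditivity bounds all terms from below independently of \<open>t\<close>,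
      so the infimum defining \<open>d\<close> is finite.\<close>
    have low: "- m (\<lambda>x. - g x) \<le> m (\<lambda>x. g x + t * f x) - t * m f" if g: "g \<in> V" and t: "t \<ge> 0" for g t
    proof -
      have "m (\<lambda>x. (g x + t * f x) + - g x) \<le> m (\<lambda>x. g x + t * f x) + m (\<lambda>x. - g x)"
        by (rule sublinear_onD(1)[OF msub V1[OF g] fun_subspaceD(4)[OF V g]])
      then show ?thesis using sublinear_onD(2)[OF msub f t] by (simp add: algebra_simps)
    qed
    have bdd: "bdd_below ((\<lambda>t. m (\<lambda>x. g x + t * f x) - t * m f) ` {0..})" if "g \<in> V" for g
      using low[OF that] by (intro bdd_belowI2) auto
    have dle: "d g \<le> m (\<lambda>x. g x + t * f x) - t * m f" if "g \<in> V" "t \<ge> 0" for g t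
      unfolding d_def using that bdd[OF that(1)] by (auto intro: cINF_lower)
    have dgr: "c \<le> d g" if "\<And>t. t \<ge> 0 \<Longrightarrow> c \<le> m (\<lambda>x. g x + t * f x) - t * m f" "g \<in> V" for c g
      unfolding d_def using that by (auto intro!: cINF_greatest)
    have dm: "d \<le> m"
    proof (rule le_funI)
      fix g show "d g \<le> m g" using dle[of g 0] AD(2)[OF m, of g] by (cases "g \<in> V") (auto simp: d_def)
    qed
    have sub: "d (\<lambda>x. g x + h x) \<le> d g + d h" if g: "g \<in> V" and h: "h \<in> V" for g h
    proof -
      have gh: "(\<lambda>x. g x + h x) \<in> V" by (rule fun_subspaceD(2)[OF V g h])
      have 1: "d (\<lambda>x. g x + h x) \<le> (m (\<lambda>x. g x + s * f x) - s * m f) + (m (\<lambda>x. h x + t * f x) - t * m f)"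
        if "s \<ge> 0" "t \<ge> 0" for s t
      proof -
        have "d (\<lambda>x. g x + h x) \<le> m (\<lambda>x. (g x + h x) + (s + t) * f x) - (s + t) * m f"
          by (rule dle[OF gh]) (use that in simp)
        also have "(\<lambda>x. (g x + h x) + (s + t) * f x) = (\<lambda>x. (g x + s * f x) + (h x + t * f x))"
          by (simp add: algebra_simps)
        also have "m \<dots> \<le> m (\<lambda>x. g x + s * f x) + m (\<lambda>x. h x + t * f x)"
          by (rule sublinear_onD(1)[OF msub V1[OF g] V1[OF h]])
        finally show ?thesis by (simp add: algebra_simps)
      qed
      have "d (\<lambda>x. g x + h x) - (m (\<lambda>x. g x + s * f x) - s * m f) \<le> d h" if "s \<ge> 0" for s
        by (rule dgr[OF _ h]) (use 1[OF that] in \<open>simp add: algebra_simps\<close>)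
      then have "d (\<lambda>x. g x + h x) - d h \<le> d g" by (intro dgr[OF _ g]) (simp add: algebra_simps)
      then show ?thesis by simp
    qed
    have hom1: "d (\<lambda>x. c * g x) \<le> c * d g" if g: "g \<in> V" and c: "c > 0" for g c
    proof -
      have "d (\<lambda>x. c * g x) / c \<le> d g"
      proof (rule dgr[OF _ g])
        fix t :: real assume t: "t \<ge> 0"
        have "d (\<lambda>x. c * g x) \<le> m (\<lambda>x. c * g x + (c * t) * f x) - (c * t) * m f"
          by (rule dle[OF fun_subspaceD(3)[OF V g]]) (use c t in simp)
        also have "(\<lambda>x. c * g x + (c * t) * f x) = (\<lambda>x. c * (g x + t * f x))"
          by (simp add: algebra_simps)
        also have "m \<dots> = c * m (\<lambda>x. g x + t * f x)"
          by (rule sublinear_onD(2)[OF msub V1[OF g]]) (use c in simp)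
        finally show "d (\<lambda>x. c * g x) / c \<le> m (\<lambda>x. g x + t * f x) - t * m f"
          using c by (simp add: field_simps)
      qed
      then show ?thesis using c by (simp add: field_simps)
    qed
    have d0: "d (\<lambda>x. 0) = 0"
    proof -
      have "d (\<lambda>x. 0) \<le> 0"
        using dle[OF fun_subspaceD(1)[OF V], of 0] sublinear_on_neg_le(1)[OF V msub f] by simp
      moreover have "0 \<le> d (\<lambda>x. 0)"
        by (rule dgr[OF _ fun_subspaceD(1)[OF V]]) (use sublinear_onD(2)[OF msub f] in simp)
      ultimately show ?thesis by simp
    qed
    have hom: "d (\<lambda>x. c * g x) = c * d g" if g: "g \<in> V" and c: "c \<ge> 0" for g c
    proof (cases "c = 0")
      case True then show ?thesis using d0 by simp
    next
      case False
      then have c0: "c > 0" using c by simp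
      have "d (\<lambda>x. (1/c) * (c * g x)) \<le> (1/c) * d (\<lambda>x. c * g x)"
        by (rule hom1[OF fun_subspaceD(3)[OF V g]]) (use c0 in simp)
      then have "c * d g \<le> d (\<lambda>x. c * g x)" using c0 by (simp add: field_simps)
      then show ?thesis using hom1[OF g c0] by simp
    qed
    \<comment> \<open>With \<open>t = 1\<close> the argument becomes \<open>- f + f = 0\<close>.
      Once \<open>d = m\<close> is known, this estimate is the missing half of oddness of
      \<open>m\<close>.\<close>
    have dneg: "d (\<lambda>x. - f x) \<le> - m f"
      using dle[OF fun_subspaceD(4)[OF V f], of 1] sublinear_on_neg_le(1)[OF V msub f] by simp
    have "ext d"
      unfolding ext_def
    proof (intro allI impI ballI; elim conjE)
      fix L1 L2 t g assume *: "functional_on V L1" "functional_on V L2"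
          "\<forall>f\<in>V. L1 f \<le> P f" "\<forall>f\<in>V. L2 f \<le> P f" "0 < t" "t < 1" "g \<in> V"
          "\<forall>f\<in>V. t * L1 f + (1 - t) * L2 f \<le> d f"
      have le: "\<forall>f\<in>V. t * L1 f + (1 - t) * L2 f \<le> m f" 
        using *(8) le_funD[OF dm] by (auto intro: order_trans)
      have L1m: "\<forall>f\<in>V. L1 f \<le> m f" 
        using AD(4)[OF m, unfolded ext_def, rule_format, of L1 L2 t] *(1-6) le by simp
      have L2m: "\<forall>f\<in>V. L2 f \<le> m f" 
        using ext2[OF AD(4)[OF m] *(1-6) le] by simp
      \<comment> \<open>Evaluation at \<open>- f\<close> shows that the combination reaches
        \<open>m f\<close>. Both \<open>L1 f\<close> and \<open>L2 f\<close> are at most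
        \<open>m f\<close>, so \<open>L1 f = m f\<close>, and then
        \<open>L1 g = L1 (g + s * f) - s * m f\<close> is bounded by every term of the
        infimum.\<close>
      have "t * L1 f + (1 - t) * L2 f \<ge> m f"
        using *(8)[rule_format, OF fun_subspaceD(4)[OF V f]] dneg
          functional_onD(3)[OF *(1) f] functional_onD(3)[OF *(2) f] by simp
      moreover have "(1 - t) * L2 f \<le> (1 - t) * m f" using L2m f *(6) by (simp add: mult_left_mono)
      ultimately have "t * m f \<le> t * L1 f" by (simp add: algebra_simps)
      then have L1f: "L1 f = m f" using *(5) L1m f by (simp add: order_antisym)
      show "L1 g \<le> d g"
      proof (rule dgr[OF _ *(7)])
        fix s :: real assume "s \<ge> 0"
        have "L1 (\<lambda>x. g x + s * f x) \<le> m (\<lambda>x. g x + s * f x)" using L1m V1[OF *(7)] by blast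
        moreover have "L1 (\<lambda>x. g x + s * f x) = L1 g + s * L1 f"
          using functional_onD(1)[OF *(1,7) fun_subspaceD(3)[OF V f]] functional_onD(2)[OF *(1) f] by simp
        ultimately show "L1 g \<le> m (\<lambda>x. g x + s * f x) - s * m f" using L1f by simp
      qed
    qed
    moreover have "d g \<le> P g" if "g \<in> V" for g
      using le_funD[OF dm, of g] AD(3)[OF m that] by simp
    moreover have "d g = 0" if "g \<notin> V" for g
      using that by (simp add: d_def)
    ultimately have "d \<in> A"
      unfolding A_def sublinear_on_def using sub hom by simp
    then have "d = m" using min dm by blast
    then show ?thesis using dneg sublinear_on_neg_le(2)[OF V msub f] by simp
  qed
  have lin: "functional_on V m"
    unfolding functional_on_def
  proof (intro conjI ballI allI)
    fix f g assume f: "f \<in> V" and g: "g \<in> V"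
    have fg: "(\<lambda>x. f x + g x) \<in> V" by (rule fun_subspaceD(2)[OF V f g])
    have "m (\<lambda>x. - f x + - g x) \<le> m (\<lambda>x. - f x) + m (\<lambda>x. - g x)"
      by (rule sublinear_onD(1)[OF msub fun_subspaceD(4)[OF V f] fun_subspaceD(4)[OF V g]])
    then have "- m (\<lambda>x. f x + g x) \<le> - m f - m g"
      using neg[OF f] neg[OF g] neg[OF fg] by simp
    then show "m (\<lambda>x. f x + g x) = m f + m g" using sublinear_onD(1)[OF msub f g] by simp
  next
    fix f c assume f: "f \<in> V"
    show "m (\<lambda>x. c * f x) = c * m f"
    proof (cases "c \<ge> 0")
      case True then show ?thesis by (rule sublinear_onD(2)[OF msub f])
    next
      case False
      then have "m (\<lambda>x. (- c) * f x) = (- c) * m f" by (intro sublinear_onD(2)[OF msub f]) simp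
      then show ?thesis using neg[OF fun_subspaceD(3)[OF V f, of c]] by simp
    qed
  qed
  have "L1 f = m f" if *: "functional_on V L1" "functional_on V L2" "\<forall>f\<in>V. L1 f \<le> P f" 
      "\<forall>f\<in>V. L2 f \<le> P f" "0 < t" "t < 1" "\<forall>f\<in>V. m f = t * L1 f + (1 - t) * L2 f" "f \<in> V" for L1 L2 t f
  proof -
    have le: "L1 f \<le> m f" if "f \<in> V" for f
      using AD(4)[OF m, unfolded ext_def, rule_format, of L1 L2 t f] * that by simp
    show ?thesis
      using le[OF *(8)] le[OF fun_subspaceD(4)[OF V *(8)]] neg[OF *(8)] functional_onD(3)[OF *(1,8)] by simp
  qed
  then show ?thesis using lin AD(3)[OF m] by (intro exI[of _ m]) blast
qed

section \<open>The Daniell-Stone representation\<close>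

text \<open>Members are total functions, but bounds are demanded on \<open>S\<close> only. Closure
  under positive parts already gives closure under \<open>max\<close> and
  \<open>min\<close>.\<close>

definition fun_lattice :: "'a set \<Rightarrow> ('a \<Rightarrow> real) set \<Rightarrow> bool" where
  "fun_lattice S V \<longleftrightarrow> fun_subspace V \<and> (\<lambda>x. 1) \<in> V \<and> (\<forall>f\<in>V. (\<lambda>x. max 0 (f x)) \<in> V) \<and>
     (\<forall>f\<in>V. \<exists>B. \<forall>x\<in>S. \<bar>f x\<bar> \<le> B)"

text \<open>They generate the least \<sigma>-algebra on \<open>S\<close> for which all of
  \<open>V\<close> is measurable. It may be smaller than a Borel \<sigma>-algebra, for instance when
  \<open>V\<close> consists of functions invariant under a group.\<close>

definition cozero_sets :: "'a set \<Rightarrow> ('a \<Rightarrow> real) set \<Rightarrow> 'a set set" where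
  "cozero_sets S V = {{x\<in>S. 0 < f x} | f. f \<in> V}"

lemma cozero_setsI: "f \<in> V \<Longrightarrow> {x\<in>S. 0 < f x} \<in> cozero_sets S V"
  unfolding cozero_sets_def by blast

lemma fun_latticeD:
  assumes "fun_lattice S V"
  shows "fun_subspace V" "(\<lambda>x. c) \<in> V" "f \<in> V \<Longrightarrow> (\<lambda>x. max 0 (f x)) \<in> V"
    "f \<in> V \<Longrightarrow> \<exists>B. \<forall>x\<in>S. \<bar>f x\<bar> \<le> B"
    "f \<in> V \<Longrightarrow> g \<in> V \<Longrightarrow> (\<lambda>x. max (f x) (g x)) \<in> V"
    "f \<in> V \<Longrightarrow> g \<in> V \<Longrightarrow> (\<lambda>x. min (f x) (g x)) \<in> V"
    "f \<in> V \<Longrightarrow> (\<lambda>x. c * f x) \<in> V" "f \<in> V \<Longrightarrow> g \<in> V \<Longrightarrow> (\<lambda>x. f x + g x) \<in> V"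
    "f \<in> V \<Longrightarrow> g \<in> V \<Longrightarrow> (\<lambda>x. f x - g x) \<in> V"
proof -
  show V: "fun_subspace V" using assms unfolding fun_lattice_def by blast
  have 1: "(\<lambda>x. 1) \<in> V" using assms unfolding fun_lattice_def by blast
  show "(\<lambda>x. c) \<in> V" using fun_subspaceD(3)[OF V 1, of c] by simp
  show m: "f \<in> V \<Longrightarrow> (\<lambda>x. max 0 (f x)) \<in> V" for f using assms unfolding fun_lattice_def by blast
  show "f \<in> V \<Longrightarrow> \<exists>B. \<forall>x\<in>S. \<bar>f x\<bar> \<le> B" using assms unfolding fun_lattice_def by blast
  show "f \<in> V \<Longrightarrow> (\<lambda>x. c * f x) \<in> V" by (rule fun_subspaceD(3)[OF V])
  show a: "f \<in> V \<Longrightarrow> g \<in> V \<Longrightarrow> (\<lambda>x. f x + g x) \<in> V" for f g by (rule fun_subspaceD(2)[OF V])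
  show d: "f \<in> V \<Longrightarrow> g \<in> V \<Longrightarrow> (\<lambda>x. f x - g x) \<in> V" for f g by (rule fun_subspaceD(5)[OF V])
  show "(\<lambda>x. max (f x) (g x)) \<in> V" if "f \<in> V" "g \<in> V"
  proof -
    have "(\<lambda>x. max (f x) (g x)) = (\<lambda>x. f x + max 0 (g x - f x))" by (auto simp: max_def)
    then show ?thesis using a[OF that(1) m[OF d[OF that(2,1)]]] by simp
  qed
  show "(\<lambda>x. min (f x) (g x)) \<in> V" if "f \<in> V" "g \<in> V"
  proof -
    have "(\<lambda>x. min (f x) (g x)) = (\<lambda>x. f x - max 0 (f x - g x))" by (auto simp: max_def min_def)
    then show ?thesis using d[OF that(1) m[OF d[OF that(1,2)]]] by simp
  qed
qed

lemma fun_lattice_sum: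
  assumes "fun_lattice S V" "\<And>i. f i \<in> V"
  shows "(\<lambda>x. \<Sum>i<(n::nat). f i x) \<in> V"
  by (induction n) (use fun_latticeD(2,8)[OF assms(1)] assms(2) in auto)

lemma functional_on_sum:
  assumes "fun_lattice S V" "functional_on V L" "\<And>i. f i \<in> V"
  shows "L (\<lambda>x. \<Sum>i<(n::nat). f i x) = (\<Sum>i<n. L (f i))"
proof (induction n)
  case 0
  show ?case using functional_onD(4)[OF assms(2) assms(3)] by simp
next
  case (Suc n)
  then show ?case using functional_onD(1)[OF assms(2) fun_lattice_sum[OF assms(1,3)] assms(3)] by simp
qed

lemma cozero_sets_Int_stable:
  assumes "fun_lattice S V" shows "Int_stable (cozero_sets S V)"
proof (rule Int_stableI)
  fix a b assume "a \<in> cozero_sets S V" "b \<in> cozero_sets S V"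
  then obtain f g where "f \<in> V" "g \<in> V" and *: "a = {x\<in>S. 0 < f x}" "b = {x\<in>S. 0 < g x}"
    unfolding cozero_sets_def by blast
  then have "(\<lambda>x. min (f x) (g x)) \<in> V" using fun_latticeD(6)[OF assms] by blast
  moreover have "a \<inter> b = {x\<in>S. 0 < min (f x) (g x)}" using * by auto
  ultimately show "a \<inter> b \<in> cozero_sets S V" using cozero_setsI by metis
qed

lemma cozero_measurable:
  assumes V: "fun_lattice S V" and M: "space M = S" "sets M = sigma_sets S (cozero_sets S V)"
    and f: "f \<in> V"
  shows "f \<in> borel_measurable M"
proof (rule borel_measurableI_greater)
  fix a
  have "(\<lambda>x. f x - a) \<in> V" using fun_latticeD(9,2)[OF V] f by blast
  then have "{x\<in>S. 0 < f x - a} \<in> cozero_sets S V" by (rule cozero_setsI)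
  moreover have "{x\<in>S. 0 < f x - a} = {x \<in> space M. a < f x}" using M by auto
  ultimately show "{x \<in> space M. a < f x} \<in> sets M" using M by auto
qed

lemma cozero_integrable:
  assumes V: "fun_lattice S V" and M: "space M = S" "sets M = sigma_sets S (cozero_sets S V)"
    and f: "f \<in> V" and "finite_measure M"
  shows "integrable M (f :: _ \<Rightarrow> real)"
proof -
  interpret finite_measure M by fact
  obtain B where "\<forall>x\<in>S. \<bar>f x\<bar> \<le> B" using fun_latticeD(4)[OF V f] by blast
  then show ?thesis using cozero_measurable[OF V M f] M
    by (intro integrable_const_bound[where B=B]) auto
qed

text \<open>For use with \<open>y = f x\<close>: truncated multiples of a function in
  \<open>V\<close> stay in \<open>V\<close> and tend to the indicator of its cozero set.\<close>

lemma min_one_LIMSEQ: "(\<lambda>n. max 0 (min 1 (real n * y))) \<longlonglongrightarrow> (if 0 < y then 1 else 0 :: real)"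
proof (cases "0 < y")
  case True
  obtain N :: nat where N: "1 / y < real N" using reals_Archimedean2 by blast
  have "max 0 (min 1 (real n * y)) = 1" if "n \<ge> N" for n
  proof -
    have "real N * y \<le> real n * y" using that True by simp
    moreover have "1 < real N * y" using N True by (simp add: field_simps)
    ultimately show ?thesis by (simp add: max_def min_def)
  qed
  then have "eventually (\<lambda>n. max 0 (min 1 (real n * y)) = 1) sequentially"
    using eventually_sequentially by blast
  then show ?thesis using True by (simp add: tendsto_eventually)
next
  case False
  then have "real n * y \<le> 0" for n by (simp add: mult_nonneg_nonpos)
  then have "max 0 (min 1 (real n * y)) = 0" for n by (meson max.absorb1 min.coboundedI2)
  then show ?thesis using False by simp
qed

lemma cozero_emeasure_LIMSEQ:
  assumes V: "fun_lattice S V" and M: "space M = S" "sets M = sigma_sets S (cozero_sets S V)"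
    and f: "f \<in> V" and fin: "finite_measure M"
  shows "(\<lambda>n. \<integral>x. max 0 (min 1 (real n * f x)) \<partial>M) \<longlonglongrightarrow> measure M {x\<in>S. 0 < f x}"
proof -
  interpret finite_measure M by fact
  have fm[measurable]: "f \<in> borel_measurable M" by (rule cozero_measurable[OF V M f])
  have "(\<lambda>n. \<integral>x. max 0 (min 1 (real n * f x)) \<partial>M) \<longlonglongrightarrow> (\<integral>x. (if 0 < f x then 1 else 0) \<partial>M)"
    by (rule integral_dominated_convergence[where w="\<lambda>_. 1"])
      (use min_one_LIMSEQ in auto)
  also have "(\<integral>x. (if 0 < f x then 1 else 0) \<partial>M) = (\<integral>x. indicator {x\<in>S. 0 < f x} x \<partial>M)"
    by (rule Bochner_Integration.integral_cong) (auto simp: M indicator_def)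
  also have "\<dots> = measure M {x\<in>S. 0 < f x}" using M by (auto intro!: arg_cong[where f="measure M"])
  finally show ?thesis .
qed

text \<open>The cozero sets form an intersection-stable generator, and the measure of each is a
  limit of integrals of truncations that belong to \<open>V\<close>.\<close>

lemma cozero_measure_eqI:
  assumes V: "fun_lattice S V"
    and M: "space M = S" "sets M = sigma_sets S (cozero_sets S V)" "finite_measure M"
    and N: "space N = S" "sets N = sigma_sets S (cozero_sets S V)" "finite_measure N"
    and eq: "\<And>f. f \<in> V \<Longrightarrow> (\<integral>x. f x \<partial>M) = (\<integral>x. f x \<partial>N)"
  shows "M = N"
proof -
  interpret M: finite_measure M by fact
  interpret N: finite_measure N by fact
  have S1: "S \<in> cozero_sets S V"
    using cozero_setsI[OF fun_latticeD(2)[OF V, of 1], of S] by simp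
  show ?thesis
  proof (rule measure_eqI_generator_eq[OF cozero_sets_Int_stable[OF V]])
    show "cozero_sets S V \<subseteq> Pow S" unfolding cozero_sets_def by auto
    show "sets M = sigma_sets S (cozero_sets S V)" "sets N = sigma_sets S (cozero_sets S V)" by fact+
    show "range (\<lambda>_::nat. S) \<subseteq> cozero_sets S V" using S1 by auto
    show "emeasure M X = emeasure N X" if X: "X \<in> cozero_sets S V" for X
    proof -
      obtain f where f: "f \<in> V" "X = {x\<in>S. 0 < f x}" using X unfolding cozero_sets_def by blast
      have g: "(\<lambda>x. max 0 (min 1 (real n * f x))) \<in> V" for n
        using fun_latticeD(2,3,6,7)[OF V] f(1) by blast
      have "measure M X = measure N X"
        using LIMSEQ_unique[OF cozero_emeasure_LIMSEQ[OF V M(1,2) f(1) M(3)]]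
          cozero_emeasure_LIMSEQ[OF V N(1,2) f(1) N(3)] eq[OF g] f(2) by auto
      then show ?thesis by (simp add: M.emeasure_eq_measure N.emeasure_eq_measure)
    qed
  qed (auto simp: M.emeasure_eq_measure)
qed

text \<open>Horizontal slicing: the parts of \<open>y\<close> in the layers from
  \<open>k / N\<close> to \<open>(k + 1) / N\<close> telescope.\<close>

lemma slice_sum:
  assumes "0 \<le> y" "0 < N"
  shows "(\<Sum>k<n. max 0 (min (y - real k / N) (1 / N))) = min y (real n / N)"
proof (induction n)
  case 0 then show ?case using assms by simp
next
  case (Suc n)
  have "real (Suc n) / N = real n / N + 1 / N" by (simp add: add_divide_distrib)
  moreover have "0 < 1 / N" using assms by simp
  ultimately have "min y (real n / N) + max 0 (min (y - real n / N) (1 / N)) = min y (real (Suc n) / N)"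
    by linarith
  then show ?case using Suc by simp
qed

text \<open>Replacing the one partly filled layer by a full one costs at most one layer of height
  \<open>1 / N\<close>. This is the whole error when a functional is compared with an integral by
  slicing.\<close>

lemma level_count:
  assumes "0 \<le> y" "0 < N"
  shows "(\<Sum>k<n. if 0 < y - real k / N then 1 else 0) \<le> N * y + (1::real)"
proof -
  have "(\<Sum>k<n. if 0 < y - real k / N then 1 else 0 :: real) = real (card {k. k < n \<and> 0 < y - real k / N})"
    by (subst sum.inter_filter[symmetric]) (auto intro!: arg_cong[where f=card])
  also have "card {k. k < n \<and> 0 < y - real k / N} \<le> card {..<nat \<lceil>N * y\<rceil>}"
    using assms by (intro card_mono) (auto simp: field_simps less_ceiling_iff zless_nat_eq_int_zless)
  also have "card {..<nat \<lceil>N * y\<rceil>} = nat \<lceil>N * y\<rceil>" by simp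
  also have "real (nat \<lceil>N * y\<rceil>) \<le> N * y + 1"
    using assms by (simp add: of_nat_nat)
  finally show ?thesis by simp
qed

text \<open>The functional measures regions between graphs: \<open>G f g\<close> receives the mass
  \<open>L (max 0 (g - f))\<close>, and these regions form a semiring to which Caratheodory's
  theorem applies. Countable additivity is checked for fixed \<open>x\<close> by Lebesgue measure on
  the vertical sections and then carried over to \<open>L\<close> by \<open>cont\<close>. The
  representing measure is the image on \<open>S\<close> of the slab of height 1. Slicing gives
  \<open>L f \<le> \<integral> f\<close>, and the same for \<open>- f\<close>, after rescaling,
  gives equality.\<close>

theorem daniell_stone:
  assumes V: "fun_lattice S V" and L: "functional_on V L"
    and pos: "\<And>f. f \<in> V \<Longrightarrow> (\<And>x. x \<in> S \<Longrightarrow> 0 \<le> f x) \<Longrightarrow> 0 \<le> L f"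
    and L1: "L (\<lambda>x. 1) = 1"
    and cont: "\<And>F :: nat \<Rightarrow> 'a \<Rightarrow> real. (\<And>n. F n \<in> V) \<Longrightarrow> (\<And>n x. x \<in> S \<Longrightarrow> F (Suc n) x \<le> F n x) \<Longrightarrow>
      (\<And>x. x \<in> S \<Longrightarrow> (\<lambda>n. F n x) \<longlonglongrightarrow> 0) \<Longrightarrow> (\<lambda>n. L (F n)) \<longlonglongrightarrow> 0"
  shows "\<exists>M. space M = S \<and> sets M = sigma_sets S (cozero_sets S V) \<and> prob_space M \<and>
    (\<forall>f\<in>V. integrable M f \<and> (\<integral>x. f x \<partial>M) = L f)"
proof -
  note Vs = fun_latticeD(1)[OF V]
  note VI = fun_latticeD(2,3,5-9)[OF V]
  have mono: "L f \<le> L g" if "f \<in> V" "g \<in> V" "\<And>x. x \<in> S \<Longrightarrow> f x \<le> g x" for f g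
    using pos[OF VI(7)[OF that(2,1)]] that(3) functional_onD(5)[OF L that(2,1) fun_subspaceD(4)[OF Vs that(1)]]
    by simp
  have cong: "L f = L g" if "f \<in> V" "g \<in> V" "\<And>x. x \<in> S \<Longrightarrow> f x = g x" for f g
    using mono[OF that(1,2)] mono[OF that(2,1)] that(3) by (simp add: order_antisym)
  define G where "G f g = {(x, t). x \<in> S \<and> f x \<le> t \<and> t < g x}" for f g :: "'a \<Rightarrow> real"
  define \<mu> where "\<mu> f g = ennreal (L (\<lambda>x. max 0 (g x - f x)))" for f g
  have Vd: "(\<lambda>x. max 0 (g x - f x)) \<in> V" if "f \<in> V" "g \<in> V" for f g
    using VI(2)[OF VI(7)[OF that(2,1)]] .
  define P where "P f g \<longleftrightarrow> f \<in> V \<and> g \<in> V" for f g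
  define M' where "M' = extend_measure (S \<times> UNIV) {(a, b). P a b} (\<lambda>(a, b). G a b) (\<lambda>(a, b). \<mu> a b)"
  define \<G> where "\<G> = {G a b | a b. P a b}"
  have \<G>_I: "G f g \<in> \<G>" if "f \<in> V" "g \<in> V" for f g using that unfolding \<G>_def P_def by blast
  have Gsec: "emeasure lborel {t. (x, t) \<in> G f g} = ennreal (max 0 (g x - f x))" if "x \<in> S" for x f g
  proof -
    have "{t. (x, t) \<in> G f g} = {f x..<g x}" using that by (auto simp: G_def)
    then show ?thesis by (cases "f x \<le> g x") (auto simp: max_def)
  qed
  have semiring: "semiring_of_sets (S \<times> UNIV) \<G>"
  proof
    show "\<G> \<subseteq> Pow (S \<times> UNIV)" by (auto simp: \<G>_def G_def)
    have "G (\<lambda>x. 0) (\<lambda>x. 0) = {}" by (auto simp: G_def)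
    then show "{} \<in> \<G>" using \<G>_I[OF VI(1) VI(1), of 0 0] by simp
    fix a b assume "a \<in> \<G>" "b \<in> \<G>"
    then obtain f g f' g' where V4: "f \<in> V" "g \<in> V" "f' \<in> V" "g' \<in> V" and ab: "a = G f g" "b = G f' g'"
      by (auto simp: \<G>_def P_def)
    have "a \<inter> b = G (\<lambda>x. max (f x) (f' x)) (\<lambda>x. min (g x) (g' x))" by (auto simp: ab G_def)
    then show "a \<inter> b \<in> \<G>" using \<G>_I[OF VI(3)[OF V4(1,3)] VI(4)[OF V4(2,4)]] by simp
    \<comment> \<open>The difference of two regions splits into the part below \<open>f'\<close> and
      the part above \<open>g'\<close>; the additional maximum with \<open>f'\<close> keeps the
      pieces disjoint where \<open>g' < f'\<close>.\<close>
    let ?A = "G f (\<lambda>x. min (g x) (f' x))"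
    let ?B = "G (\<lambda>x. max (max (f x) (f' x)) (g' x)) g"
    have "a - b = \<Union>{?A, ?B}" by (auto simp: ab G_def)
    moreover have "?A \<in> \<G>" by (rule \<G>_I[OF V4(1) VI(4)[OF V4(2,3)]])
    moreover have "?B \<in> \<G>" by (rule \<G>_I[OF VI(3)[OF VI(3)[OF V4(1,3)] V4(4)] V4(2)])
    moreover have "disjoint {?A, ?B}" by (auto simp: disjoint_def G_def)
    ultimately show "\<exists>C\<subseteq>\<G>. finite C \<and> disjoint C \<and> a - b = \<Union>C"
      by (intro exI[of _ "{?A, ?B}"]) auto
  qed
  have em: "emeasure M' (G f g) = \<mu> f g" if fg: "f \<in> V" "g \<in> V" for f g
  proof (rule extend_measure_caratheodory_pair[OF M'_def])
    show "P f g" using fg by (simp add: P_def)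
    show "semiring_of_sets (S \<times> UNIV) {G a b |a b. P a b}" using semiring by (simp add: \<G>_def)
    \<comment> \<open>The mass depends on the region only: its vertical sections have length
      \<open>max 0 (g x - f x)\<close>, and \<open>L\<close> depends only on values on
      \<open>S\<close>.\<close>
    show inj: "\<mu> f g = \<mu> k l" if "P f g" "P k l" "G f g = G k l" for f g k l
    proof -
      have "max 0 (g x - f x) = max 0 (l x - k x)" if "x \<in> S" for x
      proof -
        have "ennreal (max 0 (g x - f x)) = ennreal (max 0 (l x - k x))"
          unfolding Gsec[OF that, symmetric] using \<open>G f g = G k l\<close> by simp
        then show ?thesis by (subst (asm) ennreal_inj) auto
      qed
      then show ?thesis unfolding \<mu>_def
        using cong[OF Vd Vd] that(1,2) unfolding P_def by (intro arg_cong[where f=ennreal]) simp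
    qed
    show "\<mu> f g = 0" if "P f g" "G f g = {}" for f g
    proof -
      have "G f f = {}" by (auto simp: G_def)
      then have "\<mu> f g = \<mu> f f" using inj[of f g f f] that by (auto simp: P_def)
      also have "\<dots> = 0" using functional_onD(4)[OF L VI(1)] by (simp add: \<mu>_def)
      finally show ?thesis .
    qed
    show "0 \<le> \<mu> f g" for f g by simp
  next
    fix A B :: "nat \<Rightarrow> 'a \<Rightarrow> real" and j k
    assume AB: "\<And>n. P (A n) (B n)" "P j k" "disjoint_family (\<lambda>n. G (A n) (B n))" "(\<Union>i. G (A i) (B i)) = G j k"
    define h where "h n x = max 0 (B n x - A n x)" for n x
    define H where "H x = max 0 (k x - j x)" for x
    have hV: "h n \<in> V" for n unfolding h_def using Vd AB(1) by (simp add: P_def)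
    have HV: "H \<in> V" unfolding H_def using Vd AB(2) by (simp add: P_def)
    \<comment> \<open>Over a fixed \<open>x\<close> the regions are disjoint intervals that exhaust
      the section of \<open>G j k\<close>, so their lengths add up.\<close>
    have sums: "(\<lambda>n. h n x) sums H x" if x: "x \<in> S" for x
    proof -
      have "(\<lambda>n. emeasure lborel {t. (x, t) \<in> G (A n) (B n)}) sums emeasure lborel (\<Union>n. {t. (x, t) \<in> G (A n) (B n)})"
      proof -
        have "disjoint_family (\<lambda>n. {t. (x, t) \<in> G (A n) (B n)})"
          using AB(3) unfolding disjoint_family_on_def by blast
        moreover have "{t. (x, t) \<in> G (A n) (B n)} = {A n x..<B n x}" for n using x by (auto simp: G_def)
        ultimately show ?thesis by (intro sums_emeasure) auto
      qed
      also have "(\<Union>n. {t. (x, t) \<in> G (A n) (B n)}) = {t. (x, t) \<in> G j k}" using AB(4) by blast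
      finally have "(\<lambda>n. ennreal (h n x)) sums ennreal (H x)" unfolding Gsec[OF x] h_def H_def .
      then show ?thesis by (subst (asm) sums_ennreal) (auto simp: h_def H_def)
    qed
    have hn: "0 \<le> h n x" for n x by (simp add: h_def)
    \<comment> \<open>The remainders decrease pointwise to 0 on \<open>S\<close>, which is the
      situation covered by \<open>cont\<close>.\<close>
    have "(\<lambda>n. L (\<lambda>x. H x - (\<Sum>i<n. h i x))) \<longlonglongrightarrow> 0"
    proof (rule cont)
      show "(\<lambda>x. H x - (\<Sum>i<n. h i x)) \<in> V" for n by (rule VI(7)[OF HV fun_lattice_sum[OF V hV]])
      show "H x - (\<Sum>i<Suc n. h i x) \<le> H x - (\<Sum>i<n. h i x)" for n x using hn[of n x] by simp
      show "(\<lambda>n. H x - (\<Sum>i<n. h i x)) \<longlonglongrightarrow> 0" if "x \<in> S" for x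
        using tendsto_diff[OF tendsto_const sums[OF that, unfolded sums_def], of "H x"] by simp
    qed
    moreover have "L (\<lambda>x. H x - (\<Sum>i<n. h i x)) = L H - (\<Sum>i<n. L (h i))" for n
      using functional_onD(5)[OF L HV fun_lattice_sum[OF V hV] fun_subspaceD(4)[OF Vs fun_lattice_sum[OF V hV]]]
        functional_on_sum[OF V L hV] by simp
    ultimately have "(\<lambda>n. L H - (\<Sum>i<n. L (h i))) \<longlonglongrightarrow> 0" by simp
    then have "(\<lambda>n. L H - (L H - (\<Sum>i<n. L (h i)))) \<longlonglongrightarrow> L H - 0" by (intro tendsto_diff tendsto_const)
    then have "(\<lambda>n. L (h n)) sums L H" unfolding sums_def by simp
    moreover have "0 \<le> L (h n)" for n by (rule pos[OF hV hn])
    moreover have "0 \<le> L H" by (rule pos[OF HV]) (simp add: H_def)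
    ultimately have "(\<lambda>n. ennreal (L (h n))) sums ennreal (L H)" by (subst sums_ennreal) auto
    then show "(\<Sum>n. \<mu> (A n) (B n)) = \<mu> j k" unfolding \<mu>_def h_def H_def by (rule sums_unique[symmetric])
  qed
  have sp: "space M' = S \<times> UNIV" unfolding M'_def by (intro space_extend_measure) (auto simp: G_def)
  have setsM': "sets M' = sigma_sets (S \<times> UNIV) \<G>"
  proof -
    have im: "(\<lambda>(a, b). G a b) ` {(a, b). P a b} = \<G>" by (auto simp: \<G>_def image_def)
    have "\<G> \<subseteq> Pow (S \<times> UNIV)" by (auto simp: \<G>_def G_def)
    then show ?thesis unfolding M'_def using sets_extend_measure[of "\<lambda>(a, b). G a b" "{(a, b). P a b}"]
      unfolding im by blast
  qed
  have GM: "G f g \<in> sets M'" if "f \<in> V" "g \<in> V" for f g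
    unfolding setsM' using \<G>_I[OF that] by auto
  define B where "B = G (\<lambda>x. 0) (\<lambda>x. 1)"
  have BM: "B \<in> sets M'" unfolding B_def by (rule GM[OF VI(1) VI(1)])
  have B: "B = S \<times> {0..<1}" by (auto simp: B_def G_def)
  define N where "N = distr (restrict_space M' B) (sigma S (cozero_sets S V)) fst"
  define c where "c n f x = max 0 (min 1 (real n * f x))" for n f and x :: 'a
  have cV: "c n f \<in> V" if "f \<in> V" for n f
    unfolding c_def using VI(1,2,4,5) that by blast
  have cozPow: "cozero_sets S V \<subseteq> Pow S" unfolding cozero_sets_def by auto
  have spN: "space N = S" and setsN: "sets N = sigma_sets S (cozero_sets S V)"
    using cozPow by (auto simp: N_def)
  \<comment> \<open>The slab has height 1 and \<open>c n f\<close> increases to the indicator of the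
    cozero set, so the part of the slab above that set is a countable union of regions. This makes
    \<open>fst\<close> measurable.\<close>
  have cut: "fst -` {x\<in>S. 0 < f x} \<inter> B = (\<Union>n. G (\<lambda>x. 0) (c n f))" for f
  proof (rule Set.set_eqI, rule iffI)
    fix z assume "z \<in> fst -` {x\<in>S. 0 < f x} \<inter> B"
    then obtain x t where z: "z = (x, t)" "x \<in> S" "0 < f x" "0 \<le> t" "t < 1" by (auto simp: B)
    obtain n :: nat where "t / f x < real n" using reals_Archimedean2 by blast
    then have "t < real n * f x" using z(3) by (simp add: field_simps)
    then have "z \<in> G (\<lambda>x. 0) (c n f)" using z by (auto simp: G_def c_def)
    then show "z \<in> (\<Union>n. G (\<lambda>x. 0) (c n f))" by blast
  next
    fix z assume "z \<in> (\<Union>n. G (\<lambda>x. 0) (c n f))"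
    then obtain n x t where z: "z = (x, t)" "x \<in> S" "0 \<le> t" "t < c n f x" by (auto simp: G_def)
    then have "0 < real n * f x" "t < 1" by (auto simp: c_def max_def min_def split: if_splits)
    then show "z \<in> fst -` {x\<in>S. 0 < f x} \<inter> B" using z by (auto simp: B zero_less_mult_iff)
  qed
  have meas: "fst \<in> restrict_space M' B \<rightarrow>\<^sub>M sigma S (cozero_sets S V)"
  proof (rule measurable_measure_of[OF cozPow])
    show "fst \<in> space (restrict_space M' B) \<rightarrow> S" by (auto simp: space_restrict_space B)
    fix A assume "A \<in> cozero_sets S V"
    then obtain f where f: "f \<in> V" "A = {x\<in>S. 0 < f x}" unfolding cozero_sets_def by blast
    have "fst -` A \<inter> B \<in> sets M'" unfolding f(2) cut using GM[OF VI(1) cV[OF f(1)]] by blast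
    moreover have "B \<subseteq> space M'" using sp by (auto simp: B)
    ultimately show "fst -` A \<inter> space (restrict_space M' B) \<in> sets (restrict_space M' B)"
      by (subst sets_restrict_space_iff) (use BM in \<open>auto simp: space_restrict_space Int_absorb2\<close>)
  qed
  have emN: "emeasure N A = emeasure M' (fst -` A \<inter> B)" if "A \<in> sets N" for A
  proof -
    have "B \<subseteq> space M'" using sp by (auto simp: B)
    moreover have "A \<in> sets (sigma S (cozero_sets S V))" using that by (simp add: N_def)
    ultimately show ?thesis unfolding N_def
      by (subst emeasure_distr[OF meas]) (use BM in \<open>auto simp: space_restrict_space Int_absorb2 intro!: emeasure_restrict_space\<close>)
  qed
  have "emeasure N (space N) = emeasure M' B"
  proof -
    have "fst -` S \<inter> B = B" by (auto simp: B)
    then show ?thesis using emN[OF sets.top] spN by simp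
  qed
  also have "\<dots> = 1" using em[OF VI(1) VI(1), of 0 1] L1 by (simp add: B_def \<mu>_def)
  finally have prob: "prob_space N" by (rule prob_spaceI)
  interpret N: prob_space N by fact
  \<comment> \<open>The region under \<open>c n f\<close> lies in the slab above the cozero set. An
    inequality is enough, since the reverse estimate comes from applying \<open>le1\<close> to a
    reflected function.\<close>
  have Lc: "L (c n f) \<le> measure N {x\<in>S. 0 < f x}" if f: "f \<in> V" for n f
  proof -
    have fs: "{x\<in>S. 0 < f x} \<in> sets N" using cozero_setsI[OF f] unfolding setsN by auto
    have fM: "fst -` {x\<in>S. 0 < f x} \<inter> B \<in> sets M'" unfolding cut using GM[OF VI(1) cV[OF f]] by blast
    have "ennreal (L (c n f)) = \<mu> (\<lambda>x. 0) (c n f)"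
      unfolding \<mu>_def by (intro arg_cong[where f=ennreal] arg_cong[where f=L] ext) (simp add: c_def)
    also have "\<dots> = emeasure M' (G (\<lambda>x. 0) (c n f))" by (rule em[OF VI(1) cV[OF f], symmetric])
    also have "\<dots> \<le> emeasure M' (fst -` {x\<in>S. 0 < f x} \<inter> B)"
      by (rule emeasure_mono[OF _ fM], unfold cut, blast)
    also have "\<dots> = ennreal (measure N {x\<in>S. 0 < f x})" using emN[OF fs] N.emeasure_eq_measure by simp
    finally show ?thesis by simp
  qed
  have le1: "L f \<le> (\<integral>x. f x \<partial>N)" if f: "f \<in> V" and f01: "\<And>x. x \<in> S \<Longrightarrow> 0 \<le> f x \<and> f x \<le> 1" for f
  proof -
    have int: "integrable N f" by (rule cozero_integrable[OF V spN setsN f N.finite_measure_axioms])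
    have bound: "L f \<le> (\<integral>x. f x \<partial>N) + 1 / real K" if K: "0 < K" for K
    proof -
      define u where "u k x = f x - real k / real K" for k x
      have uV: "u k \<in> V" for k unfolding u_def by (rule VI(7)[OF f VI(1)])
      have us: "{x\<in>S. 0 < u k x} \<in> sets N" for k using cozero_setsI[OF uV] unfolding setsN by auto
      have ii: "integrable N (\<lambda>x. indicator {x\<in>S. 0 < u k x} x :: real)" for k
        using us by (intro integrable_real_indicator) (auto simp: N.emeasure_eq_measure)
      have Ii: "(\<integral>x. indicator {x\<in>S. 0 < u k x} x \<partial>N) = measure N {x\<in>S. 0 < u k x}" for k
        using us[of k] sets.sets_into_space[OF us[of k]] by (simp add: Int_absorb2)
      \<comment> \<open>A function with values in \<open>[0, 1]\<close> is the mean of its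
        \<open>K\<close> layers, each stretched to height 1. A stretched layer is the truncation
        \<open>c K (u k)\<close>, whose value under \<open>L\<close> is at most the measure of the
        set where \<open>f\<close> exceeds \<open>k / K\<close>.\<close>
      have "L f = L (\<lambda>x. \<Sum>k<K. (1 / real K) * c K (u k) x)"
      proof (rule cong[OF f])
        show "(\<lambda>x. \<Sum>k<K. (1 / real K) * c K (u k) x) \<in> V"
          by (rule fun_lattice_sum[OF V VI(5)[OF cV[OF uV]]])
        fix x assume x: "x \<in> S"
        have "(1 / real K) * c K (u k) x = max 0 (min (f x - real k / K) (1 / K))" for k
        proof -
          have "min (f x - real k / K) (1 / K) = (1 / real K) * min 1 (real K * u k x)"
            using K by (auto simp: min_def u_def field_simps)
          then show ?thesis using K by (auto simp: c_def max_def zero_le_divide_iff)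
        qed
        then have "(\<Sum>k<K. (1 / real K) * c K (u k) x) = min (f x) (real K / real K)"
          using slice_sum[of "f x" "real K" K] f01[OF x] K by simp
        then show "f x = (\<Sum>k<K. (1 / real K) * c K (u k) x)" using f01[OF x] K by simp
      qed
      also have "\<dots> = (\<Sum>k<K. L (\<lambda>x. (1 / real K) * c K (u k) x))"
        by (rule functional_on_sum[OF V L VI(5)[OF cV[OF uV]]])
      also have "\<dots> = (\<Sum>k<K. (1 / real K) * L (c K (u k)))"
        by (intro sum.cong refl functional_onD(2)[OF L cV[OF uV]])
      also have "\<dots> \<le> (\<Sum>k<K. (1 / real K) * measure N {x\<in>S. 0 < u k x})"
        by (intro sum_mono mult_left_mono Lc[OF uV]) simp
      also have "\<dots> = (\<integral>x. (1 / real K) * (\<Sum>k<K. indicator {x\<in>S. 0 < u k x} x) \<partial>N)"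
        by (subst integral_mult_right_zero, subst Bochner_Integration.integral_sum)
          (use ii Ii in \<open>auto simp: sum_distrib_left\<close>)
      also have "\<dots> \<le> (\<integral>x. f x + 1 / real K \<partial>N)"
      proof (rule integral_mono)
        show "integrable N (\<lambda>x. (1 / real K) * (\<Sum>k<K. indicator {x\<in>S. 0 < u k x} x))"
          using ii by (intro integrable_mult_right Bochner_Integration.integrable_sum) auto
        show "integrable N (\<lambda>x. f x + 1 / real K)" using int by simp
        fix x assume x: "x \<in> space N"
        have "(\<Sum>k<K. indicator {x\<in>S. 0 < u k x} x) = (\<Sum>k<K. if 0 < f x - real k / K then 1 else 0 :: real)"
          using x spN by (intro sum.cong) (auto simp: u_def indicator_def)
        also have "\<dots> \<le> K * f x + 1" using level_count[of "f x" "real K" K] f01 x spN K by simp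
        finally show "(1 / real K) * (\<Sum>k<K. indicator {x\<in>S. 0 < u k x} x) \<le> f x + 1 / real K"
          using K by (simp add: field_simps)
      qed
      also have "\<dots> = (\<integral>x. f x \<partial>N) + 1 / real K" using int N.prob_space by simp
      finally show ?thesis .
    qed
    show ?thesis
    proof (rule field_le_epsilon)
      fix e :: real assume "0 < e"
      then obtain K where "0 < K" "1 / real K < e" using nat_approx_posE by (metis inverse_eq_divide of_nat_0_less_iff ex_inverse_of_nat_less)
      then show "L f \<le> (\<integral>x. f x \<partial>N) + e" using bound[of K] by simp
    qed
  qed
  have eq: "(\<integral>x. f x \<partial>N) = L f" if f: "f \<in> V" for f
  proof -
    have int: "integrable N g" if "g \<in> V" for g
      by (rule cozero_integrable[OF V spN setsN that N.finite_measure_axioms])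
    obtain b where b: "\<forall>x\<in>S. \<bar>f x\<bar> \<le> b" using fun_latticeD(4)[OF V f] by blast
    define D where "D = \<bar>b\<bar> + 1"
    have D: "0 < D" "\<And>x. x \<in> S \<Longrightarrow> \<bar>f x\<bar> \<le> D" using b by (auto simp: D_def abs_le_iff intro: order_trans)
    \<comment> \<open>Dividing by \<open>2 * D\<close> and adding \<open>1 / 2\<close> moves
      \<open>s * f\<close> into \<open>[0, 1]\<close>, where \<open>le1\<close> applies; the two
      signs \<open>s\<close> give the two inequalities.\<close>
    have *: "s * L f / (2 * D) + 1 / 2 \<le> s * (\<integral>x. f x \<partial>N) / (2 * D) + 1 / 2" if s: "s = 1 \<or> s = -1" for s
    proof -
      define g where "g x = (s / (2 * D)) * f x + 1 / 2" for x
      have gV: "g \<in> V" unfolding g_def by (rule VI(6)[OF VI(5)[OF f] VI(1)])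
      have "L g \<le> (\<integral>x. g x \<partial>N)"
      proof (rule le1[OF gV])
        fix x assume x: "x \<in> S"
        have "\<bar>(s / (2 * D)) * f x\<bar> \<le> 1 / 2" using D(2)[OF x] D(1) s by (auto simp: abs_mult field_simps)
        then show "0 \<le> g x \<and> g x \<le> 1" unfolding g_def by linarith
      qed
      moreover have "L g = s * L f / (2 * D) + 1 / 2"
      proof -
        have "L g = L (\<lambda>x. (s / (2 * D)) * f x) + L (\<lambda>x. 1 / 2)"
          unfolding g_def by (rule functional_onD(1)[OF L VI(5)[OF f] VI(1)])
        moreover have "L (\<lambda>x. (s / (2 * D)) * f x) = (s / (2 * D)) * L f" by (rule functional_onD(2)[OF L f])
        moreover have "L (\<lambda>x. (1 / 2) * 1) = (1 / 2) * L (\<lambda>x. 1)" by (rule functional_onD(2)[OF L VI(1)])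
        ultimately show ?thesis using L1 by simp
      qed
      moreover have "(\<integral>x. g x \<partial>N) = s * (\<integral>x. f x \<partial>N) / (2 * D) + 1 / 2"
        unfolding g_def using int[OF f] N.prob_space by simp
      ultimately show ?thesis by simp
    qed
    show ?thesis using *[of 1] *[of "-1"] D(1) by (simp add: divide_le_cancel)
  qed
  show ?thesis
    using spN setsN prob eq cozero_integrable[OF V spN setsN _ N.finite_measure_axioms] by blast
qed

section \<open>Ergodic measures and absolute continuity\<close>

text \<open>The set of points whose orbit is eventually in \<open>A\<close> is strictly invariant.
  For almost every point the whole orbit agrees on membership in \<open>A\<close>, so this set
  differs from \<open>A\<close> by a null set.\<close>

lemma ergodic_AE_invariant:
  assumes "prob_space \<nu>" and T: "T \<in> \<nu> \<rightarrow>\<^sub>M \<nu>" and inv: "distr \<nu> \<nu> T = \<nu>"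
    and erg: "\<And>A. A \<in> sets \<nu> \<Longrightarrow> T -` A \<inter> space \<nu> = A \<Longrightarrow> measure \<nu> A \<in> {0, 1}"
    and A: "A \<in> sets \<nu>" and AE: "AE x in \<nu>. x \<in> A \<longleftrightarrow> T x \<in> A"
  shows "measure \<nu> A \<in> {0, 1}"
proof -
  interpret prob_space \<nu> by fact
  have Tn[measurable]: "(T ^^ n) \<in> \<nu> \<rightarrow>\<^sub>M \<nu>" for n
    by (induction n) (use T in auto)
  have invn: "distr \<nu> \<nu> (T ^^ n) = \<nu>" for n
  proof (induction n)
    case 0 show ?case by (simp add: distr_id)
  next
    case (Suc n)
    have "distr \<nu> \<nu> (T ^^ Suc n) = distr (distr \<nu> \<nu> (T ^^ n)) \<nu> T"
      by (subst distr_distr[OF T]) (use T in \<open>auto simp: comp_def\<close>)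
    then show ?case using Suc inv by (simp add: comp_def)
  qed
  note A[measurable] T[measurable]
  have "AE x in \<nu>. (T ^^ n) x \<in> A \<longleftrightarrow> T ((T ^^ n) x) \<in> A" for n
  proof -
    have "AE y in distr \<nu> \<nu> (T ^^ n). y \<in> A \<longleftrightarrow> T y \<in> A"
      unfolding invn by (rule AE)
    then show ?thesis by (subst (asm) AE_distr_iff) auto
  qed
  then have AEn: "AE x in \<nu>. \<forall>n. (T ^^ n) x \<in> A \<longleftrightarrow> T ((T ^^ n) x) \<in> A" unfolding AE_all_countable by blast
  define A' where "A' = {x \<in> space \<nu>. \<exists>N. \<forall>n\<ge>N. (T ^^ n) x \<in> A}"
  have A'[measurable]: "A' \<in> sets \<nu>" unfolding A'_def by measurable
  have shift: "(\<exists>N. \<forall>n\<ge>N. (T ^^ n) (T x) \<in> A) \<longleftrightarrow> (\<exists>N. \<forall>n\<ge>N. (T ^^ n) x \<in> A)" for x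
  proof -
    have "(T ^^ n) (T x) = (T ^^ Suc n) x" for n by (simp add: funpow_swap1)
    moreover have "(\<exists>N. \<forall>n\<ge>N. (T ^^ Suc n) x \<in> A) \<longleftrightarrow> (\<exists>N. \<forall>n\<ge>N. (T ^^ n) x \<in> A)"
      by (metis Suc_le_D Suc_le_mono le_SucI)
    ultimately show ?thesis by simp
  qed
  have "T -` A' \<inter> space \<nu> = A'" using measurable_space[OF T] by (auto simp: A'_def shift)
  then have "measure \<nu> A' \<in> {0, 1}" by (rule erg[OF A'])
  moreover have "AE x in \<nu>. x \<in> A' \<longleftrightarrow> x \<in> A"
    using AEn AE_space
  proof eventually_elim
    case (elim x)
    have "(T ^^ n) x \<in> A \<longleftrightarrow> x \<in> A" for n using elim(1) by (induction n) auto
    then show ?case using elim(2) by (auto simp: A'_def)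
  qed
  then have "measure \<nu> A' = measure \<nu> A" by (intro finite_measure_eq_AE) auto
  ultimately show ?thesis by simp
qed

text \<open>The set where the density exceeds 1 is almost invariant: passing to its preimage trades
  a set of density above 1 for one of equal mass and density at most 1.\<close>

lemma ergodic_measure_unique:
  assumes "prob_space \<nu>" and T: "T \<in> \<nu> \<rightarrow>\<^sub>M \<nu>" and inv: "distr \<nu> \<nu> T = \<nu>"
    and erg: "\<And>A. A \<in> sets \<nu> \<Longrightarrow> T -` A \<inter> space \<nu> = A \<Longrightarrow> measure \<nu> A \<in> {0, 1}"
    and "prob_space \<nu>'" and sets: "sets \<nu>' = sets \<nu>" and inv': "distr \<nu>' \<nu>' T = \<nu>'"
    and ac: "absolutely_continuous \<nu> \<nu>'"
  shows "\<nu>' = \<nu>"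
proof -
  interpret prob_space \<nu> by fact
  interpret P': prob_space \<nu>' by fact
  have sp: "space \<nu>' = space \<nu>" using sets by (rule sets_eq_imp_space_eq)
  obtain g where g[measurable]: "g \<in> borel_measurable \<nu>" and dg: "density \<nu> g = \<nu>'"
    using Radon_Nikodym[OF ac sets] by blast
  have em': "emeasure \<nu>' A = (\<integral>\<^sup>+x\<in>A. g x \<partial>\<nu>)" if "A \<in> sets \<nu>" for A
    using emeasure_density[OF g that] dg by simp
  have T': "T \<in> \<nu>' \<rightarrow>\<^sub>M \<nu>'" using T measurable_cong_sets[OF sets sets] by simp
  define A where "A = {x \<in> space \<nu>. 1 < g x}"
  have A[measurable]: "A \<in> sets \<nu>" unfolding A_def by measurable
  define B where "B = T -` A \<inter> space \<nu>"
  have B[measurable]: "B \<in> sets \<nu>" unfolding B_def using T A by (rule measurable_sets)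
  have "emeasure \<nu> B = emeasure \<nu> A" using emeasure_distr[OF T A] inv by (simp add: B_def)
  then have mB: "measure \<nu> B = measure \<nu> A" by (simp add: measure_def)
  have "emeasure \<nu>' B = emeasure \<nu>' A" using emeasure_distr[OF T', of A] inv' sets A sp by (simp add: B_def)
  then have mB': "measure \<nu>' B = measure \<nu>' A" by (simp add: measure_def)
  \<comment> \<open>\<open>A\<close> and its preimage \<open>B\<close> have equal mass under each of
    the two invariant measures, hence so do the two differences.\<close>
  have d: "measure \<nu> (A - B) = measure \<nu> (B - A)"
    using mB finite_measure_Diff'[OF A B] finite_measure_Diff'[OF B A] by (simp add: Int_commute)
  have d': "measure \<nu>' (A - B) = measure \<nu>' (B - A)"
    using mB' P'.finite_measure_Diff'[of A B] P'.finite_measure_Diff'[of B A] sets by (simp add: Int_commute)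
  have "emeasure \<nu>' (A - B) = emeasure \<nu>' (B - A)" using d' by (simp add: P'.emeasure_eq_measure)
  also have "\<dots> = (\<integral>\<^sup>+x\<in>B - A. g x \<partial>\<nu>)" by (rule em') auto
  also have "\<dots> \<le> (\<integral>\<^sup>+x\<in>B - A. 1 \<partial>\<nu>)"
    by (intro nn_integral_mono) (auto simp: A_def indicator_def not_less)
  also have "\<dots> = emeasure \<nu> (A - B)" using d by (simp add: emeasure_eq_measure)
  finally have le: "(\<integral>\<^sup>+x\<in>A - B. g x \<partial>\<nu>) \<le> (\<integral>\<^sup>+x\<in>A - B. 1 \<partial>\<nu>)" by (simp add: em')
  have "AE x in \<nu>. g x * indicator (A - B) x \<le> 1 * indicator (A - B) x"
  proof (rule ccontr)
    assume n: "\<not> (AE x in \<nu>. g x * indicator (A - B) x \<le> 1 * indicator (A - B) x)"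
    have "(\<integral>\<^sup>+x\<in>A - B. 1 \<partial>\<nu>) < (\<integral>\<^sup>+x\<in>A - B. g x \<partial>\<nu>)"
    proof (rule nn_integral_less[OF _ _ _ _ n])
      show "(\<integral>\<^sup>+x\<in>A - B. 1 \<partial>\<nu>) \<noteq> \<infinity>" by (simp add: emeasure_eq_measure)
    qed (auto simp: A_def indicator_def)
    then show False using le by simp
  qed
  then have "AE x in \<nu>. x \<notin> A - B" by (rule AE_mp) (auto intro!: AE_I2 simp: A_def indicator_def split: if_splits)
  then have null: "measure \<nu> (A - B) = 0" by (subst prob_eq_0) auto
  then have "AE x in \<nu>. x \<notin> A - B" by (subst (asm) prob_eq_0) auto
  moreover have "AE x in \<nu>. x \<notin> B - A" using null d by (subst prob_eq_0[symmetric]) auto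
  ultimately have "AE x in \<nu>. x \<in> A \<longleftrightarrow> T x \<in> A"
    using AE_space by eventually_elim (auto simp: B_def)
  then have m01: "measure \<nu> A \<in> {0, 1}" 
    using ergodic_AE_invariant[OF assms(1) T inv _ A] erg by blast
  have g1: "(\<integral>\<^sup>+x. g x \<partial>\<nu>) = 1"
    using em'[OF sets.top] P'.emeasure_space_1 sp by (simp add: nn_integral_cong[of _ "\<lambda>x. g x * indicator (space \<nu>) x" g] cong: nn_integral_cong)
  \<comment> \<open>A density above 1 almost everywhere would give total mass above 1. In the
    remaining case the density is at most 1 almost everywhere with integral 1, so it equals
    1.\<close>
  have "measure \<nu> A \<noteq> 1"
  proof
    assume "measure \<nu> A = 1"
    then have AE: "AE x in \<nu>. x \<in> A" by (subst (asm) prob_eq_1) auto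
    have "\<not> (AE x in \<nu>. g x \<le> 1)"
    proof
      assume "AE x in \<nu>. g x \<le> 1"
      with AE have "AE x in \<nu>. False" by eventually_elim (auto simp: A_def)
      then show False using AE_False emeasure_space_1 by simp
    qed
    then have "(\<integral>\<^sup>+x. 1 \<partial>\<nu>) < (\<integral>\<^sup>+x. g x \<partial>\<nu>)"
      by (rule nn_integral_less[rotated 4]) (use AE emeasure_space_1 in \<open>auto simp: A_def elim: AE_mp\<close>)
    then show False using g1 emeasure_space_1 by simp
  qed
  then have "AE x in \<nu>. x \<notin> A" using m01 by (subst prob_eq_0[symmetric]) auto
  with AE_space have gle: "AE x in \<nu>. g x \<le> 1" by eventually_elim (auto simp: A_def)
  have "AE x in \<nu>. 1 \<le> g x"
  proof (rule ccontr)
    assume "\<not> (AE x in \<nu>. 1 \<le> g x)"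
    then have "(\<integral>\<^sup>+x. g x \<partial>\<nu>) < (\<integral>\<^sup>+x. 1 \<partial>\<nu>)"
      by (rule nn_integral_less[rotated 4]) (use gle g1 in auto)
    then show False using g1 emeasure_space_1 by simp
  qed
  with gle have "AE x in \<nu>. g x = 1" by eventually_elim auto
  then have "density \<nu> g = density \<nu> (\<lambda>_. 1)" by (intro density_cong) auto
  then show ?thesis using dg by (simp add: density_1)
qed

section \<open>Ergodic lifts supported on fibres\<close>

text \<open>In the instance \<open>S\<close> is the total space of \<open>Q\<close>,
  \<open>T\<close> the automorphism, and \<open>\<Phi> x\<close> the set of frames that carry
  \<open>H\<close> to \<open>chi x\<close>. No topology on \<open>S\<close> occurs:
  \<open>dini\<close> stands for compactness of the fibres as seen by \<open>V\<close>,
  \<open>sup_meas\<close> for their measurable dependence on \<open>x\<close>, and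
  \<open>\<A>_approx\<close> for the supply of functions pulled back from the base. The family
  \<open>\<H>\<close> serves to recognise the fibres; it is countable because almost sure statements
  about its members have to be combined.\<close>

locale fibre_lift =
  fixes S :: "'p set" and V :: "('p \<Rightarrow> real) set" and T :: "'p \<Rightarrow> 'p"
    and \<nu> :: "'x measure" and b :: "'x \<Rightarrow> 'x" and \<pi> :: "'p \<Rightarrow> 'x"
    and \<Omega> :: "'x set" and \<Phi> :: "'x \<Rightarrow> 'p set"
    and \<A> :: "'x set set" and \<H> :: "('p \<Rightarrow> real) set"
  assumes V: "fun_lattice S V"
    and V_mult: "f \<in> V \<Longrightarrow> g \<in> V \<Longrightarrow> (\<lambda>p. f p * g p) \<in> V"
    and V_T: "f \<in> V \<Longrightarrow> (\<lambda>p. f (T p)) \<in> V"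
    and T_S: "p \<in> S \<Longrightarrow> T p \<in> S" and \<pi>_S: "p \<in> S \<Longrightarrow> \<pi> p \<in> space \<nu>"
    and \<pi>_T: "p \<in> S \<Longrightarrow> \<pi> (T p) = b (\<pi> p)"
    and prob_\<nu>: "prob_space \<nu>" and b_meas: "b \<in> \<nu> \<rightarrow>\<^sub>M \<nu>" and b_inv: "distr \<nu> \<nu> b = \<nu>"
    and \<Omega>: "\<Omega> \<in> sets \<nu>" "measure \<nu> \<Omega> = 1" "x \<in> \<Omega> \<Longrightarrow> b x \<in> \<Omega>"
    and \<Phi>_ne: "x \<in> \<Omega> \<Longrightarrow> \<Phi> x \<noteq> {}" and \<Phi>_sub: "x \<in> \<Omega> \<Longrightarrow> p \<in> \<Phi> x \<Longrightarrow> p \<in> S \<and> \<pi> p = x"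
    and \<Phi>_T: "x \<in> \<Omega> \<Longrightarrow> p \<in> \<Phi> x \<Longrightarrow> T p \<in> \<Phi> (b x)"
    and sup_meas: "f \<in> V \<Longrightarrow> (\<lambda>x. if x \<in> \<Omega> then (SUP p\<in>\<Phi> x. f p) else 0) \<in> borel_measurable \<nu>"
    and dini: "\<And>F. (\<And>n::nat. F n \<in> V) \<Longrightarrow> (\<And>n p. p \<in> S \<Longrightarrow> F (Suc n) p \<le> F n p) \<Longrightarrow>
        (\<And>p. p \<in> S \<Longrightarrow> (\<lambda>n. F n p) \<longlonglongrightarrow> 0) \<Longrightarrow> x \<in> \<Omega> \<Longrightarrow> (\<lambda>n. SUP p\<in>\<Phi> x. F n p) \<longlonglongrightarrow> 0"
    and \<A>: "Int_stable \<A>" "\<A> \<subseteq> Pow (space \<nu>)" "sets \<nu> = sigma_sets (space \<nu>) \<A>" "space \<nu> \<in> \<A>"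
    and \<A>_approx: "A \<in> \<A> \<Longrightarrow> \<exists>g::nat \<Rightarrow> 'x \<Rightarrow> real. \<forall>n. (\<lambda>p. g n (\<pi> p)) \<in> V \<and>
        (\<forall>x\<in>space \<nu>. 0 \<le> g n x \<and> g n x \<le> 1 \<and> (\<lambda>n. g n x) \<longlonglongrightarrow> indicator A x)"
    and \<H>: "countable \<H>" "\<H> \<subseteq> V"
    and \<H>_const: "h \<in> \<H> \<Longrightarrow> x \<in> \<Omega> \<Longrightarrow> p \<in> \<Phi> x \<Longrightarrow> q \<in> \<Phi> x \<Longrightarrow> h p = h q"
    and \<H>_sep: "p \<in> S \<Longrightarrow> \<pi> p \<in> \<Omega> \<Longrightarrow> (\<And>h. h \<in> \<H> \<Longrightarrow> \<exists>q\<in>\<Phi> (\<pi> p). h p = h q) \<Longrightarrow> p \<in> \<Phi> (\<pi> p)"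
begin

sublocale nu: prob_space \<nu> by (rule prob_\<nu>)

definition supf :: "('p \<Rightarrow> real) \<Rightarrow> 'x \<Rightarrow> real" where
  "supf f x = (if x \<in> \<Omega> then (SUP p\<in>\<Phi> x. f p) else 0)"

text \<open>On these functions \<open>supint\<close> is linear, so every functional that it
  dominates takes the same value on them.\<close>

definition fconst :: "('p \<Rightarrow> real) \<Rightarrow> bool" where
  "fconst f \<longleftrightarrow> (\<forall>x\<in>\<Omega>. \<forall>p\<in>\<Phi> x. \<forall>q\<in>\<Phi> x. f p = f q)"

definition supint :: "('p \<Rightarrow> real) \<Rightarrow> real" where
  "supint f = (\<integral>x. supf f x \<partial>\<nu>)"

definition supinv :: "('p \<Rightarrow> real) \<Rightarrow> real" where
  "supinv f = (INF g\<in>V. supint (\<lambda>p. f p + (g p - g (T p))))"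

lemma supf_measurable[measurable]: "f \<in> V \<Longrightarrow> supf f \<in> borel_measurable \<nu>"
  unfolding supf_def[abs_def] by (rule sup_meas)

lemma AE_\<Omega>: "AE x in \<nu>. x \<in> \<Omega>"
  using \<Omega>(1,2) by (subst nu.prob_eq_1[symmetric]) auto

lemmas Vs = fun_latticeD(1)[OF V]
lemmas VI = fun_latticeD(2,3,5-9)[OF V]

lemma VT_diff: "g \<in> V \<Longrightarrow> (\<lambda>p. g p - g (T p)) \<in> V"
  by (intro VI(7) V_T)

lemma bdd_V: assumes "f \<in> V" "x \<in> \<Omega>" shows "bdd_above (f ` \<Phi> x)"
proof -
  obtain B where "\<forall>p\<in>S. \<bar>f p\<bar> \<le> B" using fun_latticeD(4)[OF V assms(1)] by blast
  then show ?thesis using \<Phi>_sub[OF assms(2)] by (intro bdd_aboveI2[where M=B]) (auto simp: abs_le_iff)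
qed

lemma supf_upper: "f \<in> V \<Longrightarrow> x \<in> \<Omega> \<Longrightarrow> p \<in> \<Phi> x \<Longrightarrow> f p \<le> supf f x"
  unfolding supf_def using bdd_V by (auto intro: cSUP_upper)

lemma supf_least: "x \<in> \<Omega> \<Longrightarrow> (\<And>p. p \<in> \<Phi> x \<Longrightarrow> f p \<le> c) \<Longrightarrow> supf f x \<le> c"
  unfolding supf_def using \<Phi>_ne by (auto intro: cSUP_least)

lemma supf_const: "fconst f \<Longrightarrow> x \<in> \<Omega> \<Longrightarrow> p \<in> \<Phi> x \<Longrightarrow> supf f x = f p"
proof -
  assume a: "fconst f" "x \<in> \<Omega>" "p \<in> \<Phi> x"
  have "f ` \<Phi> x = {f p}" using a unfolding fconst_def by blast
  then show ?thesis using a by (simp add: supf_def)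
qed

lemma supf_bound:
  assumes "\<And>p. p \<in> S \<Longrightarrow> \<bar>f p\<bar> \<le> B" "f \<in> V" shows "\<bar>supf f x\<bar> \<le> \<bar>B\<bar>"
proof (cases "x \<in> \<Omega>")
  case True
  obtain p where p: "p \<in> \<Phi> x" using \<Phi>_ne[OF True] by blast
  have "- B \<le> f p" using assms(1)[of p] \<Phi>_sub[OF True p] by simp
  then have "- \<bar>B\<bar> \<le> supf f x" using supf_upper[OF assms(2) True p] by simp
  moreover have "supf f x \<le> \<bar>B\<bar>"
    by (rule supf_least[OF True]) (use assms(1) \<Phi>_sub[OF True] in \<open>force simp: abs_le_iff\<close>)
  ultimately show ?thesis by (simp add: abs_le_iff)
qed (simp add: supf_def)

lemma supf_integrable: "f \<in> V \<Longrightarrow> integrable \<nu> (supf f)"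
proof -
  assume f: "f \<in> V"
  obtain B where "\<forall>p\<in>S. \<bar>f p\<bar> \<le> B" using fun_latticeD(4)[OF V f] by blast
  then have "\<bar>supf f x\<bar> \<le> \<bar>B\<bar>" for x using supf_bound f by blast
  then show ?thesis using f by (intro nu.integrable_const_bound[where B="\<bar>B\<bar>"]) auto
qed

lemma supint_mono:
  assumes "f \<in> V" "g \<in> V" "\<And>x. x \<in> \<Omega> \<Longrightarrow> supf f x \<le> supf g x"
  shows "supint f \<le> supint g"
  unfolding supint_def using assms AE_\<Omega>
  by (intro integral_mono_AE supf_integrable) auto

lemma supint_sublinear: "sublinear_on V supint"
  unfolding sublinear_on_def
proof (intro conjI ballI allI impI)
  fix f g assume f: "f \<in> V" and g: "g \<in> V"
  have "supint (\<lambda>x. f x + g x) \<le> (\<integral>x. supf f x + supf g x \<partial>\<nu>)"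
    unfolding supint_def
  proof (rule integral_mono_AE)
    show "AE x in \<nu>. supf (\<lambda>x. f x + g x) x \<le> supf f x + supf g x"
      using AE_\<Omega>
    proof eventually_elim
      case (elim x)
      show ?case
        by (rule supf_least[OF elim]) (use supf_upper[OF f elim] supf_upper[OF g elim] in \<open>simp add: add_mono\<close>)
    qed
  qed (use supf_integrable f g VI(6) in auto)
  then show "supint (\<lambda>x. f x + g x) \<le> supint f + supint g"
    unfolding supint_def using supf_integrable f g by simp
next
  fix f and c :: real assume f: "f \<in> V" and c: "0 \<le> c"
  have "supf (\<lambda>x. c * f x) x = c * supf f x" if x: "x \<in> \<Omega>" for x
  proof (rule antisym)
    show "supf (\<lambda>x. c * f x) x \<le> c * supf f x"
      by (rule supf_least[OF x]) (use supf_upper[OF f x] c in \<open>simp add: mult_left_mono\<close>)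
    show "c * supf f x \<le> supf (\<lambda>x. c * f x) x"
    proof (cases "c = 0")
      case True
      then show ?thesis using \<Phi>_ne[OF x] by (simp add: supf_def)
    next
      case False
      then have c: "0 < c" using c by simp
      have "supf f x \<le> supf (\<lambda>x. c * f x) x / c"
        by (rule supf_least[OF x]) (use supf_upper[OF VI(5)[OF f, of c] x] c in \<open>simp add: field_simps\<close>)
      then show ?thesis using c by (simp add: field_simps)
    qed
  qed
  then have "supint (\<lambda>x. c * f x) = (\<integral>x. c * supf f x \<partial>\<nu>)"
    unfolding supint_def using f VI(5)[OF f] AE_\<Omega> by (intro integral_cong_AE) auto
  then show "supint (\<lambda>x. c * f x) = c * supint f" unfolding supint_def by simp
qed

text \<open>\<open>T\<close> carries the fibre over \<open>x\<close> into the fibre over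
  \<open>b x\<close>, so the supremum over the fibre of \<open>x\<close> is at most
  \<open>supf f (b x)\<close>, and \<open>b\<close> preserves \<nu>.\<close>

lemma supint_T: assumes f: "f \<in> V" shows "supint (\<lambda>p. f (T p)) \<le> supint f"
proof -
  have "supint (\<lambda>p. f (T p)) \<le> (\<integral>x. supf f (b x) \<partial>\<nu>)"
    unfolding supint_def
  proof (rule integral_mono_AE)
    show "integrable \<nu> (supf (\<lambda>p. f (T p)))" by (rule supf_integrable[OF V_T[OF f]])
    show "integrable \<nu> (\<lambda>x. supf f (b x))"
      using integrable_distr_eq[OF b_meas, of "supf f"] supf_integrable[OF f] f b_inv by simp
    show "AE x in \<nu>. supf (\<lambda>p. f (T p)) x \<le> supf f (b x)"
      using AE_\<Omega>
    proof eventually_elim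
      case (elim x)
      show ?case by (rule supf_least[OF elim]) (rule supf_upper[OF f \<Omega>(3)[OF elim] \<Phi>_T[OF elim]])
    qed
  qed
  also have "\<dots> = supint f" using integral_distr[OF b_meas, of "supf f"] f b_inv by (simp add: supint_def)
  finally show ?thesis .
qed

text \<open>Subadditivity applied to \<open>g = (g - g \<circ> T) + g \<circ> T\<close>. This keeps
  the infimum in \<open>supinv\<close> finite and gives it the value 0 at 0.\<close>

lemma supint_coboundary: assumes g: "g \<in> V" shows "0 \<le> supint (\<lambda>p. g p - g (T p))"
  using sublinear_onD(1)[OF supint_sublinear VT_diff[OF g] V_T[OF g]] supint_T[OF g] by simp

lemma supint_const: "supint (\<lambda>_. c) = c"
proof -
  have "fconst (\<lambda>_. c)" by (simp add: fconst_def)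
  then have "AE x in \<nu>. supf (\<lambda>_. c) x = c" using AE_\<Omega> \<Phi>_ne supf_const by (auto elim!: eventually_mono)
  then have "supint (\<lambda>_. c) = (\<integral>x. c \<partial>\<nu>)"
    unfolding supint_def by (intro integral_cong_AE) (use VI(1) in auto)
  then show ?thesis using nu.prob_space by simp
qed

lemma supinv_bdd: assumes f: "f \<in> V"
  shows "bdd_below ((\<lambda>g. supint (\<lambda>p. f p + (g p - g (T p)))) ` V)"
proof (rule bdd_belowI2)
  fix g assume g: "g \<in> V"
  note gT = VT_diff[OF g]
  have "supint (\<lambda>p. (f p + (g p - g (T p))) + - f p) \<le> supint (\<lambda>p. f p + (g p - g (T p))) + supint (\<lambda>p. - f p)"
    by (rule sublinear_onD(1)[OF supint_sublinear VI(6)[OF f gT] fun_subspaceD(4)[OF Vs f]])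
  then show "- supint (\<lambda>p. - f p) \<le> supint (\<lambda>p. f p + (g p - g (T p)))"
    using supint_coboundary[OF g] by simp
qed

lemma supinv_le: "f \<in> V \<Longrightarrow> g \<in> V \<Longrightarrow> supinv f \<le> supint (\<lambda>p. f p + (g p - g (T p)))"
  unfolding supinv_def using supinv_bdd by (auto intro: cINF_lower)

lemma supinv_greatest: "(\<And>g. g \<in> V \<Longrightarrow> c \<le> supint (\<lambda>p. f p + (g p - g (T p)))) \<Longrightarrow> c \<le> supinv f"
  unfolding supinv_def using VI(1)[of 0] by (auto intro!: cINF_greatest)

lemma supinv_le_supint: "f \<in> V \<Longrightarrow> supinv f \<le> supint f"
  using supinv_le[of f "\<lambda>_. 0"] VI(1) by simp

lemma supinv_sublinear: "sublinear_on V supinv"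
  unfolding sublinear_on_def
proof (intro conjI ballI allI impI)
  fix f g assume f: "f \<in> V" and g: "g \<in> V"
  have fg: "(\<lambda>x. f x + g x) \<in> V" by (rule VI(6)[OF f g])
  have 1: "supinv (\<lambda>x. f x + g x) \<le> supint (\<lambda>p. f p + (h p - h (T p))) + supint (\<lambda>p. g p + (k p - k (T p)))"
    if h: "h \<in> V" and k: "k \<in> V" for h k
  proof -
    have "supinv (\<lambda>x. f x + g x) \<le> supint (\<lambda>p. f p + g p + ((h p + k p) - (h (T p) + k (T p))))"
      by (rule supinv_le[OF fg VI(6)[OF h k]])
    also have "(\<lambda>p. f p + g p + ((h p + k p) - (h (T p) + k (T p)))) =
        (\<lambda>p. (f p + (h p - h (T p))) + (g p + (k p - k (T p))))" by (simp add: algebra_simps)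
    also have "supint \<dots> \<le> supint (\<lambda>p. f p + (h p - h (T p))) + supint (\<lambda>p. g p + (k p - k (T p)))"
      by (intro sublinear_onD(1)[OF supint_sublinear] VI(6) f g VT_diff h k)
    finally show ?thesis .
  qed
  have "supinv (\<lambda>x. f x + g x) - supint (\<lambda>p. f p + (h p - h (T p))) \<le> supinv g" if "h \<in> V" for h
    by (rule supinv_greatest) (use 1[OF that] in \<open>simp add: algebra_simps\<close>)
  then have "supinv (\<lambda>x. f x + g x) - supinv g \<le> supinv f"
    by (intro supinv_greatest) (simp add: algebra_simps)
  then show "supinv (\<lambda>x. f x + g x) \<le> supinv f + supinv g" by simp
next
  have hom: "supinv (\<lambda>x. c * f x) \<le> c * supinv f" if f: "f \<in> V" and c: "0 < c" for f c
  proof -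
    have "supinv (\<lambda>x. c * f x) / c \<le> supinv f"
    proof (rule supinv_greatest)
      fix g assume g: "g \<in> V"
      have "supinv (\<lambda>x. c * f x) \<le> supint (\<lambda>p. c * f p + (c * g p - c * g (T p)))"
        by (rule supinv_le[OF VI(5)[OF f] VI(5)[OF g]])
      also have "(\<lambda>p. c * f p + (c * g p - c * g (T p))) = (\<lambda>p. c * (f p + (g p - g (T p))))"
        by (simp add: algebra_simps)
      also have "supint \<dots> = c * supint (\<lambda>p. f p + (g p - g (T p)))"
        by (rule sublinear_onD(2)[OF supint_sublinear VI(6)[OF f VT_diff[OF g]]]) (use c in simp)
      finally show "supinv (\<lambda>x. c * f x) / c \<le> supint (\<lambda>p. f p + (g p - g (T p)))"
        using c by (simp add: field_simps)
    qed
    then show ?thesis using c by (simp add: field_simps)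
  qed
  fix f and c :: real assume f: "f \<in> V" and c: "0 \<le> c"
  show "supinv (\<lambda>x. c * f x) = c * supinv f"
  proof (cases "c = 0")
    case True
    have "supinv (\<lambda>_. 0) \<le> 0" using supinv_le_supint[OF VI(1)] supint_const by metis
    moreover have "0 \<le> supinv (\<lambda>_. 0)" by (rule supinv_greatest) (use supint_coboundary in simp)
    ultimately show ?thesis using True by simp
  next
    case False
    then have c: "0 < c" using c by simp
    have "supinv (\<lambda>x. (1 / c) * (c * f x)) \<le> (1 / c) * supinv (\<lambda>x. c * f x)"
      by (rule hom[OF VI(5)[OF f]]) (use c in simp)
    then show ?thesis using hom[OF f c] c by (simp add: field_simps)
  qed
qed

definition lift_functional :: "(('p \<Rightarrow> real) \<Rightarrow> real) \<Rightarrow> bool" where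
  "lift_functional L \<longleftrightarrow> functional_on V L \<and> (\<forall>f\<in>V. L f \<le> supinv f)"

lemma lift_functionalD:
  assumes "lift_functional L"
  shows "functional_on V L" and "f \<in> V \<Longrightarrow> L f \<le> supinv f" and "f \<in> V \<Longrightarrow> L f \<le> supint f"
proof -
  show "functional_on V L" using assms unfolding lift_functional_def by (rule conjunct1)
  show 1: "L f \<le> supinv f" if "f \<in> V" using assms that unfolding lift_functional_def by simp
  show "L f \<le> supint f" if f: "f \<in> V" using 1[OF f] supinv_le_supint[OF f] by simp
qed

text \<open>Choosing the coboundary of \<open>h\<close> in the infimum cancels
  \<open>h \<circ> T - h\<close> and leaves \<open>supint\<close> of 0; the inequality for
  \<open>h = g\<close> and for \<open>h = - g\<close> gives equality.\<close>

lemma lift_functional_T: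
  assumes L: "lift_functional L" and g: "g \<in> V" shows "L (\<lambda>p. g (T p)) = L g"
proof -
  note lin = lift_functionalD(1)[OF L] and le = lift_functionalD(2)[OF L]
  have 1: "L (\<lambda>p. h (T p)) \<le> L h" if h: "h \<in> V" for h
  proof -
    have d: "(\<lambda>p. h (T p) - h p) \<in> V" by (rule VI(7)[OF V_T[OF h] h])
    have "L (\<lambda>p. h (T p) - h p) \<le> supinv (\<lambda>p. h (T p) - h p)" by (rule le[OF d])
    also have "\<dots> \<le> supint (\<lambda>p. (h (T p) - h p) + (h p - h (T p)))" by (rule supinv_le[OF d h])
    also have "\<dots> = 0" using supint_const[of 0] by simp
    finally show ?thesis
      using functional_onD(5)[OF lin V_T[OF h] h fun_subspaceD(4)[OF Vs h]] by simp
  qed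
  have "L (\<lambda>p. - g (T p)) \<le> L (\<lambda>p. - g p)" by (rule 1[OF fun_subspaceD(4)[OF Vs g]])
  then have "L g \<le> L (\<lambda>p. g (T p))"
    using functional_onD(3)[OF lin g] functional_onD(3)[OF lin V_T[OF g]] by simp
  then show ?thesis using 1[OF g] by simp
qed

lemma supint_neg_fconst:
  assumes f: "f \<in> V" and c: "fconst f" shows "supint (\<lambda>p. - f p) = - supint f"
proof -
  have c': "fconst (\<lambda>p. - f p)" using c unfolding fconst_def by (simp only: neg_equal_iff_equal)
  have "AE x in \<nu>. supf (\<lambda>p. - f p) x = - supf f x"
    using AE_\<Omega>
  proof eventually_elim
    case (elim x)
    then obtain p where "p \<in> \<Phi> x" using \<Phi>_ne by blast
    show ?case unfolding supf_const[OF c elim \<open>p \<in> \<Phi> x\<close>] supf_const[OF c' elim \<open>p \<in> \<Phi> x\<close>] ..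
  qed
  then have "supint (\<lambda>p. - f p) = (\<integral>x. - supf f x \<partial>\<nu>)"
    unfolding supint_def
    by (rule integral_cong_AE[OF supf_measurable[OF fun_subspaceD(4)[OF Vs f]] borel_measurable_uminus[OF supf_measurable[OF f]]])
  then show ?thesis by (simp add: supint_def)
qed

text \<open>Domination of \<open>f\<close> and of \<open>- f\<close> leaves a single possible value,
  because the supremum over a fibre on which \<open>f\<close> is constant changes sign with
  \<open>f\<close>.\<close>

lemma lift_functional_fconst:
  assumes L: "lift_functional L" and f: "f \<in> V" and c: "fconst f" shows "L f = supint f"
proof -
  note lin = lift_functionalD(1)[OF L] and le = lift_functionalD(3)[OF L]
  have "- L f \<le> - supint f"
    using le[OF fun_subspaceD(4)[OF Vs f]] supint_neg_fconst[OF f c] functional_onD(3)[OF lin f] by simp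
  then show ?thesis using le[OF f] by simp
qed

text \<open>Continuity along decreasing sequences comes from \<open>dini\<close> on each fibre and
  dominated convergence over the base. Positivity holds because the supremum of \<open>- f\<close>
  is at most 0 for nonnegative \<open>f\<close>.\<close>

lemma lift_functional_measure:
  assumes L: "lift_functional L"
  shows "\<exists>M. space M = S \<and> sets M = sigma_sets S (cozero_sets S V) \<and> prob_space M \<and>
    (\<forall>f\<in>V. integrable M f \<and> (\<integral>x. f x \<partial>M) = L f)"
proof (rule daniell_stone[OF V])
  show lin: "functional_on V L" by (rule lift_functionalD(1)[OF L])
  note le = lift_functionalD(3)[OF L]
  show pos: "0 \<le> L f" if f: "f \<in> V" and "\<And>x. x \<in> S \<Longrightarrow> 0 \<le> f x" for f
  proof -
    have "supint (\<lambda>p. - f p) \<le> supint (\<lambda>_. 0)"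
    proof (rule supint_mono[OF fun_subspaceD(4)[OF Vs f] VI(1)])
      fix x assume x: "x \<in> \<Omega>"
      have "supf (\<lambda>p. - f p) x \<le> 0" by (rule supf_least[OF x]) (use \<Phi>_sub[OF x] that(2) in auto)
      also have "0 \<le> supf (\<lambda>_. 0) x" using \<Phi>_ne[OF x] by (simp add: supf_def)
      finally show "supf (\<lambda>p. - f p) x \<le> supf (\<lambda>_. 0) x" .
    qed
    then show ?thesis
      using le[OF fun_subspaceD(4)[OF Vs f]] functional_onD(3)[OF lin f] supint_const[of 0] by simp
  qed
  show "L (\<lambda>x. 1) = 1"
    using lift_functional_fconst[OF L VI(1)[of 1]] supint_const[of 1] by (simp add: fconst_def)
  fix F :: "nat \<Rightarrow> 'p \<Rightarrow> real"
  assume F: "\<And>n. F n \<in> V" "\<And>n x. x \<in> S \<Longrightarrow> F (Suc n) x \<le> F n x"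
    "\<And>x. x \<in> S \<Longrightarrow> (\<lambda>n. F n x) \<longlonglongrightarrow> 0"
  have decm: "F (n + k) x \<le> F n x" if x: "x \<in> S" for n k x
  proof (induction k)
    case (Suc k)
    then show ?case using F(2)[OF x, of "n + k"] by simp
  qed simp
  have nn: "0 \<le> F n x" if x: "x \<in> S" for n x
  proof (rule LIMSEQ_le_const2[OF F(3)[OF x]])
    show "\<exists>N. \<forall>m\<ge>N. F m x \<le> F n x"
    proof (intro exI[of _ n] allI impI)
      fix m assume "n \<le> m"
      then show "F m x \<le> F n x" using decm[OF x, of n "m - n"] by simp
    qed
  qed
  obtain B where B: "\<forall>p\<in>S. \<bar>F 0 p\<bar> \<le> B" using fun_latticeD(4)[OF V F(1)] by blast
  have FB: "\<bar>F n p\<bar> \<le> B" if "p \<in> S" for n p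
  proof -
    have "F 0 p \<le> B" using B that by (simp add: abs_le_iff)
    then show ?thesis using decm[OF that, of 0 n] nn[OF that, of n] by simp
  qed
  have "(\<lambda>n. supint (F n)) \<longlonglongrightarrow> (\<integral>x. 0 \<partial>\<nu>)"
    unfolding supint_def
  proof (rule integral_dominated_convergence[where w="\<lambda>_. \<bar>B\<bar>"])
    show "AE x in \<nu>. (\<lambda>n. supf (F n) x) \<longlonglongrightarrow> 0"
      using AE_\<Omega>
    proof eventually_elim
      case (elim x)
      then show ?case using dini[OF F elim] by (simp add: supf_def)
    qed
    show "AE x in \<nu>. norm (supf (F n) x) \<le> \<bar>B\<bar>" for n
      using supf_bound[OF FB F(1)] by simp
  qed (use F(1) in auto)
  then have lim: "(\<lambda>n. supint (F n)) \<longlonglongrightarrow> 0" by simp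
  have 1: "eventually (\<lambda>n. 0 \<le> L (F n)) sequentially"
    by (intro always_eventually allI) (rule pos[OF F(1) nn])
  have 2: "eventually (\<lambda>n. L (F n) \<le> supint (F n)) sequentially"
    by (intro always_eventually allI) (rule le[OF F(1)])
  show "(\<lambda>n. L (F n)) \<longlonglongrightarrow> 0" by (rule tendsto_sandwich[OF 1 2 tendsto_const lim])
qed

lemma exists_lift_functional:
  "\<exists>L. lift_functional L \<and> (\<forall>L1 L2 t. lift_functional L1 \<and> lift_functional L2 \<and> 0 < t \<and> t < 1 \<and>
     (\<forall>f\<in>V. L f = t * L1 f + (1 - t) * L2 f) \<longrightarrow> (\<forall>f\<in>V. L1 f = L f))"
proof -
  obtain L where L: "functional_on V L" "\<forall>f\<in>V. L f \<le> supinv f"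
    "\<forall>L1 L2 t. functional_on V L1 \<and> functional_on V L2 \<and> (\<forall>f\<in>V. L1 f \<le> supinv f) \<and>
       (\<forall>f\<in>V. L2 f \<le> supinv f) \<and> 0 < t \<and> t < 1 \<and> (\<forall>f\<in>V. L f = t * L1 f + (1 - t) * L2 f) \<longrightarrow>
       (\<forall>f\<in>V. L1 f = L f)"
    using exists_extreme_functional[OF Vs supinv_sublinear] by blast
  show ?thesis
  proof (intro exI[of _ L] conjI allI impI)
    show "lift_functional L" unfolding lift_functional_def by (rule conjI[OF L(1,2)])
    fix L1 L2 t
    assume *: "lift_functional L1 \<and> lift_functional L2 \<and> 0 < t \<and> t < 1 \<and>
      (\<forall>f\<in>V. L f = t * L1 f + (1 - t) * L2 f)"
    show "\<forall>f\<in>V. L1 f = L f"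
      by (rule L(3)[rule_format, of L1 L2 t, THEN ballI]) (use * in \<open>unfold lift_functional_def, blast\<close>)+
  qed
qed

end

section \<open>Projection and support of the representing measure\<close>

locale fibre_lift_measure = fibre_lift S V T \<nu> b \<pi> \<Omega> \<Phi> \<A> \<H>
  for S :: "'p set" and V T \<nu> b and \<pi> :: "'p \<Rightarrow> 'x" and \<Omega> \<Phi> \<A> \<H> +
  fixes L :: "('p \<Rightarrow> real) \<Rightarrow> real" and m :: "'p measure"
  assumes L: "lift_functional L"
    and m: "space m = S" "sets m = sigma_sets S (cozero_sets S V)" "prob_space m"
    and Lm: "f \<in> V \<Longrightarrow> (\<integral>x. f x \<partial>m) = L f"
begin

sublocale m: prob_space m by (rule m(3))

lemma V_measurable[measurable]: "f \<in> V \<Longrightarrow> f \<in> borel_measurable m"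
  by (rule cozero_measurable[OF V m(1,2)])

lemma V_integrable: "f \<in> V \<Longrightarrow> integrable m f"
  by (rule cozero_integrable[OF V m(1,2) _ m.finite_measure_axioms])

lemma T_measurable[measurable]: "T \<in> m \<rightarrow>\<^sub>M m"
proof (rule measurable_sigma_sets[OF m(2)])
  show "cozero_sets S V \<subseteq> Pow S" by (auto simp: cozero_sets_def)
  show "T \<in> space m \<rightarrow> S" using T_S m(1) by auto
  fix y assume "y \<in> cozero_sets S V"
  then obtain f where f: "f \<in> V" "y = {x\<in>S. 0 < f x}" unfolding cozero_sets_def by blast
  then have "T -` y \<inter> space m = {x\<in>S. 0 < f (T x)}" using T_S m(1) by auto
  then show "T -` y \<inter> space m \<in> sets m" using cozero_setsI[OF V_T[OF f(1)], of S] m(2) by auto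
qed

lemma m_invariant: "distr m m T = m"
proof (rule cozero_measure_eqI[OF V _ _ _ m(1,2) m.finite_measure_axioms])
  show "finite_measure (distr m m T)" by (rule m.finite_measure_distr) simp
  fix f assume f: "f \<in> V"
  have "(\<integral>x. f x \<partial>distr m m T) = (\<integral>x. f (T x) \<partial>m)" by (rule integral_distr) (use f in auto)
  also have "\<dots> = (\<integral>x. f x \<partial>m)" using Lm[OF f] Lm[OF V_T[OF f]] lift_functional_T[OF L f] by simp
  finally show "(\<integral>x. f x \<partial>distr m m T) = (\<integral>x. f x \<partial>m)" .
qed (use m in auto)

text \<open>The \<sigma>-algebra of \<open>m\<close> is generated by \<open>V\<close>, so preimages
  under \<open>\<pi>\<close> are reached through functions of the base point that belong to
  \<open>V\<close> and converge to the indicator of a generating set.\<close>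

lemma \<pi>_measurable[measurable]: "\<pi> \<in> m \<rightarrow>\<^sub>M \<nu>"
proof (rule measurable_sigma_sets[OF \<A>(3,2)])
  show "\<pi> \<in> space m \<rightarrow> space \<nu>" using \<pi>_S m(1) by auto
  fix A assume A: "A \<in> \<A>"
  obtain g :: "nat \<Rightarrow> 'x \<Rightarrow> real" where g: "\<And>n. (\<lambda>p. g n (\<pi> p)) \<in> V"
    "\<And>x. x \<in> space \<nu> \<Longrightarrow> (\<lambda>n. g n x) \<longlonglongrightarrow> indicator A x" using \<A>_approx[OF A] by blast
  have [measurable]: "(\<lambda>p. indicator A (\<pi> p) :: real) \<in> borel_measurable m"
    by (rule borel_measurable_LIMSEQ_metric[where f="\<lambda>n p. g n (\<pi> p)"])
      (use g \<pi>_S m(1) in \<open>auto intro: V_measurable\<close>)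
  have "\<pi> -` A \<inter> space m = {p \<in> space m. indicator A (\<pi> p) = (1::real)}"
    by (auto simp: indicator_def)
  then show "\<pi> -` A \<inter> space m \<in> sets m" by simp
qed

text \<open>The fibrewise constant functions have the same integrals as on the base, which
  identifies the image of \<open>m\<close> weighted by such a function.\<close>

lemma distr_density_fconst:
  assumes h: "h \<in> V" "fconst h" and h0: "\<And>p. p \<in> S \<Longrightarrow> 0 \<le> h p"
  shows "distr (density m (\<lambda>p. ennreal (h p))) \<nu> \<pi> = density \<nu> (\<lambda>x. ennreal (supf h x))"
proof -
  have [measurable]: "h \<in> borel_measurable m" by (rule V_measurable[OF h(1)])
  have [measurable]: "supf h \<in> borel_measurable \<nu>" by (rule supf_measurable[OF h(1)])
  have s0: "0 \<le> supf h x" for x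
  proof (cases "x \<in> \<Omega>")
    case True
    then obtain p where p: "p \<in> \<Phi> x" using \<Phi>_ne by blast
    show ?thesis using supf_const[OF h(2) True p] h0[of p] \<Phi>_sub[OF True p] by simp
  qed (simp add: supf_def)
  obtain B where B: "\<forall>p\<in>S. \<bar>h p\<bar> \<le> B" using fun_latticeD(4)[OF V h(1)] by blast
  have sB: "supf h x \<le> \<bar>B\<bar>" for x using supf_bound[of h B x] B h(1) by (simp add: abs_le_iff)
  have em: "emeasure (distr (density m (\<lambda>p. ennreal (h p))) \<nu> \<pi>) A = emeasure (density \<nu> (\<lambda>x. ennreal (supf h x))) A"
    if A: "A \<in> \<A>" for A
  proof -
    have A'[measurable]: "A \<in> sets \<nu>" using A \<A>(3) by auto
    obtain g :: "nat \<Rightarrow> 'x \<Rightarrow> real" where g: "\<And>n. (\<lambda>p. g n (\<pi> p)) \<in> V"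
      "\<And>x n. x \<in> space \<nu> \<Longrightarrow> 0 \<le> g n x \<and> g n x \<le> 1"
      "\<And>x. x \<in> space \<nu> \<Longrightarrow> (\<lambda>n. g n x) \<longlonglongrightarrow> indicator A x" using \<A>_approx[OF A] by blast
    \<comment> \<open>The product is again constant on fibres, so its integral over \<open>m\<close>
      is the integral over the base of its fibre value \<open>supf h x * g n x\<close>. In the limit
      \<open>g n\<close> becomes the indicator of \<open>A\<close>.\<close>
    define u where "u n p = h p * g n (\<pi> p)" for n p
    have uV: "u n \<in> V" for n unfolding u_def by (rule V_mult[OF h(1) g(1)])
    have uc: "fconst (u n)" for n
      unfolding fconst_def u_def
    proof (intro ballI)
      fix x p q assume "x \<in> \<Omega>" "p \<in> \<Phi> x" "q \<in> \<Phi> x"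
      then have "h p = h q" "\<pi> p = x" "\<pi> q = x" using h(2) \<Phi>_sub unfolding fconst_def by blast+
      then show "h p * g n (\<pi> p) = h q * g n (\<pi> q)" by simp
    qed
    have eq: "(\<integral>p. u n p \<partial>m) = (\<integral>x. supf (u n) x \<partial>\<nu>)" for n
      using Lm[OF uV] lift_functional_fconst[OF L uV uc] by (simp add: supint_def)
    have su: "supf (u n) x = supf h x * g n x" if x: "x \<in> \<Omega>" for n x
    proof -
      obtain p where p: "p \<in> \<Phi> x" using \<Phi>_ne[OF x] by blast
      show ?thesis
        using supf_const[OF uc x p] supf_const[OF h(2) x p] \<Phi>_sub[OF x p] by (simp add: u_def)
    qed
    have "(\<lambda>n. \<integral>p. u n p \<partial>m) \<longlonglongrightarrow> (\<integral>p. h p * indicator A (\<pi> p) \<partial>m)"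
    proof (rule integral_dominated_convergence[where w="\<lambda>_. B"])
      show "(\<lambda>p. h p * indicator A (\<pi> p)) \<in> borel_measurable m" by measurable
      show "AE p in m. (\<lambda>n. u n p) \<longlonglongrightarrow> h p * indicator A (\<pi> p)"
        unfolding u_def using g(3) \<pi>_S m(1) by (intro AE_I2 tendsto_mult tendsto_const) auto
      show "AE p in m. norm (u n p) \<le> B" for n
      proof (rule AE_I2)
        fix p assume p: "p \<in> space m"
        have "\<bar>h p\<bar> * \<bar>g n (\<pi> p)\<bar> \<le> B * 1"
          using B g(2)[of "\<pi> p" n] \<pi>_S[of p] p m(1) by (intro mult_mono) (auto intro: order_trans)
        then show "norm (u n p) \<le> B" by (simp add: u_def abs_mult)
      qed
    qed (use uV in \<open>auto intro: V_measurable\<close>)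
    moreover have "(\<lambda>n. \<integral>x. supf (u n) x \<partial>\<nu>) \<longlonglongrightarrow> (\<integral>x. supf h x * indicator A x \<partial>\<nu>)"
    proof (rule integral_dominated_convergence[where w="\<lambda>_. \<bar>B\<bar>"])
      show "AE x in \<nu>. (\<lambda>n. supf (u n) x) \<longlonglongrightarrow> supf h x * indicator A x"
        using AE_\<Omega> AE_space
      proof eventually_elim
        case (elim x)
        show ?case unfolding su[OF elim(1)] by (intro tendsto_mult tendsto_const g(3)[OF elim(2)])
      qed
      show "AE x in \<nu>. norm (supf (u n) x) \<le> \<bar>B\<bar>" for n
        using AE_\<Omega> AE_space
      proof eventually_elim
        case (elim x)
        have "supf h x * g n x \<le> \<bar>B\<bar> * 1" using g(2)[OF elim(2)] s0 sB by (intro mult_mono) auto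
        then show ?case unfolding su[OF elim(1)] using g(2)[OF elim(2)] s0[of x] by (simp add: abs_mult)
      qed
    qed (use uV in \<open>auto intro: supf_measurable\<close>)
    ultimately have I: "(\<integral>p. h p * indicator A (\<pi> p) \<partial>m) = (\<integral>x. supf h x * indicator A x \<partial>\<nu>)"
      unfolding eq by (rule LIMSEQ_unique)
    have "emeasure (distr (density m (\<lambda>p. ennreal (h p))) \<nu> \<pi>) A = (\<integral>\<^sup>+p. ennreal (h p * indicator A (\<pi> p)) \<partial>m)"
    proof -
      have "emeasure (distr (density m (\<lambda>p. ennreal (h p))) \<nu> \<pi>) A = emeasure (density m (\<lambda>p. ennreal (h p))) (\<pi> -` A \<inter> space m)"
        by (subst emeasure_distr) auto
      also have "\<dots> = (\<integral>\<^sup>+p. ennreal (h p) * indicator (\<pi> -` A \<inter> space m) p \<partial>m)"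
        by (rule emeasure_density) auto
      also have "\<dots> = (\<integral>\<^sup>+p. ennreal (h p * indicator A (\<pi> p)) \<partial>m)"
        by (intro nn_integral_cong) (auto simp: indicator_def)
      finally show ?thesis .
    qed
    also have "\<dots> = ennreal (\<integral>p. h p * indicator A (\<pi> p) \<partial>m)"
    proof (rule nn_integral_eq_integral)
      show "integrable m (\<lambda>p. h p * indicator A (\<pi> p))"
        using B m(1) by (intro m.integrable_const_bound[where B="\<bar>B\<bar>"] AE_I2) (auto simp: indicator_def intro: order_trans)
      show "AE p in m. 0 \<le> h p * indicator A (\<pi> p)" using h0 m(1) by (intro AE_I2) auto
    qed
    also have "\<dots> = ennreal (\<integral>x. supf h x * indicator A x \<partial>\<nu>)" using I by simp
    also have "\<dots> = (\<integral>\<^sup>+x. ennreal (supf h x * indicator A x) \<partial>\<nu>)"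
    proof (rule nn_integral_eq_integral[symmetric])
      show "integrable \<nu> (\<lambda>x. supf h x * indicator A x)"
        using s0 sB by (intro nu.integrable_const_bound[where B="\<bar>B\<bar>"] AE_I2) (auto simp: indicator_def)
      show "AE x in \<nu>. 0 \<le> supf h x * indicator A x" using s0 by (intro AE_I2) auto
    qed
    also have "\<dots> = (\<integral>\<^sup>+x. ennreal (supf h x) * indicator A x \<partial>\<nu>)"
      by (intro nn_integral_cong) (auto simp: indicator_def)
    also have "\<dots> = emeasure (density \<nu> (\<lambda>x. ennreal (supf h x))) A" by (rule emeasure_density[symmetric]) auto
    finally show ?thesis .
  qed
  show ?thesis
  proof (rule measure_eqI_generator_eq[OF \<A>(1,2) em])
    show "range (\<lambda>_::nat. space \<nu>) \<subseteq> \<A>" using \<A>(4) by auto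
    have "emeasure (density m (\<lambda>p. ennreal (h p))) (space m) \<le> (\<integral>\<^sup>+p. ennreal \<bar>B\<bar> \<partial>m)"
    proof (subst emeasure_density)
      show "(\<integral>\<^sup>+p. ennreal (h p) * indicator (space m) p \<partial>m) \<le> (\<integral>\<^sup>+p. ennreal \<bar>B\<bar> \<partial>m)"
      proof (rule nn_integral_mono)
        fix p assume "p \<in> space m"
        then have "h p \<le> \<bar>B\<bar>" using B m(1) by (auto simp: abs_le_iff)
        then show "ennreal (h p) * indicator (space m) p \<le> ennreal \<bar>B\<bar>"
          by (auto simp: indicator_def intro: ennreal_leI)
      qed
    qed auto
    also have "\<dots> < \<infinity>" using m.emeasure_space_1 by simp
    finally show "emeasure (distr (density m (\<lambda>p. ennreal (h p))) \<nu> \<pi>) (space \<nu>) \<noteq> \<infinity>"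
      by (subst emeasure_distr) (auto simp: Int_absorb1 \<pi>_S m(1) subset_eq)
  qed (use \<A>(3) in auto)
qed

lemma distr_m: "distr m \<nu> \<pi> = \<nu>"
proof -
  have c: "fconst (\<lambda>_. 1)" by (simp add: fconst_def)
  have "distr (density m (\<lambda>p. ennreal 1)) \<nu> \<pi> = density \<nu> (\<lambda>x. ennreal (supf (\<lambda>_. 1) x))"
    by (rule distr_density_fconst[OF VI(1) c]) simp
  also have "\<dots> = density \<nu> (\<lambda>_. 1)"
  proof (rule density_cong)
    show "AE x in \<nu>. ennreal (supf (\<lambda>_. 1) x) = 1"
      using AE_\<Omega>
    proof eventually_elim
      case (elim x)
      then obtain p where p: "p \<in> \<Phi> x" using \<Phi>_ne by blast
      show ?case unfolding supf_const[OF c elim p] by simp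
    qed
  qed (use supf_measurable[OF VI(1)] in auto)
  finally show ?thesis by (simp add: density_1)
qed

lemma AE_\<pi>_\<Omega>: "AE p in m. \<pi> p \<in> \<Omega>"
proof -
  have "AE x in distr m \<nu> \<pi>. x \<in> \<Omega>" unfolding distr_m by (rule AE_\<Omega>)
  then show ?thesis by (subst (asm) AE_distr_iff) (use \<Omega>(1) in auto)
qed

text \<open>A variance argument: the square of \<open>h - supf h \<circ> \<pi>\<close> integrates to
  \<open>J - 2 * J + J = 0\<close>. The mixed term uses \<open>h\<close> as a density, which is why
  \<open>h\<close> is taken nonnegative.\<close>

lemma AE_fconst_nonneg:
  assumes h: "h \<in> V" "fconst h" and h0: "\<And>p. p \<in> S \<Longrightarrow> 0 \<le> h p"
  shows "AE p in m. h p = supf h (\<pi> p)"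
proof -
  have hm[measurable]: "h \<in> borel_measurable m" by (rule V_measurable[OF h(1)])
  have sm[measurable]: "supf h \<in> borel_measurable \<nu>" by (rule supf_measurable[OF h(1)])
  obtain B' where B': "\<forall>p\<in>S. \<bar>h p\<bar> \<le> B'" using fun_latticeD(4)[OF V h(1)] by blast
  define B where "B = \<bar>B'\<bar>"
  have B0: "0 \<le> B" by (simp add: B_def)
  have sB: "\<bar>supf h x\<bar> \<le> B" for x using supf_bound[of h B' x] B' h(1) by (simp add: B_def)
  have s0: "0 \<le> supf h x" for x
  proof (cases "x \<in> \<Omega>")
    case True
    then obtain p where p: "p \<in> \<Phi> x" using \<Phi>_ne by blast
    show ?thesis using supf_const[OF h(2) True p] h0[of p] \<Phi>_sub[OF True p] by simp
  qed (simp add: supf_def)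
  have hB: "\<bar>h p\<bar> \<le> B" if "p \<in> space m" for p using B' that m(1) by (force simp: B_def)
  define J where "J = (\<integral>x. supf h x * supf h x \<partial>\<nu>)"
  have i1: "integrable m (\<lambda>p. h p * h p)"
    by (rule V_integrable[OF V_mult[OF h(1) h(1)]])
  have i2: "integrable m (\<lambda>p. h p * supf h (\<pi> p))"
    using hB sB B0 by (intro m.integrable_const_bound[where B="B * B"] AE_I2)
      (auto simp: abs_mult intro!: mult_mono)
  have i3: "integrable m (\<lambda>p. supf h (\<pi> p) * supf h (\<pi> p))"
    using sB B0 by (intro m.integrable_const_bound[where B="B * B"] AE_I2)
      (auto simp: abs_mult simp del: abs_mult_self_eq intro!: mult_mono)
  have c2: "fconst (\<lambda>p. h p * h p)" using h(2) unfolding fconst_def by metis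
  have I1: "(\<integral>p. h p * h p \<partial>m) = J"
  proof -
    have "(\<integral>p. h p * h p \<partial>m) = supint (\<lambda>p. h p * h p)"
      using Lm[OF V_mult[OF h(1) h(1)]] lift_functional_fconst[OF L V_mult[OF h(1) h(1)] c2] by simp
    also have "\<dots> = J"
      unfolding supint_def J_def
    proof (rule integral_cong_AE)
      show "AE x in \<nu>. supf (\<lambda>p. h p * h p) x = supf h x * supf h x"
        using AE_\<Omega>
      proof eventually_elim
        case (elim x)
        then obtain p where p: "p \<in> \<Phi> x" using \<Phi>_ne by blast
        show ?case unfolding supf_const[OF c2 elim p] supf_const[OF h(2) elim p] ..
      qed
    qed (use supf_measurable[OF V_mult[OF h(1) h(1)]] in auto)
    finally show ?thesis .
  qed
  have I3: "(\<integral>p. supf h (\<pi> p) * supf h (\<pi> p) \<partial>m) = J"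
    using integral_distr[OF \<pi>_measurable, of "\<lambda>x. supf h x * supf h x"] distr_m by (simp add: J_def)
  have I2: "(\<integral>p. h p * supf h (\<pi> p) \<partial>m) = J"
  proof -
    have "(\<integral>p. h p * supf h (\<pi> p) \<partial>m) = (\<integral>p. supf h (\<pi> p) \<partial>density m (\<lambda>p. ennreal (h p)))"
      using h0 m(1) by (subst integral_density) auto
    also have "\<dots> = (\<integral>x. supf h x \<partial>distr (density m (\<lambda>p. ennreal (h p))) \<nu> \<pi>)"
      by (rule integral_distr[symmetric]) auto
    also have "\<dots> = (\<integral>x. supf h x \<partial>density \<nu> (\<lambda>x. ennreal (supf h x)))"
      using distr_density_fconst[OF h h0] by simp
    also have "\<dots> = J" using s0 by (subst integral_density) (auto simp: J_def)
    finally show ?thesis .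
  qed
  have "(\<integral>p. (h p - supf h (\<pi> p)) * (h p - supf h (\<pi> p)) \<partial>m) =
      (\<integral>p. h p * h p - 2 * (h p * supf h (\<pi> p)) + supf h (\<pi> p) * supf h (\<pi> p) \<partial>m)"
    by (simp add: algebra_simps)
  also have "\<dots> = J - 2 * J + J" using i1 i2 i3 I1 I2 I3 by simp
  finally have z: "(\<integral>p. (h p - supf h (\<pi> p)) * (h p - supf h (\<pi> p)) \<partial>m) = 0" by simp
  have "integrable m (\<lambda>p. (h p * h p - 2 * (h p * supf h (\<pi> p))) + supf h (\<pi> p) * supf h (\<pi> p))"
    using i1 i2 i3 by simp
  then have "integrable m (\<lambda>p. (h p - supf h (\<pi> p)) * (h p - supf h (\<pi> p)))"
    by (simp add: algebra_simps)
  then have "AE p in m. (h p - supf h (\<pi> p)) * (h p - supf h (\<pi> p)) = 0"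
    using z by (subst (asm) integral_nonneg_eq_0_iff_AE) auto
  then show ?thesis by eventually_elim simp
qed

text \<open>Adding a bound to each \<open>h\<close> makes it nonnegative. Almost surely every
  \<open>h\<close> in \<open>\<H>\<close> has at \<open>p\<close> the value it takes on the fibre
  over \<open>\<pi> p\<close>; countability gives one null set for all of them, and
  \<open>\<H>_sep\<close> concludes.\<close>

lemma AE_\<Phi>: "AE p in m. \<pi> p \<in> \<Omega> \<and> p \<in> \<Phi> (\<pi> p)"
proof -
  have "AE p in m. \<exists>q\<in>\<Phi> (\<pi> p). h p = h q" if h: "h \<in> \<H>" for h
  proof -
    have hV: "h \<in> V" using h \<H>(2) by blast
    obtain B where B: "\<forall>p\<in>S. \<bar>h p\<bar> \<le> B" using fun_latticeD(4)[OF V hV] by blast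
    define k where "k p = h p + B" for p
    have kV: "k \<in> V" unfolding k_def by (rule VI(6)[OF hV VI(1)])
    have kc: "fconst k"
      unfolding fconst_def k_def
    proof (intro ballI)
      fix x p q assume "x \<in> \<Omega>" "p \<in> \<Phi> x" "q \<in> \<Phi> x"
      then show "h p + B = h q + B" using \<H>_const[OF h, of x p q] by simp
    qed
    have k0: "0 \<le> k p" if "p \<in> S" for p
    proof -
      have "- h p \<le> B" using B that by (auto simp: abs_le_iff)
      then show ?thesis by (simp add: k_def)
    qed
    have "AE p in m. k p = supf k (\<pi> p)" by (rule AE_fconst_nonneg[OF kV kc]) (rule k0)
    then show ?thesis
      using AE_\<pi>_\<Omega>
    proof eventually_elim
      case (elim p)
      obtain q where q: "q \<in> \<Phi> (\<pi> p)" using \<Phi>_ne[OF elim(2)] by blast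
      have "k p = k q" using elim(1) supf_const[OF kc elim(2) q] by simp
      then show ?case using q by (auto simp: k_def)
    qed
  qed
  then have "AE p in m. \<forall>h\<in>\<H>. \<exists>q\<in>\<Phi> (\<pi> p). h p = h q"
    by (subst AE_ball_countable[OF \<H>(1)]) auto
  then show ?thesis using AE_\<pi>_\<Omega> AE_space
  proof eventually_elim
    case (elim p)
    then show ?case using \<H>_sep[of p] m(1) by auto
  qed
qed

end

section \<open>Extremality and ergodicity\<close>

locale fibre_lift_ergodic = fibre_lift_measure S V T \<nu> b \<pi> \<Omega> \<Phi> \<A> \<H> L m
  for S :: "'p set" and V T \<nu> b and \<pi> :: "'p \<Rightarrow> 'x" and \<Omega> \<Phi> \<A> \<H> L m +
  assumes erg: "A \<in> sets \<nu> \<Longrightarrow> b -` A \<inter> space \<nu> = A \<Longrightarrow> measure \<nu> A \<in> {0, 1}"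
    and ext: "lift_functional L1 \<Longrightarrow> lift_functional L2 \<Longrightarrow> 0 < t \<Longrightarrow> t < 1 \<Longrightarrow>
      (\<And>f. f \<in> V \<Longrightarrow> L f = t * L1 f + (1 - t) * L2 f) \<Longrightarrow> f \<in> V \<Longrightarrow> L1 f = L f"
begin

text \<open>Conditioning on an invariant set gives another lift, since its image on the base is
  invariant and absolutely continuous and hence \<open>\<nu>\<close>.\<close>

lemma uniform_lift:
  assumes A: "A \<in> sets m" "T -` A \<inter> space m = A" and pos: "0 < measure m A"
  defines "U \<equiv> uniform_measure m A"
  shows "lift_functional (\<lambda>f. \<integral>p. f p \<partial>U)" and "prob_space U"
    and "\<And>f. f \<in> V \<Longrightarrow> (\<integral>p. f p \<partial>U) = (\<integral>p. f p * indicator A p \<partial>m) / measure m A"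
proof -
  have eA: "emeasure m A \<noteq> 0" "emeasure m A \<noteq> \<infinity>" using pos by (auto simp: m.emeasure_eq_measure)
  show pU: "prob_space U" unfolding U_def by (rule prob_space_uniform_measure[OF eA])
  interpret U: prob_space U by fact
  have spU: "space U = S" and setsU: "sets U = sets m" by (simp_all add: U_def m(1))
  have mU: "measurable U N = measurable m N" for N :: "'c measure" by (rule measurable_cong_sets) (auto simp: U_def)
  note A(1)[measurable]
  have iU: "integrable U f" if "f \<in> V" for f
    by (rule cozero_integrable[OF V spU _ that U.finite_measure_axioms]) (simp add: setsU m(2))
  show intU: "(\<integral>p. f p \<partial>U) = (\<integral>p. f p * indicator A p \<partial>m) / measure m A" if f: "f \<in> V" for f
  proof -
    have [measurable]: "f \<in> borel_measurable m" by (rule V_measurable[OF f])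
    have "U = density m (\<lambda>x. ennreal (indicator A x / measure m A))"
      unfolding U_def uniform_measure_def
    proof (rule density_cong)
      show "AE x in m. indicator A x / emeasure m A = ennreal (indicator A x / measure m A)"
        using pos by (intro AE_I2) (auto simp: indicator_def m.emeasure_eq_measure ennreal_1[symmetric] divide_ennreal simp del: ennreal_1)
    qed auto
    then have "(\<integral>p. f p \<partial>U) = (\<integral>p. (indicator A p / measure m A) *\<^sub>R f p \<partial>m)"
      using pos by (simp add: integral_density)
    also have "\<dots> = (\<integral>p. (f p * indicator A p) / measure m A \<partial>m)"
      by (intro Bochner_Integration.integral_cong) auto
    finally show ?thesis by simp
  qed
  have TU: "T \<in> U \<rightarrow>\<^sub>M U" unfolding mU U_def by simp
  have invU: "distr U U T = U"
  proof (rule measure_eqI)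
    show "sets (distr U U T) = sets U" by simp
    fix B assume "B \<in> sets (distr U U T)"
    then have B[measurable]: "B \<in> sets m" by (simp add: setsU)
    have "emeasure (distr U U T) B = emeasure U (T -` B \<inter> S)"
      using B by (subst emeasure_distr[OF TU]) (auto simp: setsU spU)
    also have "\<dots> = emeasure m (A \<inter> (T -` B \<inter> space m)) / emeasure m A"
      unfolding U_def using measurable_sets[OF T_measurable B] m(1) by (subst emeasure_uniform_measure) auto
    \<comment> \<open>Strict invariance of \<open>A\<close> moves it inside the preimage, where
      invariance of \<open>m\<close> applies.\<close>
    also have "A \<inter> (T -` B \<inter> space m) = T -` (A \<inter> B) \<inter> space m" using A(2) by blast
    also have "emeasure m \<dots> = emeasure (distr m m T) (A \<inter> B)" by (rule emeasure_distr[symmetric]) auto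
    also have "\<dots> = emeasure m (A \<inter> B)" by (simp add: m_invariant)
    also have "\<dots> / emeasure m A = emeasure U B" unfolding U_def by (rule emeasure_uniform_measure[symmetric]) auto
    finally show "emeasure (distr U U T) B = emeasure U B" .
  qed
  have \<pi>U: "\<pi> \<in> U \<rightarrow>\<^sub>M \<nu>" unfolding mU by simp
  have "distr U \<nu> \<pi> = \<nu>"
  proof (rule ergodic_measure_unique[OF prob_\<nu> b_meas b_inv erg])
    show "prob_space (distr U \<nu> \<pi>)" by (rule U.prob_space_distr[OF \<pi>U])
    show "sets (distr U \<nu> \<pi>) = sets \<nu>" by simp
    have "distr (distr U \<nu> \<pi>) (distr U \<nu> \<pi>) b = distr (distr U \<nu> \<pi>) \<nu> b" by (rule distr_cong) auto
    also have "\<dots> = distr U \<nu> (b \<circ> \<pi>)" by (rule distr_distr[OF b_meas \<pi>U])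
    also have "\<dots> = distr U \<nu> (\<pi> \<circ> T)" by (rule distr_cong) (auto simp: spU \<pi>_T)
    also have "\<dots> = distr (distr U U T) \<nu> \<pi>" by (rule distr_distr[OF \<pi>U TU, symmetric])
    also have "\<dots> = distr U \<nu> \<pi>" by (simp add: invU)
    finally show "distr (distr U \<nu> \<pi>) (distr U \<nu> \<pi>) b = distr U \<nu> \<pi>" .
    show "absolutely_continuous \<nu> (distr U \<nu> \<pi>)"
      unfolding absolutely_continuous_def
    proof
      fix N assume N: "N \<in> null_sets \<nu>"
      then have Ns: "N \<in> sets \<nu>" by auto
      have "emeasure m (\<pi> -` N \<inter> space m) = 0"
        using N distr_m emeasure_distr[OF \<pi>_measurable Ns] by (metis null_setsD1)
      then have "emeasure m (A \<inter> (\<pi> -` N \<inter> space m)) = 0"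
        by (rule order_antisym[OF order_trans[OF emeasure_mono] zero_le, rotated 2, OF order_refl[THEN ord_le_eq_trans]])
          (use measurable_sets[OF \<pi>_measurable Ns] in auto)
      then have "emeasure U (\<pi> -` N \<inter> space m) = 0"
        unfolding U_def using measurable_sets[OF \<pi>_measurable Ns] by (subst emeasure_uniform_measure) auto
      then show "N \<in> null_sets (distr U \<nu> \<pi>)"
        using Ns by (auto simp: null_sets_def emeasure_distr[OF \<pi>U] spU m(1))
    qed
  qed
  note dU = this
  have AEU: "AE p in U. \<pi> p \<in> \<Omega> \<and> p \<in> \<Phi> (\<pi> p)"
    unfolding U_def by (rule AE_uniform_measureI[OF A(1)]) (use AE_\<Phi> in eventually_elim, simp)
  \<comment> \<open>The conditional measure is carried by the same fibres and projects to \<nu>, so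
    integrating \<open>f \<le> supf f \<circ> \<pi>\<close> gives the bound by
    \<open>supint\<close>. Invariance of \<open>U\<close> improves it to \<open>supinv\<close>
    below.\<close>
  have leint: "(\<integral>p. f p \<partial>U) \<le> supint f" if f: "f \<in> V" for f
  proof -
    have sm: "supf f \<in> borel_measurable \<nu>" by (rule supf_measurable[OF f])
    have "(\<integral>p. f p \<partial>U) \<le> (\<integral>p. supf f (\<pi> p) \<partial>U)"
    proof (rule integral_mono_AE[OF iU[OF f]])
      show "integrable U (\<lambda>p. supf f (\<pi> p))"
        using integrable_distr_eq[OF \<pi>U sm] supf_integrable[OF f] dU by simp
      show "AE p in U. f p \<le> supf f (\<pi> p)"
        using AEU by eventually_elim (use supf_upper[OF f] in blast)
    qed
    also have "\<dots> = supint f" using integral_distr[OF \<pi>U sm] dU by (simp add: supint_def)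
    finally show ?thesis .
  qed
  show "lift_functional (\<lambda>f. \<integral>p. f p \<partial>U)"
    unfolding lift_functional_def functional_on_def
  proof (intro conjI ballI allI)
    fix f g assume f: "f \<in> V" and g: "g \<in> V"
    show "(\<integral>p. f p + g p \<partial>U) = (\<integral>p. f p \<partial>U) + (\<integral>p. g p \<partial>U)" using iU f g by simp
  next
    fix f c assume f: "f \<in> V"
    show "(\<integral>p. c * f p \<partial>U) = c * (\<integral>p. f p \<partial>U)" by simp
  next
    fix f assume f: "f \<in> V"
    show "(\<integral>p. f p \<partial>U) \<le> supinv f"
    proof (rule supinv_greatest)
      fix g assume g: "g \<in> V"
      have "g \<in> borel_measurable U" unfolding mU by (rule V_measurable[OF g])
      then have "(\<integral>p. g (T p) \<partial>U) = (\<integral>p. g p \<partial>U)"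
        using integral_distr[OF TU, of g] invU by simp
      then have "(\<integral>p. f p \<partial>U) = (\<integral>p. f p + (g p - g (T p)) \<partial>U)"
        using iU[OF f] iU[OF g] iU[OF V_T[OF g]] by simp
      also have "\<dots> \<le> supint (\<lambda>p. f p + (g p - g (T p)))" by (rule leint[OF VI(6)[OF f VT_diff[OF g]]])
      finally show "(\<integral>p. f p \<partial>U) \<le> supint (\<lambda>p. f p + (g p - g (T p)))" .
    qed
  qed
qed

text \<open>An invariant set of measure \<open>t\<close> strictly between 0 and 1 writes
  \<open>L\<close> as a proper convex combination of two conditional lifts. Extremality makes the
  first one equal to \<open>m\<close>, although it gives the set full measure.\<close>

lemma m_ergodic:
  assumes A: "A \<in> sets m" "T -` A \<inter> space m = A"
  shows "measure m A \<in> {0, 1}"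
proof (rule ccontr)
  assume n: "measure m A \<notin> {0, 1}"
  define t where "t = measure m A"
  have t: "0 < t" "t < 1" using n m.prob_le_1[of A] measure_nonneg[of m A] by (auto simp: t_def less_le)
  define C where "C = space m - A"
  have C: "C \<in> sets m" "T -` C \<inter> space m = C"
    using A measurable_space[OF T_measurable] by (auto simp: C_def)
  have mC: "measure m C = 1 - t" unfolding C_def t_def by (rule m.prob_compl[OF A(1)])
  let ?U = "uniform_measure m A" and ?W = "uniform_measure m C"
  have pA: "0 < measure m A" and pC: "0 < measure m C" using t mC by (auto simp: t_def)
  note U = uniform_lift[OF A pA] and W = uniform_lift[OF C pC]
  have "(\<integral>p. f p \<partial>?U) = L f" if f: "f \<in> V" for f
  proof (rule ext[OF U(1) W(1) t _ f])
    fix f assume f: "f \<in> V"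
    note [measurable] = A(1) C(1) V_measurable[OF f]
    have "L f = (\<integral>p. f p * indicator A p + f p * indicator C p \<partial>m)"
      unfolding Lm[OF f, symmetric] by (rule Bochner_Integration.integral_cong) (auto simp: C_def indicator_def)
    also have "\<dots> = (\<integral>p. f p * indicator A p \<partial>m) + (\<integral>p. f p * indicator C p \<partial>m)"
      by (intro Bochner_Integration.integral_add integrable_real_mult_indicator V_integrable f A(1) C(1))
    finally show "L f = t * (\<integral>p. f p \<partial>?U) + (1 - t) * (\<integral>p. f p \<partial>?W)"
      using U(3)[OF f] W(3)[OF f] t mC by (simp add: t_def[symmetric])
  qed
  then have "?U = m"
    by (intro cozero_measure_eqI[OF V _ _ _ m(1,2) m.finite_measure_axioms])
      (use U(2) m(1,2) Lm in \<open>auto simp: prob_space_def\<close>)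
  moreover have "measure ?U A = 1" using pA A(1) by (simp add: m.emeasure_eq_measure)
  ultimately show False using n by simp
qed

end

context fibre_lift
begin

theorem exists_ergodic_lift:
  assumes erg: "\<And>A. A \<in> sets \<nu> \<Longrightarrow> b -` A \<inter> space \<nu> = A \<Longrightarrow> measure \<nu> A \<in> {0, 1}"
  shows "\<exists>m. space m = S \<and> sets m = sigma_sets S (cozero_sets S V) \<and> prob_space m \<and>
    T \<in> m \<rightarrow>\<^sub>M m \<and> distr m m T = m \<and>
    (\<forall>A\<in>sets m. T -` A \<inter> space m = A \<longrightarrow> measure m A \<in> {0, 1}) \<and>
    \<pi> \<in> m \<rightarrow>\<^sub>M \<nu> \<and> distr m \<nu> \<pi> = \<nu> \<and> (AE p in m. \<pi> p \<in> \<Omega> \<and> p \<in> \<Phi> (\<pi> p))"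
proof -
  obtain L where L: "lift_functional L" and ext: "\<And>L1 L2 t. lift_functional L1 \<and> lift_functional L2 \<and>
      0 < t \<and> t < 1 \<and> (\<forall>f\<in>V. L f = t * L1 f + (1 - t) * L2 f) \<Longrightarrow> (\<forall>f\<in>V. L1 f = L f)"
    using exists_lift_functional by blast
  obtain m where m: "space m = S" "sets m = sigma_sets S (cozero_sets S V)" "prob_space m"
    "\<forall>f\<in>V. integrable m f \<and> (\<integral>x. f x \<partial>m) = L f" using lift_functional_measure[OF L] by blast
  interpret m: prob_space m by (rule m(3))
  interpret fibre_lift_ergodic S V T \<nu> b \<pi> \<Omega> \<Phi> \<A> \<H> L m
  proof unfold_locales
    show "lift_functional L" by (rule L)
    show "space m = S" "sets m = sigma_sets S (cozero_sets S V)" by (rule m(1) m(2))+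
    show "(\<integral>x. f x \<partial>m) = L f" if "f \<in> V" for f using m(4) that by blast
    show "measure \<nu> A \<in> {0, 1}" if "A \<in> sets \<nu>" "b -` A \<inter> space \<nu> = A" for A
      by (rule erg[OF that])
    show "L1 f = L f" if "lift_functional L1" "lift_functional L2" "0 < t" "t < 1"
      "\<And>f. f \<in> V \<Longrightarrow> L f = t * L1 f + (1 - t) * L2 f" "f \<in> V" for L1 L2 t f
      using ext[of L1 L2 t] that by blast
  qed
  show ?thesis using m T_measurable m_invariant m_ergodic \<pi>_measurable distr_m AE_\<Phi> by blast
qed

end

section \<open>Calculus in charts\<close>

lemma smooth_onD:
  assumes "smooth_on S f" "open S"
  shows "continuous_on S f" "x \<in> S \<Longrightarrow> (f has_derivative frechet_derivative f (at x)) (at x)"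
    "smooth_on S (\<lambda>x. frechet_derivative f (at x) v)"
proof -
  have C: "C_k_on k S f" for k using assms(1) unfolding smooth_on_def by blast
  show "continuous_on S f" using C[of 0] by simp
  show "(f has_derivative frechet_derivative f (at x)) (at x)" if "x \<in> S"
  proof -
    have "f differentiable (at x within S)" using C[of "Suc 0"] that by (auto simp: differentiable_on_def)
    then show ?thesis using at_within_open[OF that assms(2)] frechet_derivative_works by metis
  qed
  show "smooth_on S (\<lambda>x. frechet_derivative f (at x) v)"
    using C[of "Suc k" for k] unfolding smooth_on_def by auto
qed

lemma linear_sum_Basis:
  fixes f :: "'a::euclidean_space \<Rightarrow> 'b::real_vector"
  assumes "linear f" shows "f x = (\<Sum>i\<in>Basis. (x \<bullet> i) *\<^sub>R f i)"
proof -
  have "f x = f (\<Sum>i\<in>Basis. (x \<bullet> i) *\<^sub>R i)" by (simp add: euclidean_representation)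
  also have "\<dots> = (\<Sum>i\<in>Basis. (x \<bullet> i) *\<^sub>R f i)"
    by (simp add: linear_sum[OF assms] linear_cmul[OF assms])
  finally show ?thesis .
qed

lemma mult_le_sum_squares: "a * b \<le> a\<^sup>2 + (b::real)\<^sup>2"
proof -
  have "0 \<le> a\<^sup>2 + b\<^sup>2" by simp
  then show ?thesis using sum_squares_bound[of a b] by linarith
qed

text \<open>The squared norm is used because it is differentiable even at zeros of \<open>u\<close>.
  Its derivative is at most \<open>4 * C\<close> times
  \<open>u t \<bullet> u t + \<epsilon>\<^sup>2\<close>, hence the factor
  \<open>exp (- 4 * C * t)\<close> that makes \<open>h\<close> nonincreasing. The term
  \<open>\<epsilon>\<close> allows solutions of two different equations to be compared.\<close>

lemma gronwall_bound:
  fixes u :: "real \<Rightarrow> 'a::euclidean_space"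
  assumes d: "\<And>t. 0 \<le> t \<Longrightarrow> t \<le> T \<Longrightarrow> (u has_vector_derivative u' t) (at t)"
    and b: "\<And>t. 0 \<le> t \<Longrightarrow> t \<le> T \<Longrightarrow> norm (u' t) \<le> C * (norm (u t) + \<epsilon>)"
    and u0: "u 0 = 0" and t: "0 \<le> t" "t \<le> T" and nn: "0 \<le> C" "0 \<le> \<epsilon>"
  shows "norm (u t) \<le> \<epsilon> * exp (2 * C * t)"
proof -
  define h where "h t = (u t \<bullet> u t + \<epsilon>\<^sup>2) * exp (- 4 * C * t)" for t
  have "h t \<le> h 0"
  proof (rule DERIV_nonpos_imp_nonincreasing[OF t(1)])
    fix x assume x: "0 \<le> x" "x \<le> t"
    have du: "(u has_derivative (\<lambda>s. s *\<^sub>R u' x)) (at x)"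
      using d[of x] x t by (simp add: has_vector_derivative_def)
    have "((\<lambda>t. u t \<bullet> u t) has_derivative (\<lambda>s. u x \<bullet> (s *\<^sub>R u' x) + (s *\<^sub>R u' x) \<bullet> u x)) (at x)"
      by (rule has_derivative_inner[OF du du])
    moreover have "(\<lambda>s. u x \<bullet> (s *\<^sub>R u' x) + (s *\<^sub>R u' x) \<bullet> u x) = (*) (2 * (u x \<bullet> u' x))"
      by (auto simp: inner_commute)
    ultimately have "((\<lambda>t. u t \<bullet> u t) has_real_derivative 2 * (u x \<bullet> u' x)) (at x)"
      by (simp add: has_field_derivative_def)
    then have 1: "((\<lambda>t. u t \<bullet> u t + \<epsilon>\<^sup>2) has_real_derivative 2 * (u x \<bullet> u' x)) (at x)"
      using DERIV_add[OF _ DERIV_const[of "\<epsilon>\<^sup>2"]] by fastforce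
    have 2: "((\<lambda>t. exp (- 4 * C * t)) has_real_derivative exp (- 4 * C * x) * (- 4 * C)) (at x)"
      by (auto intro!: derivative_eq_intros)
    have "(h has_real_derivative (2 * (u x \<bullet> u' x) - 4 * C * (u x \<bullet> u x + \<epsilon>\<^sup>2)) * exp (- 4 * C * x)) (at x)"
      unfolding h_def using DERIV_mult[OF 1 2] by (simp add: algebra_simps)
    moreover have "(2 * (u x \<bullet> u' x) - 4 * C * (u x \<bullet> u x + \<epsilon>\<^sup>2)) * exp (- 4 * C * x) \<le> 0"
    proof -
      have "u x \<bullet> u' x \<le> norm (u x) * norm (u' x)" by (rule norm_cauchy_schwarz)
      also have "\<dots> \<le> norm (u x) * (C * (norm (u x) + \<epsilon>))" using b[of x] x t by (intro mult_left_mono) auto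
      also have "\<dots> = C * ((norm (u x))\<^sup>2 + norm (u x) * \<epsilon>)" by (simp add: algebra_simps power2_eq_square)
      also have "\<dots> \<le> C * (2 * ((norm (u x))\<^sup>2 + \<epsilon>\<^sup>2))"
      proof (rule mult_left_mono[OF _ nn(1)])
        have "norm (u x) * \<epsilon> \<le> (norm (u x))\<^sup>2 + \<epsilon>\<^sup>2" by (rule mult_le_sum_squares)
        then show "(norm (u x))\<^sup>2 + norm (u x) * \<epsilon> \<le> 2 * ((norm (u x))\<^sup>2 + \<epsilon>\<^sup>2)"
          by (smt (verit) zero_le_power2)
      qed
      finally have "2 * (u x \<bullet> u' x) - 4 * C * (u x \<bullet> u x + \<epsilon>\<^sup>2) \<le> 0" by (simp add: dot_square_norm algebra_simps)
      then show ?thesis by (intro mult_nonpos_nonneg) auto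
    qed
    ultimately show "\<exists>y. (h has_real_derivative y) (at x) \<and> y \<le> 0" by blast
  qed
  then have "(u t \<bullet> u t + \<epsilon>\<^sup>2) * exp (- 4 * C * t) \<le> \<epsilon>\<^sup>2" by (simp add: h_def u0)
  then have "u t \<bullet> u t + \<epsilon>\<^sup>2 \<le> \<epsilon>\<^sup>2 * exp (4 * C * t)" by (simp add: exp_minus field_simps)
  then have "(norm (u t))\<^sup>2 \<le> \<epsilon>\<^sup>2 * exp (4 * C * t)" by (simp add: dot_square_norm) (smt (verit) zero_le_power2)
  also have "\<dots> = (\<epsilon> * exp (2 * C * t))\<^sup>2"
  proof -
    have "exp (4 * C * t) = (exp (2 * C * t))\<^sup>2" by (simp add: power2_eq_square flip: exp_add)
    then show ?thesis by (simp add: power_mult_distrib)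
  qed
  finally show ?thesis by (rule power2_le_imp_le) (use nn(2) in simp)
qed

lemma gronwall_zero:
  fixes u :: "real \<Rightarrow> 'a::euclidean_space"
  assumes d: "\<And>t. 0 \<le> t \<Longrightarrow> t \<le> T \<Longrightarrow> (u has_vector_derivative u' t) (at t)"
    and b: "\<And>t. 0 \<le> t \<Longrightarrow> t \<le> T \<Longrightarrow> norm (u' t) \<le> C * norm (u t)"
    and u0: "u 0 = 0" and t: "0 \<le> t" "t \<le> T"
  shows "u t = 0"
proof -
  have "norm (u' s) \<le> \<bar>C\<bar> * (norm (u s) + 0)" if "0 \<le> s" "s \<le> T" for s
    using order.trans[OF b[OF that] mult_right_mono[OF abs_ge_self]] by simp
  from gronwall_bound[OF d this u0 t] show ?thesis by simp
qed

text \<open>\<open>C_k_on\<close> gives continuity of directional derivatives only. On a compact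
  ball the bounds in the finitely many coordinate directions add up to a bound on the operator
  norm.\<close>

lemma smooth_locally_lipschitz:
  fixes f :: "'a::euclidean_space \<Rightarrow> 'b::real_normed_vector"
  assumes S: "open S" and f: "smooth_on S f" and x: "x \<in> S"
  shows "\<exists>e>0. \<exists>C. cball x e \<subseteq> S \<and> (\<forall>y\<in>cball x e. \<forall>z\<in>cball x e. norm (f y - f z) \<le> C * norm (y - z))"
proof -
  obtain e where e: "e > 0" "cball x e \<subseteq> S" using S x open_contains_cball by metis
  have D: "(f has_derivative frechet_derivative f (at y)) (at y)" if "y \<in> S" for y
    by (rule smooth_onD(2)[OF f S that])
  have "\<exists>B. \<forall>y\<in>cball x e. norm (frechet_derivative f (at y) i) \<le> B" for i
  proof -
    have "continuous_on S (\<lambda>y. frechet_derivative f (at y) i)"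
      by (rule smooth_onD(1)[OF smooth_onD(3)[OF f S] S])
    then have "compact ((\<lambda>y. frechet_derivative f (at y) i) ` cball x e)"
      by (intro compact_continuous_image[OF continuous_on_subset[OF _ e(2)] compact_cball])
    then have "bounded ((\<lambda>y. frechet_derivative f (at y) i) ` cball x e)" by (rule compact_imp_bounded)
    then show ?thesis unfolding bounded_iff by blast
  qed
  then obtain B where B: "\<And>i y. y \<in> cball x e \<Longrightarrow> norm (frechet_derivative f (at y) i) \<le> B i" by metis
  define C where "C = (\<Sum>i\<in>Basis. B i)"
  have "norm (f y - f z) \<le> C * norm (y - z)" if yz: "y \<in> cball x e" "z \<in> cball x e" for y z
  proof (rule differentiable_bound[OF convex_cball _ _ yz])
    show "(f has_derivative frechet_derivative f (at u)) (at u within cball x e)" if "u \<in> cball x e" for u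
      by (rule has_derivative_at_withinI[OF D]) (use that e(2) in blast)
    show "onorm (frechet_derivative f (at u)) \<le> C" if u: "u \<in> cball x e" for u
    proof (rule onorm_le)
      fix v
      have lin: "linear (frechet_derivative f (at u))"
        using D[of u] u e(2) has_derivative_linear by blast
      have "norm (frechet_derivative f (at u) v) \<le> (\<Sum>i\<in>Basis. norm ((v \<bullet> i) *\<^sub>R frechet_derivative f (at u) i))"
        by (subst linear_sum_Basis[OF lin]) (rule norm_sum)
      also have "\<dots> \<le> (\<Sum>i\<in>Basis. norm v * B i)"
        by (intro sum_mono) (simp add: mult_mono B[OF u] Basis_le_norm)
      also have "\<dots> = C * norm v" by (simp add: C_def sum_distrib_left sum_distrib_right mult.commute)
      finally show "norm (frechet_derivative f (at u) v) \<le> C * norm v" .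
    qed
  qed
  then show ?thesis using e by blast
qed

lemma has_vector_derivative_comp_linear:
  assumes "(f has_derivative f') (at (g t))" "(g has_vector_derivative v) (at t)"
  shows "((\<lambda>t. f (g t)) has_vector_derivative f' v) (at t)"
proof -
  have "((\<lambda>t. f (g t)) has_derivative (\<lambda>s. f' (s *\<^sub>R v))) (at t)"
    using has_derivative_compose[OF assms(2)[unfolded has_vector_derivative_def] assms(1)] .
  moreover have "f' (s *\<^sub>R v) = s *\<^sub>R f' v" for s
    using has_derivative_linear[OF assms(1)] by (simp add: linear_cmul)
  ultimately show ?thesis by (simp add: has_vector_derivative_def)
qed

lemma has_vector_derivative_eventually:
  assumes "(f has_vector_derivative v) (at t)" "eventually (\<lambda>s. f s = g s) (at t)" "f t = g t"
  shows "(g has_vector_derivative v) (at t)"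
  using assms unfolding has_vector_derivative_def by (intro has_derivative_transform_eventually[of f _ t UNIV g]) auto

section \<open>The adjoint representation of a Lie group\<close>

locale lie_grp =
  fixes G :: "('g, 'l::euclidean_space, 'm) lie_data_scheme" (structure)
  assumes lie: "lie_group G"
begin

sublocale group G using lie unfolding lie_group_def by blast

abbreviation "I1 \<equiv> chart_one G"
abbreviation "e0 \<equiv> snd (chart_one G) \<one>"

lemma topspace_G[simp]: "topspace (topol G) = carrier G"
  using lie unfolding lie_group_def by blast

lemma Hausdorff_G: "Hausdorff_space (topol G)" and second_countable_G: "second_countable (topol G)"
  using lie unfolding lie_group_def by blast+

lemma continuous_mult: "continuous_map (prod_topology (topol G) (topol G)) (topol G) (\<lambda>(x, y). x \<otimes> y)"
  and continuous_inv: "continuous_map (topol G) (topol G) (\<lambda>x. inv x)"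
  using lie unfolding lie_group_def by blast+

definition cmul :: "'g set \<times> ('g \<Rightarrow> 'l) \<Rightarrow> 'g set \<times> ('g \<Rightarrow> 'l) \<Rightarrow> 'g set \<times> ('g \<Rightarrow> 'l) \<Rightarrow> 'l \<times> 'l \<Rightarrow> 'l" where
  "cmul A B C = (\<lambda>(a, b). snd C (inv_into (fst A) (snd A) a \<otimes> inv_into (fst B) (snd B) b))"

definition cdom :: "'g set \<times> ('g \<Rightarrow> 'l) \<Rightarrow> 'g set \<times> ('g \<Rightarrow> 'l) \<Rightarrow> 'g set \<times> ('g \<Rightarrow> 'l) \<Rightarrow> ('l \<times> 'l) set" where
  "cdom A B C = {(snd A x, snd B y) | x y. x \<in> fst A \<and> y \<in> fst B \<and> x \<otimes> y \<in> fst C}"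

definition cinv :: "'g set \<times> ('g \<Rightarrow> 'l) \<Rightarrow> 'g set \<times> ('g \<Rightarrow> 'l) \<Rightarrow> 'l \<Rightarrow> 'l" where
  "cinv A B = (\<lambda>a. snd B (inv (inv_into (fst A) (snd A) a)))"

lemma smooth_cmul:
  assumes "A \<in> atlas G" "B \<in> atlas G" "C \<in> atlas G"
  shows "smooth_on (cdom A B C) (cmul A B C)"
proof -
  have "\<forall>(U, c)\<in>atlas G. \<forall>(V, d)\<in>atlas G. \<forall>(W, e)\<in>atlas G.
        smooth_on {(c x, d y) | x y. x \<in> U \<and> y \<in> V \<and> x \<otimes> y \<in> W}
          (\<lambda>(a, b). e (inv_into U c a \<otimes> inv_into V d b))"
    using lie unfolding lie_group_def by blast
  then show ?thesis using assms unfolding cdom_def cmul_def case_prod_beta by blast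
qed

lemma smooth_cinv:
  assumes "A \<in> atlas G" "B \<in> atlas G"
  shows "smooth_on {snd A x | x. x \<in> fst A \<and> inv x \<in> fst B} (cinv A B)"
proof -
  have "\<forall>(U, c)\<in>atlas G. \<forall>(V, d)\<in>atlas G.
        smooth_on {c x | x. x \<in> U \<and> inv x \<in> V} (\<lambda>a. d (inv (inv_into U c a)))"
    using lie unfolding lie_group_def by blast
  then show ?thesis using assms unfolding cinv_def case_prod_beta by blast
qed

lemma chart:
  assumes "A \<in> atlas G"
  shows "openin (topol G) (fst A)" "inj_on (snd A) (fst A)"
    "continuous_map (subtopology (topol G) (fst A)) euclidean (snd A)"
    "\<And>N. openin (topol G) N \<Longrightarrow> N \<subseteq> fst A \<Longrightarrow> open (snd A ` N)"
    "fst A \<subseteq> carrier G"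
proof -
  have "is_chart (topol G) (fst A) (snd A)"
    using lie assms unfolding lie_group_def smooth_atlas_def case_prod_beta by blast
  then have o: "openin (topol G) (fst A)" and oc: "open (snd A ` fst A)"
    and h: "homeomorphic_map (subtopology (topol G) (fst A)) (top_of_set (snd A ` fst A)) (snd A)"
    unfolding is_chart_def by auto
  show "openin (topol G) (fst A)" by fact
  show sub: "fst A \<subseteq> carrier G" using openin_subset[OF o] by simp
  have ts: "topspace (subtopology (topol G) (fst A)) = fst A" using sub by (auto simp: Int_absorb1)
  show "inj_on (snd A) (fst A)" using homeomorphic_imp_injective_map[OF h] ts by simp
  show "continuous_map (subtopology (topol G) (fst A)) euclidean (snd A)"
    using homeomorphic_imp_continuous_map[OF h] continuous_map_in_subtopology by blast
  fix N assume N: "openin (topol G) N" "N \<subseteq> fst A"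
  then have "openin (subtopology (topol G) (fst A)) N" using openin_subtopology by blast
  then have "openin (top_of_set (snd A ` fst A)) (snd A ` N)"
    using homeomorphic_map_openness[OF h, of N] N ts by auto
  then show "open (snd A ` N)" using openin_open_trans oc by blast
qed

lemma chart_inv[simp]: "A \<in> atlas G \<Longrightarrow> x \<in> fst A \<Longrightarrow> inv_into (fst A) (snd A) (snd A x) = x"
  using chart(2) by simp

lemma chart_exists: "g \<in> carrier G \<Longrightarrow> \<exists>A\<in>atlas G. g \<in> fst A"
proof -
  assume "g \<in> carrier G"
  moreover have "(\<Union>(U, c)\<in>atlas G. U) = topspace (topol G)"
    using lie unfolding lie_group_def smooth_atlas_def by blast
  ultimately have "g \<in> (\<Union>A\<in>atlas G. fst A)" by (simp add: case_prod_beta)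
  then show ?thesis by blast
qed

lemma I1: "I1 \<in> atlas G" "\<one> \<in> fst I1"
  using lie unfolding lie_group_def by blast+

lemma open_cdom:
  assumes A: "A \<in> atlas G" "B \<in> atlas G" "C \<in> atlas G"
  shows "open (cdom A B C)"
proof (subst open_subopen, intro ballI)
  fix p assume "p \<in> cdom A B C"
  then obtain x y where xy: "p = (snd A x, snd B y)" "x \<in> fst A" "y \<in> fst B" "x \<otimes> y \<in> fst C"
    unfolding cdom_def by blast
  define D where "D = {z \<in> topspace (prod_topology (topol G) (topol G)). (\<lambda>(x, y). x \<otimes> y) z \<in> fst C}"
  have oD: "openin (prod_topology (topol G) (topol G)) D"
    unfolding D_def by (rule openin_continuous_map_preimage[OF continuous_mult chart(1)[OF A(3)]])
  have xyD: "(x, y) \<in> D"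
    using xy chart(5)[OF A(1)] chart(5)[OF A(2)] by (auto simp: D_def)
  obtain N P where NP: "openin (topol G) N" "openin (topol G) P" "x \<in> N" "y \<in> P" "N \<times> P \<subseteq> D"
    using oD[unfolded openin_prod_topology_alt, rule_format, OF xyD] by auto
  let ?N = "snd A ` (N \<inter> fst A)" and ?P = "snd B ` (P \<inter> fst B)"
  have "open ?N" by (rule chart(4)[OF A(1)]) (use NP chart(1)[OF A(1)] in auto)
  moreover have "open ?P" by (rule chart(4)[OF A(2)]) (use NP chart(1)[OF A(2)] in auto)
  ultimately have "open (?N \<times> ?P)" by (rule open_Times)
  moreover have "p \<in> ?N \<times> ?P" using xy NP by auto
  moreover have "?N \<times> ?P \<subseteq> cdom A B C"
  proof
    fix z assume "z \<in> ?N \<times> ?P"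
    then obtain u v where uv: "z = (snd A u, snd B v)" "u \<in> N" "u \<in> fst A" "v \<in> P" "v \<in> fst B" by auto
    then have "(u, v) \<in> D" using NP(5) by auto
    then have "u \<otimes> v \<in> fst C" by (simp add: D_def)
    then show "z \<in> cdom A B C" unfolding cdom_def using uv by blast
  qed
  ultimately show "\<exists>T. open T \<and> p \<in> T \<and> T \<subseteq> cdom A B C" by blast
qed

lemma open_cinv_dom:
  assumes A: "A \<in> atlas G" "B \<in> atlas G"
  shows "open {snd A x | x. x \<in> fst A \<and> inv x \<in> fst B}"
proof -
  have "openin (topol G) {x \<in> topspace (topol G). inv x \<in> fst B}"
    by (rule openin_continuous_map_preimage[OF continuous_inv chart(1)[OF A(2)]])
  then have "openin (topol G) (fst A \<inter> {x \<in> topspace (topol G). inv x \<in> fst B})"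
    using chart(1)[OF A(1)] by blast
  then have "open (snd A ` (fst A \<inter> {x \<in> topspace (topol G). inv x \<in> fst B}))"
    by (rule chart(4)[OF A(1)]) auto
  moreover have "snd A ` (fst A \<inter> {x \<in> topspace (topol G). inv x \<in> fst B}) = {snd A x | x. x \<in> fst A \<and> inv x \<in> fst B}"
    using chart(5)[OF A(1)] by auto
  ultimately show ?thesis by simp
qed

lemma cmul_derivative:
  assumes "A \<in> atlas G" "B \<in> atlas G" "C \<in> atlas G" "x \<in> fst A" "y \<in> fst B" "x \<otimes> y \<in> fst C"
  shows "(cmul A B C has_derivative frechet_derivative (cmul A B C) (at (snd A x, snd B y))) (at (snd A x, snd B y))"
  by (rule smooth_onD(2)[OF smooth_cmul[OF assms(1-3)] open_cdom[OF assms(1-3)]])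
    (use assms in \<open>auto simp: cdom_def\<close>)

text \<open>Continuity is required at parameter 0 only; this survives products and inverses and is
  all that differentiation at 0 uses. Values are in the group at every parameter, so the group laws
  hold along the curve without restriction.\<close>

definition tcurve :: "(real \<Rightarrow> 'g) \<Rightarrow> 'g \<Rightarrow> bool" where
  "tcurve \<gamma> g \<longleftrightarrow> limitin (topol G) \<gamma> g (at 0) \<and> \<gamma> 0 = g \<and> (\<forall>t. \<gamma> t \<in> carrier G)"

lemma tcurve_eventually:
  "tcurve \<gamma> g \<Longrightarrow> openin (topol G) N \<Longrightarrow> g \<in> N \<Longrightarrow> eventually (\<lambda>t. \<gamma> t \<in> N) (at 0)"
  unfolding tcurve_def by (auto dest: limitinD)

lemma tcurveD: "tcurve \<gamma> g \<Longrightarrow> \<gamma> 0 = g" "tcurve \<gamma> g \<Longrightarrow> \<gamma> t \<in> carrier G" "tcurve \<gamma> g \<Longrightarrow> g \<in> carrier G"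
  unfolding tcurve_def by auto

lemma tcurve_const: "g \<in> carrier G \<Longrightarrow> tcurve (\<lambda>_. g) g"
  unfolding tcurve_def by simp

lemma tcurve_mult: assumes "tcurve \<gamma> g" "tcurve \<delta> h" shows "tcurve (\<lambda>t. \<gamma> t \<otimes> \<delta> t) (g \<otimes> h)"
proof -
  have "limitin (prod_topology (topol G) (topol G)) (\<lambda>t. (\<gamma> t, \<delta> t)) (g, h) (at 0)"
    using assms unfolding tcurve_def limitin_pairwise by (simp add: comp_def)
  then have "limitin (topol G) ((\<lambda>(x, y). x \<otimes> y) \<circ> (\<lambda>t. (\<gamma> t, \<delta> t))) ((\<lambda>(x, y). x \<otimes> y) (g, h)) (at 0)"
    by (rule continuous_map_limit[OF continuous_mult])
  then show ?thesis using assms unfolding tcurve_def by (simp add: comp_def)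
qed

lemma tcurve_inv: assumes "tcurve \<gamma> g" shows "tcurve (\<lambda>t. inv \<gamma> t) (inv g)"
proof -
  have "limitin (topol G) ((\<lambda>x. inv x) \<circ> \<gamma>) (inv g) (at 0)"
    using assms unfolding tcurve_def by (intro continuous_map_limit[OF continuous_inv]) auto
  then show ?thesis using assms unfolding tcurve_def by (simp add: comp_def)
qed

lemma curve_mult_derivative:
  assumes at: "A \<in> atlas G" "B \<in> atlas G" "C \<in> atlas G" "x \<in> fst A" "y \<in> fst B" "x \<otimes> y \<in> fst C"
    and c: "tcurve \<gamma> x" "tcurve \<delta> y"
    and d: "((\<lambda>t. snd A (\<gamma> t)) has_vector_derivative v) (at 0)" "((\<lambda>t. snd B (\<delta> t)) has_vector_derivative w) (at 0)"
  shows "((\<lambda>t. snd C (\<gamma> t \<otimes> \<delta> t)) has_vector_derivative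
      frechet_derivative (cmul A B C) (at (snd A x, snd B y)) (v, w)) (at 0)"
proof (rule has_vector_derivative_eventually)
  have p: "((\<lambda>t. (snd A (\<gamma> t), snd B (\<delta> t))) has_vector_derivative (v, w)) (at 0)"
    by (rule has_vector_derivative_Pair[OF d])
  show "((\<lambda>t. cmul A B C (snd A (\<gamma> t), snd B (\<delta> t))) has_vector_derivative
      frechet_derivative (cmul A B C) (at (snd A x, snd B y)) (v, w)) (at 0)"
    by (rule has_vector_derivative_comp_linear[OF _ p])
      (use cmul_derivative[OF at] tcurveD(1)[OF c(1)] tcurveD(1)[OF c(2)] in simp)
  show "\<forall>\<^sub>F t in at 0. cmul A B C (snd A (\<gamma> t), snd B (\<delta> t)) = snd C (\<gamma> t \<otimes> \<delta> t)"
    using tcurve_eventually[OF c(1) chart(1)[OF at(1)] at(4)] tcurve_eventually[OF c(2) chart(1)[OF at(2)] at(5)]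
    by eventually_elim (simp add: cmul_def at)
  show "cmul A B C (snd A (\<gamma> 0), snd B (\<delta> 0)) = snd C (\<gamma> 0 \<otimes> \<delta> 0)"
    using tcurveD(1)[OF c(1)] tcurveD(1)[OF c(2)] at by (simp add: cmul_def)
qed

lemma curve_inv_derivative:
  assumes at: "A \<in> atlas G" "B \<in> atlas G" "x \<in> fst A" "inv x \<in> fst B" and c: "tcurve \<gamma> x"
    and d: "((\<lambda>t. snd A (\<gamma> t)) has_vector_derivative v) (at 0)"
  shows "((\<lambda>t. snd B (inv \<gamma> t)) has_vector_derivative frechet_derivative (cinv A B) (at (snd A x)) v) (at 0)"
proof (rule has_vector_derivative_eventually)
  have "(cinv A B has_derivative frechet_derivative (cinv A B) (at (snd A x))) (at (snd A x))"
    by (rule smooth_onD(2)[OF smooth_cinv[OF at(1,2)] open_cinv_dom[OF at(1,2)]]) (use at in auto)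
  then show "((\<lambda>t. cinv A B (snd A (\<gamma> t))) has_vector_derivative frechet_derivative (cinv A B) (at (snd A x)) v) (at 0)"
    by (intro has_vector_derivative_comp_linear[OF _ d]) (simp add: tcurveD(1)[OF c])
  show "\<forall>\<^sub>F t in at 0. cinv A B (snd A (\<gamma> t)) = snd B (inv \<gamma> t)"
    using tcurve_eventually[OF c chart(1)[OF at(1)] at(3)] by eventually_elim (simp add: cinv_def at)
  show "cinv A B (snd A (\<gamma> 0)) = snd B (inv \<gamma> 0)"
    using tcurveD(1)[OF c] at by (simp add: cinv_def)
qed

definition tangent :: "(real \<Rightarrow> 'g) \<Rightarrow> 'l \<Rightarrow> bool" where
  "tangent \<gamma> X \<longleftrightarrow> tcurve \<gamma> \<one> \<and> ((\<lambda>t. snd I1 (\<gamma> t)) has_vector_derivative X) (at 0)"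

lemma expo_hom: "expo G ((s + t) *\<^sub>R X) = expo G (s *\<^sub>R X) \<otimes> expo G (t *\<^sub>R X)"
  and expo_continuous: "continuous_map euclideanreal (topol G) (\<lambda>t. expo G (t *\<^sub>R X))"
  and expo_derivative: "((\<lambda>t. snd I1 (expo G (t *\<^sub>R X))) has_vector_derivative X) (at 0)"
  using lie unfolding lie_group_def is_exponential_def by blast+

lemma expo_closed[simp]: "expo G X \<in> carrier G"
  using continuous_map_image_subset_topspace[OF expo_continuous[of X]] by (force dest: subsetD[of _ _ "expo G X"] intro: image_eqI[of _ _ 1])

lemma expo_zero[simp]: "expo G 0 = \<one>"
proof -
  have "expo G 0 \<otimes> expo G 0 = expo G 0" using expo_hom[of 0 0 0] by simp
  then show ?thesis using expo_closed l_cancel_one by blast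
qed

lemma expo_minus: "expo G (- X) = inv (expo G X)"
proof -
  have "expo G (- X) \<otimes> expo G X = \<one>" using expo_hom[of "-1" 1 X] by simp
  then show ?thesis by (simp add: inv_equality)
qed

lemma tangent_expo: "tangent (\<lambda>t. expo G (t *\<^sub>R X)) X"
proof -
  have "limitin (topol G) (\<lambda>t. expo G (t *\<^sub>R X)) (expo G (0 *\<^sub>R X)) (at 0)"
    unfolding limitin_def
  proof (intro conjI allI impI)
    fix N assume N: "openin (topol G) N \<and> expo G (0 *\<^sub>R X) \<in> N"
    then have "open {t. expo G (t *\<^sub>R X) \<in> N}"
      using openin_continuous_map_preimage[OF expo_continuous[of X], of N] by simp
    then have "eventually (\<lambda>t. t \<in> {t. expo G (t *\<^sub>R X) \<in> N}) (at 0)"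
      using N eventually_at_topological by blast
    then show "\<forall>\<^sub>F t in at 0. expo G (t *\<^sub>R X) \<in> N" by simp
  qed simp
  then show ?thesis unfolding tangent_def tcurve_def using expo_derivative by simp
qed

lemma cdomI: "x \<in> fst A \<Longrightarrow> y \<in> fst B \<Longrightarrow> x \<otimes> y \<in> fst C \<Longrightarrow> (snd A x, snd B y) \<in> cdom A B C"
  unfolding cdom_def by blast

text \<open>The differential of conjugation in charts: left translation by \<open>g\<close> is read
  in a chart \<open>A\<close> around \<open>g\<close>, and right translation by \<open>inv g\<close>
  leads back to the chart at the identity. Auxiliary charts are used because \<open>g\<close> may
  lie outside that chart.\<close>

definition Adloc :: "'g set \<times> ('g \<Rightarrow> 'l) \<Rightarrow> 'g set \<times> ('g \<Rightarrow> 'l) \<Rightarrow> 'g \<Rightarrow> 'l \<Rightarrow> 'l" where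
  "Adloc A B g X = frechet_derivative (cmul A B I1) (at (snd A g, snd B (inv g)))
     (frechet_derivative (cmul A I1 A) (at (snd A g, e0)) (0, X), 0)"

lemma Ad_curve:
  assumes A: "A \<in> atlas G" "B \<in> atlas G" "g \<in> fst A" "inv g \<in> fst B" and t: "tangent \<gamma> X"
  shows "((\<lambda>t. snd I1 (g \<otimes> \<gamma> t \<otimes> inv g)) has_vector_derivative Adloc A B g X) (at 0)"
    and "tcurve (\<lambda>t. g \<otimes> \<gamma> t \<otimes> inv g) \<one>"
proof -
  have g: "g \<in> carrier G" using A chart(5) by blast
  have c: "tcurve \<gamma> \<one>" and d: "((\<lambda>t. snd I1 (\<gamma> t)) has_vector_derivative X) (at 0)"
    using t unfolding tangent_def by auto
  have g1: "g \<otimes> \<one> = g" "g \<otimes> inv g = \<one>" using g by auto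
  have c1: "tcurve (\<lambda>t. g \<otimes> \<gamma> t) g" using tcurve_mult[OF tcurve_const[OF g] c] g by simp
  show "tcurve (\<lambda>t. g \<otimes> \<gamma> t \<otimes> inv g) \<one>"
    using tcurve_mult[OF c1 tcurve_const[of "inv g"]] g by simp
  have d1: "((\<lambda>t. snd A (g \<otimes> \<gamma> t)) has_vector_derivative
      frechet_derivative (cmul A I1 A) (at (snd A g, e0)) (0, X)) (at 0)"
    by (rule curve_mult_derivative[OF A(1) I1(1) A(1) A(3) I1(2) _ tcurve_const[OF g] c _ d])
      (use g1 A in auto)
  show "((\<lambda>t. snd I1 (g \<otimes> \<gamma> t \<otimes> inv g)) has_vector_derivative Adloc A B g X) (at 0)"
    unfolding Adloc_def
    by (rule curve_mult_derivative[OF A(1,2) I1(1) A(3,4) _ c1 tcurve_const d1])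
      (use g1 g I1 in auto)
qed

lemma Ad_eq_Adloc:
  assumes A: "A \<in> atlas G" "B \<in> atlas G" "g \<in> fst A" "inv g \<in> fst B"
  shows "Ad G g X = Adloc A B g X"
  unfolding Ad_def by (rule vector_derivative_at[OF Ad_curve(1)[OF A tangent_expo]])

text \<open>\<open>Ad\<close> may be computed along any curve with tangent \<open>X\<close>, not
  only along the one-parameter subgroup of its definition; multiplicativity of \<open>Ad\<close>
  rests on this.\<close>

lemma Ad_tangent:
  assumes g: "g \<in> carrier G" and t: "tangent \<gamma> X"
  shows "tangent (\<lambda>t. g \<otimes> \<gamma> t \<otimes> inv g) (Ad G g X)"
proof -
  obtain A B where A: "A \<in> atlas G" "B \<in> atlas G" "g \<in> fst A" "inv g \<in> fst B"
    using chart_exists[OF g] chart_exists[OF inv_closed[OF g]] by blast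
  show ?thesis unfolding tangent_def Ad_eq_Adloc[OF A] using Ad_curve[OF A t] by blast
qed

lemma tangent_unique: "tangent \<gamma> X \<Longrightarrow> tangent \<gamma> Y \<Longrightarrow> X = Y"
  unfolding tangent_def using vector_derivative_unique_at by blast

lemma Ad_one[simp]: "Ad G \<one> X = X"
proof -
  have "tangent (\<lambda>t. \<one> \<otimes> expo G (t *\<^sub>R X) \<otimes> inv \<one>) (Ad G \<one> X)" by (rule Ad_tangent[OF one_closed tangent_expo])
  then show ?thesis using tangent_unique[OF tangent_expo[of X], of "Ad G \<one> X"] by simp
qed

lemma Ad_mult:
  assumes "g \<in> carrier G" "h \<in> carrier G" shows "Ad G (g \<otimes> h) X = Ad G g (Ad G h X)"
proof -
  have "tangent (\<lambda>t. g \<otimes> (h \<otimes> expo G (t *\<^sub>R X) \<otimes> inv h) \<otimes> inv g) (Ad G g (Ad G h X))"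
    by (intro Ad_tangent tangent_expo assms)
  moreover have "g \<otimes> (h \<otimes> expo G (t *\<^sub>R X) \<otimes> inv h) \<otimes> inv g = (g \<otimes> h) \<otimes> expo G (t *\<^sub>R X) \<otimes> inv (g \<otimes> h)" for t
    using assms by (simp add: m_assoc inv_mult_group)
  ultimately have "tangent (\<lambda>t. (g \<otimes> h) \<otimes> expo G (t *\<^sub>R X) \<otimes> inv (g \<otimes> h)) (Ad G g (Ad G h X))" by simp
  moreover have "tangent (\<lambda>t. (g \<otimes> h) \<otimes> expo G (t *\<^sub>R X) \<otimes> inv (g \<otimes> h)) (Ad G (g \<otimes> h) X)"
    by (intro Ad_tangent tangent_expo) (use assms in simp)
  ultimately show ?thesis using tangent_unique by blast
qed

lemma Ad_inv[simp]:
  assumes "g \<in> carrier G" shows "Ad G (inv g) (Ad G g X) = X" "Ad G g (Ad G (inv g) X) = X"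
  using Ad_mult[of "inv g" g X] Ad_mult[of g "inv g" X] assms by auto

lemma cmul_linear:
  assumes "A \<in> atlas G" "B \<in> atlas G" "C \<in> atlas G" "x \<in> fst A" "y \<in> fst B" "x \<otimes> y \<in> fst C"
  shows "linear (frechet_derivative (cmul A B C) (at (snd A x, snd B y)))"
  by (rule has_derivative_linear[OF cmul_derivative[OF assms]])

lemma linear_fst_slot:
  fixes D :: "'l \<times> 'l \<Rightarrow> 'l" assumes "linear D" shows "linear (\<lambda>X. D (X, 0))"
proof -
  have "linear (\<lambda>X::'l. (X, 0::'l))" by (auto intro!: linearI)
  from linear_compose[OF this assms] show ?thesis by (simp add: comp_def)
qed

lemma linear_snd_slot:
  fixes D :: "'l \<times> 'l \<Rightarrow> 'l" assumes "linear D" shows "linear (\<lambda>X. D (0, X))"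
proof -
  have "linear (\<lambda>X::'l. (0::'l, X))" by (auto intro!: linearI)
  from linear_compose[OF this assms] show ?thesis by (simp add: comp_def)
qed

lemma Ad_linear: assumes g: "g \<in> carrier G" shows "linear (Ad G g)"
proof -
  obtain A B where A: "A \<in> atlas G" "B \<in> atlas G" "g \<in> fst A" "inv g \<in> fst B"
    using chart_exists[OF g] chart_exists[OF inv_closed[OF g]] by blast
  have "linear (\<lambda>X. frechet_derivative (cmul A I1 A) (at (snd A g, e0)) (0, X))"
    by (rule linear_snd_slot[OF cmul_linear]) (use A I1 g in auto)
  moreover have "linear (\<lambda>X. frechet_derivative (cmul A B I1) (at (snd A g, snd B (inv g))) (X, 0))"
    by (rule linear_fst_slot[OF cmul_linear]) (use A I1 g in auto)
  ultimately have "linear (\<lambda>X. Adloc A B g X)" unfolding Adloc_def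
    by (rule linear_compose[unfolded comp_def])
  moreover have "Ad G g = (\<lambda>X. Adloc A B g X)" using Ad_eq_Adloc[OF A] by blast
  ultimately show ?thesis by simp
qed

text \<open>\<open>Adloc\<close> as a function of the coordinates of \<open>g\<close> and
  \<open>inv g\<close>. Expanding the inner vector in a basis leaves only derivatives in fixed
  directions, and for these \<open>smooth_on\<close> provides continuity and differentiability in
  the base point.\<close>

definition Adcoord :: "'g set \<times> ('g \<Rightarrow> 'l) \<Rightarrow> 'g set \<times> ('g \<Rightarrow> 'l) \<Rightarrow> 'l \<Rightarrow> 'l \<times> 'l \<Rightarrow> 'l" where
  "Adcoord A B X p = (\<Sum>j\<in>Basis. (frechet_derivative (cmul A I1 A) (at (fst p, e0)) (0, X) \<bullet> j) *\<^sub>R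
      frechet_derivative (cmul A B I1) (at p) (j, 0))"

lemma Adloc_Adcoord:
  assumes A: "A \<in> atlas G" "B \<in> atlas G" "g \<in> fst A" "inv g \<in> fst B"
  shows "Adloc A B g X = Adcoord A B X (snd A g, snd B (inv g))"
proof -
  have g: "g \<in> carrier G" using A chart(5) by blast
  have "linear (\<lambda>X. frechet_derivative (cmul A B I1) (at (snd A g, snd B (inv g))) (X, 0))"
    by (rule linear_fst_slot[OF cmul_linear]) (use A I1 g in auto)
  then show ?thesis unfolding Adloc_def Adcoord_def fst_conv by (rule linear_sum_Basis)
qed

lemma cdom_fst: "A \<in> atlas G \<Longrightarrow> p \<in> cdom A B I1 \<Longrightarrow> (fst p, e0) \<in> cdom A I1 A"
  unfolding cdom_def using I1 chart(5) by fastforce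

lemma Adcoord_continuous:
  assumes A: "A \<in> atlas G" "B \<in> atlas G"
  shows "continuous_on (cdom A B I1) (Adcoord A B X)"
proof -
  have 1: "continuous_on (cdom A I1 A) (\<lambda>p. frechet_derivative (cmul A I1 A) (at p) v)" for v
    by (rule smooth_onD(1)[OF smooth_onD(3)[OF smooth_cmul open_cdom] open_cdom]) (use A I1 in auto)
  have 2: "continuous_on (cdom A B I1) (\<lambda>p. frechet_derivative (cmul A B I1) (at p) v)" for v
    by (rule smooth_onD(1)[OF smooth_onD(3)[OF smooth_cmul open_cdom] open_cdom]) (use A I1 in auto)
  have 3: "continuous_on (cdom A B I1) (\<lambda>p. frechet_derivative (cmul A I1 A) (at (fst p, e0)) v)" for v
  proof (rule continuous_on_compose2[OF 1])
    show "continuous_on (cdom A B I1) (\<lambda>p. (fst p, e0))" by (intro continuous_intros)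
    show "(\<lambda>p. (fst p, e0)) ` cdom A B I1 \<subseteq> cdom A I1 A" using cdom_fst[OF A(1), of _ B] by blast
  qed
  show ?thesis unfolding Adcoord_def by (intro continuous_intros 2 3)
qed

text \<open>Near each point \<open>Ad\<close> is the continuous function \<open>Adcoord\<close> of
  chart coordinates; the local statements are glued.\<close>

lemma Ad_continuous1: "continuous_map (topol G) euclidean (\<lambda>g. Ad G g X)"
proof -
  define N where "N g0 A B = {g \<in> fst A. inv g \<in> fst B}" for g0 :: 'g and A B :: "'g set \<times> ('g \<Rightarrow> 'l)"
  have "\<exists>N0. openin (topol G) N0 \<and> g0 \<in> N0 \<and> continuous_map (subtopology (topol G) N0) euclidean (\<lambda>g. Ad G g X)"
    if g0: "g0 \<in> carrier G" for g0
  proof -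
    obtain A B where A: "A \<in> atlas G" "B \<in> atlas G" "g0 \<in> fst A" "inv g0 \<in> fst B"
      using chart_exists[OF g0] chart_exists[OF inv_closed[OF g0]] by blast
    define M where "M = fst A \<inter> {x \<in> topspace (topol G). inv x \<in> fst B}"
    have "openin (topol G) {x \<in> topspace (topol G). inv x \<in> fst B}"
      by (rule openin_continuous_map_preimage[OF continuous_inv chart(1)[OF A(2)]])
    then have oM: "openin (topol G) M" unfolding M_def using chart(1)[OF A(1)] by blast
    have a: "continuous_map (subtopology (topol G) M) euclidean (snd A)"
      by (rule continuous_map_from_subtopology_mono[OF chart(3)[OF A(1)]]) (auto simp: M_def)
    have "continuous_map (subtopology (topol G) M) (subtopology (topol G) (fst B)) (\<lambda>x. inv x)"
      by (rule continuous_map_into_subtopology[OF continuous_map_from_subtopology[OF continuous_inv]]) (auto simp: M_def)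
    from continuous_map_compose[OF this chart(3)[OF A(2)]]
    have b: "continuous_map (subtopology (topol G) M) euclidean (\<lambda>g. snd B (inv g))" by (simp add: comp_def)
    have "continuous_map (subtopology (topol G) M) (prod_topology euclidean euclidean) (\<lambda>g. (snd A g, snd B (inv g)))"
      by (rule continuous_map_pairedI[OF a b])
    then have "continuous_map (subtopology (topol G) M) (top_of_set (cdom A B I1)) (\<lambda>g. (snd A g, snd B (inv g)))"
      unfolding prod_topology_euclidean
      by (rule continuous_map_into_subtopology) (auto simp: M_def I1 intro!: cdomI)
    moreover have "continuous_map (top_of_set (cdom A B I1)) euclidean (Adcoord A B X)"
      using Adcoord_continuous[OF A(1,2)] by simp
    ultimately have "continuous_map (subtopology (topol G) M) euclidean (Adcoord A B X \<circ> (\<lambda>g. (snd A g, snd B (inv g))))"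
      by (rule continuous_map_compose)
    then have "continuous_map (subtopology (topol G) M) euclidean (\<lambda>g. Ad G g X)"
      by (rule continuous_map_eq) (use A in \<open>auto simp: M_def Ad_eq_Adloc Adloc_Adcoord\<close>)
    then show ?thesis using oM A g0 by (intro exI[of _ M]) (auto simp: M_def)
  qed
  then obtain N0 where N0: "\<And>g. g \<in> carrier G \<Longrightarrow> openin (topol G) (N0 g) \<and> g \<in> N0 g \<and> continuous_map (subtopology (topol G) (N0 g)) euclidean (\<lambda>g. Ad G g X)"
    by metis
  show ?thesis
    by (rule pasting_lemma[where I="carrier G" and T=N0 and f="\<lambda>_ g. Ad G g X"]) (use N0 in auto)
qed

lemma Ad_continuous: "continuous_map (prod_topology (topol G) euclidean) euclidean (\<lambda>(g, X). Ad G g X)"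
proof -
  have "continuous_map (prod_topology (topol G) euclidean) euclidean (\<lambda>z. \<Sum>i\<in>Basis. (snd z \<bullet> i) *\<^sub>R Ad G (fst z) i)"
  proof -
    have 1: "continuous_map (prod_topology (topol G) euclidean) (prod_topology euclidean euclidean) (\<lambda>z. (snd z, Ad G (fst z) i))" for i :: 'l
      using continuous_map_compose[OF continuous_map_fst Ad_continuous1[of i], of euclidean]
      by (intro continuous_map_pairedI continuous_map_snd) (simp add: comp_def)
    have 2: "continuous_map (euclidean :: ('l \<times> 'l) topology) euclidean (\<lambda>(X, Y). (X \<bullet> i) *\<^sub>R Y)" for i :: 'l
      by (auto intro!: continuous_intros simp: case_prod_beta)
    have "continuous_map (prod_topology (topol G) euclidean) euclidean (\<lambda>z. (snd z \<bullet> i) *\<^sub>R Ad G (fst z) i)" for i :: 'l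
      using continuous_map_compose[OF 1[unfolded prod_topology_euclidean] 2] by (simp add: comp_def)
    then show ?thesis by (intro continuous_map_sum) auto
  qed
  then show ?thesis
    by (rule continuous_map_eq) (auto simp: linear_sum_Basis[OF Ad_linear, symmetric])
qed

end

lemma has_vector_derivative_shift:
  assumes "((\<lambda>s. f (t + s)) has_vector_derivative v) (at 0)"
  shows "(f has_vector_derivative v) (at t)"
proof -
  have "((\<lambda>s. f (t + s)) has_derivative (\<lambda>x. x *\<^sub>R v)) (at (t - t))"
    using assms by (simp add: has_vector_derivative_def)
  moreover have "((\<lambda>s::real. s - t) has_derivative (\<lambda>x. x)) (at t)" by (auto intro!: derivative_eq_intros)
  ultimately have "((\<lambda>s. f (t + (s - t))) has_derivative (\<lambda>x. x *\<^sub>R v)) (at t)"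
    using has_derivative_compose[of "\<lambda>s. s - t" "\<lambda>x. x" t UNIV "\<lambda>s. f (t + s)"] by blast
  then show ?thesis by (simp add: has_vector_derivative_def)
qed

lemma has_vector_derivative_linear:
  fixes L :: "'a::euclidean_space \<Rightarrow> 'b::real_normed_vector"
  assumes "linear L" "(g has_vector_derivative v) (at t)"
  shows "((\<lambda>t. L (g t)) has_vector_derivative L v) (at t)"
  by (rule has_vector_derivative_comp_linear[OF _ assms(2)])
    (rule linear_imp_has_derivative[OF assms(1)])

text \<open>The part of a vector orthogonal to \<open>W\<close>, a linear model of the quotient by
  \<open>W\<close>. If \<open>P\<close> vanishes along a curve, the curve stays in
  \<open>W\<close>.\<close>

lemma subspace_projection:
  fixes W :: "'a::euclidean_space set" assumes W: "subspace W"
  shows "\<exists>P. linear P \<and> (\<forall>w\<in>W. P w = 0) \<and> (\<forall>v. v - P v \<in> W)"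
proof -
  obtain B where B: "B \<subseteq> W" "pairwise orthogonal B" "\<And>x. x \<in> B \<Longrightarrow> norm x = 1" "independent B" "card B = dim W" "span B = W"
    using orthonormal_basis_subspace[OF W] by metis
  have fin: "finite B" using B(4) independent_imp_finite by blast
  define P where "P v = v - (\<Sum>b\<in>B. (v \<bullet> b) *\<^sub>R b)" for v
  have lin: "linear P" unfolding P_def
    by (intro linearI) (simp_all add: algebra_simps inner_add_left sum.distrib scaleR_add_left scaleR_sum_right)
  have Pb: "P b = 0" if b: "b \<in> B" for b
  proof -
    have "(b \<bullet> c) *\<^sub>R c = (if c = b then b else 0)" if "c \<in> B" for c
    proof (cases "c = b")
      case True then show ?thesis using B(3)[OF b] by (simp add: norm_eq_1)
    next
      case False then show ?thesis using B(2) b that by (auto simp: pairwise_def orthogonal_def)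
    qed
    then have "(\<Sum>c\<in>B. (b \<bullet> c) *\<^sub>R c) = b" using fin b by (simp add: sum.delta')
    then show ?thesis by (simp add: P_def)
  qed
  have "P w = 0" if "w \<in> W" for w
  proof -
    have "w \<in> span B" using that B(6) by simp
    moreover have "span B \<subseteq> {x. P x = 0}"
      by (rule span_minimal) (use Pb linear_subspace_kernel[OF lin] in auto)
    ultimately show ?thesis by blast
  qed
  moreover have "v - P v \<in> W" for v
  proof -
    have "(\<Sum>b\<in>B. (v \<bullet> b) *\<^sub>R b) \<in> span B" by (intro span_sum span_scale span_base)
    then show ?thesis using B(6) by (simp add: P_def)
  qed
  ultimately show ?thesis using lin by blast
qed

section \<open>The bracket as derivative of the adjoint representation\<close>

context lie_grp
begin

text \<open>The bracket \<open>[X, Y]\<close> with its arguments exchanged, obtained by the chain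
  rule for \<open>Adcoord\<close> along the coordinates of a curve and of its inverse. Linearity in
  \<open>X\<close> is visible here, while in \<open>bracket\<close>, which differentiates along
  \<open>expo G (t *\<^sub>R X)\<close>, it is not.\<close>

definition Brk :: "'l \<Rightarrow> 'l \<Rightarrow> 'l" where
  "Brk Y X = frechet_derivative (Adcoord I1 I1 Y) (at (e0, e0)) (X, frechet_derivative (cinv I1 I1) (at e0) X)"

lemma e0_cdom: "(e0, e0) \<in> cdom I1 I1 I1"
  by (rule cdomI) (auto simp: I1)

lemma frechet_cmul_differentiable: "(\<lambda>p. frechet_derivative (cmul I1 I1 I1) (at p) v) differentiable (at (e0, e0))"
  using smooth_onD(2)[OF smooth_onD(3)[OF smooth_cmul[OF I1(1) I1(1) I1(1)] open_cdom[OF I1(1) I1(1) I1(1)]]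
      open_cdom[OF I1(1) I1(1) I1(1)] e0_cdom] unfolding differentiable_def by blast

lemma Adcoord_differentiable: "Adcoord I1 I1 Y differentiable (at (e0, e0))"
proof -
  have 1: "(\<lambda>p. frechet_derivative (cmul I1 I1 I1) (at (fst p, e0)) (0, Y)) differentiable (at (e0, e0))"
  proof -
    have "(\<lambda>p. (fst p, e0)) differentiable (at (e0, e0))"
      unfolding differentiable_def by (auto intro!: exI derivative_eq_intros)
    then show ?thesis
      using differentiable_compose[of "\<lambda>p. frechet_derivative (cmul I1 I1 I1) (at p) (0, Y)" "\<lambda>p. (fst p, e0)" "(e0, e0)" UNIV]
        frechet_cmul_differentiable[of "(0, Y)"] by simp
  qed
  have "(\<lambda>p. \<Sum>j\<in>Basis. (frechet_derivative (cmul I1 I1 I1) (at (fst p, e0)) (0, Y) \<bullet> j) *\<^sub>R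
      frechet_derivative (cmul I1 I1 I1) (at p) (j, 0)) differentiable (at (e0, e0))"
    by (intro differentiable_sum differentiable_scaleR differentiable_inner finite_Basis 1 frechet_cmul_differentiable differentiable_const ballI)
  then show ?thesis unfolding Adcoord_def[abs_def] .
qed

lemma Ad_curve_Brk:
  assumes t: "tangent \<gamma> X"
  shows "((\<lambda>t. Ad G (\<gamma> t) Y) has_vector_derivative Brk Y X) (at 0)"
proof (rule has_vector_derivative_eventually)
  have c: "tcurve \<gamma> \<one>" and d: "((\<lambda>t. snd I1 (\<gamma> t)) has_vector_derivative X) (at 0)"
    using t unfolding tangent_def by auto
  have ci: "tcurve (\<lambda>t. inv \<gamma> t) \<one>" using tcurve_inv[OF c] by simp
  have di: "((\<lambda>t. snd I1 (inv \<gamma> t)) has_vector_derivative frechet_derivative (cinv I1 I1) (at e0) X) (at 0)"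
    by (rule curve_inv_derivative[OF I1(1) I1(1) I1(2) _ c d]) (simp add: I1)
  have g0: "\<gamma> 0 = \<one>" using tcurveD(1)[OF c] .
  show "((\<lambda>t. Adcoord I1 I1 Y (snd I1 (\<gamma> t), snd I1 (inv \<gamma> t))) has_vector_derivative Brk Y X) (at 0)"
    unfolding Brk_def
    by (rule has_vector_derivative_comp_linear[OF _ has_vector_derivative_Pair[OF d di]])
      (use Adcoord_differentiable[of Y] in \<open>simp add: g0 frechet_derivative_works[symmetric]\<close>)
  show "\<forall>\<^sub>F t in at 0. Adcoord I1 I1 Y (snd I1 (\<gamma> t), snd I1 (inv \<gamma> t)) = Ad G (\<gamma> t) Y"
    using tcurve_eventually[OF c chart(1)[OF I1(1)] I1(2)] tcurve_eventually[OF ci chart(1)[OF I1(1)] I1(2)]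
    by eventually_elim (simp add: Ad_eq_Adloc[OF I1(1) I1(1)] Adloc_Adcoord[OF I1(1) I1(1)])
  show "Adcoord I1 I1 Y (snd I1 (\<gamma> 0), snd I1 (inv \<gamma> 0)) = Ad G (\<gamma> 0) Y"
    using I1 by (simp add: g0 Ad_eq_Adloc[OF I1(1) I1(1)] Adloc_Adcoord[OF I1(1) I1(1)] del: Ad_one)
qed

lemma bracket_Brk: "bracket G X Y = Brk Y X"
  unfolding bracket_def by (rule vector_derivative_at[OF Ad_curve_Brk[OF tangent_expo]])

lemma Ad_curve_bracket:
  "tangent \<gamma> X \<Longrightarrow> ((\<lambda>t. Ad G (\<gamma> t) Y) has_vector_derivative bracket G X Y) (at 0)"
  unfolding bracket_Brk by (rule Ad_curve_Brk)

lemma bracket_linear_left: "linear (\<lambda>X. bracket G X Y)"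
proof -
  have 1: "linear (frechet_derivative (Adcoord I1 I1 Y) (at (e0, e0)))"
    using Adcoord_differentiable by (simp add: linear_frechet_derivative)
  have 2: "linear (frechet_derivative (cinv I1 I1) (at e0))"
    by (rule has_derivative_linear[OF smooth_onD(2)[OF smooth_cinv open_cinv_dom]]) (auto simp: I1 intro!: exI[of _ \<one>])
  have "linear (\<lambda>X. (X, frechet_derivative (cinv I1 I1) (at e0) X))"
    by (intro linearI) (simp_all add: linear_add[OF 2] linear_cmul[OF 2])
  from linear_compose[OF this 1] show ?thesis unfolding bracket_Brk Brk_def by (simp add: comp_def)
qed

lemma bracket_linear_right: "linear (\<lambda>Y. bracket G X Y)"
proof (rule linearI)
  note d = Ad_curve_bracket[OF tangent_expo[of X]]
  fix Y Z c
  have "((\<lambda>t. Ad G (expo G (t *\<^sub>R X)) Y + Ad G (expo G (t *\<^sub>R X)) Z) has_vector_derivative bracket G X Y + bracket G X Z) (at 0)"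
    by (rule has_vector_derivative_add[OF d d])
  then show "bracket G X (Y + Z) = bracket G X Y + bracket G X Z"
    using vector_derivative_unique_at[OF d[of "Y + Z"]] by (simp add: linear_add[OF Ad_linear])
  have "((\<lambda>t. c *\<^sub>R Ad G (expo G (t *\<^sub>R X)) Y) has_vector_derivative c *\<^sub>R bracket G X Y) (at 0)"
    by (rule has_vector_derivative_linear[OF _ d]) (simp add: linear_scale_self)
  then show "bracket G X (c *\<^sub>R Y) = c *\<^sub>R bracket G X Y"
    using vector_derivative_unique_at[OF d[of "c *\<^sub>R Y"]] by (simp add: linear_cmul[OF Ad_linear])
qed

lemma Ad_expo_self[simp]: "Ad G (expo G (s *\<^sub>R X)) X = X"
proof -
  have "tangent (\<lambda>t. expo G (s *\<^sub>R X) \<otimes> expo G (t *\<^sub>R X) \<otimes> inv expo G (s *\<^sub>R X)) (Ad G (expo G (s *\<^sub>R X)) X)"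
    by (rule Ad_tangent[OF expo_closed tangent_expo])
  moreover have "expo G (s *\<^sub>R X) \<otimes> expo G (t *\<^sub>R X) \<otimes> inv expo G (s *\<^sub>R X) = expo G (t *\<^sub>R X)" for t
    unfolding expo_hom[symmetric] using expo_hom[of t s X]
    by (metis add.commute expo_closed inv_solve_right')
  ultimately show ?thesis using tangent_unique[OF tangent_expo[of X], of "Ad G (expo G (s *\<^sub>R X)) X"] by simp
qed

lemma bracket_self: "bracket G X X = 0"
  using vector_derivative_unique_at[OF Ad_curve_bracket[OF tangent_expo[of X], of X]] has_vector_derivative_const[of X "at 0"] by simp

text \<open>Polarisation of \<open>bracket_self\<close>, which holds because \<open>X\<close> is
  fixed by its own one-parameter subgroup.\<close>

lemma bracket_antisym: "bracket G X Y = - bracket G Y X"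
proof -
  have "0 = bracket G (X + Y) (X + Y)" by (simp add: bracket_self)
  also have "\<dots> = bracket G X Y + bracket G Y X"
    by (simp add: linear_add[OF bracket_linear_left] linear_add[OF bracket_linear_right]
        bracket_self[of X] bracket_self[of Y])
  finally have "bracket G X Y + bracket G Y X = 0" by (rule sym)
  then show ?thesis by (simp only: eq_neg_iff_add_eq_0)
qed

text \<open>Both sides are the derivative at 0 of
  \<open>Ad G g (Ad G (expo G (t *\<^sub>R Y)) Z)\<close>, computed once along the conjugated curve
  and once by linearity of \<open>Ad G g\<close>.\<close>

lemma Ad_bracket:
  assumes g: "g \<in> carrier G"
  shows "Ad G g (bracket G Y Z) = bracket G (Ad G g Y) (Ad G g Z)"
proof -
  have "((\<lambda>t. Ad G (g \<otimes> expo G (t *\<^sub>R Y) \<otimes> inv g) (Ad G g Z)) has_vector_derivative bracket G (Ad G g Y) (Ad G g Z)) (at 0)"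
    by (rule Ad_curve_bracket[OF Ad_tangent[OF g tangent_expo]])
  moreover have "Ad G (g \<otimes> expo G (t *\<^sub>R Y) \<otimes> inv g) (Ad G g Z) = Ad G g (Ad G (expo G (t *\<^sub>R Y)) Z)" for t
    using g by (simp add: Ad_mult)
  moreover have "((\<lambda>t. Ad G g (Ad G (expo G (t *\<^sub>R Y)) Z)) has_vector_derivative Ad G g (bracket G Y Z)) (at 0)"
    by (rule has_vector_derivative_linear[OF Ad_linear[OF g] Ad_curve_bracket[OF tangent_expo]])
  ultimately show ?thesis using vector_derivative_unique_at by simp
qed

lemma Ad_expo_derivative:
  "((\<lambda>t. Ad G (expo G (t *\<^sub>R X)) Y) has_vector_derivative Ad G (expo G (s *\<^sub>R X)) (bracket G X Y)) (at s)"
proof (rule has_vector_derivative_shift)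
  have "Ad G (expo G ((s + t) *\<^sub>R X)) Y = Ad G (expo G (s *\<^sub>R X)) (Ad G (expo G (t *\<^sub>R X)) Y)" for t
    by (simp add: expo_hom Ad_mult)
  then show "((\<lambda>t. Ad G (expo G ((s + t) *\<^sub>R X)) Y) has_vector_derivative Ad G (expo G (s *\<^sub>R X)) (bracket G X Y)) (at 0)"
    using has_vector_derivative_linear[OF Ad_linear[OF expo_closed] Ad_curve_bracket[OF tangent_expo]] by simp
qed

lemma Ad_expo_derivative':
  "((\<lambda>t. Ad G (expo G (t *\<^sub>R X)) Y) has_vector_derivative bracket G X (Ad G (expo G (s *\<^sub>R X)) Y)) (at s)"
  using Ad_expo_derivative[of X Y s] by (simp add: Ad_bracket)

text \<open>The Jacobi identity, as the derivative at 0 of \<open>Ad_bracket\<close> along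
  \<open>expo G (t *\<^sub>R X)\<close>.\<close>

lemma bracket_derivation:
  "bracket G X (bracket G Y Z) = bracket G (bracket G X Y) Z + bracket G Y (bracket G X Z)"
proof -
  have bb: "bounded_bilinear (bracket G)"
    by (rule bilinear_conv_bounded_bilinear[THEN iffD1]) (simp add: bilinear_def bracket_linear_left bracket_linear_right)
  let ?A = "\<lambda>t. Ad G (expo G (t *\<^sub>R X))"
  have "((\<lambda>t. bracket G (?A t Y) (?A t Z)) has_vector_derivative
      bracket G (?A 0 Y) (bracket G X Z) + bracket G (bracket G X Y) (?A 0 Z)) (at 0)"
    by (rule bounded_bilinear.has_vector_derivative[OF bb]) (rule Ad_curve_bracket[OF tangent_expo])+
  then have 1: "((\<lambda>t. bracket G (?A t Y) (?A t Z)) has_vector_derivative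
      bracket G (bracket G X Y) Z + bracket G Y (bracket G X Z)) (at 0)" by (simp add: add.commute)
  have "((\<lambda>t. ?A t (bracket G Y Z)) has_vector_derivative bracket G X (bracket G Y Z)) (at 0)"
    by (rule Ad_curve_bracket[OF tangent_expo])
  then have "((\<lambda>t. bracket G (?A t Y) (?A t Z)) has_vector_derivative bracket G X (bracket G Y Z)) (at 0)"
    by (simp add: Ad_bracket)
  then show ?thesis using 1 by (rule vector_derivative_unique_at)
qed

text \<open>Modulo \<open>W\<close> the curve \<open>Ad (exp t X) Y\<close> solves a linear
  equation, because \<open>bracket G X\<close> acts on the quotient. It starts at 0, and uniqueness
  keeps it there.\<close>

lemma Ad_expo_subspace:
  assumes W: "subspace W" and inv: "\<And>Y. Y \<in> W \<Longrightarrow> bracket G X Y \<in> W" and Y: "Y \<in> W"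
  shows "Ad G (expo G X) Y \<in> W"
proof -
  obtain P :: "'l \<Rightarrow> 'l" where P: "linear P" "\<And>w. w \<in> W \<Longrightarrow> P w = 0" "\<And>v. v - P v \<in> W"
    using subspace_projection[OF W] by metis
  let ?f = "\<lambda>t. Ad G (expo G (t *\<^sub>R X)) Y"
  let ?D = "\<lambda>v. P (bracket G X v)"
  have linD: "linear ?D" using linear_compose[OF bracket_linear_right[of X] P(1)] by (simp add: comp_def)
  obtain C where C: "\<And>v. norm (?D v) \<le> C * norm v"
    using linear_bounded[OF linD] by (auto simp: mult.commute)
  have "P (?f 1) = 0"
  proof (rule gronwall_zero[where T=1 and C=C and u="\<lambda>t. P (?f t)" and u'="\<lambda>t. P (bracket G X (?f t))"])
    show "((\<lambda>t. P (?f t)) has_vector_derivative P (bracket G X (?f t))) (at t)" for t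
      by (rule has_vector_derivative_linear[OF P(1) Ad_expo_derivative'])
    show "norm (P (bracket G X (?f t))) \<le> C * norm (P (?f t))" for t
    proof -
      have "P (bracket G X (?f t - P (?f t))) = 0" by (intro P(2) inv P(3))
      then have "?D (?f t) = ?D (P (?f t))"
        by (simp add: linear_diff[OF bracket_linear_right] linear_diff[OF P(1)])
      then show ?thesis using C[of "P (?f t)"] by simp
    qed
    show "P (?f 0) = 0" using P(2)[OF Y] by simp
  qed auto
  then show ?thesis using P(3)[of "?f 1"] by simp
qed

lemma Ad_expo_fixed: assumes "bracket G X Y = 0" shows "Ad G (expo G X) Y = Y"
proof -
  have "Ad G (expo G (1 *\<^sub>R X)) Y - Y = 0"
  proof (rule gronwall_zero[where T=1 and C=0 and u="\<lambda>t. Ad G (expo G (t *\<^sub>R X)) Y - Y" and u'="\<lambda>_. 0"])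
    show "((\<lambda>t. Ad G (expo G (t *\<^sub>R X)) Y - Y) has_vector_derivative 0) (at t)" for t
      using has_vector_derivative_diff[OF Ad_expo_derivative[of X Y t] has_vector_derivative_const[of Y]] assms
      by (simp add: linear_0[OF Ad_linear])
  qed auto
  then show ?thesis by simp
qed

end

section \<open>One-parameter subgroups and the exponential map\<close>

context lie_grp
begin

definition one_param :: "(real \<Rightarrow> 'g) \<Rightarrow> bool" where
  "one_param \<alpha> \<longleftrightarrow> continuous_map euclideanreal (topol G) \<alpha> \<and> (\<forall>s t. \<alpha> (s + t) = \<alpha> s \<otimes> \<alpha> t)"

lemma one_paramD:
  assumes "one_param \<alpha>"
  shows "continuous_map euclideanreal (topol G) \<alpha>" "\<alpha> (s + t) = \<alpha> s \<otimes> \<alpha> t" "\<alpha> t \<in> carrier G" "\<alpha> 0 = \<one>"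
    "\<alpha> (- t) = inv (\<alpha> t)" "tcurve \<alpha> \<one>"
proof -
  show c: "continuous_map euclideanreal (topol G) \<alpha>" and h: "\<alpha> (s + t) = \<alpha> s \<otimes> \<alpha> t" for s t
    using assms unfolding one_param_def by blast+
  show car: "\<alpha> t \<in> carrier G" for t
    using continuous_map_image_subset_topspace[OF c] by auto
  have "\<alpha> 0 \<otimes> \<alpha> 0 = \<alpha> 0" using h[of 0 0] by simp
  then show z: "\<alpha> 0 = \<one>" using car l_cancel_one by blast
  have "\<alpha> (- t) \<otimes> \<alpha> t = \<one>" using h[of "- t" t] z by simp
  then show "\<alpha> (- t) = inv (\<alpha> t)" using car by (simp add: inv_equality)
  have "limitin (topol G) \<alpha> \<one> (at 0)"
    unfolding limitin_def
  proof (intro conjI allI impI)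
    fix N assume N: "openin (topol G) N \<and> \<one> \<in> N"
    then have "open {t. \<alpha> t \<in> N}" using openin_continuous_map_preimage[OF c, of N] by simp
    then show "\<forall>\<^sub>F t in at 0. \<alpha> t \<in> N"
      unfolding eventually_at_topological by (intro exI[of _ "{t. \<alpha> t \<in> N}"]) (simp add: N z)
  qed simp
  then show "tcurve \<alpha> \<one>" unfolding tcurve_def using z car by simp
qed

lemma one_param_expo: "one_param (\<lambda>t. expo G (t *\<^sub>R X))"
  unfolding one_param_def using expo_continuous expo_hom by simp

text \<open>The left-invariant vector field of \<open>X\<close>, in the chart at the
  identity.\<close>

definition vfield :: "'l \<Rightarrow> 'l \<Rightarrow> 'l" where
  "vfield X a = frechet_derivative (cmul I1 I1 I1) (at (a, e0)) (0, X)"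

lemma one_param_ode:
  assumes a: "one_param \<alpha>" and t: "tangent \<alpha> X" and U: "\<alpha> t \<in> fst I1"
  shows "((\<lambda>s. snd I1 (\<alpha> s)) has_vector_derivative vfield X (snd I1 (\<alpha> t))) (at t)"
proof (rule has_vector_derivative_shift)
  have "((\<lambda>s. snd I1 (\<alpha> t \<otimes> \<alpha> s)) has_vector_derivative vfield X (snd I1 (\<alpha> t))) (at 0)"
    unfolding vfield_def
    by (rule curve_mult_derivative[OF I1(1) I1(1) I1(1) U I1(2) _ tcurve_const one_paramD(6)[OF a]])
      (use t U one_paramD(3)[OF a] in \<open>auto simp: tangent_def\<close>)
  then show "((\<lambda>s. snd I1 (\<alpha> (t + s))) has_vector_derivative vfield X (snd I1 (\<alpha> t))) (at 0)"
    by (simp add: one_paramD(2)[OF a])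
qed

text \<open>Near 0 both curves solve the equation of the same locally Lipschitz vector field. The
  homomorphism property carries the agreement from \<open>t / n\<close> to \<open>t\<close>.\<close>

lemma one_param_unique:
  assumes a: "one_param \<alpha>" "tangent \<alpha> X" and b: "one_param \<beta>" "tangent \<beta> X"
  shows "\<alpha> t = \<beta> t"
proof -
  obtain e C where e: "0 < e" "cball (e0, e0) e \<subseteq> cdom I1 I1 I1"
    and C: "\<And>y z. y \<in> cball (e0, e0) e \<Longrightarrow> z \<in> cball (e0, e0) e \<Longrightarrow>
      norm (frechet_derivative (cmul I1 I1 I1) (at y) (0, X) - frechet_derivative (cmul I1 I1 I1) (at z) (0, X)) \<le> C * norm (y - z)"
    using smooth_locally_lipschitz[OF open_cdom[OF I1(1) I1(1) I1(1)]
        smooth_onD(3)[OF smooth_cmul[OF I1(1) I1(1) I1(1)] open_cdom[OF I1(1) I1(1) I1(1)]] e0_cdom, of "(0, X)"] by blast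
  have lip: "norm (vfield X x - vfield X y) \<le> C * norm (x - y)" if "x \<in> cball e0 e" "y \<in> cball e0 e" for x y
  proof -
    have "(x, e0) \<in> cball (e0, e0) e" "(y, e0) \<in> cball (e0, e0) e" using that by (auto simp: dist_Pair_Pair)
    from C[OF this] show ?thesis by (simp add: vfield_def norm_Pair)
  qed
  define N where "N = {x \<in> fst I1. snd I1 x \<in> ball e0 e}"
  have "openin (subtopology (topol G) (fst I1)) {x \<in> topspace (subtopology (topol G) (fst I1)). snd I1 x \<in> ball e0 e}"
    by (rule openin_continuous_map_preimage[OF chart(3)[OF I1(1)]]) simp
  then have "openin (topol G) {x \<in> topspace (subtopology (topol G) (fst I1)). snd I1 x \<in> ball e0 e}"
    using openin_trans_full chart(1)[OF I1(1)] by blast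
  moreover have "{x \<in> topspace (subtopology (topol G) (fst I1)). snd I1 x \<in> ball e0 e} = N"
    using chart(5)[OF I1(1)] by (auto simp: N_def)
  ultimately have oN: "openin (topol G) N" by simp
  have "open {t. \<alpha> t \<in> N}" "open {t. \<beta> t \<in> N}"
    using openin_continuous_map_preimage[OF one_paramD(1)[OF a(1)] oN]
      openin_continuous_map_preimage[OF one_paramD(1)[OF b(1)] oN] by simp_all
  then have "open ({t. \<alpha> t \<in> N} \<inter> {t. \<beta> t \<in> N})" by (rule open_Int)
  moreover have "0 \<in> {t. \<alpha> t \<in> N} \<inter> {t. \<beta> t \<in> N}"
    using one_paramD(4)[OF a(1)] one_paramD(4)[OF b(1)] I1(2) e(1) by (simp add: N_def)
  ultimately obtain T where T: "0 < T" "cball 0 T \<subseteq> {t. \<alpha> t \<in> N} \<inter> {t. \<beta> t \<in> N}"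
    using open_contains_cball by metis
  have small: "\<alpha> t = \<beta> t" if t: "0 \<le> t" "t \<le> T" for t
  proof -
    have tN: "\<alpha> s \<in> N" "\<beta> s \<in> N" if "0 \<le> s" "s \<le> T" for s
    proof -
      have "s \<in> cball 0 T" using that by simp
      then show "\<alpha> s \<in> N" "\<beta> s \<in> N" using T(2) by blast+
    qed
    have "snd I1 (\<alpha> t) - snd I1 (\<beta> t) = 0"
    proof (rule gronwall_zero[where T=T and C=C and u="\<lambda>t. snd I1 (\<alpha> t) - snd I1 (\<beta> t)"
          and u'="\<lambda>t. vfield X (snd I1 (\<alpha> t)) - vfield X (snd I1 (\<beta> t))", OF _ _ _ t])
      fix s assume s: "0 \<le> s" "s \<le> T"
      show "((\<lambda>t. snd I1 (\<alpha> t) - snd I1 (\<beta> t)) has_vector_derivative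
          vfield X (snd I1 (\<alpha> s)) - vfield X (snd I1 (\<beta> s))) (at s)"
        by (intro has_vector_derivative_diff one_param_ode a b) (use tN[OF s] in \<open>auto simp: N_def\<close>)
      show "norm (vfield X (snd I1 (\<alpha> s)) - vfield X (snd I1 (\<beta> s))) \<le> C * norm (snd I1 (\<alpha> s) - snd I1 (\<beta> s))"
        by (rule lip) (use tN[OF s] in \<open>auto simp: N_def\<close>)
    next
      show "snd I1 (\<alpha> 0) - snd I1 (\<beta> 0) = 0"
        using one_paramD(4)[OF a(1)] one_paramD(4)[OF b(1)] by simp
    qed
    then show ?thesis using tN[OF t] chart(2)[OF I1(1)] unfolding N_def by (auto dest: inj_onD)
  qed
  have pow: "\<alpha> (real n * s) = \<beta> (real n * s)" if "\<alpha> s = \<beta> s" for n s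
  proof (induction n)
    case 0
    show ?case using one_paramD(4)[OF a(1)] one_paramD(4)[OF b(1)] by simp
  next
    case (Suc n)
    have "real (Suc n) * s = real n * s + s" by (simp add: algebra_simps)
    then show ?case using Suc that one_paramD(2)[OF a(1)] one_paramD(2)[OF b(1)] by simp
  qed
  have pos: "\<alpha> t = \<beta> t" if t: "0 \<le> t" for t
  proof -
    obtain n :: nat where n: "t / T < real n" using reals_Archimedean2 by blast
    then have n0: "0 < real n" using t T(1) by (meson divide_nonneg_pos le_less_trans)
    have "t / real n \<le> T" using n n0 T(1) by (simp add: field_simps)
    then have "\<alpha> (t / real n) = \<beta> (t / real n)" using small t n0 by simp
    from pow[OF this, of n] show ?thesis using n0 by simp
  qed
  show ?thesis
  proof (cases "0 \<le> t")
    case True then show ?thesis by (rule pos)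
  next
    case False
    then have "\<alpha> (- t) = \<beta> (- t)" by (intro pos) simp
    then show ?thesis using one_paramD(5)[OF a(1), of "- t"] one_paramD(5)[OF b(1), of "- t"] by simp
  qed
qed

text \<open>Conjugation turns a one-parameter subgroup with tangent \<open>X\<close> into one with
  tangent \<open>Ad G g X\<close>, and uniqueness applies.\<close>

lemma expo_Ad:
  assumes g: "g \<in> carrier G" shows "expo G (Ad G g X) = g \<otimes> expo G X \<otimes> inv g"
proof -
  have "one_param (\<lambda>t. g \<otimes> expo G (t *\<^sub>R X) \<otimes> inv g)"
    unfolding one_param_def
  proof (intro conjI allI)
    have 1: "continuous_map euclideanreal (prod_topology (topol G) (topol G)) (\<lambda>t. (g, expo G (t *\<^sub>R X)))"
      using g by (intro continuous_map_pairedI expo_continuous) auto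
    have 2: "continuous_map euclideanreal (topol G) (\<lambda>t. g \<otimes> expo G (t *\<^sub>R X))"
      using continuous_map_compose[OF 1 continuous_mult] by (simp add: comp_def)
    have 3: "continuous_map euclideanreal (prod_topology (topol G) (topol G)) (\<lambda>t. (g \<otimes> expo G (t *\<^sub>R X), inv g))"
      using g by (intro continuous_map_pairedI 2) auto
    show "continuous_map euclideanreal (topol G) (\<lambda>t. g \<otimes> expo G (t *\<^sub>R X) \<otimes> inv g)"
      using continuous_map_compose[OF 3 continuous_mult] by (simp add: comp_def)
    show "g \<otimes> expo G ((s + t) *\<^sub>R X) \<otimes> inv g = (g \<otimes> expo G (s *\<^sub>R X) \<otimes> inv g) \<otimes> (g \<otimes> expo G (t *\<^sub>R X) \<otimes> inv g)" for s t
      using g by (simp add: expo_hom m_assoc inv_solve_left)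
  qed
  from one_param_unique[OF one_param_expo tangent_expo this Ad_tangent[OF g tangent_expo], of 1]
  show ?thesis by simp
qed

lemma expo_commute: assumes "bracket G X Y = 0" shows "expo G X \<otimes> expo G Y = expo G Y \<otimes> expo G X"
proof -
  have "expo G Y = expo G X \<otimes> expo G Y \<otimes> inv expo G X"
    using expo_Ad[of "expo G X" Y] Ad_expo_fixed[OF assms] by simp
  then show ?thesis by (metis expo_closed inv_solve_right' m_closed)
qed

text \<open>For commuting \<open>X\<close> and \<open>Y\<close> the product of the two one-parameter
  subgroups is again one, and uniqueness applies once its tangent is known.\<close>

lemma expo_add: assumes c: "bracket G X Y = 0" shows "expo G (X + Y) = expo G X \<otimes> expo G Y"
proof -
  have comm: "expo G (s *\<^sub>R X) \<otimes> expo G (t *\<^sub>R Y) = expo G (t *\<^sub>R Y) \<otimes> expo G (s *\<^sub>R X)" for s t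
    by (rule expo_commute) (simp add: linear_cmul[OF bracket_linear_left] linear_cmul[OF bracket_linear_right] c)
  let ?\<alpha> = "\<lambda>t. expo G (t *\<^sub>R X) \<otimes> expo G (t *\<^sub>R Y)"
  have op: "one_param ?\<alpha>"
    unfolding one_param_def
  proof (intro conjI allI)
    have 1: "continuous_map euclideanreal (prod_topology (topol G) (topol G)) (\<lambda>t. (expo G (t *\<^sub>R X), expo G (t *\<^sub>R Y)))"
      by (intro continuous_map_pairedI expo_continuous)
    show "continuous_map euclideanreal (topol G) ?\<alpha>"
      using continuous_map_compose[OF 1 continuous_mult] by (simp add: comp_def)
    fix s t
    have "?\<alpha> (s + t) = expo G (s *\<^sub>R X) \<otimes> (expo G (t *\<^sub>R X) \<otimes> expo G (s *\<^sub>R Y)) \<otimes> expo G (t *\<^sub>R Y)"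
      by (simp add: expo_hom m_assoc)
    also have "expo G (t *\<^sub>R X) \<otimes> expo G (s *\<^sub>R Y) = expo G (s *\<^sub>R Y) \<otimes> expo G (t *\<^sub>R X)" by (rule comm)
    finally show "?\<alpha> (s + t) = ?\<alpha> s \<otimes> ?\<alpha> t" by (simp add: m_assoc)
  qed
  have tX: "tcurve (\<lambda>t. expo G (t *\<^sub>R Z)) \<one>" "((\<lambda>t. snd I1 (expo G (t *\<^sub>R Z))) has_vector_derivative Z) (at 0)" for Z
    using tangent_expo[of Z] unfolding tangent_def by auto
  let ?D = "frechet_derivative (cmul I1 I1 I1) (at (e0, e0))"
  have D: "((\<lambda>t. snd I1 (\<gamma> t \<otimes> \<delta> t)) has_vector_derivative ?D (v, w)) (at 0)"
    if "tcurve \<gamma> \<one>" "tcurve \<delta> \<one>" "((\<lambda>t. snd I1 (\<gamma> t)) has_vector_derivative v) (at 0)"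
      "((\<lambda>t. snd I1 (\<delta> t)) has_vector_derivative w) (at 0)" for \<gamma> \<delta> v w
    by (rule curve_mult_derivative[OF I1(1) I1(1) I1(1) I1(2) I1(2) _ that]) (simp add: I1)
  have lin: "linear ?D" by (rule cmul_linear) (auto simp: I1)
  have z: "((\<lambda>t. snd I1 \<one>) has_vector_derivative 0) (at 0)" by simp
  have "((\<lambda>t. snd I1 (expo G (t *\<^sub>R X))) has_vector_derivative ?D (X, 0)) (at 0)"
    using D[OF tX(1)[of X] tcurve_const[OF one_closed] tX(2) z] by simp
  \<comment> \<open>The partial derivatives of multiplication at the identity are found by
    multiplying with a constant curve.\<close>
  then have "?D (X, 0) = X" using tX(2)[of X] by (rule vector_derivative_unique_at)
  moreover have "((\<lambda>t. snd I1 (expo G (t *\<^sub>R Y))) has_vector_derivative ?D (0, Y)) (at 0)"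
    using D[OF tcurve_const[OF one_closed] tX(1)[of Y] z tX(2)] by simp
  then have "?D (0, Y) = Y" using tX(2)[of Y] by (rule vector_derivative_unique_at)
  moreover have "?D (X, Y) = ?D (X, 0) + ?D (0, Y)" using linear_add[OF lin, of "(X, 0)" "(0, Y)"] by simp
  ultimately have "?D (X, Y) = X + Y" by simp
  then have "tangent ?\<alpha> (X + Y)"
    unfolding tangent_def using D[OF tX(1)[of X] tX(1)[of Y] tX(2) tX(2)] one_paramD(6)[OF op] by simp
  from one_param_unique[OF one_param_expo tangent_expo op this, of 1] show ?thesis by simp
qed

section \<open>Continuity of the exponential map\<close>

lemma vfield_linear: "(a, e0) \<in> cdom I1 I1 I1 \<Longrightarrow> linear (\<lambda>X. vfield X a)"
  unfolding vfield_def
  by (rule linear_snd_slot[OF has_derivative_linear[OF smooth_onD(2)[OF smooth_cmul open_cdom]]]) (auto simp: I1)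

text \<open>Constants uniform in the point and in the field, as needed to compare integral curves of
  different \<open>X\<close>. They are assembled from the Lipschitz constants for basis vectors;
  \<open>d\<close> is the smallest of the finitely many radii.\<close>

lemma vfield_bounds:
  "\<exists>e>0. \<exists>B\<ge>0. cball e0 e \<subseteq> snd I1 ` fst I1 \<and>
    (\<forall>x\<in>cball e0 e. \<forall>X. norm (vfield X x) \<le> B * norm X) \<and>
    (\<forall>x\<in>cball e0 e. \<forall>y\<in>cball e0 e. \<forall>X Y. norm X \<le> 1 \<longrightarrow> norm (vfield X x - vfield Y y) \<le> B * (norm (x - y) + norm (X - Y)))"
proof -
  let ?D = "\<lambda>i p. frechet_derivative (cmul I1 I1 I1) (at p) (0, i)"
  have "\<exists>e>0. \<exists>C. cball (e0, e0) e \<subseteq> cdom I1 I1 I1 \<and>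
      (\<forall>y\<in>cball (e0, e0) e. \<forall>z\<in>cball (e0, e0) e. norm (?D i y - ?D i z) \<le> C * norm (y - z))" for i
    using smooth_locally_lipschitz[OF open_cdom[OF I1(1) I1(1) I1(1)]
        smooth_onD(3)[OF smooth_cmul[OF I1(1) I1(1) I1(1)] open_cdom[OF I1(1) I1(1) I1(1)]] e0_cdom, of "(0, i)"] .
  then obtain e C where e: "\<And>i. 0 < e i" "\<And>i. cball (e0, e0) (e i) \<subseteq> cdom I1 I1 I1"
    and C: "\<And>i y z. y \<in> cball (e0, e0) (e i) \<Longrightarrow> z \<in> cball (e0, e0) (e i) \<Longrightarrow> norm (?D i y - ?D i z) \<le> C i * norm (y - z)"
    by metis
  define d where "d = Min (e ` Basis)"
  have d: "0 < d" "\<And>i. i \<in> Basis \<Longrightarrow> d \<le> e i" using e(1) by (auto simp: d_def)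
  have inball: "(x, e0) \<in> cball (e0, e0) (e i)" if "x \<in> cball e0 d" "i \<in> Basis" for x i
    using that d(2)[OF that(2)] by (auto simp: dist_Pair_Pair)
  obtain i0 :: 'l where i0: "i0 \<in> Basis" using nonempty_Basis by blast
  have dom: "(x, e0) \<in> cdom I1 I1 I1" if "x \<in> cball e0 d" for x
    using inball[OF that i0] e(2) by blast
  have lin: "linear (\<lambda>X. vfield X x)" if "x \<in> cball e0 d" for x by (rule vfield_linear[OF dom[OF that]])
  define L where "L = (\<Sum>i\<in>Basis. \<bar>C i\<bar>)"
  have L0: "0 \<le> L" by (auto simp: L_def intro!: sum_nonneg)
  have lip: "norm (vfield X x - vfield X y) \<le> L * norm (x - y) * norm X" if x: "x \<in> cball e0 d" and y: "y \<in> cball e0 d" for x y X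
  proof -
    have "vfield X x - vfield X y = (\<Sum>i\<in>Basis. (X \<bullet> i) *\<^sub>R (vfield i x - vfield i y))"
      unfolding linear_sum_Basis[OF lin[OF x], of X] linear_sum_Basis[OF lin[OF y], of X]
      by (simp add: sum_subtractf scaleR_diff_right)
    also have "norm \<dots> \<le> (\<Sum>i\<in>Basis. norm ((X \<bullet> i) *\<^sub>R (vfield i x - vfield i y)))" by (rule norm_sum)
    also have "\<dots> \<le> (\<Sum>i\<in>Basis. norm X * (\<bar>C i\<bar> * norm (x - y)))"
    proof (rule sum_mono)
      fix i :: 'l assume i: "i \<in> Basis"
      have "norm (vfield i x - vfield i y) \<le> C i * norm ((x, e0) - (y, e0))"
        unfolding vfield_def by (rule C[OF inball[OF x i] inball[OF y i]])
      also have "\<dots> \<le> \<bar>C i\<bar> * norm (x - y)" by (simp add: norm_Pair mult_right_mono)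
      finally show "norm ((X \<bullet> i) *\<^sub>R (vfield i x - vfield i y)) \<le> norm X * (\<bar>C i\<bar> * norm (x - y))"
        using Basis_le_norm[OF i, of X] by (simp add: mult_mono)
    qed
    also have "\<dots> = L * norm (x - y) * norm X" by (simp add: L_def sum_distrib_left sum_distrib_right mult_ac)
    finally show ?thesis .
  qed
  obtain K where K: "\<And>X. norm (vfield X e0) \<le> K * norm X"
    using linear_bounded[OF lin[of e0]] d(1) by (auto simp: mult.commute)
  define B where "B = \<bar>K\<bar> + L * d + L"
  have Bn: "norm (vfield X x) \<le> (\<bar>K\<bar> + L * d) * norm X" if x: "x \<in> cball e0 d" for x X
  proof -
    have "norm (vfield X x) \<le> norm (vfield X e0) + norm (vfield X x - vfield X e0)" by norm
    also have "\<dots> \<le> \<bar>K\<bar> * norm X + L * norm (x - e0) * norm X"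
      using lip[OF x, of e0 X] d(1) K[of X] by (intro add_mono) (auto intro: order_trans[OF _ mult_right_mono])
    also have "\<dots> \<le> \<bar>K\<bar> * norm X + L * d * norm X"
      using x L0 by (intro add_left_mono mult_right_mono mult_left_mono) (auto simp: dist_norm norm_minus_commute)
    finally show ?thesis by (simp add: algebra_simps)
  qed
  have B0: "0 \<le> B" using L0 d(1) by (simp add: B_def)
  have 1: "norm (vfield X x) \<le> B * norm X" if x: "x \<in> cball e0 d" for x X
  proof -
    have "(\<bar>K\<bar> + L * d) * norm X \<le> B * norm X" using L0 by (intro mult_right_mono) (auto simp: B_def)
    then show ?thesis using Bn[OF x, of X] by simp
  qed
  have 2: "norm (vfield X x - vfield Y y) \<le> B * (norm (x - y) + norm (X - Y))"
    if x: "x \<in> cball e0 d" and y: "y \<in> cball e0 d" and X: "norm X \<le> 1" for x y X Y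
  proof -
    have "vfield X x - vfield Y y = (vfield X x - vfield X y) + vfield (X - Y) y"
      using linear_diff[OF lin[OF y], of X Y] by simp
    then have "norm (vfield X x - vfield Y y) \<le> L * norm (x - y) * norm X + B * norm (X - Y)"
      using lip[OF x y, of X] 1[OF y, of "X - Y"] by (smt (verit) norm_triangle_ineq)
    also have "\<dots> \<le> L * norm (x - y) * 1 + B * norm (X - Y)"
      using X L0 by (intro add_right_mono mult_left_mono) auto
    also have "L * norm (x - y) * 1 \<le> B * norm (x - y)"
      unfolding mult_1_right using L0 d(1) by (intro mult_right_mono) (auto simp: B_def)
    finally show ?thesis by (simp add: algebra_simps)
  qed
  have "cball e0 d \<subseteq> snd I1 ` fst I1"
    using dom unfolding cdom_def by blast
  then show ?thesis using d(1) B0 1 2 by blast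
qed

text \<open>First exit argument: before the exit time \<open>t0\<close> the speed is at most
  \<open>B * norm X \<le> e / 2\<close>, so the curve remains in the half ball \<open>D\<close>.
  \<open>D\<close> is compact, hence closed in the Hausdorff group, so the point at time
  \<open>t0\<close> is still in \<open>D\<close> and inside the ball it was to leave.\<close>

lemma expo_stays:
  assumes e: "0 < e" "cball e0 e \<subseteq> snd I1 ` fst I1"
    and B: "0 \<le> B" "\<And>x X. x \<in> cball e0 e \<Longrightarrow> norm (vfield X x) \<le> B * norm X"
    and X: "B * norm X \<le> e / 2" and t: "0 \<le> t" "t \<le> 1"
  shows "expo G (t *\<^sub>R X) \<in> fst I1 \<and> snd I1 (expo G (t *\<^sub>R X)) \<in> cball e0 e"
proof (rule ccontr)
  assume n: "\<not> ?thesis"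
  define N where "N = {x \<in> fst I1. snd I1 x \<in> ball e0 e}"
  define D where "D = {x \<in> fst I1. snd I1 x \<in> cball e0 (e / 2)}"
  let ?\<alpha> = "\<lambda>t. expo G (t *\<^sub>R X)"
  have hom: "homeomorphic_map (subtopology (topol G) (fst I1)) (top_of_set (snd I1 ` fst I1)) (snd I1)"
    using lie I1(1) unfolding lie_group_def smooth_atlas_def is_chart_def case_prod_beta by blast
  have ts: "topspace (subtopology (topol G) (fst I1)) = fst I1" using chart(5)[OF I1(1)] by auto
  have "openin (subtopology (topol G) (fst I1)) {x \<in> topspace (subtopology (topol G) (fst I1)). snd I1 x \<in> ball e0 e}"
    by (rule openin_continuous_map_preimage[OF chart(3)[OF I1(1)]]) simp
  then have oN: "openin (topol G) N"
    unfolding ts N_def using openin_trans_full chart(1)[OF I1(1)] by blast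
  have "compactin (subtopology (topol G) (fst I1)) D"
  proof -
    have "cball e0 (e / 2) \<subseteq> snd I1 ` fst I1" using e by (auto intro!: subsetD[OF e(2)])
    then have "snd I1 ` D = cball e0 (e / 2)" unfolding D_def by blast
    moreover have "compactin (top_of_set (snd I1 ` fst I1)) (cball e0 (e / 2))"
      using e by (auto simp: compactin_subtopology)
    ultimately show ?thesis using homeomorphic_map_compactness[OF hom, of D] ts by (auto simp: D_def)
  qed
  then have "compactin (topol G) D" by (simp add: compactin_subtopology)
  then have cD: "closedin (topol G) D" by (rule compactin_imp_closedin[OF Hausdorff_G])
  have oT: "open {t. ?\<alpha> t \<in> N}" using openin_continuous_map_preimage[OF expo_continuous oN] by simp
  have cT: "closed {t. ?\<alpha> t \<in> D}" using closedin_continuous_map_preimage[OF expo_continuous cD] by simp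
  define S where "S = {0..1} \<inter> - {t. ?\<alpha> t \<in> N}"
  have "compact S" unfolding S_def by (rule compact_Int_closed) (use oT in auto)
  moreover have "t \<in> S" using n t unfolding S_def N_def by auto
  ultimately obtain t0 where t0: "t0 \<in> S" "\<And>s. s \<in> S \<Longrightarrow> t0 \<le> s" using compact_attains_inf[of S] by blast
  have before: "?\<alpha> s \<in> N" if "0 \<le> s" "s < t0" for s
    using t0(2)[of s] that t0(1) unfolding S_def by force
  have "0 \<in> {t. ?\<alpha> t \<in> N}" using I1(2) e(1) by (simp add: N_def)
  then have t0p: "0 < t0" "t0 \<le> 1" using t0(1) unfolding S_def by (auto simp: less_le)
  have inD: "?\<alpha> s \<in> D" if s: "0 \<le> s" "s < t0" for s
  proof -
    have "norm (snd I1 (?\<alpha> s) - snd I1 (?\<alpha> 0)) \<le> (B * norm X) * norm (s - 0)"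
    proof (rule differentiable_bound[where S="{0..s}" and f'="\<lambda>u v. v *\<^sub>R vfield X (snd I1 (?\<alpha> u))"])
      fix u assume u: "u \<in> {0..s}"
      then have uN: "?\<alpha> u \<in> N" using before s by auto
      have "((\<lambda>s. snd I1 (?\<alpha> s)) has_vector_derivative vfield X (snd I1 (?\<alpha> u))) (at u)"
        by (rule one_param_ode[OF one_param_expo tangent_expo]) (use uN in \<open>simp add: N_def\<close>)
      then show "((\<lambda>s. snd I1 (?\<alpha> s)) has_derivative (\<lambda>v. v *\<^sub>R vfield X (snd I1 (?\<alpha> u)))) (at u within {0..s})"
        unfolding has_vector_derivative_def by (rule has_derivative_at_withinI)
      have "norm (vfield X (snd I1 (?\<alpha> u))) \<le> B * norm X" by (rule B(2)) (use uN in \<open>auto simp: N_def\<close>)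
      then show "onorm (\<lambda>v. v *\<^sub>R vfield X (snd I1 (?\<alpha> u))) \<le> B * norm X"
        by (intro onorm_le) (simp add: mult.commute[of "norm _" "\<bar>_\<bar>"] mult_mono mult.commute mult_left_mono)
    qed (use s in auto)
    also have "\<dots> \<le> (e / 2) * 1" using X s t0p e(1) by (intro mult_mono) auto
    finally show ?thesis using before[OF s] by (auto simp: D_def N_def dist_norm norm_minus_commute)
  qed
  have "t0 \<in> closure {t. ?\<alpha> t \<in> D}"
  proof -
    have "t0 \<in> closure {0<..<t0}" using t0p by simp
    moreover have "closure {0<..<t0} \<subseteq> closure {t. ?\<alpha> t \<in> D}" using inD by (intro closure_mono) auto
    ultimately show ?thesis by blast
  qed
  then have "?\<alpha> t0 \<in> D" using cT by simp
  then have "?\<alpha> t0 \<in> N" using e(1) by (auto simp: D_def N_def)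
  then show False using t0(1) by (simp add: S_def)
qed

text \<open>The coordinates of \<open>expo G (t *\<^sub>R X)\<close> and
  \<open>expo G (t *\<^sub>R Y)\<close> solve equations whose fields differ by at most a multiple of
  \<open>norm (Y - X)\<close>; this norm is the \<open>\<epsilon>\<close> of
  \<open>gronwall_bound\<close>.\<close>

lemma expo_locally_continuous:
  "\<exists>r>0. \<forall>X N. norm X < r \<and> openin (topol G) N \<and> expo G X \<in> N \<longrightarrow>
     (\<exists>d>0. \<forall>Y. norm (Y - X) < d \<longrightarrow> expo G Y \<in> N)"
proof -
  obtain e B where e: "0 < e" "cball e0 e \<subseteq> snd I1 ` fst I1" and B: "0 \<le> B"
    "\<And>x X. x \<in> cball e0 e \<Longrightarrow> norm (vfield X x) \<le> B * norm X"
    "\<And>x y X Y. x \<in> cball e0 e \<Longrightarrow> y \<in> cball e0 e \<Longrightarrow> norm X \<le> 1 \<Longrightarrow>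
       norm (vfield X x - vfield Y y) \<le> B * (norm (x - y) + norm (X - Y))"
    using vfield_bounds by blast
  \<comment> \<open>The bound 1 serves the Lipschitz estimate for fields of norm at most 1, and
    \<open>e / (2 * B + 1)\<close> ensures \<open>B * norm X \<le> e / 2\<close> also for
    \<open>B = 0\<close>.\<close>
  define r where "r = min 1 (e / (2 * B + 1))"
  have r: "0 < r" "r \<le> 1" using e(1) B(1) by (auto simp: r_def)
  have Br: "B * norm X \<le> e / 2" if "norm X \<le> r" for X :: 'l
  proof -
    have "B * norm X \<le> B * (e / (2 * B + 1))" using that B(1) by (intro mult_left_mono) (auto simp: r_def)
    also have "\<dots> \<le> e / 2" using B(1) e(1) by (simp add: field_simps)
    finally show ?thesis .
  qed
  have stay: "expo G (t *\<^sub>R X) \<in> fst I1 \<and> snd I1 (expo G (t *\<^sub>R X)) \<in> cball e0 e"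
    if "norm X \<le> r" "0 \<le> t" "t \<le> 1" for X t
    by (rule expo_stays[OF e B(1) _ Br[OF that(1)] that(2,3)]) (rule B(2))
  let ?c = "\<lambda>X. snd I1 (expo G X)"
  have lip: "norm (?c Y - ?c X) \<le> norm (Y - X) * exp (2 * B)" if X: "norm X \<le> r" and Y: "norm Y \<le> r" for X Y
  proof -
    have "norm (?c (1 *\<^sub>R Y) - ?c (1 *\<^sub>R X)) \<le> norm (Y - X) * exp (2 * B * 1)"
    proof (rule gronwall_bound[where T=1 and u="\<lambda>t. ?c (t *\<^sub>R Y) - ?c (t *\<^sub>R X)"
          and u'="\<lambda>t. vfield Y (?c (t *\<^sub>R Y)) - vfield X (?c (t *\<^sub>R X))"])
      fix t :: real assume t: "0 \<le> t" "t \<le> 1"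
      show "((\<lambda>t. ?c (t *\<^sub>R Y) - ?c (t *\<^sub>R X)) has_vector_derivative
          vfield Y (?c (t *\<^sub>R Y)) - vfield X (?c (t *\<^sub>R X))) (at t)"
        using stay[OF X t] stay[OF Y t]
        by (intro has_vector_derivative_diff one_param_ode one_param_expo tangent_expo) auto
      show "norm (vfield Y (?c (t *\<^sub>R Y)) - vfield X (?c (t *\<^sub>R X))) \<le>
          B * (norm (?c (t *\<^sub>R Y) - ?c (t *\<^sub>R X)) + norm (Y - X))"
        by (rule B(3)) (use stay[OF X t] stay[OF Y t] Y r in auto)
    qed (use B(1) in auto)
    then show ?thesis by simp
  qed
  have "\<exists>d>0. \<forall>Y. norm (Y - X) < d \<longrightarrow> expo G Y \<in> N"
    if X: "norm X < r" and N: "openin (topol G) N" "expo G X \<in> N" for X N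
  proof -
    have Xr: "norm X \<le> r" using X by simp
    have XU: "expo G X \<in> fst I1" using stay[OF Xr, of 1] by simp
    have "open (snd I1 ` (N \<inter> fst I1))"
      by (rule chart(4)[OF I1(1)]) (use N chart(1)[OF I1(1)] in auto)
    moreover have "?c X \<in> snd I1 ` (N \<inter> fst I1)" using N XU by blast
    ultimately obtain s where s: "0 < s" "ball (?c X) s \<subseteq> snd I1 ` (N \<inter> fst I1)"
      using open_contains_ball by blast
    define d where "d = min (r - norm X) (s / exp (2 * B))"
    have "expo G Y \<in> N" if Yd: "norm (Y - X) < d" for Y
    proof -
      have "norm Y \<le> norm X + norm (Y - X)" by norm
      then have Yr: "norm Y \<le> r" using Yd by (simp add: d_def)
      have "norm (?c Y - ?c X) \<le> norm (Y - X) * exp (2 * B)" by (rule lip[OF Xr Yr])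
      also have "\<dots> < s" using Yd by (simp add: d_def field_simps)
      finally have "?c Y \<in> ball (?c X) s" by (simp add: dist_norm norm_minus_commute)
      then obtain z where z: "?c Y = snd I1 z" "z \<in> N" "z \<in> fst I1" using s(2) by blast
      moreover have "expo G Y \<in> fst I1" using stay[OF Yr, of 1] by simp
      ultimately have "expo G Y = z" using chart(2)[OF I1(1)] by (auto dest: inj_onD)
      then show ?thesis using z by simp
    qed
    moreover have "0 < d" using X s(1) by (simp add: d_def)
    ultimately show ?thesis by blast
  qed
  then show ?thesis using r(1) by blast
qed

lemma expo_pow: "expo G (real n *\<^sub>R X) = expo G X [^] n"
proof (induction n)
  case (Suc n)
  have "expo G (real (Suc n) *\<^sub>R X) = expo G ((real n + 1) *\<^sub>R X)" by (simp add: add.commute)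
  also have "\<dots> = expo G (real n *\<^sub>R X) \<otimes> expo G X" using expo_hom[of "real n" 1 X] by simp
  finally show ?case using Suc by simp
qed simp

lemma continuous_pow: "continuous_map (topol G) (topol G) (\<lambda>g. g [^] (n::nat))"
proof (induction n)
  case 0 show ?case by simp
next
  case (Suc n)
  have "continuous_map (topol G) (prod_topology (topol G) (topol G)) (\<lambda>g. (g [^] n, g))"
    using Suc by (intro continuous_map_pairedI) auto
  from continuous_map_compose[OF this continuous_mult] show ?case by (simp add: comp_def)
qed

text \<open>\<open>expo G X\<close> is the \<open>n\<close>-th power of the exponential of
  \<open>X\<close> divided by \<open>n\<close>, so continuity near 0 spreads to every
  \<open>X\<close>.\<close>

lemma expo_continuous_map: "continuous_map euclidean (topol G) (expo G)"
  unfolding continuous_map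
proof (intro conjI allI impI)
  show "expo G ` topspace euclidean \<subseteq> topspace (topol G)" by auto
  fix N assume N: "openin (topol G) N"
  obtain r where r1: "0 < r" and r2: "\<forall>X N. norm X < r \<and> openin (topol G) N \<and> expo G X \<in> N \<longrightarrow>
     (\<exists>d>0. \<forall>Y. norm (Y - X) < d \<longrightarrow> expo G Y \<in> N)"
    using expo_locally_continuous by (elim exE conjE) (rule that)
  have r: "0 < r" "\<And>X N. norm X < r \<Longrightarrow> openin (topol G) N \<Longrightarrow> expo G X \<in> N \<Longrightarrow>
     \<exists>d>0. \<forall>Y. norm (Y - X) < d \<longrightarrow> expo G Y \<in> N"
    by (rule r1) (rule r2[rule_format], simp)
  have "\<exists>s>0. ball X s \<subseteq> {X. expo G X \<in> N}" if X: "expo G X \<in> N" for X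
  proof -
    obtain n :: nat where n: "norm X / r < real n" using reals_Archimedean2 by blast
    then have n0: "0 < real n" using r(1) by (meson divide_nonneg_pos le_less_trans norm_ge_zero)
    have sc: "expo G Y = expo G ((1 / real n) *\<^sub>R Y) [^] n" for Y
      using expo_pow[of n "(1 / real n) *\<^sub>R Y"] n0 by simp
    have small: "norm ((1 / real n) *\<^sub>R X) < r" using n n0 r(1) by (simp add: field_simps)
    have oM: "openin (topol G) {g \<in> topspace (topol G). g [^] n \<in> N}"
      by (rule openin_continuous_map_preimage[OF continuous_pow N])
    have "expo G ((1 / real n) *\<^sub>R X) \<in> {g \<in> topspace (topol G). g [^] n \<in> N}" using X sc[of X] by simp
    from r(2)[OF small oM this] obtain d where d: "0 < d"
      "\<And>Y. norm (Y - (1 / real n) *\<^sub>R X) < d \<Longrightarrow> expo G Y [^] n \<in> N" by auto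
    have "expo G Y \<in> N" if "Y \<in> ball X (real n * d)" for Y
    proof -
      have "norm ((1 / real n) *\<^sub>R Y - (1 / real n) *\<^sub>R X) = norm (Y - X) / real n"
        using n0 by (simp flip: scaleR_diff_right)
      also have "\<dots> < d" using that n0 by (simp add: dist_norm norm_minus_commute field_simps)
      finally show ?thesis using d(2) sc[of Y] by simp
    qed
    then show ?thesis using d(1) n0 by (intro exI[of _ "real n * d"]) auto
  qed
  then show "openin euclidean {x \<in> topspace euclidean. expo G x \<in> N}"
    by (simp add: open_contains_ball)
qed

end

section \<open>Reductive groups and the minimal parabolic subgroup\<close>

locale red_grp =
  fixes G :: "('g, 'l::euclidean_space, 'm) cartan_data_scheme" (structure)
  assumes red: "reductive_lie_group G" and iwa: "iwasawa_decomposition G"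
begin

sublocale lie_grp G
  using red unfolding reductive_lie_group_def by unfold_locales blast

lemma cartan: "cartan_decomposition G" and maxab: "maximal_abelian G" and possys: "positive_system G"
  using red unfolding reductive_lie_group_def by blast+

lemma cartan_parts:
  "subspace (kk G)" "subspace (ss G)" "\<forall>X\<in>kk G. \<forall>Y\<in>kk G. bracket G X Y \<in> kk G"
  "\<forall>X\<in>kk G. \<forall>Y\<in>ss G. bracket G X Y \<in> ss G" "bilinear (bform G)"
  "\<forall>g\<in>carrier G. \<forall>X Y. bform G (Ad G g X) (Ad G g Y) = bform G X Y"
  "\<forall>X\<in>ss G. X \<noteq> 0 \<longrightarrow> bform G X X > 0"
  "subgroup (grp_K G) G" "compactin (topol G) (grp_K G)"
  "homeomorphic_map (prod_topology (subtopology (topol G) (grp_K G)) (top_of_set (ss G)))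
       (topol G) (\<lambda>(k, X). k \<otimes> expo G X)"
  using cartan unfolding cartan_decomposition_def by - (elim conjE, assumption)+

lemma maximal_abelian_parts:
  "subspace (aa G)" "aa G \<subseteq> ss G" "\<forall>X\<in>aa G. \<forall>Y\<in>aa G. bracket G X Y = 0"
  using maxab unfolding maximal_abelian_def Let_def by - (elim conjE, assumption)+

lemma subspaces: "subspace (kk G)" "subspace (ss G)" "subspace (aa G)" "aa G \<subseteq> ss G"
  by (rule cartan_parts maximal_abelian_parts)+

lemma brackets: "X \<in> kk G \<Longrightarrow> Y \<in> kk G \<Longrightarrow> bracket G X Y \<in> kk G"
    "X \<in> kk G \<Longrightarrow> Y \<in> ss G \<Longrightarrow> bracket G X Y \<in> ss G" "X \<in> aa G \<Longrightarrow> Y \<in> aa G \<Longrightarrow> bracket G X Y = 0"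
  by (rule cartan_parts(3)[rule_format] cartan_parts(4)[rule_format] maximal_abelian_parts(3)[rule_format]; assumption)+

lemma bform: "bilinear (bform G)"
    "g \<in> carrier G \<Longrightarrow> bform G (Ad G g X) (Ad G g Y) = bform G X Y"
    "X \<in> ss G \<Longrightarrow> X \<noteq> 0 \<Longrightarrow> 0 < bform G X X"
  by (rule cartan_parts(5)) (rule cartan_parts(6)[rule_format] cartan_parts(7)[rule_format]; assumption)+

lemmas K_subgroup = cartan_parts(8) and K_compact = cartan_parts(9) and polar = cartan_parts(10)

lemma iwasawa: "subgroup (grp_A G) G" "subgroup (grp_N G) G"
     "homeomorphic_map (prod_topology (subtopology (topol G) (grp_K G))
         (prod_topology (top_of_set (aa G)) (subtopology (topol G) (grp_N G))))
       (topol G) (\<lambda>(k, H, n). k \<otimes> expo G H \<otimes> n)"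
  using iwa unfolding iwasawa_decomposition_def by - (elim conjE, assumption)+

lemma pos_roots: "\<alpha> \<in> pos_roots G \<Longrightarrow> \<alpha> \<in> roots G"
  "\<alpha> \<in> pos_roots G \<Longrightarrow> (\<lambda>H. - \<alpha> H) \<notin> pos_roots G"
  "\<alpha> \<in> pos_roots G \<Longrightarrow> \<beta> \<in> pos_roots G \<Longrightarrow> (\<lambda>H. \<alpha> H + \<beta> H) \<in> roots G \<Longrightarrow> (\<lambda>H. \<alpha> H + \<beta> H) \<in> pos_roots G"
proof -
  have p: "pos_roots G \<subseteq> roots G" "\<forall>\<alpha>\<in>roots G. \<alpha> \<in> pos_roots G \<longleftrightarrow> (\<lambda>H. - \<alpha> H) \<notin> pos_roots G"
    "\<forall>\<alpha>\<in>pos_roots G. \<forall>\<beta>\<in>pos_roots G. (\<lambda>H. \<alpha> H + \<beta> H) \<in> roots G \<longrightarrow> (\<lambda>H. \<alpha> H + \<beta> H) \<in> pos_roots G"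
    using possys unfolding positive_system_def by - (elim conjE, assumption)+
  show 1: "\<alpha> \<in> pos_roots G \<Longrightarrow> \<alpha> \<in> roots G" using p(1) by (rule subsetD)
  show "\<alpha> \<in> pos_roots G \<Longrightarrow> (\<lambda>H. - \<alpha> H) \<notin> pos_roots G" using bspec[OF p(2) 1] by simp
  show "\<alpha> \<in> pos_roots G \<Longrightarrow> \<beta> \<in> pos_roots G \<Longrightarrow> (\<lambda>H. \<alpha> H + \<beta> H) \<in> roots G \<Longrightarrow> (\<lambda>H. \<alpha> H + \<beta> H) \<in> pos_roots G"
    by (rule p(3)[rule_format])
qed

lemma K_sub: "grp_K G \<subseteq> carrier G" using subgroup.subset[OF K_subgroup] .
lemma N_sub: "grp_N G \<subseteq> carrier G" using subgroup.subset[OF iwasawa(2)] .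

lemmas br_l = bracket_linear_left and br_r = bracket_linear_right

lemma nn_subspace: "subspace (nn G)" unfolding nn_def by (rule subspace_span)

lemma root_spaceD: "X \<in> root_space G \<alpha> \<Longrightarrow> H \<in> aa G \<Longrightarrow> bracket G H X = \<alpha> H *\<^sub>R X"
  unfolding root_space_def by blast

lemma nn_root: "\<alpha> \<in> pos_roots G \<Longrightarrow> X \<in> root_space G \<alpha> \<Longrightarrow> X \<in> nn G"
  unfolding nn_def by (rule span_base) blast

text \<open>Reduces linear statements about \<open>nn\<close> to root vectors, on which
  \<open>aa\<close> acts by scalars.\<close>

lemma nn_induct:
  assumes Y: "Y \<in> nn G" and W: "subspace W" and f: "linear f"
    and b: "\<And>\<alpha> X. \<alpha> \<in> pos_roots G \<Longrightarrow> X \<in> root_space G \<alpha> \<Longrightarrow> f X \<in> W"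
  shows "f Y \<in> W"
proof -
  have "nn G \<subseteq> f -` W" unfolding nn_def
    by (rule span_minimal) (use b in auto, use linear_subspace_vimage[OF f W] in simp)
  then show ?thesis using Y by blast
qed

lemma aa_nn: assumes "H \<in> aa G" "Y \<in> nn G" shows "bracket G H Y \<in> nn G"
proof (rule nn_induct[OF assms(2) nn_subspace br_r])
  fix \<alpha> X assume "\<alpha> \<in> pos_roots G" "X \<in> root_space G \<alpha>"
  then show "bracket G H X \<in> nn G"
    using root_spaceD[OF _ assms(1)] nn_root subspace_scale[OF nn_subspace] by metis
qed

lemma pos_sum_nonzero:
  assumes "\<alpha> \<in> pos_roots G" "\<beta> \<in> pos_roots G" shows "\<exists>H\<in>aa G. \<alpha> H + \<beta> H \<noteq> 0"
proof (rule ccontr)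
  assume n: "\<not> ?thesis"
  have "\<alpha> X = 0" "\<beta> X = 0" if "X \<notin> aa G" for X
    using pos_roots(1)[OF assms(1)] pos_roots(1)[OF assms(2)] that unfolding roots_def by blast+
  then have "\<alpha> H + \<beta> H = 0" for H using n by (cases "H \<in> aa G") auto
  then have "\<beta> = (\<lambda>H. - \<alpha> H)" by (auto simp: eq_neg_iff_add_eq_0 add.commute)
  then show False using pos_roots(2)[OF assms(1)] assms(2) by simp
qed

text \<open>By the Jacobi identity the bracket lies in the root space of the sum. If it is nonzero,
  it witnesses that the sum is a root, which is then positive.\<close>

lemma root_bracket:
  assumes "\<alpha> \<in> pos_roots G" "\<beta> \<in> pos_roots G" "Y \<in> root_space G \<alpha>" "Z \<in> root_space G \<beta>"
  shows "bracket G Y Z \<in> nn G"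
proof (cases "bracket G Y Z = 0")
  case True then show ?thesis using subspace_0[OF nn_subspace] by simp
next
  case False
  have rs: "bracket G Y Z \<in> root_space G (\<lambda>H. \<alpha> H + \<beta> H)"
    unfolding root_space_def
  proof (intro CollectI ballI)
    fix H assume H: "H \<in> aa G"
    show "bracket G H (bracket G Y Z) = (\<alpha> H + \<beta> H) *\<^sub>R bracket G Y Z"
      unfolding bracket_derivation[of H Y Z] root_spaceD[OF assms(3) H] root_spaceD[OF assms(4) H]
      by (simp add: linear_cmul[OF br_l] linear_cmul[OF br_r] scaleR_add_left)
  qed
  have "(\<lambda>H. \<alpha> H + \<beta> H) \<in> roots G"
    unfolding roots_def
  proof (intro CollectI conjI)
    show "\<forall>X. X \<notin> aa G \<longrightarrow> \<alpha> X + \<beta> X = 0"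
      using pos_roots(1)[OF assms(1)] pos_roots(1)[OF assms(2)] unfolding roots_def by auto
    show "(\<lambda>H. \<alpha> H + \<beta> H) \<noteq> (\<lambda>X. 0)" using pos_sum_nonzero[OF assms(1,2)] by metis
    show "root_space G (\<lambda>H. \<alpha> H + \<beta> H) \<noteq> {0}" using rs False by blast
  qed
  then have "(\<lambda>H. \<alpha> H + \<beta> H) \<in> pos_roots G" by (rule pos_roots(3)[OF assms(1,2)])
  then show ?thesis using nn_root rs by blast
qed

lemma nn_nn: assumes "Y \<in> nn G" "Z \<in> nn G" shows "bracket G Y Z \<in> nn G"
  by (rule nn_induct[OF assms(1) nn_subspace br_l], rule nn_induct[OF assms(2) nn_subspace br_r])
    (rule root_bracket)

lemma mm_subspace: "subspace (mm G)"
  unfolding mm_def subspace_def using subspaces(1)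
  by (auto simp: subspace_def linear_add[OF br_l] linear_cmul[OF br_l] linear_0[OF br_l])

lemma mm_aa: assumes "X \<in> mm G" "H \<in> aa G" shows "bracket G X H = 0" "bracket G H X = 0"
  using assms bracket_antisym[of H X] unfolding mm_def by auto

lemma mm_nn: assumes "X \<in> mm G" "Y \<in> nn G" shows "bracket G X Y \<in> nn G"
proof (rule nn_induct[OF assms(2) nn_subspace br_r])
  fix \<alpha> Z assume \<alpha>: "\<alpha> \<in> pos_roots G" and Z: "Z \<in> root_space G \<alpha>"
  have "bracket G X Z \<in> root_space G \<alpha>"
    unfolding root_space_def
  proof (intro CollectI ballI)
    fix H assume H: "H \<in> aa G"
    show "bracket G H (bracket G X Z) = \<alpha> H *\<^sub>R bracket G X Z"
      unfolding bracket_derivation[of H X Z] root_spaceD[OF Z H] mm_aa(2)[OF assms(1) H]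
      by (simp add: linear_0[OF br_l] linear_cmul[OF br_r])
  qed
  then show "bracket G X Z \<in> nn G" by (rule nn_root[OF \<alpha>])
qed

definition pp :: "'l set" where
  "pp = {X + H + Y | X H Y. X \<in> mm G \<and> H \<in> aa G \<and> Y \<in> nn G}"

lemma min_parabolic_pp: "min_parabolic G = {g \<in> carrier G. Ad G g ` pp = pp}"
  unfolding min_parabolic_def pp_def Let_def ..

lemma pp_subspace: "subspace pp"
proof -
  have "pp = {x + y | x y. x \<in> {X + H | X H. X \<in> mm G \<and> H \<in> aa G} \<and> y \<in> nn G}"
    unfolding pp_def by blast
  then show ?thesis using subspace_sums[OF subspace_sums[OF mm_subspace subspaces(3)] nn_subspace] by simp
qed

lemma nn_pp: "Y \<in> nn G \<Longrightarrow> Y \<in> pp"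
  unfolding pp_def using subspace_0[OF mm_subspace] subspace_0[OF subspaces(3)] by force

text \<open>The brackets even land in \<open>nn\<close>: \<open>aa\<close> commutes with
  \<open>mm\<close> and with itself and preserves \<open>nn\<close>, and \<open>nn\<close> is an
  ideal of \<open>pp\<close>.\<close>

lemma aa_nn_pp: assumes "X \<in> aa G \<union> nn G" "Z \<in> pp" shows "bracket G X Z \<in> pp"
proof -
  obtain m h y where Z: "Z = m + h + y" and m: "m \<in> mm G" and h: "h \<in> aa G" and y: "y \<in> nn G"
    using assms(2) unfolding pp_def by blast
  have e: "bracket G X Z = bracket G X m + bracket G X h + bracket G X y"
    by (simp add: Z linear_add[OF br_r])
  have "bracket G X Z \<in> nn G"
    using assms(1)
  proof
    assume "X \<in> aa G"
    then show ?thesis using e mm_aa(2)[OF m] brackets(3)[OF _ h] aa_nn[OF _ y] by simp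
  next
    assume X: "X \<in> nn G"
    have "bracket G X m \<in> nn G" "bracket G X h \<in> nn G"
      using mm_nn[OF m X] aa_nn[OF h X] bracket_antisym[of X m] bracket_antisym[of X h] subspace_neg[OF nn_subspace]
      by auto
    then show ?thesis using e nn_nn[OF X y] subspace_add[OF nn_subspace] by simp
  qed
  then show ?thesis by (rule nn_pp)
qed

lemma parabolicI:
  assumes "g \<in> carrier G" "\<And>Z. Z \<in> pp \<Longrightarrow> Ad G g Z \<in> pp" "\<And>Z. Z \<in> pp \<Longrightarrow> Ad G (inv g) Z \<in> pp"
  shows "g \<in> min_parabolic G"
proof -
  have "pp \<subseteq> Ad G g ` pp"
  proof
    fix Z assume "Z \<in> pp"
    then have "Ad G (inv g) Z \<in> pp" "Z = Ad G g (Ad G (inv g) Z)" using assms by auto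
    then show "Z \<in> Ad G g ` pp" by blast
  qed
  then show ?thesis unfolding min_parabolic_pp using assms by auto
qed

lemma expo_parabolic: assumes "X \<in> aa G \<union> nn G" shows "expo G X \<in> min_parabolic G"
proof (rule parabolicI)
  show "Ad G (expo G X) Z \<in> pp" if "Z \<in> pp" for Z
    by (rule Ad_expo_subspace[OF pp_subspace aa_nn_pp[OF assms] that])
  have X': "- X \<in> aa G \<union> nn G" using assms subspace_neg[OF subspaces(3)] subspace_neg[OF nn_subspace] by auto
  show "Ad G (inv expo G X) Z \<in> pp" if "Z \<in> pp" for Z
    using Ad_expo_subspace[OF pp_subspace aa_nn_pp[OF X'] that] by (simp add: expo_minus)
qed simp

lemma P_subgroup: "subgroup (min_parabolic G) G"
proof (rule subgroupI)
  show "min_parabolic G \<subseteq> carrier G" unfolding min_parabolic_pp by blast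
  have "\<one> \<in> min_parabolic G" by (rule parabolicI) auto
  then show "min_parabolic G \<noteq> {}" by blast
  fix a assume a: "a \<in> min_parabolic G"
  then have ac: "a \<in> carrier G" "Ad G a ` pp = pp" unfolding min_parabolic_pp by auto
  have inva: "Ad G (inv a) Z \<in> pp" if Z: "Z \<in> pp" for Z
  proof -
    have "Z \<in> Ad G a ` pp" using Z ac(2) by simp
    then obtain Y where "Y \<in> pp" "Z = Ad G a Y" by blast
    then show ?thesis using ac(1) by simp
  qed
  show "inv a \<in> min_parabolic G"
    by (rule parabolicI) (use ac inva in auto)
  fix b assume b: "b \<in> min_parabolic G"
  then have bc: "b \<in> carrier G" "Ad G b ` pp = pp" unfolding min_parabolic_pp by auto
  have "Ad G (a \<otimes> b) ` pp = Ad G a ` (Ad G b ` pp)"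
    unfolding image_image by (rule image_cong[OF refl Ad_mult[OF ac(1) bc(1)]])
  then have "Ad G (a \<otimes> b) ` pp = pp" by (simp only: ac(2) bc(2))
  then show "a \<otimes> b \<in> min_parabolic G" unfolding min_parabolic_pp using ac(1) bc(1) by blast
qed

end

section \<open>Sigma-compact sets and Borel sets of a topology\<close>

text \<open>Unlike Borel sets, these sets are preserved by continuous images, and in a Hausdorff
  space they are Borel. Measurability of projections is obtained through them.\<close>

definition sigma_compactin :: "'a topology \<Rightarrow> 'a set \<Rightarrow> bool" where
  "sigma_compactin T S \<longleftrightarrow> (\<exists>C :: nat \<Rightarrow> 'a set. (\<forall>n. compactin T (C n)) \<and> S = (\<Union>n. C n))"

lemma sigma_compactinI: "(\<And>n::nat. compactin T (C n)) \<Longrightarrow> sigma_compactin T (\<Union>n. C n)"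
  unfolding sigma_compactin_def by blast

lemma sigma_compactinE:
  assumes "sigma_compactin T S"
  obtains C :: "nat \<Rightarrow> 'a set" where "\<forall>n. compactin T (C n)" "S = (\<Union>n. C n)"
proof -
  have "\<exists>C :: nat \<Rightarrow> 'a set. (\<forall>n. compactin T (C n)) \<and> S = (\<Union>n. C n)"
    using assms unfolding sigma_compactin_def .
  then show thesis by (elim exE conjE) (rule that)
qed

lemma compactin_imp_sigma: "compactin T S \<Longrightarrow> sigma_compactin T S"
  using sigma_compactinI[of T "\<lambda>_. S"] by simp

lemma sigma_compactin_image:
  assumes "sigma_compactin X S" "continuous_map X Y f" shows "sigma_compactin Y (f ` S)"
proof -
  obtain C :: "nat \<Rightarrow> 'a set" where C: "\<forall>n. compactin X (C n)" "S = (\<Union>n. C n)"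
    by (rule sigma_compactinE[OF assms(1)])
  have "sigma_compactin Y (\<Union>n. f ` C n)" by (rule sigma_compactinI) (rule image_compactin[OF C(1)[rule_format] assms(2)])
  then show ?thesis unfolding C(2) image_UN .
qed

lemma sigma_compactin_Times:
  assumes "sigma_compactin X S" "sigma_compactin Y T" shows "sigma_compactin (prod_topology X Y) (S \<times> T)"
proof -
  obtain C :: "nat \<Rightarrow> 'a set" where C: "\<forall>n. compactin X (C n)" "S = (\<Union>n. C n)"
    by (rule sigma_compactinE[OF assms(1)])
  obtain D :: "nat \<Rightarrow> 'b set" where D: "\<forall>n. compactin Y (D n)" "T = (\<Union>n. D n)"
    by (rule sigma_compactinE[OF assms(2)])
  have "sigma_compactin (prod_topology X Y) (\<Union>n. C (fst (prod_decode n)) \<times> D (snd (prod_decode n)))"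
    by (rule sigma_compactinI) (simp add: compactin_Times C D)
  moreover have "(\<Union>n. C (fst (prod_decode n)) \<times> D (snd (prod_decode n))) = S \<times> T"
  proof (intro equalityI subsetI)
    fix z assume "z \<in> S \<times> T"
    then obtain i j where "fst z \<in> C i" "snd z \<in> D j" using C(2) D(2) by auto
    then have "z \<in> C (fst (prod_decode (prod_encode (i, j)))) \<times> D (snd (prod_decode (prod_encode (i, j))))"
      by (simp add: mem_Times_iff)
    then show "z \<in> (\<Union>n. C (fst (prod_decode n)) \<times> D (snd (prod_decode n)))" by blast
  qed (auto simp: C D)
  ultimately show ?thesis by simp
qed

lemma sigma_compactin_closed:
  assumes "sigma_compactin X S" "closedin X A" shows "sigma_compactin X (S \<inter> A)"
proof -
  obtain C :: "nat \<Rightarrow> 'a set" where C: "\<forall>n. compactin X (C n)" "S = (\<Union>n. C n)"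
    by (rule sigma_compactinE[OF assms(1)])
  have "sigma_compactin X (\<Union>n. A \<inter> C n)"
    by (rule sigma_compactinI) (rule closed_Int_compactin[OF assms(2) C(1)[rule_format]])
  then show ?thesis unfolding C(2) by (simp add: Int_commute)
qed

lemma sigma_compactin_Union:
  assumes "\<And>n::nat. sigma_compactin X (S n)" shows "sigma_compactin X (\<Union>n. S n)"
proof -
  have "\<exists>C :: nat \<Rightarrow> 'a set. (\<forall>m. compactin X (C m)) \<and> S n = (\<Union>m. C m)" for n
    using assms unfolding sigma_compactin_def by blast
  then obtain C :: "nat \<Rightarrow> nat \<Rightarrow> 'a set" where C: "\<And>n m. compactin X (C n m)" "\<And>n. S n = (\<Union>m. C n m)"
    by metis
  have "sigma_compactin X (\<Union>n. C (fst (prod_decode n)) (snd (prod_decode n)))"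
    by (rule sigma_compactinI) (rule C(1))
  moreover have "(\<Union>n. C (fst (prod_decode n)) (snd (prod_decode n))) = (\<Union>n. S n)"
  proof (intro equalityI subsetI)
    fix z assume "z \<in> (\<Union>n. S n)"
    then obtain i j where "z \<in> C i j" using C(2) by auto
    then have "z \<in> C (fst (prod_decode (prod_encode (i, j)))) (snd (prod_decode (prod_encode (i, j))))" by simp
    then show "z \<in> (\<Union>n. C (fst (prod_decode n)) (snd (prod_decode n)))" by blast
  qed (auto simp: C(2))
  ultimately show ?thesis by simp
qed

lemma sigma_compactin_subspace:
  fixes W :: "'a::euclidean_space set" assumes "subspace W"
  shows "sigma_compactin euclidean W" "sigma_compactin (top_of_set W) W"
proof -
  have c: "compact (cball 0 (real n) \<inter> W)" for n by (intro compact_Int_closed compact_cball closed_subspace assms)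
  have U: "(\<Union>n. cball 0 (real n) \<inter> W) = W"
  proof (intro equalityI subsetI)
    fix x assume "x \<in> W"
    moreover obtain n where "norm x \<le> real n" using real_arch_simple by blast
    ultimately show "x \<in> (\<Union>n. cball 0 (real n) \<inter> W)" by auto
  qed auto
  show "sigma_compactin euclidean W"
    using sigma_compactinI[of euclidean "\<lambda>n. cball 0 (real n) \<inter> W"] c U by simp
  show "sigma_compactin (top_of_set W) W"
    using sigma_compactinI[of "top_of_set W" "\<lambda>n. cball 0 (real n) \<inter> W"] c U by (simp add: compactin_subtopology)
qed

lemma space_borel_of[simp]: "space (borel_of T) = topspace T"
  unfolding borel_of_def by (simp add: space_measure_of_conv)

lemma sets_borel_of: "sets (borel_of T) = sigma_sets (topspace T) {U. openin T U}"
  unfolding borel_of_def by (rule sets_measure_of) (auto dest: openin_subset)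

lemma borel_of_open: "openin T U \<Longrightarrow> U \<in> sets (borel_of T)"
  unfolding sets_borel_of by blast

lemma borel_of_closed: "closedin T U \<Longrightarrow> U \<in> sets (borel_of T)"
proof -
  assume a: "closedin T U"
  then have "topspace T - U \<in> sets (borel_of T)" by (intro borel_of_open) blast
  then have "space (borel_of T) - (topspace T - U) \<in> sets (borel_of T)" by (rule sets.compl_sets)
  moreover have "topspace T - (topspace T - U) = U" using closedin_subset[OF a] by blast
  ultimately show ?thesis by simp
qed

lemma borel_of_sigma_compact:
  assumes "Hausdorff_space T" "sigma_compactin T S" shows "S \<in> sets (borel_of T)"
proof -
  obtain C :: "nat \<Rightarrow> 'a set" where C: "\<forall>n. compactin T (C n)" "S = (\<Union>n. C n)"
    by (rule sigma_compactinE[OF assms(2)])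
  have "C n \<in> sets (borel_of T)" for n
    by (rule borel_of_closed[OF compactin_imp_closedin[OF assms(1) C(1)[rule_format]]])
  then show ?thesis unfolding C(2) by blast
qed

lemma measurable_to_borel_of:
  assumes "f \<in> space M \<rightarrow> topspace T" "\<And>U. openin T U \<Longrightarrow> f -` U \<inter> space M \<in> sets M"
  shows "f \<in> M \<rightarrow>\<^sub>M borel_of T"
  using assms by (intro measurable_sigma_sets[OF sets_borel_of]) (auto dest: openin_subset)

lemma continuous_map_measurable: "continuous_map S T f \<Longrightarrow> f \<in> borel_of S \<rightarrow>\<^sub>M borel_of T"
proof (rule measurable_to_borel_of)
  assume f: "continuous_map S T f"
  then show "f \<in> space (borel_of S) \<rightarrow> topspace T" by (auto simp: continuous_map_def)
  fix U assume "openin T U"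
  moreover have "f -` U \<inter> space (borel_of S) = {x \<in> topspace S. f x \<in> U}" by auto
  ultimately show "f -` U \<inter> space (borel_of S) \<in> sets (borel_of S)"
    using openin_continuous_map_preimage[OF f] by (simp add: borel_of_open)
qed

lemma borel_of_euclidean: "sets (borel_of euclidean) = sets borel"
  unfolding sets_borel_of by (simp add: borel_def)

section \<open>Subgroups of \<open>K\<close>, the Iwasawa decomposition and centralisers\<close>

context red_grp
begin

lemma mult_inv_cancel[simp]:
  assumes "x \<in> carrier G" "y \<in> carrier G"
  shows "x \<otimes> (inv x \<otimes> y) = y" "inv x \<otimes> (x \<otimes> y) = y"
  using assms by (simp_all flip: m_assoc)

lemma K_kk: assumes "k \<in> grp_K G" "X \<in> kk G" shows "Ad G k X \<in> kk G"
proof -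
  obtain Z where "Z \<in> kk G" "k = expo G Z" using assms(1) unfolding grp_K_def by blast
  then show ?thesis using Ad_expo_subspace[OF subspaces(1) brackets(1) assms(2)] by simp
qed

lemma K_ss: assumes "k \<in> grp_K G" "X \<in> ss G" shows "Ad G k X \<in> ss G"
proof -
  obtain Z where "Z \<in> kk G" "k = expo G Z" using assms(1) unfolding grp_K_def by blast
  then show ?thesis using Ad_expo_subspace[OF subspaces(2) brackets(2) assms(2)] by simp
qed

lemma K_inv: "k \<in> grp_K G \<Longrightarrow> inv k \<in> grp_K G"
  by (rule subgroup.m_inv_closed[OF K_subgroup])

lemma K_closed: "k \<in> grp_K G \<Longrightarrow> k \<in> carrier G" using K_sub by blast
lemma N_closed: "n \<in> grp_N G \<Longrightarrow> n \<in> carrier G" using N_sub by blast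

definition cent_M :: "'g set" where "cent_M = {k \<in> grp_K G. \<forall>H\<in>aa G. Ad G k H = H}"
definition norm_M :: "'g set" where "norm_M = {k \<in> grp_K G. Ad G k ` aa G = aa G}"

lemma cent_M_inv: assumes "k \<in> cent_M" shows "inv k \<in> cent_M"
proof -
  have k: "k \<in> grp_K G" "\<forall>H\<in>aa G. Ad G k H = H" using assms unfolding cent_M_def by auto
  have "Ad G (inv k) H = H" if "H \<in> aa G" for H
    using Ad_inv(1)[OF K_closed[OF k(1)], of H] k(2) that by simp
  then show ?thesis using K_inv[OF k(1)] unfolding cent_M_def by simp
qed

text \<open>\<open>Ad G k\<close> fixes \<open>aa\<close> pointwise, so it commutes with
  \<open>bracket G H\<close> for \<open>H\<close> in \<open>aa\<close> and preserves
  \<open>mm\<close> and every root space.\<close>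

lemma cent_M_pp: assumes k: "k \<in> cent_M" and Z: "Z \<in> pp" shows "Ad G k Z \<in> pp"
proof -
  have kK: "k \<in> grp_K G" and fix_aa: "\<And>H. H \<in> aa G \<Longrightarrow> Ad G k H = H" using k unfolding cent_M_def by auto
  have kc: "k \<in> carrier G" by (rule K_closed[OF kK])
  obtain m h y where Z: "Z = m + h + y" "m \<in> mm G" "h \<in> aa G" "y \<in> nn G"
    using Z unfolding pp_def by blast
  have "Ad G k m \<in> mm G"
    unfolding mm_def
  proof (intro CollectI conjI ballI)
    show "Ad G k m \<in> kk G" by (rule K_kk[OF kK]) (use Z(2) in \<open>simp add: mm_def\<close>)
    fix H assume H: "H \<in> aa G"
    have "bracket G (Ad G k m) H = Ad G k (bracket G m H)" using Ad_bracket[OF kc, of m H] fix_aa[OF H] by simp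
    then show "bracket G (Ad G k m) H = 0" using mm_aa(1)[OF Z(2) H] by (simp add: linear_0[OF Ad_linear[OF kc]])
  qed
  moreover have "Ad G k h \<in> aa G" using fix_aa[OF Z(3)] Z(3) by simp
  moreover have "Ad G k y \<in> nn G"
  proof (rule nn_induct[OF Z(4) nn_subspace Ad_linear[OF kc]])
    fix \<alpha> X assume \<alpha>: "\<alpha> \<in> pos_roots G" and X: "X \<in> root_space G \<alpha>"
    have "Ad G k X \<in> root_space G \<alpha>"
      unfolding root_space_def
    proof (intro CollectI ballI)
      fix H assume H: "H \<in> aa G"
      have "bracket G H (Ad G k X) = Ad G k (bracket G H X)" using Ad_bracket[OF kc, of H X] fix_aa[OF H] by simp
      then show "bracket G H (Ad G k X) = \<alpha> H *\<^sub>R Ad G k X"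
        using root_spaceD[OF X H] by (simp add: linear_cmul[OF Ad_linear[OF kc]])
    qed
    then show "Ad G k X \<in> nn G" by (rule nn_root[OF \<alpha>])
  qed
  moreover have "Ad G k Z = Ad G k m + Ad G k h + Ad G k y"
    by (simp add: Z(1) linear_add[OF Ad_linear[OF kc]])
  ultimately show ?thesis unfolding pp_def by blast
qed

lemma cent_M_parabolic: "k \<in> cent_M \<Longrightarrow> k \<in> min_parabolic G"
  by (rule parabolicI) (use cent_M_pp cent_M_inv K_closed in \<open>auto simp: cent_M_def\<close>)

text \<open>The factor group consists of right cosets of \<open>cent_M\<close> in
  \<open>norm_M\<close>, so the representative stands on the right.\<close>

lemma weyl_carrier:
  assumes "w \<in> carrier (weyl_group G)"
  obtains k where "k \<in> norm_M" "w = {m \<otimes> k | m. m \<in> cent_M}"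
proof -
  have "w \<in> rcosets\<^bsub>G\<lparr>carrier := norm_M\<rparr>\<^esub> cent_M"
    using assms unfolding weyl_group_def FactGroup_def norm_M_def cent_M_def by simp
  then show ?thesis using that unfolding RCOSETS_def r_coset_def by auto
qed

lemma P_closed: "p \<in> min_parabolic G \<Longrightarrow> p \<in> carrier G"
  using subgroup.subset[OF P_subgroup] by blast

text \<open>\<open>k\<close> normalises \<open>cent_M\<close>, which is contained in the parabolic
  subgroup, so \<open>m \<otimes> k \<otimes> p = k \<otimes> (inv k \<otimes> m \<otimes> k
  \<otimes> p)\<close> lies in the coset of \<open>k\<close>.\<close>

lemma weyl_point_coset:
  assumes k: "k \<in> norm_M" and w: "w = {m \<otimes> k | m. m \<in> cent_M}"
  shows "weyl_point G w = k <# min_parabolic G"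
proof (intro equalityI subsetI)
  have kK: "k \<in> grp_K G" and kaa: "Ad G k ` aa G = aa G" using k unfolding norm_M_def by auto
  have kc: "k \<in> carrier G" by (rule K_closed[OF kK])
  fix x assume "x \<in> weyl_point G w"
  then obtain m p where x: "x = (m \<otimes> k) \<otimes> p" and m: "m \<in> cent_M" and p: "p \<in> min_parabolic G"
    unfolding weyl_point_def w set_mult_def by blast
  have mK: "m \<in> grp_K G" and mc: "m \<in> carrier G" using m K_closed unfolding cent_M_def by auto
  have "inv k \<otimes> m \<otimes> k \<in> cent_M"
    unfolding cent_M_def
  proof (intro CollectI conjI ballI)
    show "inv k \<otimes> m \<otimes> k \<in> grp_K G"
      by (intro subgroup.m_closed[OF K_subgroup] K_inv kK mK)
    fix H assume H: "H \<in> aa G"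
    have "Ad G k H \<in> aa G" using kaa H by blast
    then have "Ad G m (Ad G k H) = Ad G k H" using m unfolding cent_M_def by blast
    then show "Ad G (inv k \<otimes> m \<otimes> k) H = H" using kc mc by (simp add: Ad_mult)
  qed
  then have "inv k \<otimes> m \<otimes> k \<otimes> p \<in> min_parabolic G"
    using cent_M_parabolic subgroup.m_closed[OF P_subgroup] p by blast
  moreover have "x = k \<otimes> (inv k \<otimes> m \<otimes> k \<otimes> p)"
    using kc mc P_closed[OF p] by (simp add: x m_assoc)
  ultimately show "x \<in> k <# min_parabolic G" unfolding l_coset_def by blast
next
  have kc: "k \<in> carrier G" using k K_closed unfolding norm_M_def by blast
  fix x assume "x \<in> k <# min_parabolic G"
  then obtain p where x: "x = k \<otimes> p" and p: "p \<in> min_parabolic G" unfolding l_coset_def by blast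
  have "\<one> \<in> cent_M" using subgroup.one_closed[OF K_subgroup] by (simp add: cent_M_def)
  moreover have "x = (\<one> \<otimes> k) \<otimes> p" using kc x by simp
  ultimately show "x \<in> weyl_point G w" unfolding weyl_point_def w set_mult_def using p by blast
qed

lemma norm_M_aa: assumes "k \<in> norm_M" "H \<in> aa G" shows "Ad G (inv k) H \<in> aa G"
proof -
  obtain H' where "H' \<in> aa G" "H = Ad G k H'" using assms unfolding norm_M_def by blast
  then show ?thesis using assms(1) K_closed unfolding norm_M_def by simp
qed

lemma N_conj: assumes H: "H \<in> aa G" and n: "n \<in> grp_N G"
  shows "inv expo G H \<otimes> n \<otimes> expo G H \<in> grp_N G"
proof -
  obtain Y where Y: "Y \<in> nn G" "n = expo G Y" using n unfolding grp_N_def by blast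
  have H': "- H \<in> aa G" by (rule subspace_neg[OF subspaces(3) H])
  have "Ad G (expo G (- H)) Y \<in> nn G" by (rule Ad_expo_subspace[OF nn_subspace aa_nn[OF H'] Y(1)])
  moreover have "expo G (Ad G (expo G (- H)) Y) = inv expo G H \<otimes> n \<otimes> expo G H"
    using expo_Ad[of "expo G (- H)" Y] Y(2) by (simp add: expo_minus)
  ultimately show ?thesis unfolding grp_N_def by (metis imageI)
qed

text \<open>\<open>A\<close> normalises \<open>N\<close>, so the factors can be reordered, and the
  components in \<open>aa\<close> add.\<close>

lemma AN_mult:
  assumes H: "H1 \<in> aa G" "H2 \<in> aa G" and n: "n1 \<in> grp_N G" "n2 \<in> grp_N G"
  shows "\<exists>n\<in>grp_N G. (expo G H2 \<otimes> n2) \<otimes> (expo G H1 \<otimes> n1) = expo G (H2 + H1) \<otimes> n"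
proof
  let ?n = "inv expo G H1 \<otimes> n2 \<otimes> expo G H1 \<otimes> n1"
  show "?n \<in> grp_N G" by (rule subgroup.m_closed[OF iwasawa(2) N_conj[OF H(1) n(2)] n(1)])
  have "expo G (H2 + H1) = expo G H2 \<otimes> expo G H1" by (rule expo_add) (rule brackets(3)[OF H(2,1)])
  then show "(expo G H2 \<otimes> n2) \<otimes> (expo G H1 \<otimes> n1) = expo G (H2 + H1) \<otimes> ?n"
    using N_closed[OF n(1)] N_closed[OF n(2)] by (simp add: m_assoc)
qed

lemma AN_parabolic: "H \<in> aa G \<Longrightarrow> n \<in> grp_N G \<Longrightarrow> expo G H \<otimes> n \<in> min_parabolic G"
  unfolding grp_N_def by (auto intro!: subgroup.m_closed[OF P_subgroup] expo_parabolic)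

lemma iwasawa_exists:
  assumes "g \<in> carrier G"
  obtains k H n where "k \<in> grp_K G" "H \<in> aa G" "n \<in> grp_N G" "g = k \<otimes> expo G H \<otimes> n"
proof -
  have "(\<lambda>(k, H, n). k \<otimes> expo G H \<otimes> n) ` topspace (prod_topology (subtopology (topol G) (grp_K G))
         (prod_topology (top_of_set (aa G)) (subtopology (topol G) (grp_N G)))) = topspace (topol G)"
    by (rule homeomorphic_imp_surjective_map[OF iwasawa(3)])
  then have "g \<in> (\<lambda>(k, H, n). k \<otimes> expo G H \<otimes> n) ` topspace (prod_topology (subtopology (topol G) (grp_K G))
         (prod_topology (top_of_set (aa G)) (subtopology (topol G) (grp_N G))))" using assms by simp
  then obtain z where z: "z \<in> topspace (prod_topology (subtopology (topol G) (grp_K G))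
         (prod_topology (top_of_set (aa G)) (subtopology (topol G) (grp_N G))))" "g = (\<lambda>(k, H, n). k \<otimes> expo G H \<otimes> n) z"
    by blast
  then show ?thesis by (intro that[of "fst z" "fst (snd z)" "snd (snd z)"]) (auto simp: case_prod_beta)
qed

lemma iwasawa_unique:
  assumes "k \<in> grp_K G" "H \<in> aa G" "n \<in> grp_N G" "k' \<in> grp_K G" "H' \<in> aa G" "n' \<in> grp_N G"
    "k \<otimes> expo G H \<otimes> n = k' \<otimes> expo G H' \<otimes> n'"
  shows "k = k' \<and> H = H' \<and> n = n'"
proof -
  have "inj_on (\<lambda>(k, H, n). k \<otimes> expo G H \<otimes> n) (topspace (prod_topology (subtopology (topol G) (grp_K G))
         (prod_topology (top_of_set (aa G)) (subtopology (topol G) (grp_N G)))))"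
    by (rule homeomorphic_imp_injective_map[OF iwasawa(3)])
  then have "(k, H, n) = (k', H', n')"
    by (rule inj_onD) (use assms K_sub N_sub in auto)
  then show ?thesis by simp
qed

text \<open>Invariance of the form under \<open>aa\<close> gives
  \<open>(\<alpha> H + \<beta> H) * bform G X W = 0\<close> for root vectors, and the sum of two
  positive roots is nonzero somewhere on \<open>aa\<close>.\<close>

lemma bform_nn: assumes "Y \<in> nn G" "Z \<in> nn G" shows "bform G Y Z = 0"
proof -
  have inv: "bform G (bracket G H Y) Z + bform G Y (bracket G H Z) = 0" for H Y Z
  proof -
    have bb: "bounded_bilinear (bform G)" using bform(1) bilinear_conv_bounded_bilinear by blast
    let ?A = "\<lambda>t. Ad G (expo G (t *\<^sub>R H))"
    have "((\<lambda>t. bform G (?A t Y) (?A t Z)) has_vector_derivative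
        bform G (?A 0 Y) (bracket G H Z) + bform G (bracket G H Y) (?A 0 Z)) (at 0)"
      by (rule bounded_bilinear.has_vector_derivative[OF bb]) (rule Ad_curve_bracket[OF tangent_expo])+
    then have "((\<lambda>t. bform G Y Z) has_vector_derivative bform G Y (bracket G H Z) + bform G (bracket G H Y) Z) (at 0)"
      by (simp add: bform(2))
    then show ?thesis using vector_derivative_unique_at[OF _ has_vector_derivative_const] by (simp add: add.commute)
  qed
  have l: "linear (\<lambda>Y. bform G Y Z)" "linear (\<lambda>Z. bform G Y Z)" for Y Z
    using bform(1) unfolding bilinear_def by blast+
  have "bform G Y Z \<in> {0}"
  proof (rule nn_induct[OF assms(1) _ l(1)], simp)
    fix \<alpha> X assume \<alpha>: "\<alpha> \<in> pos_roots G" "X \<in> root_space G \<alpha>"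
    show "bform G X Z \<in> {0}"
    proof (rule nn_induct[OF assms(2) _ l(2)], simp)
      fix \<beta> W assume \<beta>: "\<beta> \<in> pos_roots G" "W \<in> root_space G \<beta>"
      obtain H where H: "H \<in> aa G" "\<alpha> H + \<beta> H \<noteq> 0" using pos_sum_nonzero[OF \<alpha>(1) \<beta>(1)] by blast
      have "(\<alpha> H + \<beta> H) * bform G X W = 0"
        using inv[of H X W] unfolding root_spaceD[OF \<alpha>(2) H(1)] root_spaceD[OF \<beta>(2) H(1)]
        by (simp add: linear_cmul[OF l(1)] linear_cmul[OF l(2)] algebra_simps)
      then show "bform G X W \<in> {0}" using H(2) by simp
    qed
  qed
  then show ?thesis by simp
qed

lemma nn_ss: "Y \<in> nn G \<Longrightarrow> Y \<in> ss G \<Longrightarrow> Y = 0"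
  using bform_nn[of Y Y] bform(3)[of Y] by force

text \<open>The derivative of \<open>Ad (exp t Y) H\<close> in \<open>t\<close> stays in
  \<open>nn\<close>, so modulo \<open>nn\<close> the curve is constant.\<close>

lemma Ad_expo_nn: assumes Y: "Y \<in> nn G" and H: "H \<in> aa G" shows "Ad G (expo G Y) H - H \<in> nn G"
proof -
  obtain P :: "'l \<Rightarrow> 'l" where P: "linear P" "\<forall>w\<in>nn G. P w = 0" "\<forall>v. v - P v \<in> nn G"
    using subspace_projection[OF nn_subspace] by metis
  have br: "bracket G Y H \<in> nn G"
    using aa_nn[OF H Y] bracket_antisym[of Y H] subspace_neg[OF nn_subspace] by simp
  let ?f = "\<lambda>t. Ad G (expo G (t *\<^sub>R Y)) H"
  have d: "((\<lambda>t. P (?f t - H)) has_vector_derivative 0) (at t)" for t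
  proof -
    have tY: "t *\<^sub>R Y \<in> nn G" by (rule subspace_scale[OF nn_subspace Y])
    have "Ad G (expo G (t *\<^sub>R Y)) (bracket G Y H) \<in> nn G"
      by (rule Ad_expo_subspace[OF nn_subspace nn_nn[OF tY] br])
    then have z: "P (Ad G (expo G (t *\<^sub>R Y)) (bracket G Y H) - 0) = 0" using P(2) by simp
    have "((\<lambda>t. ?f t - H) has_vector_derivative Ad G (expo G (t *\<^sub>R Y)) (bracket G Y H) - 0) (at t)"
      by (rule has_vector_derivative_diff[OF Ad_expo_derivative has_vector_derivative_const])
    from has_vector_derivative_linear[OF P(1) this] show ?thesis using z by simp
  qed
  have "P (?f 1 - H) = 0"
    by (rule gronwall_zero[where T=1 and C=0 and u="\<lambda>t. P (?f t - H)" and u'="\<lambda>_. 0"])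
      (use d linear_0[OF P(1)] in auto)
  then show ?thesis using P(3)[rule_format, of "?f 1 - H"] by simp
qed

text \<open>With \<open>g = k a n\<close>, \<open>Ad(an) H - H\<close> lies in \<open>nn\<close> and, being \<open>Ad(k\<^sup>-\<^sup>1) H - H\<close>, also in \<open>ss\<close>;
  since \<open>nn\<close> is isotropic for the form, which is definite on \<open>ss\<close>, it vanishes.\<close>

lemma Z_decomposition:
  assumes H: "H \<in> aa G" and g: "g \<in> Z_of G H"
  obtains k j where "k \<in> K_of G H" "j \<in> Z_of G H" "j \<in> min_parabolic G" "g = k \<otimes> j"
proof -
  have gc: "g \<in> carrier G" and gH: "Ad G g H = H" using g unfolding Z_of_def by auto
  obtain k A n where k: "k \<in> grp_K G" and A: "A \<in> aa G" and n: "n \<in> grp_N G" and gk: "g = k \<otimes> expo G A \<otimes> n"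
    by (rule iwasawa_exists[OF gc])
  define j where "j = expo G A \<otimes> n"
  have kc: "k \<in> carrier G" and nc: "n \<in> carrier G" using k n K_closed N_closed by auto
  have jc: "j \<in> carrier G" using nc by (simp add: j_def)
  have gj: "g = k \<otimes> j" using kc nc by (simp add: gk j_def m_assoc)
  obtain Y where Y: "Y \<in> nn G" "n = expo G Y" using n unfolding grp_N_def by blast
  have 1: "Ad G n H - H \<in> nn G" unfolding Y(2) by (rule Ad_expo_nn[OF Y(1) H])
  have "Ad G (expo G A) (Ad G n H - H) \<in> nn G"
    by (rule Ad_expo_subspace[OF nn_subspace aa_nn[OF A] 1])
  moreover have "Ad G (expo G A) H = H" by (rule Ad_expo_fixed[OF brackets(3)[OF A H]])
  ultimately have nnj: "Ad G j H - H \<in> nn G"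
    using nc by (simp add: j_def Ad_mult linear_diff[OF Ad_linear])
  have "Ad G j H = Ad G (inv k) H" using gH kc jc by (metis Ad_inv(1) Ad_mult gj)
  moreover have "Ad G (inv k) H \<in> ss G" by (rule K_ss[OF K_inv[OF k]]) (use H subspaces(4) in blast)
  ultimately have "Ad G j H - H \<in> ss G" using subspace_diff[OF subspaces(2)] H subspaces(4) by auto
  then have jH: "Ad G j H = H" using nn_ss[OF nnj] by simp
  then have kH: "Ad G k H = H" using gH kc jc by (simp add: gj Ad_mult)
  show ?thesis
    by (rule that[of k j]) (use k kc jc jH kH gj AN_parabolic[OF A n] in \<open>auto simp: K_of_def Z_of_def j_def\<close>)
qed

lemma closedin_Ad: assumes "closed C" shows "closedin (topol G) {g \<in> carrier G. Ad G g X \<in> C}"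
  using closedin_continuous_map_preimage[OF Ad_continuous1, of C X] assms by simp

lemma closedin_Ad_inv: assumes "closed C" shows "closedin (topol G) {g \<in> carrier G. Ad G (inv g) X \<in> C}"
proof -
  have "closedin (topol G) {g \<in> topspace (topol G). inv g \<in> {g \<in> carrier G. Ad G g X \<in> C}}"
    by (rule closedin_continuous_map_preimage[OF continuous_inv closedin_Ad[OF assms]])
  moreover have "{g \<in> topspace (topol G). inv g \<in> {g \<in> carrier G. Ad G g X \<in> C}} = {g \<in> carrier G. Ad G (inv g) X \<in> C}"
    by auto
  ultimately show ?thesis by simp
qed

text \<open>Equality of \<open>pp\<close> with its image is replaced by two inclusions, one for
  \<open>g\<close> and one for its inverse; for every vector of \<open>pp\<close> each is a closed
  condition on \<open>g\<close>.\<close>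

lemma P_closedin: "closedin (topol G) (min_parabolic G)"
proof -
  have c: "closed pp" by (rule closed_subspace[OF pp_subspace])
  have "closedin (topol G) (\<Inter>Z\<in>pp. {g \<in> carrier G. Ad G g Z \<in> pp} \<inter> {g \<in> carrier G. Ad G (inv g) Z \<in> pp})"
    by (intro closedin_INT closedin_Int closedin_Ad closedin_Ad_inv c) (use subspace_0[OF pp_subspace] in blast)
  moreover have "(\<Inter>Z\<in>pp. {g \<in> carrier G. Ad G g Z \<in> pp} \<inter> {g \<in> carrier G. Ad G (inv g) Z \<in> pp}) = min_parabolic G"
  proof (intro equalityI subsetI)
    fix g assume g: "g \<in> (\<Inter>Z\<in>pp. {g \<in> carrier G. Ad G g Z \<in> pp} \<inter> {g \<in> carrier G. Ad G (inv g) Z \<in> pp})"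
    have "g \<in> carrier G" using g subspace_0[OF pp_subspace] by blast
    then show "g \<in> min_parabolic G" by (rule parabolicI) (use g in blast)+
  next
    fix g assume g: "g \<in> min_parabolic G"
    have "Ad G g Z \<in> pp \<and> Ad G (inv g) Z \<in> pp" if "Z \<in> pp" for Z
      using g subgroup.m_inv_closed[OF P_subgroup g] that unfolding min_parabolic_pp by blast
    then show "g \<in> (\<Inter>Z\<in>pp. {g \<in> carrier G. Ad G g Z \<in> pp} \<inter> {g \<in> carrier G. Ad G (inv g) Z \<in> pp})"
      using P_closed[OF g] by blast
  qed
  ultimately show ?thesis by simp
qed

lemma K_of_compact: "compactin (topol G) (K_of G H)"
proof -
  have "K_of G H = {g \<in> carrier G. Ad G g H \<in> {H}} \<inter> grp_K G"
    unfolding K_of_def Z_of_def by auto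
  then show ?thesis using closed_Int_compactin[OF closedin_Ad[of "{H}" H] K_compact] by simp
qed

text \<open>By the polar decomposition the group is a continuous image of the compact
  \<open>K\<close> times a finite-dimensional vector space.\<close>

lemma carrier_sigma_compact: "sigma_compactin (topol G) (carrier G)"
proof -
  let ?f = "\<lambda>(k, X). k \<otimes> expo G X"
  let ?X = "prod_topology (subtopology (topol G) (grp_K G)) (top_of_set (ss G))"
  have "compactin (subtopology (topol G) (grp_K G)) (grp_K G)" using K_compact by (simp add: compactin_subtopology)
  from sigma_compactin_Times[OF compactin_imp_sigma[OF this] sigma_compactin_subspace(2)[OF subspaces(2)]]
  have "sigma_compactin ?X (topspace ?X)" using K_sub by (simp add: Int_absorb1)
  from sigma_compactin_image[OF this homeomorphic_imp_continuous_map[OF polar]]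
  show ?thesis using homeomorphic_imp_surjective_map[OF polar] by simp
qed

text \<open>Continuity of the exponential map on a whole subspace of the Lie algebra enters
  here.\<close>

lemma N_minus_sigma_compact: "sigma_compactin (topol G) (N_minus_of G H)"
  unfolding N_minus_of_def
  by (rule sigma_compactin_image[OF sigma_compactin_subspace(1)[OF subspace_span] expo_continuous_map])

lemma chamber_aa: "H \<in> closure (weyl_chamber G) \<Longrightarrow> H \<in> aa G"
  using closure_minimal[OF _ closed_subspace[OF subspaces(3)], of "weyl_chamber G"]
  unfolding weyl_chamber_def by blast

end

section \<open>Second countable spaces\<close>

lemma second_countable_prod:
  assumes "second_countable X" "second_countable Y" shows "second_countable (prod_topology X Y)"
proof -
  obtain \<A> where A: "countable \<A>" "\<forall>V\<in>\<A>. openin X V" "\<forall>U x. openin X U \<and> x \<in> U \<longrightarrow> (\<exists>V\<in>\<A>. x \<in> V \<and> V \<subseteq> U)"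
    using assms(1) unfolding second_countable_def by metis
  obtain \<B> where B: "countable \<B>" "\<forall>V\<in>\<B>. openin Y V" "\<forall>U x. openin Y U \<and> x \<in> U \<longrightarrow> (\<exists>V\<in>\<B>. x \<in> V \<and> V \<subseteq> U)"
    using assms(2) unfolding second_countable_def by metis
  show ?thesis
    unfolding second_countable_def
  proof (intro exI conjI allI impI ballI)
    show "countable ((\<lambda>(U, V). U \<times> V) ` (\<A> \<times> \<B>))" using A(1) B(1) by simp
    show "openin (prod_topology X Y) W" if "W \<in> (\<lambda>(U, V). U \<times> V) ` (\<A> \<times> \<B>)" for W
      using that A(2) B(2) by (auto simp: openin_prod_Times_iff)
    fix W z assume W: "openin (prod_topology X Y) W \<and> z \<in> W"
    obtain x y where z: "z = (x, y)" by (cases z)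
    have "\<exists>U V. openin X U \<and> openin Y V \<and> x \<in> U \<and> y \<in> V \<and> U \<times> V \<subseteq> W"
      using W z unfolding openin_prod_topology_alt by blast
    then obtain U V where UV: "openin X U" "openin Y V" "x \<in> U" "y \<in> V" "U \<times> V \<subseteq> W" by blast
    obtain U' where U': "U' \<in> \<A>" "x \<in> U'" "U' \<subseteq> U" using A(3) UV(1,3) by blast
    obtain V' where V': "V' \<in> \<B>" "y \<in> V'" "V' \<subseteq> V" using B(3) UV(2,4) by blast
    show "\<exists>V\<in>(\<lambda>(U, V). U \<times> V) ` (\<A> \<times> \<B>). z \<in> V \<and> V \<subseteq> W"
    proof (rule bexI[of _ "U' \<times> V'"])
      show "z \<in> U' \<times> V' \<and> U' \<times> V' \<subseteq> W" using U' V' UV(5) z by blast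
      show "U' \<times> V' \<in> (\<lambda>(U, V). U \<times> V) ` (\<A> \<times> \<B>)" using U' V' by (intro image_eqI[of _ _ "(U', V')"]) auto
    qed
  qed
qed

lemma compact_metrizable_second_countable:
  assumes "compact_space X" "metrizable_space X" shows "second_countable X"
proof -
  obtain M d where "Metric_space M d" and X: "X = Metric_space.mtopology M d"
    using assms(2) unfolding metrizable_space_def by blast
  interpret Metric_space M d by fact
  have "\<exists>F. finite F \<and> F \<subseteq> M \<and> M \<subseteq> (\<Union>x\<in>F. mball x (1 / real (Suc n)))" for n
  proof -
    have "compactin mtopology M" using assms(1) X unfolding compact_space_def by simp
    then have "mtotally_bounded M" by (rule compactin_imp_mtotally_bounded)
    moreover have "0 < 1 / real (Suc n)" by simp
    ultimately show ?thesis unfolding mtotally_bounded_def by meson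
  qed
  then obtain F where F: "\<And>n. finite (F n)" "\<And>n. F n \<subseteq> M" "\<And>n. M \<subseteq> (\<Union>x\<in>F n. mball x (1 / real (Suc n)))"
    by metis
  show ?thesis
    unfolding second_countable_def X
  proof (intro exI conjI allI impI ballI)
    let ?B = "\<Union>n. (\<lambda>x. mball x (1 / real (Suc n))) ` F n"
    show "countable ?B" using F(1) by (intro countable_UN) (auto intro: countable_finite)
    show "openin mtopology V" if "V \<in> ?B" for V using that by auto
    fix U x assume U: "openin mtopology U \<and> x \<in> U"
    then obtain r where r: "0 < r" "mball x r \<subseteq> U" unfolding openin_mtopology by blast
    have xM: "x \<in> M" using U openin_subset by fastforce
    obtain n where n: "1 / real (Suc n) < r / 2" using r(1) by (metis half_gt_zero nat_approx_posE)
    obtain y where y: "y \<in> F n" "x \<in> mball y (1 / real (Suc n))" using F(3)[of n] xM by blast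
    have "mball y (1 / real (Suc n)) \<subseteq> mball x r"
    proof
      fix z assume z: "z \<in> mball y (1 / real (Suc n))"
      have "d x z \<le> d x y + d y z" using z xM y by (intro triangle) auto
      also have "\<dots> < r" using z y n by (simp add: commute)
      finally show "z \<in> mball x r" using z xM by simp
    qed
    then show "\<exists>V\<in>?B. x \<in> V \<and> V \<subseteq> U" using y r(2) by blast
  qed
qed

lemma second_countable_open_cover:
  assumes I: "countable I" and U: "\<And>i. i \<in> I \<Longrightarrow> openin X (U i)" "topspace X \<subseteq> (\<Union>i\<in>I. U i)"
    and sc: "\<And>i. i \<in> I \<Longrightarrow> second_countable (subtopology X (U i))"
  shows "second_countable X"
proof -
  have "\<exists>\<B>. countable \<B> \<and> (\<forall>V\<in>\<B>. openin (subtopology X (U i)) V) \<and>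
      (\<forall>N x. openin (subtopology X (U i)) N \<and> x \<in> N \<longrightarrow> (\<exists>V\<in>\<B>. x \<in> V \<and> V \<subseteq> N))" if "i \<in> I" for i
    using sc[OF that] unfolding second_countable_def .
  then obtain \<B> where B: "\<And>i. i \<in> I \<Longrightarrow> countable (\<B> i) \<and> (\<forall>V\<in>\<B> i. openin (subtopology X (U i)) V) \<and>
      (\<forall>N x. openin (subtopology X (U i)) N \<and> x \<in> N \<longrightarrow> (\<exists>V\<in>\<B> i. x \<in> V \<and> V \<subseteq> N))" by metis
  show ?thesis
    unfolding second_countable_def
  proof (intro exI conjI allI impI ballI)
    show "countable (\<Union>i\<in>I. \<B> i)" using I B by (intro countable_UN) auto
    show "openin X V" if "V \<in> (\<Union>i\<in>I. \<B> i)" for V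
      using that B U(1) openin_trans_full by blast
    fix N x assume N: "openin X N \<and> x \<in> N"
    then have "x \<in> topspace X" using openin_subset by blast
    then obtain i where i: "i \<in> I" "x \<in> U i" using U(2) by blast
    have "openin (subtopology X (U i)) (N \<inter> U i)" using N openin_subtopology by blast
    then show "\<exists>V\<in>\<Union>i\<in>I. \<B> i. x \<in> V \<and> V \<subseteq> N" using B[OF i(1)] i N by (metis (no_types, lifting) Int_iff UN_I le_inf_iff)
  qed
qed

text \<open>A product of quotient maps need not be a quotient map, but openness passes to the
  product. This controls the product of \<open>Q\<close> with the flag manifold.\<close>

lemma open_map_prod_right:
  assumes "open_map Y Z f" shows "open_map (prod_topology X Y) (prod_topology X Z) (\<lambda>(x, y). (x, f y))"
  unfolding open_map_def
proof (intro allI impI)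
  fix W assume W: "openin (prod_topology X Y) W"
  show "openin (prod_topology X Z) ((\<lambda>(x, y). (x, f y)) ` W)"
    unfolding openin_prod_topology_alt
  proof (intro allI impI)
    fix x z assume "(x, z) \<in> (\<lambda>(x, y). (x, f y)) ` W"
    then obtain y where y: "(x, y) \<in> W" "z = f y" by auto
    then obtain U V where UV: "openin X U" "openin Y V" "x \<in> U" "y \<in> V" "U \<times> V \<subseteq> W"
      using W unfolding openin_prod_topology_alt by metis
    have "openin Z (f ` V)" using assms UV(2) unfolding open_map_def by blast
    moreover have "U \<times> f ` V \<subseteq> (\<lambda>(x, y). (x, f y)) ` W"
    proof
      fix p assume "p \<in> U \<times> f ` V"
      then obtain a c where "p = (a, f c)" "a \<in> U" "c \<in> V" by auto
      then show "p \<in> (\<lambda>(x, y). (x, f y)) ` W" using UV(5) by (intro image_eqI[of _ _ "(a, c)"]) auto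
    qed
    ultimately show "\<exists>U V. openin X U \<and> openin Z V \<and> x \<in> U \<and> z \<in> V \<and> U \<times> V \<subseteq> (\<lambda>(x, y). (x, f y)) ` W"
      using UV y(2) by (intro exI[of _ U] exI[of _ "f ` V"]) auto
  qed
qed

text \<open>By regularity the basic sets with closure inside \<open>U\<close> cover
  \<open>U\<close>. There are countably many of them, and each receives a Urysohn function.\<close>

lemma open_cozero_cover:
  assumes X: "compact_space X" "Hausdorff_space X" "second_countable X" and U: "openin X U"
  shows "\<exists>f :: nat \<Rightarrow> 'a \<Rightarrow> real. (\<forall>n. continuous_map X euclideanreal (f n) \<and> (\<forall>x\<in>topspace X. 0 \<le> f n x \<and> f n x \<le> 1)) \<and>
    (\<forall>x\<in>topspace X. x \<in> U \<longleftrightarrow> (\<exists>n. 0 < f n x))"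
proof -
  have reg: "regular_space X" by (rule compact_Hausdorff_imp_regular_space) (use X in auto)
  have nor: "normal_space X" by (rule compact_Hausdorff_or_regular_imp_normal_space) (use X in auto)
  obtain \<B> where B: "countable \<B>" "\<forall>V\<in>\<B>. openin X V" "\<forall>U x. openin X U \<and> x \<in> U \<longrightarrow> (\<exists>V\<in>\<B>. x \<in> V \<and> V \<subseteq> U)"
    using X(3) unfolding second_countable_def by metis
  define P where "P = {V\<in>\<B>. X closure_of V \<subseteq> U}"
  have P: "\<exists>V\<in>P. x \<in> V" if x: "x \<in> U" for x
  proof -
    have "\<exists>W C. openin X W \<and> closedin X C \<and> x \<in> W \<and> W \<subseteq> C \<and> C \<subseteq> U"
      using reg U x unfolding neighbourhood_base_of_closedin[symmetric] neighbourhood_base_of by blast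
    then obtain W C where W: "openin X W" "closedin X C" "x \<in> W" "W \<subseteq> C" "C \<subseteq> U" by blast
    then obtain V where V: "V \<in> \<B>" "x \<in> V" "V \<subseteq> W" using B(3) by blast
    have "X closure_of V \<subseteq> C" using V W by (intro closure_of_minimal) auto
    then show ?thesis using V W(5) unfolding P_def by blast
  qed
  have "\<exists>f. continuous_map X euclideanreal f \<and> (\<forall>x\<in>topspace X. 0 \<le> f x \<and> f x \<le> 1) \<and>
      (\<forall>x\<in>topspace X - U. f x = 0) \<and> (\<forall>x\<in>V. f x = 1)" if V: "V \<in> P" for V
  proof -
    have "disjnt (topspace X - U) (X closure_of V)" using V unfolding P_def disjnt_iff by blast
    note dis = this
    have cl: "closedin X (topspace X - U)" using U by blast
    obtain f where f: "continuous_map X (top_of_set {0..1::real}) f" "f ` (topspace X - U) \<subseteq> {0}" "f ` (X closure_of V) \<subseteq> {1}"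
      by (rule Urysohn_lemma[OF nor cl closedin_closure_of dis zero_le_one])
    have VX: "V \<subseteq> topspace X" using V B(2) unfolding P_def by (auto dest: openin_subset)
    then have "V \<subseteq> X closure_of V" by (rule closure_of_subset)
    moreover have "continuous_map X euclideanreal f" using f(1) continuous_map_in_subtopology by blast
    moreover have "f ` topspace X \<subseteq> {0..1}" using f(1) unfolding continuous_map_in_subtopology by auto
    moreover have "f x = 0" if "x \<in> topspace X - U" for x using f(2) that by blast
    moreover have "f x = 1" if "x \<in> X closure_of V" for x using f(3) that by blast
    ultimately show ?thesis by (intro exI[of _ f]) (auto simp: image_subset_iff)
  qed
  then obtain f where f: "\<And>V. V \<in> P \<Longrightarrow> continuous_map X euclideanreal (f V) \<and> (\<forall>x\<in>topspace X. 0 \<le> f V x \<and> f V x \<le> (1::real)) \<and>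
      (\<forall>x\<in>topspace X - U. f V x = 0) \<and> (\<forall>x\<in>V. f V x = 1)" by metis
  show ?thesis
  proof (cases "P = {}")
    case True
    then have "U = {}" using P by blast
    then show ?thesis by (intro exI[of _ "\<lambda>n x. 0"]) auto
  next
    case False
    have cP: "countable P" using B(1) unfolding P_def by (rule countable_subset[rotated]) auto
    let ?e = "from_nat_into P"
    have eP: "?e n \<in> P" for n by (rule from_nat_into[OF False])
    show ?thesis
    proof (intro exI[of _ "\<lambda>n. f (?e n)"] conjI allI ballI)
      show "continuous_map X euclideanreal (f (?e n))" for n using f[OF eP[of n]] by blast
      fix x assume x: "x \<in> topspace X"
      show "0 \<le> f (?e n) x" "f (?e n) x \<le> 1" for n using f[OF eP[of n]] x by auto
      show "x \<in> U \<longleftrightarrow> (\<exists>n. 0 < f (?e n) x)"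
      proof
        assume "x \<in> U"
        then obtain V where V: "V \<in> P" "x \<in> V" using P by blast
        then obtain n where "?e n = V" using from_nat_into_surj[OF cP] by blast
        then show "\<exists>n. 0 < f (?e n) x" using f[OF V(1)] V(2) by (intro exI[of _ n]) auto
      next
        assume "\<exists>n. 0 < f (?e n) x"
        then obtain n where n: "0 < f (?e n) x" by blast
        show "x \<in> U"
        proof (rule ccontr)
          assume "x \<notin> U"
          then have "f (?e n) x = 0" using f[OF eP[of n]] x by blast
          then show False using n by simp
        qed
      qed
    qed
  qed
qed

text \<open>The functions \<open>f i\<close> come from the complement of \<open>C\<close>. On
  \<open>C\<close> they vanish, so \<open>g n\<close> is 1; off \<open>C\<close> one of them is
  positive, and the factor \<open>n\<close> eventually brings \<open>g n\<close> to 0.\<close>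

lemma closed_indicator_approx:
  assumes X: "compact_space X" "Hausdorff_space X" "second_countable X" and C: "closedin X C"
  shows "\<exists>g :: nat \<Rightarrow> 'a \<Rightarrow> real. \<forall>n. continuous_map X euclideanreal (g n) \<and>
    (\<forall>x\<in>topspace X. 0 \<le> g n x \<and> g n x \<le> 1 \<and> (\<lambda>n. g n x) \<longlonglongrightarrow> indicator C x)"
proof -
  have "openin X (topspace X - C)" using C by blast
  from open_cozero_cover[OF X this] obtain f :: "nat \<Rightarrow> 'a \<Rightarrow> real" where
    f: "\<forall>n. continuous_map X euclideanreal (f n) \<and> (\<forall>x\<in>topspace X. 0 \<le> f n x \<and> f n x \<le> 1)"
      "\<forall>x\<in>topspace X. x \<in> topspace X - C \<longleftrightarrow> (\<exists>n. 0 < f n x)" by metis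
  define g where "g n x = max 0 (1 - real n * (\<Sum>i<n. f i x))" for n x
  have "continuous_map X euclideanreal (g n)" for n
    unfolding g_def
    by (intro continuous_map_real_max continuous_map_diff continuous_map_real_mult continuous_map_sum) (use f(1) in auto)
  moreover have "0 \<le> g n x \<and> g n x \<le> 1" if x: "x \<in> topspace X" for n x
    using f(1) x by (auto simp: g_def intro!: mult_nonneg_nonneg sum_nonneg)
  moreover have "(\<lambda>n. g n x) \<longlonglongrightarrow> indicator C x" if x: "x \<in> topspace X" for x
  proof (cases "x \<in> C")
    case True
    then have "\<not> (\<exists>n. 0 < f n x)" using f(2) x by blast
    then have "f n x = 0" for n using f(1) x by (meson order_antisym not_less)
    then show ?thesis using True by (simp add: g_def)
  next
    case False
    then obtain i where i: "0 < f i x" using f(2) x by blast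
    obtain N :: nat where N: "1 / f i x < real N" using reals_Archimedean2 by blast
    have "g n x = 0" if n: "n \<ge> Suc i + N" for n
    proof -
      have "1 < real N * f i x" using N i by (simp add: field_simps)
      also have "\<dots> \<le> real n * f i x" using n i by (intro mult_right_mono) auto
      also have "\<dots> \<le> real n * (\<Sum>j<n. f j x)"
        using n f(1) x by (intro mult_left_mono member_le_sum) auto
      finally show ?thesis by (simp add: g_def)
    qed
    then have "eventually (\<lambda>n. g n x = 0) sequentially" using eventually_sequentially by blast
    then show ?thesis using False by (simp add: tendsto_eventually)
  qed
  ultimately show ?thesis by blast
qed

section \<open>Principal and associated bundles\<close>

lemma compact_space_finite_subcover:
  assumes "compact_space X" "\<forall>x\<in>topspace X. openin X (W x) \<and> x \<in> W x"
  shows "\<exists>I. finite I \<and> I \<subseteq> topspace X \<and> topspace X \<subseteq> (\<Union>x\<in>I. W x)"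
proof -
  have c: "compactin X (topspace X)" using assms(1) by (simp add: compact_space_def)
  have "\<exists>F. finite F \<and> F \<subseteq> W ` topspace X \<and> topspace X \<subseteq> \<Union>F"
    by (rule compactinD[OF c]) (use assms(2) in auto)
  then obtain F where F: "finite F" "F \<subseteq> W ` topspace X" "topspace X \<subseteq> \<Union>F" by (elim exE conjE)
  then obtain I where "I \<subseteq> topspace X" "finite I" "F = W ` I" using finite_subset_image[OF F(1,2)] by blast
  then show ?thesis using F(3) by blast
qed

text \<open>Stated for an arbitrary Hausdorff topological group, so that it applies both to
  \<open>Q\<close> with the group \<open>G\<close> and to the subbundle \<open>R\<close> with the
  compact group \<open>K\<close>.\<close>

locale pbundle = group G for G :: "('g, 'm) monoid_scheme" (structure) +
  fixes T :: "'g topology" and Q :: "('x, 'q, 'g) bundle_data"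
  assumes topspace_T: "topspace T = carrier G"
    and cont_mult: "continuous_map (prod_topology T T) T (\<lambda>(x, y). x \<otimes> y)"
    and cont_inv: "continuous_map T T (\<lambda>x. inv x)"
    and princ: "principal_bundle G T Q"
    and haus_T: "Hausdorff_space T"
begin

abbreviation "E \<equiv> topspace (total Q)"
abbreviation act (infixl "\<triangleleft>" 70) where "p \<triangleleft> g \<equiv> ract Q p g"

lemma bundle_parts:
  "continuous_map (prod_topology (total Q) T) (total Q) (\<lambda>(p, g). p \<triangleleft> g)"
  "\<forall>p\<in>E. p \<triangleleft> \<one> = p"
  "\<forall>p\<in>E. \<forall>g\<in>carrier G. \<forall>h\<in>carrier G. p \<triangleleft> (g \<otimes> h) = (p \<triangleleft> g) \<triangleleft> h"
  "continuous_map (total Q) (base Q) (proj Q)"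
  "\<forall>x\<in>topspace (base Q). \<exists>U \<psi>. openin (base Q) U \<and> x \<in> U \<and>
        homeomorphic_map (prod_topology (subtopology (base Q) U) T)
          (subtopology (total Q) {p \<in> E. proj Q p \<in> U}) \<psi> \<and>
        (\<forall>u\<in>U. \<forall>g\<in>carrier G. proj Q (\<psi> (u, g)) = u \<and>
           (\<forall>h\<in>carrier G. \<psi> (u, g \<otimes> h) = \<psi> (u, g) \<triangleleft> h))"
  using princ unfolding principal_bundle_def by - (elim conjE, assumption)+

lemma act_one[simp]: "p \<in> E \<Longrightarrow> p \<triangleleft> \<one> = p" using bundle_parts(2) by simp
lemma act_mult: "p \<in> E \<Longrightarrow> g \<in> carrier G \<Longrightarrow> h \<in> carrier G \<Longrightarrow> p \<triangleleft> (g \<otimes> h) = p \<triangleleft> g \<triangleleft> h"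
  using bundle_parts(3) by simp
lemma act_closed[simp]: assumes "p \<in> E" "g \<in> carrier G" shows "p \<triangleleft> g \<in> E"
proof -
  have "(\<lambda>(p, g). p \<triangleleft> g) (p, g) \<in> E"
    using continuous_map_image_subset_topspace[OF bundle_parts(1)] assms topspace_T by (force simp: image_subset_iff)
  then show ?thesis by simp
qed
lemma proj_closed[simp]: "p \<in> E \<Longrightarrow> proj Q p \<in> topspace (base Q)"
  using continuous_map_image_subset_topspace[OF bundle_parts(4)] by blast

text \<open>A local trivialisation split into a section \<open>\<sigma>\<close> and an equivariant
  group coordinate \<open>\<tau>\<close>. In terms of the homeomorphism \<open>\<psi>\<close> of the
  bundle, \<open>\<sigma> u\<close> is \<open>\<psi> (u, \<one>)\<close> and \<open>\<tau>\<close>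
  is the second component of the inverse.\<close>

definition triv :: "'x set \<Rightarrow> ('q \<Rightarrow> 'g) \<Rightarrow> ('x \<Rightarrow> 'q) \<Rightarrow> bool" where
  "triv U \<tau> \<sigma> \<longleftrightarrow> openin (base Q) U \<and>
     continuous_map (subtopology (total Q) {p \<in> E. proj Q p \<in> U}) T \<tau> \<and>
     continuous_map (subtopology (base Q) U) (total Q) \<sigma> \<and>
     (\<forall>u\<in>U. \<sigma> u \<in> E \<and> proj Q (\<sigma> u) = u) \<and>
     (\<forall>u\<in>U. \<forall>g\<in>carrier G. proj Q (\<sigma> u \<triangleleft> g) = u \<and> \<tau> (\<sigma> u \<triangleleft> g) = g) \<and>
     (\<forall>p\<in>E. proj Q p \<in> U \<longrightarrow> \<tau> p \<in> carrier G \<and> p = \<sigma> (proj Q p) \<triangleleft> \<tau> p)"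

lemma triv_exists:
  assumes x: "x \<in> topspace (base Q)"
  obtains U \<tau> \<sigma> where "triv U \<tau> \<sigma>" "x \<in> U"
proof -
  obtain U \<psi> where U: "openin (base Q) U" "x \<in> U" and h: "homeomorphic_map (prod_topology (subtopology (base Q) U) T)
          (subtopology (total Q) {p \<in> E. proj Q p \<in> U}) \<psi>"
    and \<psi>: "\<And>u g. u \<in> U \<Longrightarrow> g \<in> carrier G \<Longrightarrow> proj Q (\<psi> (u, g)) = u"
      "\<And>u g h. u \<in> U \<Longrightarrow> g \<in> carrier G \<Longrightarrow> h \<in> carrier G \<Longrightarrow> \<psi> (u, g \<otimes> h) = \<psi> (u, g) \<triangleleft> h"
    using bspec[OF bundle_parts(5) x] by (elim exE conjE) (rule that, auto)
  obtain \<psi>' where \<psi>': "homeomorphic_maps (prod_topology (subtopology (base Q) U) T)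
          (subtopology (total Q) {p \<in> E. proj Q p \<in> U}) \<psi> \<psi>'"
    using h unfolding homeomorphic_map_maps by blast
  have UX: "U \<subseteq> topspace (base Q)" using U(1) by (rule openin_subset)
  have dom: "topspace (prod_topology (subtopology (base Q) U) T) = U \<times> carrier G"
    using UX topspace_T by (simp add: Int_absorb1)
  have c: "continuous_map (prod_topology (subtopology (base Q) U) T) (subtopology (total Q) {p \<in> E. proj Q p \<in> U}) \<psi>"
    and c': "continuous_map (subtopology (total Q) {p \<in> E. proj Q p \<in> U}) (prod_topology (subtopology (base Q) U) T) \<psi>'"
    and inv1: "\<And>z. z \<in> U \<times> carrier G \<Longrightarrow> \<psi>' (\<psi> z) = z"
    and inv2: "\<And>p. p \<in> E \<Longrightarrow> proj Q p \<in> U \<Longrightarrow> \<psi> (\<psi>' p) = p"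
    using \<psi>' dom unfolding homeomorphic_maps_def by auto
  have \<psi>E: "\<psi> (u, g) \<in> E" if "u \<in> U" "g \<in> carrier G" for u g
    using continuous_map_image_subset_topspace[OF c] that dom by (auto simp: image_subset_iff)
  have \<psi>'D: "\<psi>' p \<in> U \<times> carrier G" if "p \<in> E" "proj Q p \<in> U" for p
    using continuous_map_image_subset_topspace[OF c'] that dom by (auto simp: image_subset_iff)
  define \<tau> where "\<tau> p = snd (\<psi>' p)" for p
  define \<sigma> where "\<sigma> u = \<psi> (u, \<one>)" for u
  have \<sigma>g: "\<sigma> u \<triangleleft> g = \<psi> (u, g)" if "u \<in> U" "g \<in> carrier G" for u g
    using \<psi>(2)[OF that(1) one_closed that(2)] that by (simp add: \<sigma>_def)
  have "triv U \<tau> \<sigma>"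
    unfolding triv_def
  proof (intro conjI ballI impI)
    show "openin (base Q) U" by (rule U(1))
    show "continuous_map (subtopology (total Q) {p \<in> E. proj Q p \<in> U}) T \<tau>"
      unfolding \<tau>_def using continuous_map_compose[OF c' continuous_map_snd] by (simp add: comp_def)
    have "continuous_map (subtopology (base Q) U) (prod_topology (subtopology (base Q) U) T) (\<lambda>u. (u, \<one>))"
      by (intro continuous_map_pairedI) (auto simp: topspace_T)
    from continuous_map_compose[OF this c] show "continuous_map (subtopology (base Q) U) (total Q) \<sigma>"
      unfolding \<sigma>_def by (simp add: comp_def continuous_map_in_subtopology)
    show "\<sigma> u \<in> E" "proj Q (\<sigma> u) = u" if "u \<in> U" for u using that \<psi>E \<psi>(1) by (auto simp: \<sigma>_def)
    show "proj Q (\<sigma> u \<triangleleft> g) = u" "\<tau> (\<sigma> u \<triangleleft> g) = g" if "u \<in> U" "g \<in> carrier G" for u g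
      using that \<psi>(1) inv1 by (auto simp: \<sigma>g \<tau>_def)
    fix p assume p: "p \<in> E" "proj Q p \<in> U"
    obtain u g where ug: "\<psi>' p = (u, g)" "u \<in> U" "g \<in> carrier G" using \<psi>'D[OF p] by blast
    have "p = \<psi> (u, g)" using inv2[OF p] ug(1) by simp
    then show "\<tau> p \<in> carrier G" "p = \<sigma> (proj Q p) \<triangleleft> \<tau> p"
      using ug \<psi>(1) \<sigma>g by (auto simp: \<tau>_def)
  qed
  then show ?thesis using that U(2) by blast
qed

lemma trivD:
  assumes "triv U \<tau> \<sigma>"
  shows "openin (base Q) U" "continuous_map (subtopology (total Q) {p \<in> E. proj Q p \<in> U}) T \<tau>"
     "continuous_map (subtopology (base Q) U) (total Q) \<sigma>"
     "u \<in> U \<Longrightarrow> \<sigma> u \<in> E" "u \<in> U \<Longrightarrow> proj Q (\<sigma> u) = u"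
     "u \<in> U \<Longrightarrow> g \<in> carrier G \<Longrightarrow> proj Q (\<sigma> u \<triangleleft> g) = u" "u \<in> U \<Longrightarrow> g \<in> carrier G \<Longrightarrow> \<tau> (\<sigma> u \<triangleleft> g) = g"
     "p \<in> E \<Longrightarrow> proj Q p \<in> U \<Longrightarrow> \<tau> p \<in> carrier G"
     "p \<in> E \<Longrightarrow> proj Q p \<in> U \<Longrightarrow> \<sigma> (proj Q p) \<triangleleft> \<tau> p = p"
  using assms unfolding triv_def by auto

text \<open>Invariance of the projection, like freeness and transitivity of the action on fibres
  below, is read off from local trivialisations.\<close>

lemma proj_act[simp]: assumes p: "p \<in> E" and g: "g \<in> carrier G" shows "proj Q (p \<triangleleft> g) = proj Q p"
proof -
  obtain U \<tau> \<sigma> where t: "triv U \<tau> \<sigma>" "proj Q p \<in> U" by (rule triv_exists[OF proj_closed[OF p]])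
  have "p \<triangleleft> g = \<sigma> (proj Q p) \<triangleleft> (\<tau> p \<otimes> g)"
    using act_mult[OF trivD(4)[OF t] trivD(8)[OF t(1) p t(2)] g] trivD(9)[OF t(1) p t(2)] by simp
  then show ?thesis using trivD(6)[OF t, of "\<tau> p \<otimes> g"] trivD(8)[OF t(1) p t(2)] g by simp
qed

lemma triv_act:
  assumes t: "triv U \<tau> \<sigma>" and p: "p \<in> E" "proj Q p \<in> U" and g: "g \<in> carrier G"
  shows "\<tau> (p \<triangleleft> g) = \<tau> p \<otimes> g"
proof -
  have "p \<triangleleft> g = \<sigma> (proj Q p) \<triangleleft> (\<tau> p \<otimes> g)"
    using act_mult[OF trivD(4)[OF t p(2)] trivD(8)[OF t p] g] trivD(9)[OF t p] by simp
  then show ?thesis using trivD(7)[OF t p(2), of "\<tau> p \<otimes> g"] trivD(8)[OF t p] g by simp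
qed

lemma fibre_transitive:
  assumes p: "p \<in> E" "p' \<in> E" "proj Q p = proj Q p'"
  obtains g where "g \<in> carrier G" "p' = p \<triangleleft> g"
proof -
  obtain U \<tau> \<sigma> where t: "triv U \<tau> \<sigma>" "proj Q p \<in> U" by (rule triv_exists[OF proj_closed[OF p(1)]])
  let ?g = "inv (\<tau> p) \<otimes> \<tau> p'"
  have c: "\<tau> p \<in> carrier G" "\<tau> p' \<in> carrier G" using trivD(8)[OF t(1)] p t(2) by auto
  have "p \<triangleleft> ?g = \<sigma> (proj Q p) \<triangleleft> \<tau> p \<triangleleft> ?g" using trivD(9)[OF t(1) p(1) t(2)] by simp
  also have "\<dots> = \<sigma> (proj Q p) \<triangleleft> (\<tau> p \<otimes> ?g)"
    using act_mult[OF trivD(4)[OF t], of "\<tau> p" ?g] c by simp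
  also have "\<tau> p \<otimes> ?g = \<tau> p'" using c by (simp flip: m_assoc)
  also have "\<sigma> (proj Q p) \<triangleleft> \<tau> p' = p'" using trivD(9)[OF t(1) p(2)] t(2) p(3) by simp
  finally show ?thesis using that[of ?g] c by simp
qed

lemma act_free:
  assumes p: "p \<in> E" and g: "g \<in> carrier G" "h \<in> carrier G" "p \<triangleleft> g = p \<triangleleft> h" shows "g = h"
proof -
  obtain U \<tau> \<sigma> where t: "triv U \<tau> \<sigma>" "proj Q p \<in> U" by (rule triv_exists[OF proj_closed[OF p]])
  have "\<tau> p \<otimes> g = \<tau> p \<otimes> h" using triv_act[OF t(1) p t(2)] g by metis
  then show ?thesis using g trivD(8)[OF t(1) p t(2)] by simp
qed

lemma proj_surj: assumes "x \<in> topspace (base Q)" obtains p where "p \<in> E" "proj Q p = x"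
proof -
  obtain U \<tau> \<sigma> where t: "triv U \<tau> \<sigma>" "x \<in> U" by (rule triv_exists[OF assms])
  then show ?thesis using that trivD(4,5)[OF t] by blast
qed

lemma continuous_act: assumes "g \<in> carrier G" shows "continuous_map (total Q) (total Q) (\<lambda>p. p \<triangleleft> g)"
proof -
  have "continuous_map (total Q) (prod_topology (total Q) T) (\<lambda>p. (p, g))"
    by (intro continuous_map_pairedI) (use assms topspace_T in auto)
  from continuous_map_compose[OF this bundle_parts(1)] show ?thesis by (simp add: comp_def)
qed

lemma continuous_act_right: assumes "p \<in> E" shows "continuous_map T (total Q) (\<lambda>g. p \<triangleleft> g)"
proof -
  have "continuous_map T (prod_topology (total Q) T) (\<lambda>g. (p, g))"
    by (intro continuous_map_pairedI) (use assms in auto)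
  from continuous_map_compose[OF this bundle_parts(1)] show ?thesis by (simp add: comp_def)
qed

lemma openin_over: "openin (base Q) U \<Longrightarrow> openin (total Q) {p \<in> E. proj Q p \<in> U}"
  by (rule openin_continuous_map_preimage[OF bundle_parts(4)])

lemma triv_map_continuous:
  assumes t: "triv U \<tau> \<sigma>"
  shows "continuous_map (prod_topology (subtopology (base Q) U) T) (total Q) (\<lambda>(u, g). \<sigma> u \<triangleleft> g)"
proof -
  have "continuous_map (prod_topology (subtopology (base Q) U) T) (prod_topology (total Q) T) (\<lambda>z. (\<sigma> (fst z), snd z))"
    by (intro continuous_map_pairedI continuous_map_compose[OF continuous_map_fst trivD(3)[OF t], unfolded comp_def] continuous_map_snd)
  from continuous_map_compose[OF this bundle_parts(1)] show ?thesis by (simp add: comp_def case_prod_unfold)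
qed

text \<open>By regularity of the base each point has an open neighbourhood inside a closed, hence
  compact, part of a trivialising set. Over that part the bundle is the image of a product of
  compact sets.\<close>

lemma compact_total:
  assumes X: "compact_space (base Q)" "Hausdorff_space (base Q)" and G: "compactin T (carrier G)"
  shows "compact_space (total Q)"
proof -
  have reg: "regular_space (base Q)" by (rule compact_Hausdorff_imp_regular_space) (use X in auto)
  have "\<exists>W C. openin (base Q) W \<and> x \<in> W \<and> W \<subseteq> C \<and> compactin (total Q) {p \<in> E. proj Q p \<in> C}"
    if x: "x \<in> topspace (base Q)" for x
  proof -
    obtain U \<tau> \<sigma> where t: "triv U \<tau> \<sigma>" "x \<in> U" by (rule triv_exists[OF x])
    have "\<exists>W C. openin (base Q) W \<and> closedin (base Q) C \<and> x \<in> W \<and> W \<subseteq> C \<and> C \<subseteq> U"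
      using reg trivD(1)[OF t(1)] t(2) unfolding neighbourhood_base_of_closedin[symmetric] neighbourhood_base_of by blast
    then obtain W C where W: "openin (base Q) W" "closedin (base Q) C" "x \<in> W" "W \<subseteq> C" "C \<subseteq> U" by blast
    have "compactin (base Q) C" by (rule closedin_compact_space[OF X(1) W(2)])
    then have "compactin (subtopology (base Q) U) C" using W(5) by (simp add: compactin_subtopology)
    then have "compactin (prod_topology (subtopology (base Q) U) T) (C \<times> carrier G)" using G by (simp add: compactin_Times)
    from image_compactin[OF this triv_map_continuous[OF t(1)]]
    have "compactin (total Q) ((\<lambda>(u, g). \<sigma> u \<triangleleft> g) ` (C \<times> carrier G))" .
    moreover have "(\<lambda>(u, g). \<sigma> u \<triangleleft> g) ` (C \<times> carrier G) = {p \<in> E. proj Q p \<in> C}"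
    proof (intro equalityI subsetI)
      fix p assume "p \<in> (\<lambda>(u, g). \<sigma> u \<triangleleft> g) ` (C \<times> carrier G)"
      then obtain u g where "p = \<sigma> u \<triangleleft> g" "u \<in> C" "g \<in> carrier G" by auto
      then show "p \<in> {p \<in> E. proj Q p \<in> C}" using trivD(4,6)[OF t(1)] W(5) by auto
    next
      fix p assume p: "p \<in> {p \<in> E. proj Q p \<in> C}"
      then have "\<sigma> (proj Q p) \<triangleleft> \<tau> p = p" "\<tau> p \<in> carrier G" using trivD(8,9)[OF t(1)] W(5) by auto
      then show "p \<in> (\<lambda>(u, g). \<sigma> u \<triangleleft> g) ` (C \<times> carrier G)" using p by (intro image_eqI[of _ _ "(proj Q p, \<tau> p)"]) auto
    qed
    ultimately show ?thesis using W by auto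
  qed
  then have "\<forall>x\<in>topspace (base Q). \<exists>z. openin (base Q) (fst z) \<and> x \<in> fst z \<and> fst z \<subseteq> snd z \<and>
      compactin (total Q) {p \<in> E. proj Q p \<in> snd z}" by simp
  from bchoice[OF this] obtain z where z: "\<forall>x\<in>topspace (base Q). openin (base Q) (fst (z x)) \<and> x \<in> fst (z x) \<and>
      fst (z x) \<subseteq> snd (z x) \<and> compactin (total Q) {p \<in> E. proj Q p \<in> snd (z x)}" ..
  define W where "W x = fst (z x)" for x
  define C where "C x = snd (z x)" for x
  have W: "openin (base Q) (W x) \<and> x \<in> W x \<and> W x \<subseteq> C x \<and> compactin (total Q) {p \<in> E. proj Q p \<in> C x}"
    if "x \<in> topspace (base Q)" for x using z that by (simp add: W_def C_def)
  have "\<forall>x\<in>topspace (base Q). openin (base Q) (W x) \<and> x \<in> W x" using W by simp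
  from compact_space_finite_subcover[OF X(1) this]
  obtain I where I: "finite I" "I \<subseteq> topspace (base Q)" "topspace (base Q) \<subseteq> (\<Union>x\<in>I. W x)"
    by (elim exE conjE)
  have "compactin (total Q) (\<Union>x\<in>I. {p \<in> E. proj Q p \<in> C x})"
    using I W by (intro compactin_Union) auto
  moreover have "(\<Union>x\<in>I. {p \<in> E. proj Q p \<in> C x}) = E"
  proof (intro equalityI subsetI)
    fix p assume p: "p \<in> E"
    then obtain x where "x \<in> I" "proj Q p \<in> W x" using I(3) proj_closed[OF p] by blast
    then show "p \<in> (\<Union>x\<in>I. {p \<in> E. proj Q p \<in> C x})" using W I(2) p by blast
  qed auto
  ultimately show ?thesis by (simp add: compact_space_def)
qed

lemma finite_triv_cover:
  assumes X: "compact_space (base Q)"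
  obtains I :: "('x set \<times> ('q \<Rightarrow> 'g) \<times> ('x \<Rightarrow> 'q)) set" where "finite I" "\<forall>(U, \<tau>, \<sigma>)\<in>I. triv U \<tau> \<sigma>"
    "topspace (base Q) \<subseteq> (\<Union>(U, \<tau>, \<sigma>)\<in>I. U)"
proof -
  have "\<forall>x\<in>topspace (base Q). \<exists>z. triv (fst z) (fst (snd z)) (snd (snd z)) \<and> x \<in> fst z"
  proof
    fix x assume "x \<in> topspace (base Q)"
    then obtain U \<tau> \<sigma> where "triv U \<tau> \<sigma>" "x \<in> U" by (rule triv_exists)
    then show "\<exists>z. triv (fst z) (fst (snd z)) (snd (snd z)) \<and> x \<in> fst z" by (intro exI[of _ "(U, \<tau>, \<sigma>)"]) simp
  qed
  from bchoice[OF this] obtain z where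
    z: "\<forall>x\<in>topspace (base Q). triv (fst (z x)) (fst (snd (z x))) (snd (snd (z x))) \<and> x \<in> fst (z x)" ..
  have "\<forall>x\<in>topspace (base Q). openin (base Q) (fst (z x)) \<and> x \<in> fst (z x)" using z trivD(1) by blast
  from compact_space_finite_subcover[OF X this] obtain J where
    J: "finite J" "J \<subseteq> topspace (base Q)" "topspace (base Q) \<subseteq> (\<Union>x\<in>J. fst (z x))" by (elim exE conjE)
  show ?thesis
  proof (rule that[of "z ` J"])
    show "finite (z ` J)" using J(1) by simp
    show "\<forall>(U, \<tau>, \<sigma>)\<in>z ` J. triv U \<tau> \<sigma>" unfolding case_prod_unfold using z J(2) by blast
    show "topspace (base Q) \<subseteq> (\<Union>(U, \<tau>, \<sigma>)\<in>z ` J. U)" unfolding case_prod_unfold using J(3) by blast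
  qed
qed

lemma second_countable_total:
  assumes X: "compact_space (base Q)" "second_countable (base Q)" and G: "second_countable T"
  shows "second_countable (total Q)"
proof -
  obtain I :: "('x set \<times> ('q \<Rightarrow> 'g) \<times> ('x \<Rightarrow> 'q)) set" where I: "finite I" "\<forall>(U, \<tau>, \<sigma>)\<in>I. triv U \<tau> \<sigma>"
    "topspace (base Q) \<subseteq> (\<Union>(U, \<tau>, \<sigma>)\<in>I. U)" by (rule finite_triv_cover[OF X(1)])
  show ?thesis
  proof (rule second_countable_open_cover[where U="\<lambda>z. {p \<in> E. proj Q p \<in> fst z}"])
    show "countable I" using I(1) by (rule countable_finite)
    show "openin (total Q) {p \<in> E. proj Q p \<in> fst z}" if "z \<in> I" for z
      by (rule openin_over) (use I(2) that trivD(1) in \<open>force simp: case_prod_beta\<close>)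
    show "E \<subseteq> (\<Union>z\<in>I. {p \<in> E. proj Q p \<in> fst z})"
    proof
      fix p assume p: "p \<in> E"
      then have "proj Q p \<in> (\<Union>z\<in>I. fst z)" using I(3)[unfolded case_prod_unfold] proj_closed[OF p] by blast
      then show "p \<in> (\<Union>z\<in>I. {p \<in> E. proj Q p \<in> fst z})" using p by blast
    qed
    fix z assume z: "z \<in> I"
    obtain U \<tau> \<sigma> where zz: "z = (U, \<tau>, \<sigma>)" by (cases z)
    then have t: "triv U \<tau> \<sigma>" using I(2) z by auto
    let ?S = "subtopology (total Q) {p \<in> E. proj Q p \<in> U}"
    let ?P = "prod_topology (subtopology (base Q) U) T"
    have UX: "U \<subseteq> topspace (base Q)" using trivD(1)[OF t] by (rule openin_subset)
    have "continuous_map ?S (base Q) (proj Q)"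
      using bundle_parts(4) by (rule continuous_map_from_subtopology)
    then have "continuous_map ?S (subtopology (base Q) U) (proj Q)"
      by (rule continuous_map_into_subtopology) auto
    then have 1: "continuous_map ?S ?P (\<lambda>p. (proj Q p, \<tau> p))" by (intro continuous_map_pairedI trivD(2)[OF t])
    have 2: "continuous_map ?P ?S (\<lambda>(u, g). \<sigma> u \<triangleleft> g)"
      by (rule continuous_map_into_subtopology[OF triv_map_continuous[OF t]])
        (use trivD(4,6)[OF t] topspace_T in auto)
    have "homeomorphic_maps ?S ?P (\<lambda>p. (proj Q p, \<tau> p)) (\<lambda>(u, g). \<sigma> u \<triangleleft> g)"
      unfolding homeomorphic_maps_def using 1 2 trivD(6-9)[OF t] topspace_T by auto
    then have "?S homeomorphic_space ?P" unfolding homeomorphic_space_def by blast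
    moreover have "second_countable ?P"
      by (rule second_countable_prod[OF second_countable_subtopology[OF X(2)] G])
    ultimately show "second_countable (subtopology (total Q) {p \<in> E. proj Q p \<in> fst z})"
      using homeomorphic_space_second_countability zz by auto
  qed
qed

end

lemma topspace_quotient_top: "topspace (quotient_top T p) = p ` topspace T"
proof (intro equalityI)
  show "topspace (quotient_top T p) \<subseteq> p ` topspace T"
    using openin_topspace[of "quotient_top T p"] unfolding openin_quotient_top by blast
  have "openin (quotient_top T p) (p ` topspace T)"
    unfolding openin_quotient_top
  proof
    have "{x \<in> topspace T. p x \<in> p ` topspace T} = topspace T" by blast
    then show "openin T {x \<in> topspace T. p x \<in> p ` topspace T}" by simp
  qed simp
  then show "p ` topspace T \<subseteq> topspace (quotient_top T p)" by (rule openin_subset)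
qed

lemma continuous_quotient_top: "continuous_map T (quotient_top T p) p"
  unfolding continuous_map by (auto simp: topspace_quotient_top openin_quotient_top)

section \<open>Associated bundles with transitive fibre\<close>

context pbundle
begin

text \<open>The action laws are asked at one point \<open>e\<close> only: the coset action on
  arbitrary sets need not satisfy them, and the fibres in use are single orbits.\<close>

definition orbital :: "('g \<Rightarrow> 'f \<Rightarrow> 'f) \<Rightarrow> 'f \<Rightarrow> bool" where
  "orbital a e \<longleftrightarrow> a \<one> e = e \<and> (\<forall>g\<in>carrier G. \<forall>h\<in>carrier G. a (g \<otimes> h) e = a g (a h e))"

lemma assoc_pt_mem: "x \<in> assoc_pt G Q a p f \<longleftrightarrow> (\<exists>g\<in>carrier G. x = (p \<triangleleft> g, a (inv g) f))"
  unfolding assoc_pt_def by auto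

text \<open>Every point of a bundle whose fibre is an orbit can thereby be written with the fixed
  fibre point \<open>e\<close>, which turns the bundle into a quotient of the frames.\<close>

lemma assoc_shift:
  assumes a: "orbital a e" and p: "p \<in> E" and g: "g \<in> carrier G"
  shows "assoc_pt G Q a p (a g e) = assoc_pt G Q a (p \<triangleleft> g) e"
proof (intro Set.set_eqI iffI)
  have am: "a (inv h) (a g e) = a (inv h \<otimes> g) e" if "h \<in> carrier G" for h
    using a g that unfolding orbital_def by simp
  fix x assume "x \<in> assoc_pt G Q a p (a g e)"
  then obtain h where h: "h \<in> carrier G" "x = (p \<triangleleft> h, a (inv h) (a g e))" unfolding assoc_pt_mem by blast
  have "p \<triangleleft> g \<triangleleft> (inv g \<otimes> h) = p \<triangleleft> (g \<otimes> (inv g \<otimes> h))"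
    using act_mult[OF p g, of "inv g \<otimes> h"] g h(1) by simp
  also have "g \<otimes> (inv g \<otimes> h) = h" using g h(1) by (simp flip: m_assoc)
  finally have "x = (p \<triangleleft> g \<triangleleft> (inv g \<otimes> h), a (inv (inv g \<otimes> h)) e)"
    using h am[OF h(1)] g by (simp add: inv_mult_group)
  then show "x \<in> assoc_pt G Q a (p \<triangleleft> g) e" unfolding assoc_pt_mem using g h(1) by blast
next
  have am: "a (inv h) (a g e) = a (inv h \<otimes> g) e" if "h \<in> carrier G" for h
    using a g that unfolding orbital_def by simp
  fix x assume "x \<in> assoc_pt G Q a (p \<triangleleft> g) e"
  then obtain h where h: "h \<in> carrier G" "x = (p \<triangleleft> g \<triangleleft> h, a (inv h) e)" unfolding assoc_pt_mem by blast
  have "a (inv (g \<otimes> h)) (a g e) = a (inv h) e"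
    using am[of "g \<otimes> h"] g h(1) by (simp add: inv_mult_group m_assoc)
  then have "x = (p \<triangleleft> (g \<otimes> h), a (inv (g \<otimes> h)) (a g e))"
    using h act_mult[OF p g h(1)] by simp
  then show "x \<in> assoc_pt G Q a p (a g e)" unfolding assoc_pt_mem using g h(1) by blast
qed

lemma assoc_self: "orbital a e \<Longrightarrow> p \<in> E \<Longrightarrow> (p, e) \<in> assoc_pt G Q a p e"
  unfolding assoc_pt_mem orbital_def by (intro bexI[of _ \<one>]) auto

text \<open>The bundle is thus the quotient of \<open>Q\<close> by the stabiliser of
  \<open>e\<close>: \<open>P\<close> for the flag bundle, \<open>Z_of G H\<close> for the adjoint
  orbit bundle.\<close>

lemma assoc_eq_iff:
  assumes a: "orbital a e" and p: "p \<in> E" "p' \<in> E"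
  shows "assoc_pt G Q a p e = assoc_pt G Q a p' e \<longleftrightarrow> (\<exists>g\<in>carrier G. p' = p \<triangleleft> g \<and> a g e = e)"
proof
  assume eq: "assoc_pt G Q a p e = assoc_pt G Q a p' e"
  then have "(p', e) \<in> assoc_pt G Q a p e" using assoc_self[OF a p(2)] by simp
  then obtain h where h: "h \<in> carrier G" "p' = p \<triangleleft> h" "e = a (inv h) e" unfolding assoc_pt_mem by blast
  have "a (h \<otimes> inv h) e = a h (a (inv h) e)" using a h(1) inv_closed[OF h(1)] unfolding orbital_def by blast
  moreover have "a (h \<otimes> inv h) e = e" using a h(1) unfolding orbital_def by simp
  ultimately have "a h e = e" using h(3) by metis
  then show "\<exists>g\<in>carrier G. p' = p \<triangleleft> g \<and> a g e = e" using h by blast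
next
  assume "\<exists>g\<in>carrier G. p' = p \<triangleleft> g \<and> a g e = e"
  then obtain g where g: "g \<in> carrier G" "p' = p \<triangleleft> g" "a g e = e" by blast
  show "assoc_pt G Q a p e = assoc_pt G Q a p' e" using assoc_shift[OF a p(1) g(1)] g by simp
qed

lemma assoc_proj_pt: assumes "p \<in> E" shows "assoc_proj Q (assoc_pt G Q a p f) = proj Q p"
proof -
  have "(\<lambda>(p, f). proj Q p) ` assoc_pt G Q a p f = {proj Q p}"
    using assms proj_act[OF assms] one_closed unfolding assoc_pt_def image_image by auto
  then show ?thesis unfolding assoc_proj_def by simp
qed

lemma assoc_map_pt:
  assumes "p \<in> E" "\<forall>p\<in>E. \<forall>g\<in>carrier G. \<phi> (p \<triangleleft> g) = \<phi> p \<triangleleft> g"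
  shows "assoc_map \<phi> (assoc_pt G Q a p f) = assoc_pt G Q a (\<phi> p) f"
  unfolding assoc_map_def assoc_pt_def image_image case_prod_conv
  using assms by (intro image_cong) auto

lemma assoc_pt_continuous:
  assumes "e \<in> topspace F" shows "continuous_map (total Q) (assoc_top G Q F a) (\<lambda>p. assoc_pt G Q a p e)"
proof -
  have "continuous_map (total Q) (prod_topology (total Q) F) (\<lambda>p. (p, e))"
    by (intro continuous_map_pairedI) (use assms in auto)
  from continuous_map_compose[OF this continuous_quotient_top, of "\<lambda>(p, f). assoc_pt G Q a p f"]
  show ?thesis unfolding assoc_top_def by (simp add: comp_def)
qed

lemma topspace_assoc_top:
  assumes a: "orbital a e" and F: "topspace F = (\<lambda>g. a g e) ` carrier G"
  shows "topspace (assoc_top G Q F a) = (\<lambda>p. assoc_pt G Q a p e) ` E"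
proof -
  have "(\<lambda>(p, f). assoc_pt G Q a p f) ` (E \<times> topspace F) = (\<lambda>p. assoc_pt G Q a p e) ` E"
  proof (intro equalityI subsetI)
    fix x assume "x \<in> (\<lambda>(p, f). assoc_pt G Q a p f) ` (E \<times> topspace F)"
    then obtain p g where "p \<in> E" "g \<in> carrier G" "x = assoc_pt G Q a p (a g e)" unfolding F by auto
    then show "x \<in> (\<lambda>p. assoc_pt G Q a p e) ` E" using assoc_shift[OF a] act_closed by auto
  next
    fix x assume "x \<in> (\<lambda>p. assoc_pt G Q a p e) ` E"
    then obtain p where p: "p \<in> E" "x = assoc_pt G Q a p e" by blast
    have "e \<in> topspace F" unfolding F using a unfolding orbital_def by (intro image_eqI[of _ _ \<one>]) auto
    then show "x \<in> (\<lambda>(p, f). assoc_pt G Q a p f) ` (E \<times> topspace F)" using p by (intro image_eqI[of _ _ "(p, e)"]) auto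
  qed
  then show ?thesis unfolding assoc_top_def topspace_quotient_top by simp
qed

lemma openin_assoc_top:
  "openin (assoc_top G Q F a) U \<longleftrightarrow> U \<subseteq> topspace (assoc_top G Q F a) \<and>
     openin (prod_topology (total Q) F) {(p, f). p \<in> E \<and> f \<in> topspace F \<and> assoc_pt G Q a p f \<in> U}"
proof -
  have "{x \<in> topspace (prod_topology (total Q) F). (\<lambda>(p, f). assoc_pt G Q a p f) x \<in> U} =
      {(p, f). p \<in> E \<and> f \<in> topspace F \<and> assoc_pt G Q a p f \<in> U}" by auto
  then show ?thesis unfolding assoc_top_def openin_quotient_top topspace_quotient_top by simp
qed

lemma assoc_top_over:
  assumes U: "openin (base Q) U" shows "openin (assoc_top G Q F a) {\<xi> \<in> topspace (assoc_top G Q F a). assoc_proj Q \<xi> \<in> U}"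
  unfolding openin_assoc_top
proof
  have "openin (prod_topology (total Q) F) ({p \<in> E. proj Q p \<in> U} \<times> topspace F)"
    by (simp add: openin_prod_Times_iff openin_over[OF U])
  moreover have "{(p, f). p \<in> E \<and> f \<in> topspace F \<and> assoc_pt G Q a p f \<in> {\<xi> \<in> topspace (assoc_top G Q F a). assoc_proj Q \<xi> \<in> U}} =
      {p \<in> E. proj Q p \<in> U} \<times> topspace F"
    by (auto simp: assoc_proj_pt assoc_top_def topspace_quotient_top)
  ultimately show "openin (prod_topology (total Q) F)
      {(p, f). p \<in> E \<and> f \<in> topspace F \<and> assoc_pt G Q a p f \<in> {\<xi> \<in> topspace (assoc_top G Q F a). assoc_proj Q \<xi> \<in> U}}"
    by simp
qed auto

end

text \<open>\<open>H\<close> is any element of \<open>aa\<close>, possibly outside the closed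
  chamber. It will be the polar exponent moved by the inverse of a representative of
  \<open>w\<close>; then the frames \<open>p\<close> with \<open>p \<cdot> H\<close> on the Lyapunov
  section reach the required part of the flag bundle simply through
  \<open>p \<cdot> b0\<close>.\<close>

locale flagb = red_grp G for G :: "('g, 'l::euclidean_space, 'm) cartan_data_scheme" (structure) +
  fixes Q :: "('x, 'q, 'g) bundle_data" and H :: 'l
  assumes base_compact: "compact_space (base Q)" and base_metrizable: "metrizable_space (base Q)"
    and Q_princ: "principal_bundle G (topol G) Q" and H_aa: "H \<in> aa G"
begin

sublocale pbundle G "topol G" Q
  by unfold_locales (use continuous_mult continuous_inv Q_princ Hausdorff_G in auto)

abbreviation "P \<equiv> min_parabolic G"
abbreviation q :: "'q \<Rightarrow> ('q \<times> 'g set) set" where "q p \<equiv> flag_pt G Q p (min_parabolic G)"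
abbreviation \<beta> :: "'q \<Rightarrow> ('q \<times> 'l) set" where "\<beta> p \<equiv> assoc_pt G Q (Ad G) p H"
abbreviation "FE \<equiv> flag_bundle G Q"
abbreviation "ADE \<equiv> adjoint_orbit_bundle G Q H"

lemma P_sub: "P \<subseteq> carrier G" using subgroup.subset[OF P_subgroup] .

lemma orbital_flag: "orbital (\<lambda>g b. g <# b) P"
  unfolding orbital_def using lcos_mult_one[OF P_sub] lcos_m_assoc[OF P_sub] by auto

lemma orbital_Ad: "orbital (Ad G) H"
  unfolding orbital_def by (simp add: Ad_mult)

lemma coset_eq_P: "g \<in> carrier G \<Longrightarrow> g <# P = P \<longleftrightarrow> g \<in> P"
proof
  assume g: "g \<in> carrier G" "g <# P = P"
  have "g \<otimes> \<one> \<in> g <# P" unfolding l_coset_def using subgroup.one_closed[OF P_subgroup] by blast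
  then show "g \<in> P" using g by simp
next
  assume g: "g \<in> carrier G" "g \<in> P"
  show "g <# P = P"
  proof (intro equalityI subsetI)
    fix x assume "x \<in> g <# P"
    then show "x \<in> P" unfolding l_coset_def using subgroup.m_closed[OF P_subgroup g(2)] by blast
  next
    fix x assume x: "x \<in> P"
    have "inv g \<otimes> x \<in> P" using subgroup.m_closed[OF P_subgroup] subgroup.m_inv_closed[OF P_subgroup g(2)] x by blast
    moreover have "x = g \<otimes> (inv g \<otimes> x)" using g(1) P_closed[OF x] by simp
    ultimately show "x \<in> g <# P" unfolding l_coset_def by blast
  qed
qed

lemma q_eq_iff: assumes "p \<in> E" "p' \<in> E" shows "q p = q p' \<longleftrightarrow> (\<exists>j\<in>P. p' = p \<triangleleft> j)"
  unfolding flag_pt_def assoc_eq_iff[OF orbital_flag assms] using coset_eq_P P_closed by blast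

lemma \<beta>_eq_iff: assumes "p \<in> E" "p' \<in> E" shows "\<beta> p = \<beta> p' \<longleftrightarrow> (\<exists>z\<in>Z_of G H. p' = p \<triangleleft> z)"
  unfolding assoc_eq_iff[OF orbital_Ad assms] Z_of_def by blast

lemma topspace_flag_top: "topspace (flag_top G) = (\<lambda>g. g <# P) ` carrier G"
  unfolding flag_top_def topspace_quotient_top by simp

lemma topspace_FE: "topspace FE = q ` E"
  unfolding flag_bundle_def flag_pt_def by (rule topspace_assoc_top[OF orbital_flag topspace_flag_top])

lemma topspace_ADE: "topspace ADE = \<beta> ` E"
  unfolding adjoint_orbit_bundle_def
  by (rule topspace_assoc_top[OF orbital_Ad]) (simp add: Ad_orbit_def)

lemma P_flag_top: "P \<in> topspace (flag_top G)"
  unfolding topspace_flag_top using lcos_mult_one[OF P_sub] one_closed by (metis imageI)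

lemma q_continuous: "continuous_map (total Q) FE q"
  unfolding flag_bundle_def flag_pt_def by (rule assoc_pt_continuous[OF P_flag_top])

lemma \<beta>_continuous: "continuous_map (total Q) ADE \<beta>"
  unfolding adjoint_orbit_bundle_def
  by (rule assoc_pt_continuous) (auto simp: Ad_orbit_def intro!: image_eqI[of _ _ \<one>])

lemma continuous_rmult: "g \<in> carrier G \<Longrightarrow> continuous_map (topol G) (topol G) (\<lambda>x. x \<otimes> g)"
  using continuous_map_compose[OF continuous_map_pairedI continuous_mult, of "topol G" "\<lambda>x. x" "\<lambda>x. g"]
  by (simp add: comp_def)

text \<open>The saturation of an open set is the union of its right translates by
  \<open>P\<close>.\<close>

lemma flag_open_map: "open_map (topol G) (flag_top G) (\<lambda>g. g <# P)"
  unfolding open_map_def flag_top_def openin_quotient_top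
proof (intro allI impI conjI)
  fix N assume N: "openin (topol G) N"
  have NG: "N \<subseteq> carrier G" using openin_subset[OF N] by simp
  then show "(\<lambda>g. g <# P) ` N \<subseteq> (\<lambda>g. g <# P) ` topspace (topol G)" by auto
  have "openin (topol G) (\<Union>j\<in>P. {g \<in> topspace (topol G). g \<otimes> j \<in> N})"
  proof (rule openin_Union, elim imageE)
    fix W j assume "j \<in> P" "W = {g \<in> topspace (topol G). g \<otimes> j \<in> N}"
    then show "openin (topol G) W" using openin_continuous_map_preimage[OF continuous_rmult[OF P_closed] N] by blast
  qed
  moreover have "(\<Union>j\<in>P. {g \<in> topspace (topol G). g \<otimes> j \<in> N}) = {x \<in> topspace (topol G). x <# P \<in> (\<lambda>g. g <# P) ` N}"
  proof (intro equalityI subsetI)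
    fix g assume "g \<in> (\<Union>j\<in>P. {g \<in> topspace (topol G). g \<otimes> j \<in> N})"
    then obtain j where j: "j \<in> P" "g \<in> carrier G" "g \<otimes> j \<in> N" by auto
    have "(g \<otimes> j) <# P = g <# (j <# P)" using lcos_m_assoc[OF P_sub j(2) P_closed[OF j(1)]] by simp
    also have "j <# P = P" using coset_eq_P[OF P_closed[OF j(1)]] j(1) by simp
    finally show "g \<in> {x \<in> topspace (topol G). x <# P \<in> (\<lambda>g. g <# P) ` N}" using j by (auto intro!: image_eqI[of _ _ "g \<otimes> j"])
  next
    fix g assume "g \<in> {x \<in> topspace (topol G). x <# P \<in> (\<lambda>g. g <# P) ` N}"
    then obtain n where n: "g \<in> carrier G" "n \<in> N" "g <# P = n <# P" by auto
    have "n \<in> n <# P" unfolding l_coset_def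
      using subgroup.one_closed[OF P_subgroup] n(2) NG by (force intro!: bexI[of _ \<one>])
    then have "n \<in> g <# P" using n(3) by simp
    then obtain j where "j \<in> P" "n = g \<otimes> j" unfolding l_coset_def by blast
    then show "g \<in> (\<Union>j\<in>P. {g \<in> topspace (topol G). g \<otimes> j \<in> N})" using n by auto
  qed
  ultimately show "openin (topol G) {x \<in> topspace (topol G). x <# P \<in> (\<lambda>g. g <# P) ` N}" by simp
qed

text \<open>The bundle topology is a quotient of \<open>Q\<close> times the flag manifold, so
  openness is checked there. The preimage of the image of \<open>N\<close> is itself the image,
  under the open map that sends \<open>g\<close> to its coset, of the open set of pairs with
  \<open>p \<triangleleft> g\<close> in \<open>N\<close>.\<close>

lemma q_open: "open_map (total Q) FE q"
  unfolding open_map_def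
proof (intro allI impI)
  fix N assume N: "openin (total Q) N"
  have NE: "N \<subseteq> E" by (rule openin_subset[OF N])
  let ?W = "{z \<in> topspace (prod_topology (total Q) (topol G)). (\<lambda>(p, g). p \<triangleleft> g) z \<in> N}"
  have "openin (prod_topology (total Q) (topol G)) ?W"
    by (rule openin_continuous_map_preimage[OF bundle_parts(1) N])
  then have o: "openin (prod_topology (total Q) (flag_top G)) ((\<lambda>(p, g). (p, g <# P)) ` ?W)"
    using open_map_prod_right[OF flag_open_map] unfolding open_map_def by blast
  have "(\<lambda>(p, g). (p, g <# P)) ` ?W =
      {(p, f). p \<in> E \<and> f \<in> topspace (flag_top G) \<and> assoc_pt G Q (\<lambda>g b. g <# b) p f \<in> q ` N}"
  proof (intro equalityI subsetI)
    fix z assume "z \<in> (\<lambda>(p, g). (p, g <# P)) ` ?W"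
    then obtain p g where pg: "z = (p, g <# P)" "p \<in> E" "g \<in> carrier G" "p \<triangleleft> g \<in> N" by auto
    have "assoc_pt G Q (\<lambda>g b. g <# b) p (g <# P) = q (p \<triangleleft> g)"
      unfolding flag_pt_def using assoc_shift[OF orbital_flag pg(2,3)] by simp
    then show "z \<in> {(p, f). p \<in> E \<and> f \<in> topspace (flag_top G) \<and> assoc_pt G Q (\<lambda>g b. g <# b) p f \<in> q ` N}"
      using pg by (auto simp: topspace_flag_top)
  next
    fix z assume "z \<in> {(p, f). p \<in> E \<and> f \<in> topspace (flag_top G) \<and> assoc_pt G Q (\<lambda>g b. g <# b) p f \<in> q ` N}"
    then obtain p g n where pg: "z = (p, g <# P)" "p \<in> E" "g \<in> carrier G" "n \<in> N"
      "assoc_pt G Q (\<lambda>g b. g <# b) p (g <# P) = q n" unfolding topspace_flag_top by auto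
    have "q (p \<triangleleft> g) = q n"
      using pg(5) assoc_shift[OF orbital_flag pg(2,3)] unfolding flag_pt_def by simp
    then obtain j where j: "j \<in> P" "n = p \<triangleleft> g \<triangleleft> j" using q_eq_iff[of "p \<triangleleft> g" n] pg NE by auto
    then have "p \<triangleleft> (g \<otimes> j) \<in> N" using act_mult[OF pg(2,3) P_closed[OF j(1)]] pg(4) by simp
    moreover have "(g \<otimes> j) <# P = g <# P"
      using lcos_m_assoc[OF P_sub pg(3) P_closed[OF j(1)]] coset_eq_P[OF P_closed[OF j(1)]] j(1) by simp
    ultimately show "z \<in> (\<lambda>(p, g). (p, g <# P)) ` ?W"
      using pg P_closed[OF j(1)] by (intro image_eqI[of _ _ "(p, g \<otimes> j)"]) auto
  qed
  then show "openin FE (q ` N)"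
    using o topspace_FE NE unfolding flag_bundle_def openin_assoc_top by auto
qed

end

lemma Hausdorff_open_map_image:
  assumes f: "open_map X Y f" "f ` topspace X = topspace Y"
    and sep: "\<And>x y. x \<in> topspace X \<Longrightarrow> y \<in> topspace X \<Longrightarrow> f x \<noteq> f y \<Longrightarrow>
      \<exists>A B. openin X A \<and> openin X B \<and> x \<in> A \<and> y \<in> B \<and> (\<forall>a\<in>A. \<forall>b\<in>B. f a \<noteq> f b)"
  shows "Hausdorff_space Y"
  unfolding Hausdorff_space_def
proof (intro allI impI)
  fix u v assume uv: "u \<in> topspace Y \<and> v \<in> topspace Y \<and> u \<noteq> v"
  then obtain x y where xy: "x \<in> topspace X" "y \<in> topspace X" "u = f x" "v = f y" using f(2) by (metis imageE)
  then obtain A B where AB: "openin X A" "openin X B" "x \<in> A" "y \<in> B" "\<forall>a\<in>A. \<forall>b\<in>B. f a \<noteq> f b"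
    using sep[OF xy(1,2)] uv by blast
  show "\<exists>U V. openin Y U \<and> openin Y V \<and> u \<in> U \<and> v \<in> V \<and> disjnt U V"
  proof (intro exI conjI)
    show "openin Y (f ` A)" "openin Y (f ` B)" using f(1) AB unfolding open_map_def by blast+
    show "disjnt (f ` A) (f ` B)" using AB(5) unfolding disjnt_def by blast
  qed (use AB xy in auto)
qed

text \<open>At points outside \<open>U\<close> the product is controlled by \<open>r\<close>, which
  is continuous and vanishes there, while \<open>g\<close> is bounded. The bound 2 is the one used
  for \<open>arctan\<close>.\<close>

lemma continuous_map_extend_zero:
  assumes U: "openin X U" and g: "continuous_map (subtopology X U) euclideanreal g"
    and bd: "\<And>x. x \<in> U \<Longrightarrow> \<bar>g x\<bar> \<le> 2" and r: "continuous_map X euclideanreal r"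
    and r0: "\<And>x. x \<in> topspace X \<Longrightarrow> x \<notin> U \<Longrightarrow> r x = 0"
  shows "continuous_map X euclideanreal (\<lambda>x. if x \<in> U then r x * g x else 0)" (is "continuous_map X _ ?h")
  unfolding continuous_map
proof (intro conjI allI impI)
  show "?h ` topspace X \<subseteq> topspace euclideanreal" by simp
  fix W :: "real set" assume W: "openin euclideanreal W"
  have UX: "U \<subseteq> topspace X" by (rule openin_subset[OF U])
  show "openin X {x \<in> topspace X. ?h x \<in> W}"
  proof (subst openin_subopen, intro ballI)
    fix x assume x: "x \<in> {x \<in> topspace X. ?h x \<in> W}"
    show "\<exists>T. openin X T \<and> x \<in> T \<and> T \<subseteq> {x \<in> topspace X. ?h x \<in> W}"
    proof (cases "x \<in> U")
      case True
      have "continuous_map (subtopology X U) euclideanreal (\<lambda>x. r x * g x)"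
        by (intro continuous_map_real_mult g continuous_map_from_subtopology[OF r])
      from openin_continuous_map_preimage[OF this W]
      have "openin (subtopology X U) {x \<in> topspace (subtopology X U). r x * g x \<in> W}" .
      then have "openin X {x \<in> topspace (subtopology X U). r x * g x \<in> W}" using U openin_trans_full by blast
      then show ?thesis using x True by (intro exI[of _ "{x \<in> topspace (subtopology X U). r x * g x \<in> W}"]) auto
    next
      case False
      then have "0 \<in> W" using x by simp
      then obtain e where e: "0 < e" "ball 0 e \<subseteq> W" using W open_contains_ball by (metis open_openin)
      have o: "openin X {y \<in> topspace X. r y \<in> ball 0 (e / 2)}"
        by (rule openin_continuous_map_preimage[OF r]) simp
      have "?h y \<in> W" if y: "y \<in> topspace X" "r y \<in> ball 0 (e / 2)" for y
      proof (cases "y \<in> U")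
        case True
        have "\<bar>r y * g y\<bar> \<le> \<bar>r y\<bar> * 2" unfolding abs_mult using bd[OF True] by (intro mult_left_mono) auto
        also have "\<dots> < e" using y(2) by simp
        finally show ?thesis using e(2) True by (auto simp: subset_iff)
      qed (use \<open>0 \<in> W\<close> in simp)
      then have "{y \<in> topspace X. r y \<in> ball 0 (e / 2)} \<subseteq> {x \<in> topspace X. ?h x \<in> W}" by blast
      moreover have "x \<in> {y \<in> topspace X. r y \<in> ball 0 (e / 2)}" using x False r0 e(1) by simp
      ultimately show ?thesis using o by blast
    qed
  qed
qed

context pbundle
begin

lemma sep_base:
  assumes H: "Hausdorff_space (base Q)" and p: "p \<in> E" "p' \<in> E" "proj Q p \<noteq> proj Q p'"
  obtains U V where "openin (base Q) U" "openin (base Q) V" "proj Q p \<in> U" "proj Q p' \<in> V" "U \<inter> V = {}"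
proof -
  have "\<exists>U V. openin (base Q) U \<and> openin (base Q) V \<and> proj Q p \<in> U \<and> proj Q p' \<in> V \<and> disjnt U V"
    using H[unfolded Hausdorff_space_def, rule_format, of "proj Q p" "proj Q p'"] p by simp
  then show ?thesis unfolding disjnt_def by (elim exE conjE) (rule that)
qed

end

section \<open>Separation properties of the flag bundle and the adjoint orbit bundle\<close>

context flagb
begin

lemma base_Hausdorff: "Hausdorff_space (base Q)" by (rule metrizable_imp_Hausdorff_space[OF base_metrizable])

lemma base_second_countable: "second_countable (base Q)"
  by (rule compact_metrizable_second_countable[OF base_compact base_metrizable])

lemma q_act: "p \<in> E \<Longrightarrow> j \<in> P \<Longrightarrow> q (p \<triangleleft> j) = q p"
  using q_eq_iff[of p "p \<triangleleft> j"] P_closed[of j] by auto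

lemma q_image: "q ` E = topspace FE" by (simp add: topspace_FE)

lemma q_quotient: "quotient_map (total Q) FE q"
  by (rule continuous_open_imp_quotient_map[OF q_continuous q_open q_image])

lemma FE_second_countable: "second_countable FE"
  by (rule second_countable_open_map_image[OF q_continuous q_open q_image
        second_countable_total[OF base_compact base_second_countable second_countable_G]])

text \<open>Points over different base points are separated in the base. Over one trivialising set,
  \<open>q a = q b\<close> forces \<open>inv (\<tau> a) \<otimes> \<tau> b\<close> into
  \<open>P\<close>, and \<open>P\<close> is closed.\<close>

lemma FE_Hausdorff: "Hausdorff_space FE"
proof (rule Hausdorff_open_map_image[OF q_open q_image])
  fix p p' assume p: "p \<in> E" "p' \<in> E" "q p \<noteq> q p'"
  show "\<exists>A B. openin (total Q) A \<and> openin (total Q) B \<and> p \<in> A \<and> p' \<in> B \<and> (\<forall>a\<in>A. \<forall>b\<in>B. q a \<noteq> q b)"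
  proof (cases "proj Q p = proj Q p'")
    case False
    obtain U V where UV: "openin (base Q) U" "openin (base Q) V" "proj Q p \<in> U" "proj Q p' \<in> V" "U \<inter> V = {}"
      by (rule sep_base[OF base_Hausdorff p(1,2) False])
    have "q a \<noteq> q b" if "a \<in> E" "b \<in> E" "proj Q a \<in> U" "proj Q b \<in> V" for a b
      using that q_eq_iff[of a b] proj_act[OF _ P_closed] UV(5) by fastforce
    then show ?thesis using openin_over[OF UV(1)] openin_over[OF UV(2)] UV(3,4) p
      by (intro exI[of _ "{p \<in> E. proj Q p \<in> U}"] exI[of _ "{p \<in> E. proj Q p \<in> V}"]) auto
  next
    case True
    obtain U \<tau> \<sigma> where t: "triv U \<tau> \<sigma>" "proj Q p \<in> U" by (rule triv_exists[OF proj_closed[OF p(1)]])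
    note tc = trivD(8)[OF t(1)]
    let ?U = "{p \<in> E. proj Q p \<in> U}" let ?S = "subtopology (total Q) ?U"
    have c1: "continuous_map (prod_topology ?S ?S) (topol G) (\<lambda>z. inv (\<tau> (fst z)))"
      using continuous_map_compose[OF continuous_map_compose[OF continuous_map_fst trivD(2)[OF t(1)]] continuous_inv]
      by (simp add: comp_def)
    have c2: "continuous_map (prod_topology ?S ?S) (topol G) (\<lambda>z. \<tau> (snd z))"
      using continuous_map_compose[OF continuous_map_snd trivD(2)[OF t(1)]] by (simp add: comp_def)
    have c: "continuous_map (prod_topology ?S ?S) (topol G) (\<lambda>z. inv (\<tau> (fst z)) \<otimes> \<tau> (snd z))"
      using continuous_map_compose[OF continuous_map_pairedI[OF c1 c2] continuous_mult] by (simp add: comp_def)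
    have "openin (topol G) (topspace (topol G) - P)" using P_closedin by blast
    from openin_continuous_map_preimage[OF c this]
    have o: "openin (prod_topology ?S ?S) {z \<in> topspace (prod_topology ?S ?S). inv (\<tau> (fst z)) \<otimes> \<tau> (snd z) \<in> topspace (topol G) - P}" .
    have "inv (\<tau> p) \<otimes> \<tau> p' \<notin> P"
    proof
      assume j: "inv (\<tau> p) \<otimes> \<tau> p' \<in> P"
      have "p' = \<sigma> (proj Q p) \<triangleleft> (\<tau> p \<otimes> (inv (\<tau> p) \<otimes> \<tau> p'))"
        using trivD(9)[OF t(1) p(2)] True t(2) tc p by simp
      also have "\<dots> = p \<triangleleft> (inv (\<tau> p) \<otimes> \<tau> p')"
        using act_mult[OF trivD(4)[OF t] tc[OF p(1) t(2)], of "inv (\<tau> p) \<otimes> \<tau> p'"] trivD(9)[OF t(1) p(1) t(2)] tc p True t(2) by simp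
      finally show False using p q_act[OF p(1) j] by simp
    qed
    then have "(p, p') \<in> {z \<in> topspace (prod_topology ?S ?S). inv (\<tau> (fst z)) \<otimes> \<tau> (snd z) \<in> topspace (topol G) - P}"
      using p t(2) True tc by auto
    then obtain A B where AB: "openin ?S A" "openin ?S B" "p \<in> A" "p' \<in> B"
      "A \<times> B \<subseteq> {z \<in> topspace (prod_topology ?S ?S). inv (\<tau> (fst z)) \<otimes> \<tau> (snd z) \<in> topspace (topol G) - P}"
      using o unfolding openin_prod_topology_alt by meson
    have oo: "openin (total Q) ?U" by (rule openin_over[OF trivD(1)[OF t(1)]])
    have "q a \<noteq> q b" if ab: "a \<in> A" "b \<in> B" for a b
    proof
      assume e: "q a = q b"
      have ab': "a \<in> E" "proj Q a \<in> U" "b \<in> E" "inv (\<tau> a) \<otimes> \<tau> b \<notin> P" using ab AB(5) by auto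
      obtain j where j: "j \<in> P" "b = a \<triangleleft> j" using e q_eq_iff[OF ab'(1,3)] by blast
      have "\<tau> b = \<tau> a \<otimes> j" using triv_act[OF t(1) ab'(1,2) P_closed[OF j(1)]] j(2) by simp
      then show False using ab'(4) tc[OF ab'(1,2)] P_closed[OF j(1)] j(1) by simp
    qed
    moreover have "openin (total Q) A" "openin (total Q) B" using AB(1,2) oo openin_trans_full by blast+
    ultimately show ?thesis using AB(3,4) by blast
  qed
qed

text \<open>The base point and the vector \<open>Ad G (\<tau> p) H\<close> are coordinates on the
  adjoint orbit bundle; separation of points and the functions that detect fibres are expressed in
  them.\<close>

lemma \<beta>_triv:
  assumes t: "triv U \<tau> \<sigma>" and p: "p \<in> E" "p' \<in> E" "proj Q p \<in> U"
  shows "\<beta> p = \<beta> p' \<longleftrightarrow> proj Q p = proj Q p' \<and> Ad G (\<tau> p) H = Ad G (\<tau> p') H"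
proof
  assume "\<beta> p = \<beta> p'"
  then obtain z where z: "z \<in> carrier G" "Ad G z H = H" "p' = p \<triangleleft> z"
    using \<beta>_eq_iff[OF p(1,2)] unfolding Z_of_def by blast
  then show "proj Q p = proj Q p' \<and> Ad G (\<tau> p) H = Ad G (\<tau> p') H"
    using triv_act[OF t p(1,3) z(1)] trivD(8)[OF t p(1,3)] p(1) by (simp add: Ad_mult)
next
  assume a: "proj Q p = proj Q p' \<and> Ad G (\<tau> p) H = Ad G (\<tau> p') H"
  obtain z where z: "z \<in> carrier G" "p' = p \<triangleleft> z" by (rule fibre_transitive[OF p(1,2)]) (use a in auto)
  have c: "\<tau> p \<in> carrier G" by (rule trivD(8)[OF t p(1,3)])
  have "Ad G (\<tau> p) H = Ad G (\<tau> p) (Ad G z H)"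
    using a triv_act[OF t p(1,3) z(1)] z c by (simp add: Ad_mult)
  then have "Ad G (inv (\<tau> p)) (Ad G (\<tau> p) H) = Ad G (inv (\<tau> p)) (Ad G (\<tau> p) (Ad G z H))" by simp
  then have "H = Ad G z H" using c by simp
  then show "\<beta> p = \<beta> p'" using \<beta>_eq_iff[OF p(1,2)] z unfolding Z_of_def by auto
qed

lemma Ad_triv_continuous:
  assumes t: "triv U \<tau> \<sigma>"
  shows "continuous_map (subtopology (total Q) {p \<in> E. proj Q p \<in> U}) euclidean (\<lambda>p. Ad G (\<tau> p) H)"
  using continuous_map_compose[OF trivD(2)[OF t] Ad_continuous1[of H]] by (simp add: comp_def)

text \<open>The orbit carries the topology of the vector space rather than that of a quotient of the
  group, so openness of \<open>\<beta>\<close> is not relied upon. Sets cut out by the coordinate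
  \<open>Ad G (\<tau> p) H\<close> are enough to separate points.\<close>

lemma ADE_open:
  assumes t: "triv U \<tau> \<sigma>" and W: "open W"
  shows "openin ADE (\<beta> ` {p \<in> E. proj Q p \<in> U \<and> Ad G (\<tau> p) H \<in> W})"
proof -
  let ?U = "{p \<in> E. proj Q p \<in> U}"
  let ?F = "top_of_set (Ad_orbit G H)"
  let ?X = "prod_topology (subtopology (total Q) ?U) ?F"
  let ?A = "\<beta> ` {p \<in> E. proj Q p \<in> U \<and> Ad G (\<tau> p) H \<in> W}"
  have "continuous_map ?X (prod_topology (topol G) euclidean) (\<lambda>z. (\<tau> (fst z), snd z))"
    by (intro continuous_map_pairedI continuous_map_compose[OF continuous_map_fst trivD(2)[OF t], unfolded comp_def])
      (rule continuous_map_into_fulltopology[OF continuous_map_snd])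
  from continuous_map_compose[OF this Ad_continuous]
  have "continuous_map ?X euclidean (\<lambda>z. Ad G (\<tau> (fst z)) (snd z))" by (simp add: comp_def)
  then have o1: "openin ?X {z \<in> topspace ?X. Ad G (\<tau> (fst z)) (snd z) \<in> W}"
    by (rule openin_continuous_map_preimage) (use W in simp)
  have X: "?X = subtopology (prod_topology (total Q) ?F) (?U \<times> topspace ?F)"
    by (rule prod_topology_subtopology(1))
  have o2: "openin (prod_topology (total Q) ?F) (?U \<times> topspace ?F)"
    using openin_over[OF trivD(1)[OF t]] unfolding openin_prod_Times_iff by blast
  have "openin (subtopology (prod_topology (total Q) ?F) (?U \<times> topspace ?F)) {z \<in> topspace ?X. Ad G (\<tau> (fst z)) (snd z) \<in> W}"
    using o1 by (subst X[symmetric])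
  from openin_trans_full[OF this o2]
  have o: "openin (prod_topology (total Q) ?F) {z \<in> topspace ?X. Ad G (\<tau> (fst z)) (snd z) \<in> W}" .
  have "{z \<in> topspace ?X. Ad G (\<tau> (fst z)) (snd z) \<in> W} =
     {(p, f). p \<in> E \<and> f \<in> topspace ?F \<and> assoc_pt G Q (Ad G) p f \<in> ?A}"
  proof (intro equalityI subsetI)
    fix z assume z: "z \<in> {z \<in> topspace ?X. Ad G (\<tau> (fst z)) (snd z) \<in> W}"
    then obtain g where g: "g \<in> carrier G" "snd z = Ad G g H" by (auto simp: Ad_orbit_def)
    have p: "fst z \<in> E" "proj Q (fst z) \<in> U" using z by auto
    have "assoc_pt G Q (Ad G) (fst z) (snd z) = \<beta> (fst z \<triangleleft> g)"
      unfolding g(2) by (rule assoc_shift[OF orbital_Ad p(1) g(1)])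
    moreover have "Ad G (\<tau> (fst z \<triangleleft> g)) H \<in> W"
      using z triv_act[OF t p g(1)] g trivD(8)[OF t p] by (simp add: Ad_mult)
    ultimately have "assoc_pt G Q (Ad G) (fst z) (snd z) \<in> ?A" using p g by auto
    then show "z \<in> {(p, f). p \<in> E \<and> f \<in> topspace ?F \<and> assoc_pt G Q (Ad G) p f \<in> ?A}"
      using z by (auto simp: case_prod_beta)
  next
    fix z assume "z \<in> {(p, f). p \<in> E \<and> f \<in> topspace ?F \<and> assoc_pt G Q (Ad G) p f \<in> ?A}"
    then obtain p g p' where z: "z = (p, Ad G g H)" "p \<in> E" "g \<in> carrier G" "p' \<in> E" "proj Q p' \<in> U" "Ad G (\<tau> p') H \<in> W"
       "assoc_pt G Q (Ad G) p (Ad G g H) = \<beta> p'" unfolding Ad_orbit_def by auto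
    have "\<beta> p' = \<beta> (p \<triangleleft> g)" using z(7) assoc_shift[OF orbital_Ad z(2,3)] by simp
    then have "proj Q p' = proj Q (p \<triangleleft> g) \<and> Ad G (\<tau> p') H = Ad G (\<tau> (p \<triangleleft> g)) H"
      using \<beta>_triv[OF t z(4) _ z(5)] z(2,3) by simp
    then have "proj Q p \<in> U" "Ad G (\<tau> p) (Ad G g H) \<in> W"
      using z triv_act[OF t z(2) _ z(3)] trivD(8)[OF t z(2)] by (simp_all add: Ad_mult)
    then show "z \<in> {z \<in> topspace ?X. Ad G (\<tau> (fst z)) (snd z) \<in> W}"
      using z by (auto simp: Ad_orbit_def)
  qed
  with o have "openin (prod_topology (total Q) ?F) {(p, f). p \<in> E \<and> f \<in> topspace ?F \<and> assoc_pt G Q (Ad G) p f \<in> ?A}" by simp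
  moreover have "?A \<subseteq> topspace ADE" unfolding topspace_ADE by blast
  ultimately show ?thesis unfolding adjoint_orbit_bundle_def openin_assoc_top by blast
qed

lemma ADE_Hausdorff: "Hausdorff_space ADE"
  unfolding Hausdorff_space_def
proof (intro allI impI)
  fix u v assume uv: "u \<in> topspace ADE \<and> v \<in> topspace ADE \<and> u \<noteq> v"
  then have uv': "u \<in> \<beta> ` E" "v \<in> \<beta> ` E" unfolding topspace_ADE by simp_all
  obtain p where p1: "u = \<beta> p" "p \<in> E" by (rule imageE[OF uv'(1)])
  obtain p' where p2: "v = \<beta> p'" "p' \<in> E" by (rule imageE[OF uv'(2)])
  note p = p1(2) p2(2) p1(1) p2(1)
  show "\<exists>U V. openin ADE U \<and> openin ADE V \<and> u \<in> U \<and> v \<in> V \<and> disjnt U V"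
  proof (cases "proj Q p = proj Q p'")
    case False
    obtain U V where UV: "openin (base Q) U" "openin (base Q) V" "proj Q p \<in> U" "proj Q p' \<in> V" "U \<inter> V = {}"
      by (rule sep_base[OF base_Hausdorff p(1,2) False])
    let ?O = "\<lambda>U. {\<xi> \<in> topspace ADE. assoc_proj Q \<xi> \<in> U}"
    have "openin ADE (?O U)" "openin ADE (?O V)"
      unfolding adjoint_orbit_bundle_def by (intro assoc_top_over UV)+
    moreover have "u \<in> ?O U" "v \<in> ?O V" using uv p UV(3,4) by (simp_all add: assoc_proj_pt)
    ultimately show ?thesis using UV(5) unfolding disjnt_def by blast
  next
    case True
    obtain U \<tau> \<sigma> where t: "triv U \<tau> \<sigma>" "proj Q p \<in> U" by (rule triv_exists[OF proj_closed[OF p(1)]])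
    have ne: "Ad G (\<tau> p) H \<noteq> Ad G (\<tau> p') H" using \<beta>_triv[OF t(1) p(1,2) t(2)] True p uv by simp
    from hausdorff[OF ne] obtain A B where AB: "open A" "open B" "Ad G (\<tau> p) H \<in> A" "Ad G (\<tau> p') H \<in> B" "A \<inter> B = {}"
      by (elim exE conjE)
    let ?O = "\<lambda>A. \<beta> ` {p \<in> E. proj Q p \<in> U \<and> Ad G (\<tau> p) H \<in> A}"
    have "openin ADE (?O A)" "openin ADE (?O B)" by (intro ADE_open[OF t(1)] AB)+
    moreover have "u \<in> ?O A" unfolding p(3) by (rule imageI) (use p t AB in simp)
    moreover have "v \<in> ?O B" unfolding p(4) by (rule imageI) (use p t True AB in simp)
    moreover have "disjnt (?O A) (?O B)"
      unfolding disjnt_iff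
    proof (intro allI notI, elim conjE imageE)
      fix \<xi> a b assume a: "\<xi> = \<beta> a" "a \<in> {p \<in> E. proj Q p \<in> U \<and> Ad G (\<tau> p) H \<in> A}"
        and b: "\<xi> = \<beta> b" "b \<in> {p \<in> E. proj Q p \<in> U \<and> Ad G (\<tau> p) H \<in> B}"
      have "Ad G (\<tau> a) H = Ad G (\<tau> b) H" using \<beta>_triv[OF t(1), of a b] a b by simp
      then show False using a(2) b(2) AB(5) by auto
    qed
    ultimately show ?thesis by blast
  qed
qed

lemma flag_proj_continuous: "continuous_map FE (base Q) (assoc_proj Q)"
proof (rule continuous_compose_quotient_map[OF q_quotient])
  show "continuous_map (total Q) (base Q) (assoc_proj Q \<circ> q)"
    by (rule continuous_map_eq[OF bundle_parts(4)]) (simp add: flag_pt_def assoc_proj_pt)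
qed

end

section \<open>The Iwasawa cocycle\<close>

locale cocyc = flagb G Q H for G :: "('g, 'l::euclidean_space, 'm) cartan_data_scheme" (structure)
    and Q :: "('x, 'q, 'g) bundle_data" and H :: 'l +
  fixes \<phi> :: "'q \<Rightarrow> 'q" and R :: "'q set" and aE :: "nat \<Rightarrow> ('q \<times> 'g set) set \<Rightarrow> 'l"
  assumes aut: "bundle_automorphism G Q \<phi>" and R: "K_subbundle G Q R" and aE: "iwasawa_cocycle G Q \<phi> R aE"
begin

lemma \<phi>_continuous: "continuous_map (total Q) (total Q) \<phi>"
  using aut unfolding bundle_automorphism_def by (blast intro: homeomorphic_imp_continuous_map)

lemma \<phi>_act: "p \<in> E \<Longrightarrow> g \<in> carrier G \<Longrightarrow> \<phi> (p \<triangleleft> g) = \<phi> p \<triangleleft> g"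
  using aut unfolding bundle_automorphism_def by simp

lemma \<phi>_closed[simp]: "p \<in> E \<Longrightarrow> \<phi> p \<in> E"
  using continuous_map_image_subset_topspace[OF \<phi>_continuous] by blast

text \<open>\<open>base_map\<close> uses an arbitrary frame over the point; equivariance of
  \<open>\<phi>\<close> and transitivity on fibres make the choice irrelevant.\<close>

lemma proj_\<phi>: assumes p: "p \<in> E" shows "proj Q (\<phi> p) = base_map Q \<phi> (proj Q p)"
proof -
  let ?p = "SOME p'. p' \<in> E \<and> proj Q p' = proj Q p"
  have s: "?p \<in> E \<and> proj Q ?p = proj Q p" by (rule someI[of _ p]) (use p in simp)
  obtain g where g: "g \<in> carrier G" "?p = p \<triangleleft> g" by (rule fibre_transitive[OF p, of ?p]) (use s in auto)
  have "proj Q (\<phi> ?p) = proj Q (\<phi> p)" unfolding g(2) \<phi>_act[OF p g(1)] by (rule proj_act) (use p g in auto)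
  then show ?thesis unfolding base_map_def by simp
qed

lemma funpow_\<phi>: "p \<in> E \<Longrightarrow> (\<phi> ^^ n) p \<in> E"
  by (induction n) auto

lemma funpow_\<phi>_act: "p \<in> E \<Longrightarrow> g \<in> carrier G \<Longrightarrow> (\<phi> ^^ n) (p \<triangleleft> g) = (\<phi> ^^ n) p \<triangleleft> g"
  by (induction n) (auto simp: \<phi>_act funpow_\<phi>)

lemma assoc_map_q: "p \<in> E \<Longrightarrow> assoc_map \<phi> (q p) = q (\<phi> p)"
  unfolding flag_pt_def by (rule assoc_map_pt) (auto simp: \<phi>_act)

lemma assoc_map_\<beta>: "p \<in> E \<Longrightarrow> assoc_map \<phi> (\<beta> p) = \<beta> (\<phi> p)"
  by (rule assoc_map_pt) (auto simp: \<phi>_act)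

lemma assoc_map_continuous: "continuous_map FE FE (assoc_map \<phi>)"
proof (rule continuous_compose_quotient_map[OF q_quotient])
  show "continuous_map (total Q) FE (assoc_map \<phi> \<circ> q)"
    by (rule continuous_map_eq[OF continuous_map_compose[OF \<phi>_continuous q_continuous]]) (simp add: assoc_map_q)
qed

sublocale RB: pbundle "G\<lparr>carrier := grp_K G\<rparr>" "subtopology (topol G) (grp_K G)" "Q\<lparr>total := subtopology (total Q) R\<rparr>"
proof -
  have K: "group (G\<lparr>carrier := grp_K G\<rparr>)" by (rule subgroup.subgroup_is_group[OF K_subgroup]) (rule group_axioms)
  have "continuous_map (prod_topology (subtopology (topol G) (grp_K G)) (subtopology (topol G) (grp_K G)))
      (topol G) (\<lambda>(x, y). x \<otimes> y)"
    unfolding subtopology_Times[symmetric] by (rule continuous_map_from_subtopology[OF continuous_mult])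
  then have m: "continuous_map (prod_topology (subtopology (topol G) (grp_K G)) (subtopology (topol G) (grp_K G)))
      (subtopology (topol G) (grp_K G)) (\<lambda>(x, y). x \<otimes> y)"
    by (rule continuous_map_into_subtopology) (auto intro: subgroup.m_closed[OF K_subgroup])
  have "continuous_map (subtopology (topol G) (grp_K G)) (subtopology (topol G) (grp_K G)) (\<lambda>x. inv x)"
    by (rule continuous_map_into_subtopology[OF continuous_map_from_subtopology[OF continuous_inv]]) (auto intro: K_inv)
  then have i: "continuous_map (subtopology (topol G) (grp_K G)) (subtopology (topol G) (grp_K G)) (\<lambda>x. inv\<^bsub>G\<lparr>carrier := grp_K G\<rparr>\<^esub> x)"
    by (rule continuous_map_eq) (use K_sub in \<open>auto simp: m_inv_consistent[OF K_subgroup]\<close>)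
  show "pbundle (G\<lparr>carrier := grp_K G\<rparr>) (subtopology (topol G) (grp_K G)) (Q\<lparr>total := subtopology (total Q) R\<rparr>)"
    by (intro pbundle.intro K pbundle_axioms.intro)
      (use R m i K_sub Hausdorff_space_subtopology[OF Hausdorff_G] in \<open>auto simp: K_subbundle_def Int_absorb1\<close>)
qed

lemma R_sub: "R \<subseteq> E" using R unfolding K_subbundle_def by blast

lemma R_surj: assumes "x \<in> topspace (base Q)" obtains r where "r \<in> R" "proj Q r = x"
  using RB.proj_surj[of x] assms by auto

lemma R_act: "r \<in> R \<Longrightarrow> k \<in> grp_K G \<Longrightarrow> r \<triangleleft> k \<in> R"
  using RB.act_closed[of r k] R_sub by auto

lemma R_transitive: assumes "r \<in> R" "r' \<in> R" "proj Q r = proj Q r'" obtains k where "k \<in> grp_K G" "r' = r \<triangleleft> k"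
  using RB.fibre_transitive[of r r'] assms R_sub by (simp add: subset_iff) blast

lemma R_compact: "compactin (total Q) R"
proof -
  have "compact_space (total (Q\<lparr>total := subtopology (total Q) R\<rparr>))"
    by (rule RB.compact_total) (use base_compact base_Hausdorff K_compact in \<open>auto simp: compactin_subtopology\<close>)
  then show ?thesis using R_sub by (simp add: compact_space_subtopology compactin_subspace)
qed

definition iwaH :: "'g \<Rightarrow> 'l" where
  "iwaH g = (THE A. A \<in> aa G \<and> (\<exists>k\<in>grp_K G. \<exists>n\<in>grp_N G. g = k \<otimes> expo G A \<otimes> n))"

lemma iwaH_eq:
  assumes "k \<in> grp_K G" "A \<in> aa G" "n \<in> grp_N G" shows "iwaH (k \<otimes> expo G A \<otimes> n) = A"
  unfolding iwaH_def using iwasawa_unique assms by (intro the_equality) blast+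

text \<open>\<open>iwaH\<close> is the middle component of the inverse of the Iwasawa
  homeomorphism.\<close>

lemma iwaH_continuous: "continuous_map (topol G) euclidean iwaH"
proof -
  let ?X = "prod_topology (subtopology (topol G) (grp_K G)) (prod_topology (top_of_set (aa G)) (subtopology (topol G) (grp_N G)))"
  obtain f where f: "homeomorphic_maps ?X (topol G) (\<lambda>(k, A, n). k \<otimes> expo G A \<otimes> n) f"
    using iwasawa(3) unfolding homeomorphic_map_maps by blast
  then have fc: "continuous_map (topol G) ?X f" and ff: "\<And>g. g \<in> carrier G \<Longrightarrow> (\<lambda>(k, A, n). k \<otimes> expo G A \<otimes> n) (f g) = g"
    unfolding homeomorphic_maps_def by auto
  have "continuous_map (topol G) (top_of_set (aa G)) (\<lambda>g. fst (snd (f g)))"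
    using continuous_map_compose[OF fc continuous_map_compose[OF continuous_map_snd continuous_map_fst]] by (simp add: comp_def)
  then have "continuous_map (topol G) euclidean (\<lambda>g. fst (snd (f g)))" by (rule continuous_map_into_fulltopology)
  then show ?thesis
  proof (rule continuous_map_eq)
    fix g assume g: "g \<in> topspace (topol G)"
    obtain k A n where kAn: "f g = (k, A, n)" by (cases "f g")
    have "f g \<in> topspace ?X" using continuous_map_image_subset_topspace[OF fc] g by blast
    then have "k \<in> grp_K G" "A \<in> aa G" "n \<in> grp_N G" using kAn by auto
    then show "fst (snd (f g)) = iwaH g" using iwaH_eq[of k A n] ff[of g] g kAn by simp
  qed
qed

text \<open>A potential on \<open>Q\<close>: the Iwasawa component of a frame relative to
  \<open>R\<close>. The cocycle is its increment along the flow, which makes additivity immediate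
  and reduces continuity to that of \<open>aQ\<close>.\<close>

definition aQ :: "'q \<Rightarrow> 'l" where
  "aQ p = (THE A. A \<in> aa G \<and> (\<exists>r\<in>R. \<exists>n\<in>grp_N G. p = r \<triangleleft> (expo G A \<otimes> n)))"

lemma R_iwasawa:
  assumes p: "p \<in> E" obtains r A n where "r \<in> R" "A \<in> aa G" "n \<in> grp_N G" "p = r \<triangleleft> (expo G A \<otimes> n)"
proof -
  obtain r where r: "r \<in> R" "proj Q r = proj Q p" by (rule R_surj[OF proj_closed[OF p]])
  have rE: "r \<in> E" using r(1) R_sub by blast
  obtain g where g: "g \<in> carrier G" "p = r \<triangleleft> g" by (rule fibre_transitive[OF rE p r(2)])
  obtain k A n where k: "k \<in> grp_K G" "A \<in> aa G" "n \<in> grp_N G" "g = k \<otimes> expo G A \<otimes> n" by (rule iwasawa_exists[OF g(1)])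
  have "p = r \<triangleleft> k \<triangleleft> (expo G A \<otimes> n)"
    using act_mult[OF rE K_closed[OF k(1)], of "expo G A \<otimes> n"] k g N_closed[OF k(3)] K_closed[OF k(1)] by (simp add: m_assoc)
  then show ?thesis using that[OF R_act[OF r(1) k(1)] k(2,3)] by blast
qed

text \<open>Two frames of \<open>R\<close> in one fibre differ by an element of \<open>K\<close>,
  which the Iwasawa decomposition absorbs, so the choice of \<open>r\<close> does not
  matter.\<close>

lemma aQ_eq_iwaH:
  assumes r: "r \<in> R" and g: "g \<in> carrier G" shows "aQ (r \<triangleleft> g) = iwaH g"
proof -
  have rE: "r \<in> E" using r(1) R_sub by blast
  obtain k A n where k: "k \<in> grp_K G" "A \<in> aa G" "n \<in> grp_N G" "g = k \<otimes> expo G A \<otimes> n" by (rule iwasawa_exists[OF g])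
  note kc = K_closed[OF k(1)] N_closed[OF k(3)]
  have 1: "r \<triangleleft> g = r \<triangleleft> k \<triangleleft> (expo G A \<otimes> n)"
    using act_mult[OF rE K_closed[OF k(1)], of "expo G A \<otimes> n"] k kc by (simp add: m_assoc)
  have "aQ (r \<triangleleft> g) = A"
    unfolding aQ_def
  proof (rule the_equality)
    show "A \<in> aa G \<and> (\<exists>r'\<in>R. \<exists>n\<in>grp_N G. r \<triangleleft> g = r' \<triangleleft> (expo G A \<otimes> n))"
      using 1 k R_act[OF r k(1)] by blast
    fix A' assume "A' \<in> aa G \<and> (\<exists>r'\<in>R. \<exists>n\<in>grp_N G. r \<triangleleft> g = r' \<triangleleft> (expo G A' \<otimes> n))"
    then obtain r' n' where A': "A' \<in> aa G" "r' \<in> R" "n' \<in> grp_N G" "r \<triangleleft> g = r' \<triangleleft> (expo G A' \<otimes> n')" by blast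
    note n'c = N_closed[OF A'(3)]
    have r'E: "r' \<in> E" using A'(2) R_sub by blast
    have "proj Q r = proj Q (r \<triangleleft> g)" using proj_act[OF rE g] by simp
    also have "\<dots> = proj Q r'" unfolding A'(4) by (rule proj_act[OF r'E]) (use n'c in simp)
    finally obtain k' where k': "k' \<in> grp_K G" "r' = r \<triangleleft> k'" using R_transitive[OF r A'(2)] by metis
    note k'c = K_closed[OF k'(1)]
    have "r \<triangleleft> g = r \<triangleleft> (k' \<otimes> expo G A' \<otimes> n')"
      using A'(4) k'(2) act_mult[OF rE k'c, of "expo G A' \<otimes> n'"] n'c k'c by (simp add: m_assoc)
    then have g': "g = k' \<otimes> expo G A' \<otimes> n'" by (intro act_free[OF rE g]) (use n'c k'c in auto)
    show "A' = A" using iwasawa_unique[OF k'(1) A'(1,3) k(1-3) trans[OF g'[symmetric] k(4)]] by blast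
  qed
  then show ?thesis unfolding k(4) using iwaH_eq[OF k(1-3)] by simp
qed

lemma aQ_R: assumes "r \<in> R" shows "aQ r = 0"
proof -
  have "expo G 0 \<in> grp_N G" unfolding grp_N_def using subspace_0[OF nn_subspace] by blast
  moreover have "expo G 0 \<in> grp_K G" unfolding grp_K_def using subspace_0[OF subspaces(1)] by blast
  ultimately have "iwaH (\<one> \<otimes> expo G 0 \<otimes> \<one>) = 0"
    by (intro iwaH_eq) (use subspace_0[OF subspaces(3)] in auto)
  then show ?thesis using aQ_eq_iwaH[OF assms one_closed] R_sub assms by auto
qed

lemma aQ_act:
  assumes p: "p \<in> E" and A: "A \<in> aa G" "n \<in> grp_N G" shows "aQ (p \<triangleleft> (expo G A \<otimes> n)) = aQ p + A"
proof -
  obtain r B m where r: "r \<in> R" "B \<in> aa G" "m \<in> grp_N G" "p = r \<triangleleft> (expo G B \<otimes> m)" by (rule R_iwasawa[OF p])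
  have rE: "r \<in> E" using r(1) R_sub by blast
  note c = N_closed[OF A(2)] N_closed[OF r(3)]
  have K1: "\<one> \<in> grp_K G" by (rule subgroup.one_closed[OF K_subgroup])
  obtain l where l: "l \<in> grp_N G" "(expo G B \<otimes> m) \<otimes> (expo G A \<otimes> n) = expo G (B + A) \<otimes> l"
    using AN_mult[OF A(1) r(2) A(2) r(3)] by blast
  have 1: "aQ (r \<triangleleft> (expo G C \<otimes> l)) = C" if "C \<in> aa G" "l \<in> grp_N G" for C l
    using aQ_eq_iwaH[OF r(1), of "expo G C \<otimes> l"] iwaH_eq[OF K1 that] N_closed[OF that(2)] by simp
  have "p \<triangleleft> (expo G A \<otimes> n) = r \<triangleleft> ((expo G B \<otimes> m) \<otimes> (expo G A \<otimes> n))"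
    unfolding r(4) by (rule act_mult[OF rE, symmetric]) (use c in auto)
  then show ?thesis using l 1[OF subspace_add[OF subspaces(3) r(2) A(1)] l(1)] 1[OF r(2,3)] r(4) by simp
qed

lemma a_comp_aQ: "a_comp G Q \<phi> R n r = aQ ((\<phi> ^^ n) r)"
  unfolding a_comp_def aQ_def ..

text \<open>The property defining \<open>aE\<close> speaks of frames in \<open>R\<close>. Writing
  \<open>p\<close> as such a frame times an element of \<open>AN\<close> shifts both potentials by
  the same vector and leaves \<open>q p\<close> unchanged.\<close>

lemma aE_q: assumes p: "p \<in> E" shows "aE n (q p) = aQ ((\<phi> ^^ n) p) - aQ p"
proof -
  obtain r A m where r: "r \<in> R" "A \<in> aa G" "m \<in> grp_N G" "p = r \<triangleleft> (expo G A \<otimes> m)" by (rule R_iwasawa[OF p])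
  have rE: "r \<in> E" using r(1) R_sub by blast
  note c = N_closed[OF r(3)]
  have "q p = q r" unfolding r(4) by (rule q_act[OF rE AN_parabolic[OF r(2,3)]])
  then have "aE n (q p) = aQ ((\<phi> ^^ n) r)" using aE r(1) a_comp_aQ unfolding iwasawa_cocycle_def by simp
  moreover have "aQ ((\<phi> ^^ n) p) = aQ ((\<phi> ^^ n) r) + A"
    unfolding r(4) by (subst funpow_\<phi>_act[OF rE]) (use c aQ_act[OF funpow_\<phi>[OF rE] r(2,3)] in auto)
  moreover have "aQ p = A" unfolding r(4) using aQ_act[OF rE r(2,3)] aQ_R[OF r(1)] by simp
  ultimately show ?thesis by simp
qed

lemma aE_Suc: assumes "p \<in> E" shows "aE (Suc n) (q p) = aE n (q (\<phi> p)) + aE 1 (q p)"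
  using assms by (simp add: aE_q funpow_swap1)

text \<open>A local section of \<open>R\<close> is compared with \<open>p\<close> in a
  trivialisation of \<open>Q\<close>: \<open>inv (\<tau> r) \<otimes> \<tau> p\<close> is the group
  element leading from \<open>r\<close> to \<open>p\<close>, and its Iwasawa component depends
  continuously on \<open>p\<close>.\<close>

lemma aQ_continuous: "continuous_map (total Q) euclidean aQ"
proof -
  have "\<exists>U. openin (base Q) U \<and> x \<in> U \<and> continuous_map (subtopology (total Q) {p \<in> E. proj Q p \<in> U}) euclidean aQ"
    if x: "x \<in> topspace (base Q)" for x
  proof -
    obtain U \<tau> \<sigma> where t: "triv U \<tau> \<sigma>" "x \<in> U" by (rule triv_exists[OF x])
    obtain U' \<tau>' \<sigma>' where t': "RB.triv U' \<tau>' \<sigma>'" "x \<in> U'" using RB.triv_exists[of x] x by auto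
    have o: "openin (base Q) (U \<inter> U')" using trivD(1)[OF t(1)] RB.trivD(1)[OF t'(1)] by auto
    let ?S = "subtopology (total Q) {p \<in> E. proj Q p \<in> U \<inter> U'}"
    have s': "\<sigma>' u \<in> R" "proj Q (\<sigma>' u) = u" if "u \<in> U'" for u
      using RB.trivD(4,5)[OF t'(1) that] R_sub by auto
    have "continuous_map ?S (base Q) (proj Q)" by (rule continuous_map_from_subtopology[OF bundle_parts(4)])
    then have pr: "continuous_map ?S (subtopology (base Q) U') (proj Q)"
      by (rule continuous_map_into_subtopology) auto
    have "continuous_map (subtopology (base Q) U') (total Q) \<sigma>'"
      using RB.trivD(3)[OF t'(1)] by (simp add: continuous_map_in_subtopology)
    from continuous_map_compose[OF pr this] have "continuous_map ?S (total Q) (\<lambda>p. \<sigma>' (proj Q p))" by (simp add: comp_def)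
    then have "continuous_map ?S (subtopology (total Q) {p \<in> E. proj Q p \<in> U}) (\<lambda>p. \<sigma>' (proj Q p))"
      by (rule continuous_map_into_subtopology) (use s' R_sub in auto)
    from continuous_map_compose[OF continuous_map_compose[OF this trivD(2)[OF t(1)]] continuous_inv]
    have c1: "continuous_map ?S (topol G) (\<lambda>p. inv (\<tau> (\<sigma>' (proj Q p))))" by (simp add: comp_def)
    have c2: "continuous_map ?S (topol G) \<tau>"
      by (rule continuous_map_from_subtopology_mono[OF trivD(2)[OF t(1)]]) auto
    from continuous_map_compose[OF continuous_map_compose[OF continuous_map_pairedI[OF c1 c2] continuous_mult] iwaH_continuous]
    have "continuous_map ?S euclidean (\<lambda>p. iwaH (inv (\<tau> (\<sigma>' (proj Q p))) \<otimes> \<tau> p))" by (simp add: comp_def)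
    then have "continuous_map ?S euclidean aQ"
    proof (rule continuous_map_eq)
      fix p assume "p \<in> topspace ?S"
      then have p: "p \<in> E" "proj Q p \<in> U" "proj Q p \<in> U'" by auto
      let ?r = "\<sigma>' (proj Q p)"
      have r: "?r \<in> R" "?r \<in> E" "proj Q ?r = proj Q p" using s'[OF p(3)] R_sub by auto
      obtain g where g: "g \<in> carrier G" "p = ?r \<triangleleft> g" by (rule fibre_transitive[OF r(2) p(1) r(3)])
      have rU: "proj Q ?r \<in> U" using r(3) p(2) by simp
      have "\<tau> p = \<tau> ?r \<otimes> g" using triv_act[OF t(1) r(2) rU g(1)] g(2) by simp
      then have "inv (\<tau> ?r) \<otimes> \<tau> p = g" using trivD(8)[OF t(1) r(2) rU] g(1) by simp
      moreover have "aQ p = iwaH g" using aQ_eq_iwaH[OF r(1) g(1)] g(2) by simp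
      ultimately show "iwaH (inv (\<tau> ?r) \<otimes> \<tau> p) = aQ p" by simp
    qed
    then show ?thesis using o t(2) t'(2) by blast
  qed
  then obtain U where U: "\<And>x. x \<in> topspace (base Q) \<Longrightarrow> openin (base Q) (U x) \<and> x \<in> U x \<and>
      continuous_map (subtopology (total Q) {p \<in> E. proj Q p \<in> U x}) euclidean aQ" by metis
  show ?thesis
  proof (rule pasting_lemma[where I="topspace (base Q)" and T="\<lambda>x. {p \<in> E. proj Q p \<in> U x}" and f="\<lambda>_. aQ"])
    show "openin (total Q) {p \<in> E. proj Q p \<in> U x}" if "x \<in> topspace (base Q)" for x
      by (rule openin_over) (use U[OF that] in blast)
    show "\<exists>j. j \<in> topspace (base Q) \<and> p \<in> {p \<in> E. proj Q p \<in> U j} \<and> aQ p = aQ p" if "p \<in> E" for p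
      using U[OF proj_closed[OF that]] that by (intro exI[of _ "proj Q p"]) auto
  qed (use U in auto)
qed

lemma aE1_continuous: "continuous_map FE euclidean (aE 1)"
proof (rule continuous_compose_quotient_map[OF q_quotient])
  have "continuous_map (total Q) euclidean (\<lambda>p. aQ (\<phi> p) - aQ p)"
    using continuous_map_compose[OF \<phi>_continuous aQ_continuous]
    by (intro continuous_map_diff aQ_continuous) (simp add: comp_def)
  then show "continuous_map (total Q) euclidean (aE 1 \<circ> q)"
    by (rule continuous_map_eq) (simp add: aE_q)
qed

text \<open>Elements of \<open>AN\<close> do not move the flag, so \<open>R\<close> already meets
  every point. As \<open>R\<close> is compact, so is the flag bundle.\<close>

lemma q_R: "q ` R = topspace FE"
proof -
  have "q p \<in> q ` R" if p: "p \<in> E" for p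
  proof -
    obtain r A m where r: "r \<in> R" "A \<in> aa G" "m \<in> grp_N G" "p = r \<triangleleft> (expo G A \<otimes> m)" by (rule R_iwasawa[OF p])
    have "q p = q r" unfolding r(4) by (rule q_act[OF _ AN_parabolic[OF r(2,3)]]) (use r(1) R_sub in blast)
    then show ?thesis using r(1) by simp
  qed
  then show ?thesis unfolding topspace_FE using R_sub by blast
qed

lemma FE_compact: "compact_space FE"
  unfolding compact_space_def q_R[symmetric] by (rule image_compactin[OF R_compact q_continuous])

lemma aE1_bounded: "\<exists>B. \<forall>p\<in>E. norm (aE 1 (q p)) \<le> B"
proof -
  have "compactin euclidean (aE 1 ` topspace FE)"
    by (rule image_compactin[OF _ aE1_continuous]) (use FE_compact in \<open>simp add: compact_space_def\<close>)
  then have "bounded (aE 1 ` topspace FE)" by (simp add: compact_imp_bounded)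
  then show ?thesis unfolding bounded_iff topspace_FE by auto
qed

text \<open>Every frame is a frame of the compact \<open>R\<close> times an element of the
  \<sigma>-compact group.\<close>

lemma E_sigma_compact: "sigma_compactin (total Q) E"
proof -
  have "sigma_compactin (prod_topology (total Q) (topol G)) (R \<times> carrier G)"
    by (rule sigma_compactin_Times[OF compactin_imp_sigma[OF R_compact] carrier_sigma_compact])
  from sigma_compactin_image[OF this bundle_parts(1)]
  have "sigma_compactin (total Q) ((\<lambda>(p, g). p \<triangleleft> g) ` (R \<times> carrier G))" .
  moreover have "(\<lambda>(p, g). p \<triangleleft> g) ` (R \<times> carrier G) = E"
  proof (intro equalityI subsetI)
    fix p assume p: "p \<in> E"
    obtain r A m where r: "r \<in> R" "A \<in> aa G" "m \<in> grp_N G" "p = r \<triangleleft> (expo G A \<otimes> m)" by (rule R_iwasawa[OF p])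
    then show "p \<in> (\<lambda>(p, g). p \<triangleleft> g) ` (R \<times> carrier G)"
      using N_closed[OF r(3)] by (intro image_eqI[of _ _ "(r, expo G A \<otimes> m)"]) auto
  qed (use R_sub in auto)
  ultimately show ?thesis by simp
qed

end

section \<open>Fibres over the Lyapunov section\<close>

locale lyap = cocyc G Q H \<phi> R aE for G :: "('g, 'l::euclidean_space, 'm) cartan_data_scheme" (structure)
    and Q :: "('x, 'q, 'g) bundle_data" and H :: 'l and \<phi> :: "'q \<Rightarrow> 'q" and R :: "'q set"
    and aE :: "nat \<Rightarrow> ('q \<times> 'g set) set \<Rightarrow> 'l" +
  fixes \<nu> :: "'x measure" and \<Omega> :: "'x set" and chi :: "'x \<Rightarrow> ('q \<times> 'l) set"
  assumes erg: "ergodic_measure (base Q) (base_map Q \<phi>) \<nu>"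
    and \<Omega>_meas: "\<Omega> \<in> sets \<nu>" and \<Omega>_full: "measure \<nu> \<Omega> = 1" and \<Omega>_base: "base_map Q \<phi> ` \<Omega> = \<Omega>"
    and chi_meas: "chi \<in> restrict_space \<nu> \<Omega> \<rightarrow>\<^sub>M borel_of ADE"
    and chi_proj: "x \<in> \<Omega> \<Longrightarrow> assoc_proj Q (chi x) = x"
    and chi_equi: "x \<in> \<Omega> \<Longrightarrow> chi (base_map Q \<phi> x) = assoc_map \<phi> (chi x)"
begin

lemma nu_parts: "prob_space \<nu>" "sets \<nu> = sets (borel_of (base Q))" "base_map Q \<phi> \<in> \<nu> \<rightarrow>\<^sub>M \<nu>"
    "distr \<nu> \<nu> (base_map Q \<phi>) = \<nu>"
    "\<forall>A\<in>sets \<nu>. base_map Q \<phi> -` A \<inter> space \<nu> = A \<longrightarrow> measure \<nu> A \<in> {0, 1}"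
  using erg unfolding ergodic_measure_def by - (elim conjE, assumption)+

lemma space_nu: "space \<nu> = topspace (base Q)"
  using sets_eq_imp_space_eq[OF nu_parts(2)] by simp

lemma \<Omega>_sub: "\<Omega> \<subseteq> topspace (base Q)"
  using sets.sets_into_space[OF \<Omega>_meas] space_nu by simp

lemma space_\<Omega>: "space (restrict_space \<nu> \<Omega>) = \<Omega>"
  using sets.sets_into_space[OF \<Omega>_meas] by (simp add: space_restrict_space Int_absorb2)

lemma chi_vimage: assumes "A \<in> sets (borel_of ADE)" shows "{x \<in> \<Omega>. chi x \<in> A} \<in> sets \<nu>"
proof -
  have "chi -` A \<inter> space (restrict_space \<nu> \<Omega>) \<in> sets (restrict_space \<nu> \<Omega>)"
    by (rule measurable_sets[OF chi_meas assms])
  moreover have "chi -` A \<inter> space (restrict_space \<nu> \<Omega>) = {x \<in> \<Omega>. chi x \<in> A}" unfolding space_\<Omega> by blast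
  moreover have "\<Omega> \<inter> space \<nu> \<in> sets \<nu>" using \<Omega>_meas by simp
  ultimately show ?thesis using sets_restrict_space_iff[of \<Omega> \<nu>] by simp
qed

lemma chi_lift: assumes x: "x \<in> \<Omega>" obtains p where "p \<in> E" "\<beta> p = chi x" "proj Q p = x"
proof -
  have "chi x \<in> topspace ADE" using measurable_space[OF chi_meas, of x] x space_\<Omega> by simp
  then have "chi x \<in> \<beta> ` E" unfolding topspace_ADE .
  then obtain p where p: "chi x = \<beta> p" "p \<in> E" by (rule imageE)
  have "proj Q p = x" using chi_proj[OF x] unfolding p(1) assoc_proj_pt[OF p(2)] .
  then show ?thesis using that p by simp
qed

definition fib :: "'x \<Rightarrow> 'q set" where "fib x = {p \<in> E. \<beta> p = chi x}"

lemma fibD: "x \<in> \<Omega> \<Longrightarrow> p \<in> fib x \<Longrightarrow> p \<in> E \<and> proj Q p = x"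
  unfolding fib_def using chi_proj[of x] assoc_proj_pt[of p "Ad G" H] by auto

section \<open>Functions that see the fibres as compact sets\<close>

definition J :: "'g set" where "J = Z_of G H \<inter> P"

text \<open>Functions of \<open>q p\<close> are invariant under \<open>P\<close>, functions of
  \<open>\<beta> p\<close> under \<open>Z_of G H\<close>; invariance under \<open>J\<close> admits
  both. The first kind carries measures to the flag bundle, the second locates the fibres.\<close>

definition V :: "('q \<Rightarrow> real) set" where
  "V = {f. continuous_map (total Q) euclideanreal f \<and> (\<exists>B. \<forall>p\<in>E. \<bar>f p\<bar> \<le> B) \<and> (\<forall>p\<in>E. \<forall>j\<in>J. f (p \<triangleleft> j) = f p)}"

lemma VI:
  assumes "continuous_map (total Q) euclideanreal f" "\<And>p. p \<in> E \<Longrightarrow> \<bar>f p\<bar> \<le> B"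
    "\<And>p j. p \<in> E \<Longrightarrow> j \<in> J \<Longrightarrow> f (p \<triangleleft> j) = f p"
  shows "f \<in> V"
  unfolding V_def using assms by blast

lemma VD:
  assumes "f \<in> V"
  shows "continuous_map (total Q) euclideanreal f" "\<exists>B. \<forall>p\<in>E. \<bar>f p\<bar> \<le> B" "p \<in> E \<Longrightarrow> j \<in> J \<Longrightarrow> f (p \<triangleleft> j) = f p"
  using assms unfolding V_def by blast+

lemma V_comp2:
  fixes F :: "real \<Rightarrow> real \<Rightarrow> real"
  assumes f: "f \<in> V" "g \<in> V" and c: "continuous_map (total Q) euclideanreal (\<lambda>p. F (f p) (g p))"
    and b: "\<And>A B. \<exists>C. \<forall>a b. \<bar>a\<bar> \<le> A \<longrightarrow> \<bar>b\<bar> \<le> B \<longrightarrow> \<bar>F a b\<bar> \<le> C"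
  shows "(\<lambda>p. F (f p) (g p)) \<in> V"
proof -
  obtain A where A: "\<forall>p\<in>E. \<bar>f p\<bar> \<le> A" using VD(2)[OF f(1)] ..
  obtain B where B: "\<forall>p\<in>E. \<bar>g p\<bar> \<le> B" using VD(2)[OF f(2)] ..
  obtain C where C: "\<forall>a b. \<bar>a\<bar> \<le> A \<longrightarrow> \<bar>b\<bar> \<le> B \<longrightarrow> \<bar>F a b\<bar> \<le> C" using b by blast
  show ?thesis
    by (rule VI[OF c, of C]) (use A B C VD(3)[OF f(1)] VD(3)[OF f(2)] in auto)
qed

lemma V_mult: assumes "f \<in> V" "g \<in> V" shows "(\<lambda>p. f p * g p) \<in> V"
proof (rule V_comp2[OF assms])
  show "continuous_map (total Q) euclideanreal (\<lambda>p. f p * g p)"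
    by (intro continuous_map_real_mult VD(1) assms)
  have "\<bar>a * b\<bar> \<le> A * B" if "\<bar>a\<bar> \<le> A" "\<bar>b\<bar> \<le> B" for a b A B :: real
    unfolding abs_mult by (rule mult_mono) (use that in auto)
  then show "\<exists>C. \<forall>a b. \<bar>a\<bar> \<le> A \<longrightarrow> \<bar>b\<bar> \<le> B \<longrightarrow> \<bar>a * b\<bar> \<le> C" for A B :: real by blast
qed

lemma V_add: assumes "f \<in> V" "g \<in> V" shows "(\<lambda>p. f p + g p) \<in> V"
proof (rule V_comp2[OF assms])
  show "continuous_map (total Q) euclideanreal (\<lambda>p. f p + g p)"
    by (intro continuous_map_add VD(1) assms)
  have "\<bar>a + b\<bar> \<le> A + B" if "\<bar>a\<bar> \<le> A" "\<bar>b\<bar> \<le> B" for a b A B :: real using that by linarith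
  then show "\<exists>C. \<forall>a b. \<bar>a\<bar> \<le> A \<longrightarrow> \<bar>b\<bar> \<le> B \<longrightarrow> \<bar>a + b\<bar> \<le> C" for A B :: real by blast
qed

lemma V_const: "(\<lambda>p. c) \<in> V"
  by (rule VI[of _ "\<bar>c\<bar>"]) auto

lemma V_max0: assumes "f \<in> V" shows "(\<lambda>p. max 0 (f p)) \<in> V"
proof (rule V_comp2[OF V_const[of 0] assms])
  show "continuous_map (total Q) euclideanreal (\<lambda>p. max 0 (f p))"
    by (intro continuous_map_real_max VD(1)[OF assms]) simp
  have "\<bar>max a b\<bar> \<le> max A B" if "\<bar>a\<bar> \<le> A" "\<bar>b\<bar> \<le> B" for a b A B :: real using that by linarith
  then show "\<exists>C. \<forall>a b. \<bar>a\<bar> \<le> A \<longrightarrow> \<bar>b\<bar> \<le> B \<longrightarrow> \<bar>max a b\<bar> \<le> C" for A B :: real by blast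
qed

lemma V_lattice: "fun_lattice E V"
  unfolding fun_lattice_def fun_subspace_def
  by (intro conjI ballI allI V_const V_add V_mult V_max0 VD(2))

lemma J_closed: "j \<in> J \<Longrightarrow> j \<in> carrier G" unfolding J_def using P_closed by blast

lemma V_\<phi>: assumes f: "f \<in> V" shows "(\<lambda>p. f (\<phi> p)) \<in> V"
proof -
  obtain B where B: "\<forall>p\<in>E. \<bar>f p\<bar> \<le> B" using VD(2)[OF f] ..
  show ?thesis
  proof (rule VI[of _ B])
    show "continuous_map (total Q) euclideanreal (\<lambda>p. f (\<phi> p))"
      using continuous_map_compose[OF \<phi>_continuous VD(1)[OF f]] by (simp add: comp_def)
  qed (use B VD(3)[OF f] J_closed \<phi>_act in auto)
qed

lemma V_base:
  assumes "continuous_map (base Q) euclideanreal g" "\<And>x. x \<in> topspace (base Q) \<Longrightarrow> \<bar>g x\<bar> \<le> B"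
  shows "(\<lambda>p. g (proj Q p)) \<in> V"
proof (rule VI[of _ B])
  show "continuous_map (total Q) euclideanreal (\<lambda>p. g (proj Q p))"
    using continuous_map_compose[OF bundle_parts(4) assms(1)] by (simp add: comp_def)
qed (use assms(2) J_closed in auto)

lemma V_flag:
  assumes "continuous_map FE euclideanreal g" "\<And>\<xi>. \<xi> \<in> topspace FE \<Longrightarrow> \<bar>g \<xi>\<bar> \<le> B"
  shows "(\<lambda>p. g (q p)) \<in> V"
proof (rule VI[of _ B])
  show "continuous_map (total Q) euclideanreal (\<lambda>p. g (q p))"
    using continuous_map_compose[OF q_continuous assms(1)] by (simp add: comp_def)
qed (use assms(2) topspace_FE J_def q_act in auto)

text \<open>A fibre is the orbit of a frame \<open>p0\<close> under \<open>Z_of G H\<close>, and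
  \<open>Z_decomposition\<close> splits off a factor in \<open>J\<close>, which members of
  \<open>V\<close> do not see. The orbit of \<open>p0\<close> under the compact
  \<open>K_of G H\<close> therefore carries all their values.\<close>

lemma fib_compact:
  assumes x: "x \<in> \<Omega>" obtains C where "compactin (total Q) C" "C \<subseteq> fib x" "\<forall>f\<in>V. f ` fib x = f ` C"
proof -
  obtain p0 where p0: "p0 \<in> E" "\<beta> p0 = chi x" by (rule chi_lift[OF x])
  let ?C = "(\<lambda>k. p0 \<triangleleft> k) ` K_of G H"
  have KZ: "k \<in> Z_of G H" "k \<in> carrier G" if "k \<in> K_of G H" for k
    using that K_closed unfolding K_of_def by auto
  have fibZ: "p0 \<triangleleft> z \<in> fib x" if z: "z \<in> Z_of G H" for z
  proof -
    have zc: "z \<in> carrier G" using z unfolding Z_of_def by blast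
    have "\<beta> p0 = \<beta> (p0 \<triangleleft> z)" using \<beta>_eq_iff[OF p0(1) act_closed[OF p0(1) zc]] z by blast
    then show ?thesis using p0 zc unfolding fib_def by simp
  qed
  show ?thesis
  proof (rule that)
    show "compactin (total Q) ?C" by (rule image_compactin[OF K_of_compact continuous_act_right[OF p0(1)]])
    show CF: "?C \<subseteq> fib x" using fibZ KZ by blast
    show "\<forall>f\<in>V. f ` fib x = f ` ?C"
    proof (intro ballI equalityI)
      fix f assume f: "f \<in> V"
      show "f ` ?C \<subseteq> f ` fib x" using CF by blast
      show "f ` fib x \<subseteq> f ` ?C"
      proof (rule image_subsetI)
        fix p assume p: "p \<in> fib x"
        then have pE: "p \<in> E" and pb: "\<beta> p0 = \<beta> p" using p0(2) unfolding fib_def by auto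
        obtain z where z: "z \<in> Z_of G H" "p = p0 \<triangleleft> z" using pb \<beta>_eq_iff[OF p0(1) pE] by blast
        obtain k j where kj: "k \<in> K_of G H" "j \<in> Z_of G H" "j \<in> P" "z = k \<otimes> j" by (rule Z_decomposition[OF H_aa z(1)])
        have "p = p0 \<triangleleft> k \<triangleleft> j" unfolding z(2) kj(4) by (rule act_mult[OF p0(1) KZ(2)[OF kj(1)] P_closed[OF kj(3)]])
        then have "f p = f (p0 \<triangleleft> k)" using VD(3)[OF f, of "p0 \<triangleleft> k" j] kj KZ(2)[OF kj(1)] p0(1) by (simp add: J_def)
        then show "f p \<in> f ` ?C" using kj(1) by blast
      qed
    qed
  qed
qed

text \<open>Dini's theorem on the compact set \<open>C\<close>, on which members of \<open>V\<close>
  take the same values as on the fibre.\<close>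

lemma dini:
  assumes F: "\<And>n::nat. F n \<in> V" "\<And>n p. p \<in> E \<Longrightarrow> F (Suc n) p \<le> F n p"
    "\<And>p. p \<in> E \<Longrightarrow> (\<lambda>n. F n p) \<longlonglongrightarrow> 0" and x: "x \<in> \<Omega>"
  shows "(\<lambda>n. SUP p\<in>fib x. F n p) \<longlonglongrightarrow> 0"
proof -
  obtain C where C: "compactin (total Q) C" "C \<subseteq> fib x" "\<forall>f\<in>V. f ` fib x = f ` C" by (rule fib_compact[OF x])
  obtain p0 where p0: "p0 \<in> fib x" using chi_lift[OF x] unfolding fib_def by blast
  have CE: "C \<subseteq> E" using C(1) by (rule compactin_subset_topspace)
  have dec: "decseq (\<lambda>n. F n p)" if "p \<in> E" for p using F(2)[OF that] by (rule decseq_SucI)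
  have nn: "0 \<le> F n p" if "p \<in> E" for n p by (rule decseq_ge[OF dec[OF that] F(3)[OF that]])
  have im: "F n ` fib x = F n ` C" for n using C(3) F(1) by blast
  have Cne: "C \<noteq> {}" using im[of 0] p0 by auto
  have bd: "bdd_above (F n ` C)" for n
  proof -
    obtain B where "\<forall>p\<in>E. \<bar>F n p\<bar> \<le> B" using VD(2)[OF F(1)] ..
    then show ?thesis using CE by (intro bdd_aboveI2[where M=B]) (auto simp: abs_le_iff)
  qed
  show ?thesis
  proof (rule LIMSEQ_I)
    fix e :: real assume e: "0 < e"
    let ?W = "\<lambda>n. {p \<in> E. F n p \<in> {..<e / 2}}"
    have Wo: "openin (total Q) (?W n)" for n
      by (rule openin_continuous_map_preimage[OF VD(1)[OF F(1)]]) simp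
    have "C \<subseteq> \<Union>(range ?W)"
    proof
      fix p assume "p \<in> C"
      then have pE: "p \<in> E" using CE by blast
      have "\<forall>\<^sub>F n in sequentially. F n p < e / 2" by (rule order_tendstoD(2)[OF F(3)[OF pE]]) (use e in simp)
      then obtain n where "F n p < e / 2" unfolding eventually_sequentially by blast
      then show "p \<in> \<Union>(range ?W)" using pE by auto
    qed
    then obtain \<F> where Fi: "finite \<F>" "\<F> \<subseteq> range ?W" "C \<subseteq> \<Union>\<F>"
      using compactinD[OF C(1), of "range ?W"] Wo by blast
    obtain I where I: "finite I" "\<F> = ?W ` I" using finite_subset_image[OF Fi(1,2)] by blast
    obtain N where N: "\<forall>i\<in>I. i \<le> N" using I(1) finite_nat_set_iff_bounded_le by blast
    show "\<exists>N. \<forall>n\<ge>N. norm ((SUP p\<in>fib x. F n p) - 0) < e"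
    proof (intro exI allI impI)
      fix n assume n: "N \<le> n"
      have le: "F n p \<le> e / 2" if p: "p \<in> C" for p
      proof -
        obtain i where i: "i \<in> I" "F i p < e / 2" using Fi(3) p unfolding I(2) by auto
        have "F n p \<le> F i p" using decseqD[OF dec, of p i n] i(1) N n p CE by fastforce
        then show ?thesis using i(2) by simp
      qed
      have "(SUP p\<in>C. F n p) \<le> e / 2" by (rule cSUP_least[OF Cne le])
      moreover obtain c where c: "c \<in> C" using Cne by blast
      have "0 \<le> (SUP p\<in>C. F n p)"
        using cSUP_upper[OF c bd[of n]] nn[of c n] c CE by force
      ultimately show "norm ((SUP p\<in>fib x. F n p) - 0) < e" using e im[of n] by simp
    qed
  qed
qed

text \<open>For \<open>x\<close> in \<open>\<Omega>\<close> the supremum exceeds \<open>c\<close>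
  exactly if \<open>chi x\<close> lies in the image under \<open>\<beta>\<close> of the set where
  \<open>f\<close> exceeds \<open>c\<close>. That set is a countable union of closed sets in a
  \<sigma>-compact space, so it is \<sigma>-compact and its image in the Hausdorff bundle is
  Borel.\<close>

lemma sup_meas:
  assumes f: "f \<in> V" shows "(\<lambda>x. if x \<in> \<Omega> then (SUP p\<in>fib x. f p) else 0) \<in> borel_measurable \<nu>"
    (is "?s \<in> _")
  unfolding borel_measurable_iff_greater
proof
  fix c :: real
  have sc: "sigma_compactin (total Q) {p \<in> E. c < f p}"
  proof -
    have "closedin (total Q) {p \<in> E. f p \<in> {c + 1 / real (Suc n)..}}" for n
      by (rule closedin_continuous_map_preimage[OF VD(1)[OF f]]) simp
    then have "sigma_compactin (total Q) (E \<inter> {p \<in> E. f p \<in> {c + 1 / real (Suc n)..}})" for n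
      by (rule sigma_compactin_closed[OF E_sigma_compact])
    then have "sigma_compactin (total Q) (\<Union>n. E \<inter> {p \<in> E. f p \<in> {c + 1 / real (Suc n)..}})"
      by (rule sigma_compactin_Union)
    moreover have "(\<Union>n. E \<inter> {p \<in> E. f p \<in> {c + 1 / real (Suc n)..}}) = {p \<in> E. c < f p}"
    proof (intro equalityI subsetI)
      fix p assume p: "p \<in> {p \<in> E. c < f p}"
      then obtain n where "1 / real (Suc n) < f p - c" using nat_approx_posE[of "f p - c"] by auto
      then have "c + 1 / real (Suc n) \<le> f p" by simp
      then show "p \<in> (\<Union>n. E \<inter> {p \<in> E. f p \<in> {c + 1 / real (Suc n)..}})" using p by auto
    next
      fix p assume "p \<in> (\<Union>n. E \<inter> {p \<in> E. f p \<in> {c + 1 / real (Suc n)..}})"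
      then obtain n where "p \<in> E" "c + 1 / real (Suc n) \<le> f p" by auto
      moreover have "0 < 1 / real (Suc n)" by simp
      ultimately have "c < f p" by linarith
      then show "p \<in> {p \<in> E. c < f p}" using \<open>p \<in> E\<close> by simp
    qed
    ultimately show ?thesis by simp
  qed
  have "\<beta> ` {p \<in> E. c < f p} \<in> sets (borel_of ADE)"
    by (rule borel_of_sigma_compact[OF ADE_Hausdorff sigma_compactin_image[OF sc \<beta>_continuous]])
  then have m: "{x \<in> \<Omega>. chi x \<in> \<beta> ` {p \<in> E. c < f p}} \<in> sets \<nu>" by (rule chi_vimage)
  obtain B where B: "\<forall>p\<in>E. \<bar>f p\<bar> \<le> B" using VD(2)[OF f] ..
  have 1: "c < ?s x \<longleftrightarrow> chi x \<in> \<beta> ` {p \<in> E. c < f p}" if x: "x \<in> \<Omega>" for x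
  proof -
    obtain p0 where p0: "p0 \<in> fib x" using chi_lift[OF x] unfolding fib_def by blast
    have "bdd_above (f ` fib x)"
      using B unfolding fib_def by (intro bdd_aboveI2[where M=B]) (auto simp: abs_le_iff)
    then have "c < (SUP p\<in>fib x. f p) \<longleftrightarrow> (\<exists>p\<in>fib x. c < f p)" by (intro less_cSUP_iff) (use p0 in auto)
    also have "\<dots> \<longleftrightarrow> chi x \<in> \<beta> ` {p \<in> E. c < f p}" unfolding fib_def image_iff by auto
    finally show ?thesis using x by simp
  qed
  \<comment> \<open>Off \<open>\<Omega>\<close> the function is 0, which exceeds \<open>c\<close>
    exactly for negative \<open>c\<close>.\<close>
  have "{x \<in> space \<nu>. c < ?s x} = {x \<in> \<Omega>. chi x \<in> \<beta> ` {p \<in> E. c < f p}} \<union> (if c < 0 then space \<nu> - \<Omega> else {})"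
  proof (intro Set.set_eqI)
    fix x
    have s: "x \<in> \<Omega> \<Longrightarrow> x \<in> space \<nu>" using \<Omega>_sub space_nu by blast
    show "x \<in> {x \<in> space \<nu>. c < ?s x} \<longleftrightarrow>
       x \<in> {x \<in> \<Omega>. chi x \<in> \<beta> ` {p \<in> E. c < f p}} \<union> (if c < 0 then space \<nu> - \<Omega> else {})"
    proof (cases "x \<in> \<Omega>")
      case True then show ?thesis using 1[OF True] s by simp
    qed simp
  qed
  then show "{x \<in> space \<nu>. c < ?s x} \<in> sets \<nu>" using m \<Omega>_meas by (simp add: sets.compl_sets)
qed

text \<open>A coordinate of \<open>\<beta> p\<close> in a trivialisation, made bounded by the
  injective \<open>arctan\<close> and cut off by \<open>r\<close>, which is meant to vanish on the
  base outside \<open>U\<close>.\<close>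

definition sep_fun :: "'x set \<Rightarrow> ('q \<Rightarrow> 'g) \<Rightarrow> ('x \<Rightarrow> real) \<Rightarrow> 'l \<Rightarrow> 'q \<Rightarrow> real" where
  "sep_fun U \<tau> r i p = (if p \<in> {p \<in> E. proj Q p \<in> U} then r (proj Q p) * arctan (Ad G (\<tau> p) H \<bullet> i) else 0)"

lemma arctan_bound: "\<bar>arctan t\<bar> \<le> 2"
  using arctan_lbound[of t] arctan_ubound[of t] pi_less_4 by linarith

lemma sep_fun_fibre:
  assumes t: "triv U \<tau> \<sigma>" and p: "p \<in> E" "p' \<in> E" "\<beta> p = \<beta> p'" shows "sep_fun U \<tau> r i p = sep_fun U \<tau> r i p'"
proof -
  obtain z where z: "z \<in> Z_of G H" "p' = p \<triangleleft> z" using p(3) \<beta>_eq_iff[OF p(1,2)] by blast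
  have "proj Q p' = proj Q p" unfolding z(2) by (rule proj_act[OF p(1)]) (use z(1) in \<open>simp add: Z_of_def\<close>)
  moreover have "Ad G (\<tau> p) H = Ad G (\<tau> p') H" if "proj Q p \<in> U"
    using \<beta>_triv[OF t p(1,2) that] p(3) by simp
  ultimately show ?thesis using p(1,2) by (simp add: sep_fun_def)
qed

lemma sep_fun_V:
  assumes t: "triv U \<tau> \<sigma>" and r: "continuous_map (base Q) euclideanreal r"
    "\<forall>x\<in>topspace (base Q). 0 \<le> r x \<and> r x \<le> 1" "\<forall>x\<in>topspace (base Q). x \<notin> U \<longrightarrow> r x = 0"
  shows "sep_fun U \<tau> r i \<in> V"
proof (rule VI[of _ 2])
  have "continuous_map euclidean euclideanreal (\<lambda>X. arctan (X \<bullet> i))" by (auto intro!: continuous_intros)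
  from continuous_map_compose[OF Ad_triv_continuous[OF t] this]
  have "continuous_map (subtopology (total Q) {p \<in> E. proj Q p \<in> U}) euclideanreal (\<lambda>p. arctan (Ad G (\<tau> p) H \<bullet> i))"
    by (simp add: comp_def)
  moreover have "continuous_map (total Q) euclideanreal (\<lambda>p. r (proj Q p))"
    using continuous_map_compose[OF bundle_parts(4) r(1)] by (simp add: comp_def)
  ultimately show "continuous_map (total Q) euclideanreal (sep_fun U \<tau> r i)"
    unfolding sep_fun_def[abs_def]
    by (intro continuous_map_extend_zero openin_over[OF trivD(1)[OF t]] arctan_bound) (use r(3) in auto)
  fix p assume p: "p \<in> E"
  have "\<bar>r (proj Q p)\<bar> * \<bar>arctan s\<bar> \<le> 1 * 2" for s
    using r(2) proj_closed[OF p] arctan_bound by (intro mult_mono) auto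
  then show "\<bar>sep_fun U \<tau> r i p\<bar> \<le> 2" unfolding sep_fun_def by (simp add: abs_mult)
  fix j assume j: "j \<in> J"
  then have "\<beta> p = \<beta> (p \<triangleleft> j)" using \<beta>_eq_iff[OF p act_closed[OF p J_closed[OF j]]] unfolding J_def by blast
  from sep_fun_fibre[OF t p act_closed[OF p J_closed[OF j]] this] show "sep_fun U \<tau> r i (p \<triangleleft> j) = sep_fun U \<tau> r i p" by simp
qed

text \<open>Finitely many trivialisations, countably many cut-offs for each and the finitely many
  coordinates suffice: over each base point some cut-off is positive, and the coordinates there
  determine \<open>\<beta> p\<close>.\<close>

lemma separating_family:
  "\<exists>\<H>. countable \<H> \<and> \<H> \<subseteq> V \<and> (\<forall>h\<in>\<H>. \<forall>x\<in>\<Omega>. \<forall>p\<in>fib x. \<forall>p'\<in>fib x. h p = h p') \<and>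
    (\<forall>p\<in>E. proj Q p \<in> \<Omega> \<longrightarrow> (\<forall>h\<in>\<H>. \<exists>p'\<in>fib (proj Q p). h p = h p') \<longrightarrow> p \<in> fib (proj Q p))"
proof -
  obtain I :: "('x set \<times> ('q \<Rightarrow> 'g) \<times> ('x \<Rightarrow> 'q)) set" where I: "finite I" "\<forall>(U, \<tau>, \<sigma>)\<in>I. triv U \<tau> \<sigma>"
    "topspace (base Q) \<subseteq> (\<Union>(U, \<tau>, \<sigma>)\<in>I. U)" by (rule finite_triv_cover[OF base_compact])
  have It: "triv (fst z) (fst (snd z)) (snd (snd z))" if "z \<in> I" for z using I(2) that by (cases z) auto
  have "\<forall>z\<in>I. \<exists>f :: nat \<Rightarrow> 'x \<Rightarrow> real. (\<forall>n. continuous_map (base Q) euclideanreal (f n) \<and> (\<forall>x\<in>topspace (base Q). 0 \<le> f n x \<and> f n x \<le> 1)) \<and>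
    (\<forall>x\<in>topspace (base Q). x \<in> fst z \<longleftrightarrow> (\<exists>n. 0 < f n x))"
    by (intro ballI open_cozero_cover[OF base_compact base_Hausdorff base_second_countable] trivD(1)[OF It])
  from bchoice[OF this] obtain f :: "_ \<Rightarrow> nat \<Rightarrow> 'x \<Rightarrow> real" where f: "\<forall>z\<in>I. (\<forall>n. continuous_map (base Q) euclideanreal (f z n) \<and>
      (\<forall>x\<in>topspace (base Q). 0 \<le> f z n x \<and> f z n x \<le> 1)) \<and> (\<forall>x\<in>topspace (base Q). x \<in> fst z \<longleftrightarrow> (\<exists>n. 0 < f z n x))" ..
  define h where "h = (\<lambda>(z, n, i). sep_fun (fst z) (fst (snd z)) (f z n) i)"
  let ?D = "I \<times> (UNIV :: nat set) \<times> (Basis :: 'l set)"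
  have f0: "f z n x = 0" if "z \<in> I" "x \<in> topspace (base Q)" "x \<notin> fst z" for z n x
    using f that by (metis order_less_le)
  have hD: "\<exists>z n i. u = sep_fun (fst z) (fst (snd z)) (f z n) i \<and> z \<in> I" if u: "u \<in> h ` ?D" for u
  proof -
    obtain t where t: "u = h t" "t \<in> ?D" by (rule imageE[OF u])
    obtain z n i where "t = (z, n, i)" by (cases t)
    then have "u = sep_fun (fst z) (fst (snd z)) (f z n) i \<and> z \<in> I" using t by (simp add: h_def)
    then show ?thesis by blast
  qed
  show ?thesis
  proof (intro exI[of _ "h ` ?D"] conjI ballI impI)
    show "countable (h ` ?D)" by (intro countable_image countable_SIGMA) (auto intro: countable_finite I(1))
    show "h ` ?D \<subseteq> V"
    proof
      fix u assume "u \<in> h ` ?D"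
      from hD[OF this] obtain z n i where u: "u = sep_fun (fst z) (fst (snd z)) (f z n) i" "z \<in> I" by (elim exE conjE)
      show "u \<in> V" unfolding u(1) by (rule sep_fun_V[OF It[OF u(2)]]) (use f f0 u(2) in blast)+
    qed
    show "u p = u p'" if uD: "u \<in> h ` ?D" and x: "x \<in> \<Omega>" "p \<in> fib x" "p' \<in> fib x" for u x p p'
    proof -
      from hD[OF uD] obtain z n i where u: "u = sep_fun (fst z) (fst (snd z)) (f z n) i" "z \<in> I" by (elim exE conjE)
      show ?thesis unfolding u(1) by (rule sep_fun_fibre[OF It[OF u(2)]]) (use x(2,3) in \<open>auto simp: fib_def\<close>)
    qed
    fix p assume p: "p \<in> E" "proj Q p \<in> \<Omega>" and e: "\<forall>u\<in>h ` ?D. \<exists>p'\<in>fib (proj Q p). u p = u p'"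
    let ?x = "proj Q p"
    have xB: "?x \<in> topspace (base Q)" by (rule proj_closed[OF p(1)])
    obtain p0 where p0: "p0 \<in> E" "\<beta> p0 = chi ?x" "proj Q p0 = ?x" by (rule chi_lift[OF p(2)])
    have "?x \<in> (\<Union>z\<in>I. fst z)" using I(3)[unfolded case_prod_unfold] xB by blast
    then obtain z where z: "z \<in> I" "?x \<in> fst z" by blast
    then obtain n where n: "0 < f z n ?x" using f xB by blast
    have "Ad G (fst (snd z) p) H = Ad G (fst (snd z) p0) H"
    proof (rule euclidean_eqI)
      fix i :: 'l assume i: "i \<in> Basis"
      have "h (z, n, i) \<in> h ` ?D" using z i by (intro imageI) simp
      then obtain p' where p': "p' \<in> fib ?x" "h (z, n, i) p = h (z, n, i) p'" using e by blast
      have "h (z, n, i) p' = h (z, n, i) p0"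
        unfolding h_def prod.case by (rule sep_fun_fibre[OF It[OF z(1)]]) (use p' p0 in \<open>auto simp: fib_def\<close>)
      then have "f z n ?x * arctan (Ad G (fst (snd z) p) H \<bullet> i) = f z n ?x * arctan (Ad G (fst (snd z) p0) H \<bullet> i)"
        using p'(2) p p0 z(2) unfolding h_def prod.case sep_fun_def by simp
      then show "Ad G (fst (snd z) p) H \<bullet> i = Ad G (fst (snd z) p0) H \<bullet> i" using n by (simp add: arctan_eq_iff)
    qed
    then have "\<beta> p = \<beta> p0" using \<beta>_triv[OF It[OF z(1)] p(1) p0(1) z(2)] p0(3) by simp
    then show "p \<in> fib ?x" unfolding fib_def using p(1) p0(2) by simp
  qed
qed

lemma exists_lift:
  "\<exists>m. space m = E \<and> sets m = sigma_sets E (cozero_sets E V) \<and> prob_space m \<and>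
    \<phi> \<in> m \<rightarrow>\<^sub>M m \<and> distr m m \<phi> = m \<and>
    (\<forall>A\<in>sets m. \<phi> -` A \<inter> space m = A \<longrightarrow> measure m A \<in> {0, 1}) \<and>
    proj Q \<in> m \<rightarrow>\<^sub>M \<nu> \<and> distr m \<nu> (proj Q) = \<nu> \<and> (AE p in m. proj Q p \<in> \<Omega> \<and> p \<in> fib (proj Q p))"
proof -
  obtain \<H> where h: "countable \<H>" "\<H> \<subseteq> V" "\<forall>h\<in>\<H>. \<forall>x\<in>\<Omega>. \<forall>p\<in>fib x. \<forall>p'\<in>fib x. h p = h p'"
    "\<forall>p\<in>E. proj Q p \<in> \<Omega> \<longrightarrow> (\<forall>h\<in>\<H>. \<exists>p'\<in>fib (proj Q p). h p = h p') \<longrightarrow> p \<in> fib (proj Q p)"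
    using separating_family by (elim exE conjE)
  let ?\<A> = "{C. closedin (base Q) C}"
  interpret fibre_lift E V \<phi> \<nu> "base_map Q \<phi>" "proj Q" \<Omega> fib ?\<A> \<H>
  proof (rule fibre_lift.intro)
    show "fun_lattice E V" by (rule V_lattice)
    show "(\<lambda>p. f p * g p) \<in> V" if "f \<in> V" "g \<in> V" for f g using that by (rule V_mult)
    show "(\<lambda>p. f (\<phi> p)) \<in> V" if "f \<in> V" for f using that by (rule V_\<phi>)
    show "\<phi> p \<in> E" if "p \<in> E" for p using that by (rule \<phi>_closed)
    show "proj Q p \<in> space \<nu>" if "p \<in> E" for p unfolding space_nu using that by (rule proj_closed)
    show "proj Q (\<phi> p) = base_map Q \<phi> (proj Q p)" if "p \<in> E" for p using that by (rule proj_\<phi>)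
    show "prob_space \<nu>" "base_map Q \<phi> \<in> \<nu> \<rightarrow>\<^sub>M \<nu>" "distr \<nu> \<nu> (base_map Q \<phi>) = \<nu>" by (rule nu_parts)+
    show "\<Omega> \<in> sets \<nu>" "measure \<nu> \<Omega> = 1" by (rule \<Omega>_meas \<Omega>_full)+
    show "base_map Q \<phi> x \<in> \<Omega>" if "x \<in> \<Omega>" for x using \<Omega>_base that by blast
    show "fib x \<noteq> {}" if x: "x \<in> \<Omega>" for x
    proof -
      obtain p where "p \<in> E" "\<beta> p = chi x" by (rule chi_lift[OF x])
      then show ?thesis unfolding fib_def by blast
    qed
    show "p \<in> E \<and> proj Q p = x" if "x \<in> \<Omega>" "p \<in> fib x" for x p using that by (rule fibD)
    show "\<phi> p \<in> fib (base_map Q \<phi> x)" if "x \<in> \<Omega>" "p \<in> fib x" for x p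
      using that chi_equi[OF that(1)] assoc_map_\<beta>[of p] unfolding fib_def by simp
    show "(\<lambda>x. if x \<in> \<Omega> then (SUP p\<in>fib x. f p) else 0) \<in> borel_measurable \<nu>" if "f \<in> V" for f
      using that by (rule sup_meas)
    show "(\<lambda>n. SUP p\<in>fib x. F n p) \<longlonglongrightarrow> 0" if "\<And>n::nat. F n \<in> V" "\<And>n p. p \<in> E \<Longrightarrow> F (Suc n) p \<le> F n p"
      "\<And>p. p \<in> E \<Longrightarrow> (\<lambda>n. F n p) \<longlonglongrightarrow> 0" "x \<in> \<Omega>" for F x using that by (rule dini)
    show "Int_stable ?\<A>" by (auto simp: Int_stable_def)
    show "?\<A> \<subseteq> Pow (space \<nu>)" unfolding space_nu using closedin_subset by blast
    show "space \<nu> \<in> ?\<A>" unfolding space_nu by simp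
    show "sets \<nu> = sigma_sets (space \<nu>) ?\<A>"
      unfolding space_nu nu_parts(2) sets_borel_of
    proof (rule sigma_sets_eqI)
      fix a assume "a \<in> {U. openin (base Q) U}"
      then have a: "openin (base Q) a" by simp
      have "topspace (base Q) - (topspace (base Q) - a) \<in> sigma_sets (topspace (base Q)) ?\<A>"
        by (rule sigma_sets.Compl, rule sigma_sets.Basic) (use a in blast)
      moreover have "topspace (base Q) - (topspace (base Q) - a) = a" using openin_subset[OF a] by blast
      ultimately show "a \<in> sigma_sets (topspace (base Q)) ?\<A>" by simp
    next
      fix b assume "b \<in> ?\<A>"
      then show "b \<in> sigma_sets (topspace (base Q)) {U. openin (base Q) U}"
        using borel_of_closed[of "base Q" b] unfolding sets_borel_of by simp
    qed
    show "\<exists>g::nat \<Rightarrow> 'x \<Rightarrow> real. \<forall>n. (\<lambda>p. g n (proj Q p)) \<in> V \<and>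
        (\<forall>x\<in>space \<nu>. 0 \<le> g n x \<and> g n x \<le> 1 \<and> (\<lambda>n. g n x) \<longlonglongrightarrow> indicator A x)" if A: "A \<in> ?\<A>" for A
    proof -
      have "closedin (base Q) A" using A by simp
      from closed_indicator_approx[OF base_compact base_Hausdorff base_second_countable this]
      obtain g :: "nat \<Rightarrow> 'x \<Rightarrow> real" where g: "\<forall>n. continuous_map (base Q) euclideanreal (g n) \<and>
        (\<forall>x\<in>topspace (base Q). 0 \<le> g n x \<and> g n x \<le> 1 \<and> (\<lambda>n. g n x) \<longlonglongrightarrow> indicator A x)" ..
      have "(\<lambda>p. g n (proj Q p)) \<in> V" for n by (rule V_base[of _ 1]) (use g in auto)
      then show ?thesis using g unfolding space_nu by blast
    qed
    show "countable \<H>" "\<H> \<subseteq> V" by (rule h)+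
    show "u p = u p'" if "u \<in> \<H>" "x \<in> \<Omega>" "p \<in> fib x" "p' \<in> fib x" for u x p p' using h(3) that by blast
    show "p \<in> fib (proj Q p)" if "p \<in> E" "proj Q p \<in> \<Omega>" "\<And>u. u \<in> \<H> \<Longrightarrow> \<exists>p'\<in>fib (proj Q p). u p = u p'" for p
      using h(4) that by blast
  qed
  show ?thesis by (rule exists_ergodic_lift) (use nu_parts(5) in blast)
qed

end

section \<open>The measure on the flag bundle\<close>

context lyap
begin

text \<open>The \<sigma>-algebra of \<open>m\<close> is generated by \<open>V\<close> only. Open
  sets of the flag bundle are countable unions of cozero sets of continuous functions, and these
  functions pull back into \<open>V\<close>.\<close>

lemma q_measurable:
  assumes "space m = E" "sets m = sigma_sets E (cozero_sets E V)" shows "q \<in> m \<rightarrow>\<^sub>M borel_of FE"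
proof (rule measurable_to_borel_of)
  show "q \<in> space m \<rightarrow> topspace FE" unfolding assms(1) topspace_FE by blast
  fix U assume "openin FE U"
  from open_cozero_cover[OF FE_compact FE_Hausdorff FE_second_countable this]
  obtain f :: "nat \<Rightarrow> _ \<Rightarrow> real" where f: "\<forall>n. continuous_map FE euclideanreal (f n) \<and> (\<forall>x\<in>topspace FE. 0 \<le> f n x \<and> f n x \<le> 1)"
    "\<forall>x\<in>topspace FE. x \<in> U \<longleftrightarrow> (\<exists>n. 0 < f n x)" by (elim exE conjE)
  have "(\<lambda>p. f n (q p)) \<in> V" for n by (rule V_flag[of _ 1]) (use f(1) in auto)
  then have "{p \<in> E. 0 < f n (q p)} \<in> sets m" for n
    unfolding assms(2) by (intro sigma_sets.Basic cozero_setsI)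
  then have "(\<Union>n. {p \<in> E. 0 < f n (q p)}) \<in> sets m" by blast
  moreover have "(\<Union>n. {p \<in> E. 0 < f n (q p)}) = q -` U \<inter> space m"
    using f(2) unfolding assms(1) topspace_FE by auto
  ultimately show "q -` U \<inter> space m \<in> sets m" by simp
qed

lemma flag_proj_measurable: "assoc_proj Q \<in> borel_of FE \<rightarrow>\<^sub>M \<nu>"
  using continuous_map_measurable[OF flag_proj_continuous] measurable_cong_sets[OF refl nu_parts(2)] by blast

lemma flag_over: "A \<in> sets \<nu> \<Longrightarrow> {\<xi> \<in> topspace FE. assoc_proj Q \<xi> \<in> A} \<in> sets (borel_of FE)"
  using measurable_sets[OF flag_proj_measurable, of A] by (simp add: vimage_def Int_def conj_commute)

text \<open>The complement of a closed set is a union of open rectangles. Grouping them by a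
  countable base of the flag bundle, with \<open>W B\<close> the largest open set whose product with
  \<open>B\<close> misses \<open>C\<close>, leaves a countable union in which \<open>chi\<close>
  enters only through preimages of open sets.\<close>

lemma graph_closed_measurable:
  assumes C: "closedin (prod_topology ADE FE) C"
  shows "{\<xi> \<in> topspace FE. assoc_proj Q \<xi> \<in> \<Omega> \<and> (chi (assoc_proj Q \<xi>), \<xi>) \<in> C} \<in> sets (borel_of FE)"
proof -
  obtain \<B> where B: "countable \<B>" "\<forall>V\<in>\<B>. openin FE V" "\<forall>U x. openin FE U \<and> x \<in> U \<longrightarrow> (\<exists>V\<in>\<B>. x \<in> V \<and> V \<subseteq> U)"
    using FE_second_countable unfolding second_countable_def by (elim exE conjE)
  define W where "W B = \<Union>{U. openin ADE U \<and> U \<times> B \<inter> C = {}}" for B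
  have Wo: "openin ADE (W B)" for B unfolding W_def by (rule openin_Union) blast
  let ?D = "\<lambda>B. B \<inter> {\<xi> \<in> topspace FE. assoc_proj Q \<xi> \<in> {x \<in> \<Omega>. chi x \<in> W B}}"
  have "?D B \<in> sets (borel_of FE)" if "B \<in> \<B>" for B
    using B(2) that by (intro sets.Int borel_of_open flag_over chi_vimage Wo) blast
  then have m: "(\<Union>B\<in>\<B>. ?D B) \<in> sets (borel_of FE)" by (intro sets.countable_UN'' B(1))
  have "{\<xi> \<in> topspace FE. assoc_proj Q \<xi> \<in> \<Omega> \<and> (chi (assoc_proj Q \<xi>), \<xi>) \<in> C} =
     {\<xi> \<in> topspace FE. assoc_proj Q \<xi> \<in> \<Omega>} - (\<Union>B\<in>\<B>. ?D B)"
  proof (intro equalityI subsetI)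
    fix \<xi> assume x: "\<xi> \<in> {\<xi> \<in> topspace FE. assoc_proj Q \<xi> \<in> \<Omega> \<and> (chi (assoc_proj Q \<xi>), \<xi>) \<in> C}"
    have "\<xi> \<notin> ?D B" for B
    proof
      assume "\<xi> \<in> ?D B"
      then have "\<xi> \<in> B" "chi (assoc_proj Q \<xi>) \<in> W B" by auto
      then show False using x unfolding W_def by blast
    qed
    then show "\<xi> \<in> {\<xi> \<in> topspace FE. assoc_proj Q \<xi> \<in> \<Omega>} - (\<Union>B\<in>\<B>. ?D B)" using x by blast
  next
    fix \<xi> assume x: "\<xi> \<in> {\<xi> \<in> topspace FE. assoc_proj Q \<xi> \<in> \<Omega>} - (\<Union>B\<in>\<B>. ?D B)"
    then have x1: "\<xi> \<in> topspace FE" "assoc_proj Q \<xi> \<in> \<Omega>" by auto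
    have "(chi (assoc_proj Q \<xi>), \<xi>) \<in> C"
    proof (rule ccontr)
      assume n: "(chi (assoc_proj Q \<xi>), \<xi>) \<notin> C"
      have "chi (assoc_proj Q \<xi>) \<in> topspace ADE"
        using measurable_space[OF chi_meas, of "assoc_proj Q \<xi>"] x1(2) space_\<Omega> by simp
      then have "(chi (assoc_proj Q \<xi>), \<xi>) \<in> topspace (prod_topology ADE FE) - C" using n x1(1) by simp
      moreover have "openin (prod_topology ADE FE) (topspace (prod_topology ADE FE) - C)" using C by blast
      ultimately have "\<exists>U V. openin ADE U \<and> openin FE V \<and> chi (assoc_proj Q \<xi>) \<in> U \<and> \<xi> \<in> V \<and>
          U \<times> V \<subseteq> topspace (prod_topology ADE FE) - C"
        unfolding openin_prod_topology_alt by blast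
      then obtain U Y where U: "openin ADE U" "openin FE Y" "chi (assoc_proj Q \<xi>) \<in> U" "\<xi> \<in> Y"
         "U \<times> Y \<subseteq> topspace (prod_topology ADE FE) - C" by (elim exE conjE)
      obtain B where Bx: "B \<in> \<B>" "\<xi> \<in> B" "B \<subseteq> Y" using B(3) U(2,4) by blast
      have "U \<times> B \<inter> C = {}" using U(5) Bx(3) by blast
      then have "chi (assoc_proj Q \<xi>) \<in> W B" unfolding W_def using U(1,3) by blast
      then have "\<xi> \<in> ?D B" using x1 Bx(2) by simp
      then show False using x Bx(1) by blast
    qed
    then show "\<xi> \<in> {\<xi> \<in> topspace FE. assoc_proj Q \<xi> \<in> \<Omega> \<and> (chi (assoc_proj Q \<xi>), \<xi>) \<in> C}" using x1 by simp
  qed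
  then show ?thesis using m flag_over[OF \<Omega>_meas] by simp
qed

lemma graph_measurable:
  assumes S: "sigma_compactin (prod_topology ADE FE) S"
  shows "{\<xi> \<in> topspace FE. assoc_proj Q \<xi> \<in> \<Omega> \<and> (chi (assoc_proj Q \<xi>), \<xi>) \<in> S} \<in> sets (borel_of FE)"
proof -
  obtain C :: "nat \<Rightarrow> _" where C: "\<forall>n. compactin (prod_topology ADE FE) (C n)" "S = (\<Union>n. C n)"
    by (rule sigma_compactinE[OF S])
  have "Hausdorff_space (prod_topology ADE FE)"
    unfolding Hausdorff_space_prod_topology using ADE_Hausdorff FE_Hausdorff by blast
  then have "closedin (prod_topology ADE FE) (C n)" for n using C(1) compactin_imp_closedin by blast
  then have "(\<Union>n. {\<xi> \<in> topspace FE. assoc_proj Q \<xi> \<in> \<Omega> \<and> (chi (assoc_proj Q \<xi>), \<xi>) \<in> C n}) \<in> sets (borel_of FE)"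
    using graph_closed_measurable by blast
  moreover have "(\<Union>n. {\<xi> \<in> topspace FE. assoc_proj Q \<xi> \<in> \<Omega> \<and> (chi (assoc_proj Q \<xi>), \<xi>) \<in> C n}) =
     {\<xi> \<in> topspace FE. assoc_proj Q \<xi> \<in> \<Omega> \<and> (chi (assoc_proj Q \<xi>), \<xi>) \<in> S}" unfolding C(2) by blast
  ultimately show ?thesis by simp
qed

lemma orbital_Ad_any: "orbital (Ad G) X"
  unfolding orbital_def by (simp add: Ad_mult)

context
  fixes k0 :: 'g and w :: "'g set" and H0 :: 'l
  assumes k0: "k0 \<in> carrier G" and w: "weyl_point G w = k0 <# P" and H0: "H0 = Ad G k0 H"
begin

lemma assoc_H0: "p \<in> E \<Longrightarrow> assoc_pt G Q (Ad G) p H0 = \<beta> (p \<triangleleft> k0)"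
  unfolding H0 by (rule assoc_shift[OF orbital_Ad _ k0])

lemma flag_pt_weyl:
  assumes "p \<in> E" "g \<in> carrier G" shows "flag_pt G Q p (g <# weyl_point G w) = q (p \<triangleleft> (g \<otimes> k0))"
proof -
  have "g <# weyl_point G w = (g \<otimes> k0) <# P" unfolding w by (rule lcos_m_assoc[OF P_sub assms(2) k0])
  then show ?thesis unfolding flag_pt_def using assoc_shift[OF orbital_flag assms(1), of "g \<otimes> k0"] assms(2) k0 by simp
qed

lemma N_minus_closed: "n \<in> N_minus_of G H0 \<Longrightarrow> n \<in> carrier G"
  unfolding N_minus_of_def by auto

lemma K_of_closed: "k \<in> K_of G H0 \<Longrightarrow> k \<in> carrier G"
  unfolding K_of_def Z_of_def by blast

text \<open>The frame in the class and the group element \<open>g\<close> of \<open>st_set\<close>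
  merge into a single frame \<open>p\<close>. This exhibits the fibre as an image of triples of a
  frame, an element of \<open>N_minus_of G H0\<close> and one of \<open>K_of G H0\<close>, subject
  to one equation.\<close>

lemma st_fiber_iff:
  assumes p1: "p1 \<in> E"
  shows "\<xi> \<in> st_fiber G Q H0 (\<beta> p1) w \<longleftrightarrow>
    (\<exists>p\<in>E. \<exists>n\<in>N_minus_of G H0. \<exists>k\<in>K_of G H0. \<beta> (p \<triangleleft> k0) = \<beta> p1 \<and> \<xi> = q (p \<triangleleft> (n \<otimes> k \<otimes> k0)))"
proof
  assume "\<xi> \<in> st_fiber G Q H0 (\<beta> p1) w"
  then obtain p' D b where 1: "(p', D) \<in> \<beta> p1" "b \<in> st_set G H0 D w" "\<xi> = flag_pt G Q p' b"
    unfolding st_fiber_def by auto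
  obtain h where h: "h \<in> carrier G" "p' = p1 \<triangleleft> h" "D = Ad G (inv h) H"
    using 1(1) unfolding assoc_pt_mem by auto
  obtain g n k where g: "b = (g \<otimes> n \<otimes> k) <# weyl_point G w" "g \<in> carrier G" "Ad G g H0 = D"
    "n \<in> N_minus_of G H0" "k \<in> K_of G H0" using 1(2) unfolding st_set_def by auto
  note c = h(1) g(2) N_minus_closed[OF g(4)] K_of_closed[OF g(5)] k0
  have p': "p' \<in> E" using h p1 by simp
  have "\<beta> (p' \<triangleleft> g \<triangleleft> k0) = assoc_pt G Q (Ad G) (p' \<triangleleft> g) H0" using assoc_H0 p' g(2) by simp
  also have "\<dots> = assoc_pt G Q (Ad G) p' D" unfolding g(3)[symmetric] by (rule assoc_shift[OF orbital_Ad_any p' g(2), symmetric])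
  also have "\<dots> = assoc_pt G Q (Ad G) (p1 \<triangleleft> h \<triangleleft> inv h) H"
    unfolding h(2,3) by (rule assoc_shift[OF orbital_Ad]) (use h(1) p1 in auto)
  also have "p1 \<triangleleft> h \<triangleleft> inv h = p1" using act_mult[OF p1 h(1) inv_closed[OF h(1)]] h(1) p1 by simp
  finally have "\<beta> (p' \<triangleleft> g \<triangleleft> k0) = \<beta> p1" .
  moreover have "\<xi> = q (p' \<triangleleft> g \<triangleleft> (n \<otimes> k \<otimes> k0))"
    using 1(3) g(1) flag_pt_weyl[OF p', of "g \<otimes> n \<otimes> k"] act_mult[OF p' g(2), of "n \<otimes> k \<otimes> k0"] c by (simp add: m_assoc)
  ultimately show "\<exists>p\<in>E. \<exists>n\<in>N_minus_of G H0. \<exists>k\<in>K_of G H0. \<beta> (p \<triangleleft> k0) = \<beta> p1 \<and> \<xi> = q (p \<triangleleft> (n \<otimes> k \<otimes> k0))"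
    using g(4,5) act_closed[OF p' g(2)] by blast
next
  assume "\<exists>p\<in>E. \<exists>n\<in>N_minus_of G H0. \<exists>k\<in>K_of G H0. \<beta> (p \<triangleleft> k0) = \<beta> p1 \<and> \<xi> = q (p \<triangleleft> (n \<otimes> k \<otimes> k0))"
  then obtain p n k where p: "p \<in> E" "n \<in> N_minus_of G H0" "k \<in> K_of G H0" "\<beta> (p \<triangleleft> k0) = \<beta> p1" "\<xi> = q (p \<triangleleft> (n \<otimes> k \<otimes> k0))" by blast
  note c = N_minus_closed[OF p(2)] K_of_closed[OF p(3)]
  have "(p, H0) \<in> \<beta> p1" using assoc_self[OF orbital_Ad_any p(1), of H0] assoc_H0[OF p(1)] p(4) by simp
  moreover have "(n \<otimes> k) <# weyl_point G w \<in> st_set G H0 H0 w"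
    unfolding st_set_def using p(2,3) c by (intro CollectI exI[of _ \<one>] exI[of _ n] exI[of _ k]) simp
  moreover have "\<xi> = flag_pt G Q p ((n \<otimes> k) <# weyl_point G w)" using flag_pt_weyl[OF p(1), of "n \<otimes> k"] c p(5) by simp
  ultimately show "\<xi> \<in> st_fiber G Q H0 (\<beta> p1) w" unfolding st_fiber_def by blast
qed

text \<open>Trivial \<open>n\<close> and \<open>k\<close> suffice, with the frame
  \<open>p \<triangleleft> inv k0\<close>: multiplying it by \<open>k0\<close> gives back
  \<open>p\<close>.\<close>

lemma fib_st_fiber:
  assumes x: "x \<in> \<Omega>" and p: "p \<in> fib x" shows "q p \<in> st_fiber G Q H0 (chi x) w"
proof -
  have pE: "p \<in> E" and b: "chi x = \<beta> p" using p unfolding fib_def by auto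
  have e: "p \<triangleleft> inv k0 \<triangleleft> k0 = p" using act_mult[OF pE inv_closed[OF k0] k0] k0 pE by simp
  have "expo G 0 \<in> N_minus_of G H0" unfolding N_minus_of_def by (intro imageI span_zero)
  then have n: "\<one> \<in> N_minus_of G H0" by simp
  have k: "\<one> \<in> K_of G H0" unfolding K_of_def Z_of_def using subgroup.one_closed[OF K_subgroup] by simp
  show ?thesis unfolding b st_fiber_iff[OF pE]
    by (intro bexI[of _ "p \<triangleleft> inv k0"] bexI[of _ \<one>] n k) (use e pE k0 in auto)
qed

text \<open>For \<open>\<xi>\<close> over \<open>\<Omega>\<close>, membership says that the pair of
  \<open>chi (assoc_proj Q \<xi>)\<close> and \<open>\<xi>\<close> lies in \<open>?S\<close>. The
  equation of \<open>st_fiber_iff\<close> has become the first component of a continuous map on a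
  \<sigma>-compact set, so \<open>graph_measurable\<close> applies.\<close>

lemma st_total_measurable: "st_total G Q \<Omega> H0 chi w \<in> sets (borel_of FE)"
proof -
  let ?f = "\<lambda>(p, n, k). (\<beta> (p \<triangleleft> k0), q (p \<triangleleft> (n \<otimes> k \<otimes> k0)))"
  let ?X = "prod_topology (total Q) (prod_topology (topol G) (topol G))"
  let ?S = "?f ` (E \<times> (N_minus_of G H0 \<times> K_of G H0))"
  have "continuous_map ?X ADE (\<lambda>z. \<beta> (fst z \<triangleleft> k0))"
    using continuous_map_compose[OF continuous_map_compose[OF continuous_map_fst continuous_act[OF k0]] \<beta>_continuous]
    by (simp add: comp_def)
  moreover have "continuous_map ?X FE (\<lambda>z. q (fst z \<triangleleft> (fst (snd z) \<otimes> snd (snd z) \<otimes> k0)))"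
  proof -
    have "continuous_map ?X (topol G) (\<lambda>z. (\<lambda>(x, y). x \<otimes> y) (snd z))"
      using continuous_map_compose[OF continuous_map_snd continuous_mult] by (simp add: comp_def)
    then have "continuous_map ?X (topol G) (\<lambda>z. fst (snd z) \<otimes> snd (snd z) \<otimes> k0)"
      using continuous_map_compose[OF _ continuous_rmult[OF k0]] by (simp add: comp_def case_prod_beta)
    from continuous_map_compose[OF continuous_map_compose[OF continuous_map_pairedI[OF continuous_map_fst this] bundle_parts(1)] q_continuous]
    show ?thesis by (simp add: comp_def)
  qed
  ultimately have "continuous_map ?X (prod_topology ADE FE) (\<lambda>z. (\<beta> (fst z \<triangleleft> k0), q (fst z \<triangleleft> (fst (snd z) \<otimes> snd (snd z) \<otimes> k0))))"
    by (rule continuous_map_pairedI)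
  then have c: "continuous_map ?X (prod_topology ADE FE) ?f" by (simp add: case_prod_beta')
  have "sigma_compactin ?X (E \<times> (N_minus_of G H0 \<times> K_of G H0))"
    by (intro sigma_compactin_Times E_sigma_compact N_minus_sigma_compact compactin_imp_sigma K_of_compact)
  then have S: "sigma_compactin (prod_topology ADE FE) ?S" by (rule sigma_compactin_image[OF _ c])
  have "st_total G Q \<Omega> H0 chi w = {\<xi> \<in> topspace FE. assoc_proj Q \<xi> \<in> \<Omega> \<and> (chi (assoc_proj Q \<xi>), \<xi>) \<in> ?S}"
  proof (intro equalityI subsetI)
    fix \<xi> assume "\<xi> \<in> st_total G Q \<Omega> H0 chi w"
    then obtain x where x: "x \<in> \<Omega>" "\<xi> \<in> st_fiber G Q H0 (chi x) w" unfolding st_total_def by blast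
    obtain p1 where p1: "p1 \<in> E" "\<beta> p1 = chi x" "proj Q p1 = x" by (rule chi_lift[OF x(1)])
    obtain p n k where p: "p \<in> E" "n \<in> N_minus_of G H0" "k \<in> K_of G H0" "\<beta> (p \<triangleleft> k0) = \<beta> p1" "\<xi> = q (p \<triangleleft> (n \<otimes> k \<otimes> k0))"
      using x(2) unfolding p1(2)[symmetric] st_fiber_iff[OF p1(1)] by blast
    have g: "n \<otimes> k \<otimes> k0 \<in> carrier G" using N_minus_closed[OF p(2)] K_of_closed[OF p(3)] k0 by simp
    have "assoc_proj Q (\<beta> (p \<triangleleft> k0)) = assoc_proj Q (\<beta> p1)" unfolding p(4) ..
    then have "proj Q p = x" using p1 p(1) k0 chi_proj[OF x(1)] by (simp add: assoc_proj_pt)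
    then have pr: "assoc_proj Q \<xi> = x" unfolding p(5) flag_pt_def using p(1) g by (simp add: assoc_proj_pt)
    have "(chi x, \<xi>) = ?f (p, n, k)" using p(4,5) p1(2) by simp
    then have "(chi x, \<xi>) \<in> ?S" using p(1-3) by blast
    moreover have "\<xi> \<in> topspace FE" unfolding topspace_FE p(5) by (rule imageI) (use p(1) g in simp)
    ultimately show "\<xi> \<in> {\<xi> \<in> topspace FE. assoc_proj Q \<xi> \<in> \<Omega> \<and> (chi (assoc_proj Q \<xi>), \<xi>) \<in> ?S}" using pr x(1) by simp
  next
    fix \<xi> assume "\<xi> \<in> {\<xi> \<in> topspace FE. assoc_proj Q \<xi> \<in> \<Omega> \<and> (chi (assoc_proj Q \<xi>), \<xi>) \<in> ?S}"
    then have x: "assoc_proj Q \<xi> \<in> \<Omega>" and s: "(chi (assoc_proj Q \<xi>), \<xi>) \<in> ?S" by auto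
    obtain p1 where p1: "p1 \<in> E" "\<beta> p1 = chi (assoc_proj Q \<xi>)" by (rule chi_lift[OF x])
    obtain t where t: "(chi (assoc_proj Q \<xi>), \<xi>) = ?f t" "t \<in> E \<times> (N_minus_of G H0 \<times> K_of G H0)" by (rule imageE[OF s])
    obtain p n k where "t = (p, n, k)" by (cases t)
    then have "p \<in> E" "n \<in> N_minus_of G H0" "k \<in> K_of G H0" "\<beta> (p \<triangleleft> k0) = \<beta> p1" "\<xi> = q (p \<triangleleft> (n \<otimes> k \<otimes> k0))"
      using t p1(2) by auto
    then have "\<xi> \<in> st_fiber G Q H0 (chi (assoc_proj Q \<xi>)) w"
      unfolding p1(2)[symmetric] st_fiber_iff[OF p1(1)] by blast
    then show "\<xi> \<in> st_total G Q \<Omega> H0 chi w" unfolding st_total_def using x by blast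
  qed
  then show ?thesis using graph_measurable[OF S] by simp
qed

end

lemma exists_ergodic_on_flags:
  assumes st: "st \<in> sets (borel_of FE)" "\<And>x p. x \<in> \<Omega> \<Longrightarrow> p \<in> fib x \<Longrightarrow> q p \<in> st"
    and lim: "\<And>x p. x \<in> \<Omega> \<Longrightarrow> p \<in> fib x \<Longrightarrow> (\<lambda>k. (1 / real k) *\<^sub>R aE k (q p)) \<longlonglongrightarrow> L"
  shows "\<exists>\<mu>. ergodic_measure FE (assoc_map \<phi>) \<mu> \<and> distr \<mu> \<nu> (assoc_proj Q) = \<nu> \<and>
    has_bochner_integral \<mu> (aE 1) L \<and> measure \<mu> st = 1"
proof -
  obtain m where m: "space m = E" "sets m = sigma_sets E (cozero_sets E V)" "prob_space m"
    "\<phi> \<in> m \<rightarrow>\<^sub>M m" "distr m m \<phi> = m" "\<forall>A\<in>sets m. \<phi> -` A \<inter> space m = A \<longrightarrow> measure m A \<in> {0, 1}"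
    "proj Q \<in> m \<rightarrow>\<^sub>M \<nu>" "distr m \<nu> (proj Q) = \<nu>" "AE p in m. proj Q p \<in> \<Omega> \<and> p \<in> fib (proj Q p)"
    using exists_lift by (elim exE conjE)
  interpret m: prob_space m by (rule m(3))
  have qm: "q \<in> m \<rightarrow>\<^sub>M borel_of FE" by (rule q_measurable[OF m(1,2)])
  define \<mu> where "\<mu> = distr m (borel_of FE) q"
  have s\<mu>: "sets \<mu> = sets (borel_of FE)" unfolding \<mu>_def by simp
  have sp\<mu>: "space \<mu> = topspace FE" unfolding \<mu>_def by simp
  have am0: "assoc_map \<phi> \<in> borel_of FE \<rightarrow>\<^sub>M borel_of FE" by (rule continuous_map_measurable[OF assoc_map_continuous])
  have am: "assoc_map \<phi> \<in> \<mu> \<rightarrow>\<^sub>M \<mu>" using am0 measurable_cong_sets[OF s\<mu> s\<mu>] by blast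
  have p\<mu>: "prob_space \<mu>" unfolding \<mu>_def by (rule m.prob_space_distr[OF qm])
  have q\<mu>: "q \<in> m \<rightarrow>\<^sub>M \<mu>" using qm measurable_cong_sets[OF refl s\<mu>] by blast
  have inv: "distr \<mu> \<mu> (assoc_map \<phi>) = \<mu>"
  proof -
    have "distr \<mu> \<mu> (assoc_map \<phi>) = distr \<mu> (borel_of FE) (assoc_map \<phi>)" by (rule distr_cong) (use s\<mu> in auto)
    also have "\<dots> = distr m (borel_of FE) (assoc_map \<phi> \<circ> q)"
      unfolding \<mu>_def by (rule distr_distr[OF am0 qm])
    also have "\<dots> = distr m (borel_of FE) (q \<circ> \<phi>)"
      by (rule distr_cong) (simp_all add: m(1) assoc_map_q)
    also have "\<dots> = distr (distr m m \<phi>) (borel_of FE) q" by (rule distr_distr[OF qm m(4), symmetric])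
    finally show ?thesis unfolding m(5) \<mu>_def .
  qed
  have meas: "measure \<mu> A = measure m (q -` A \<inter> space m)" if "A \<in> sets \<mu>" for A
    using that unfolding \<mu>_def by (subst measure_distr[OF qm]) simp_all
  have erg\<mu>: "measure \<mu> A \<in> {0, 1}" if A: "A \<in> sets \<mu>" "assoc_map \<phi> -` A \<inter> space \<mu> = A" for A
  proof -
    have "q -` A \<inter> space m \<in> sets m" by (rule measurable_sets[OF q\<mu> A(1)])
    moreover have "\<phi> -` (q -` A \<inter> space m) \<inter> space m = q -` A \<inter> space m"
    proof -
      have "q (\<phi> p) \<in> A \<longleftrightarrow> q p \<in> A" if p: "p \<in> E" for p
      proof -
        have "q p \<in> space \<mu>" unfolding sp\<mu> topspace_FE using p by blast
        then have "q p \<in> A \<longleftrightarrow> assoc_map \<phi> (q p) \<in> A" using A(2) by blast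
        then show ?thesis using assoc_map_q[OF p] by simp
      qed
      then show ?thesis unfolding m(1) by auto
    qed
    ultimately have "measure m (q -` A \<inter> space m) \<in> {0, 1}" using m(6) by blast
    then show ?thesis using meas[OF A(1)] by simp
  qed
  have proj: "distr \<mu> \<nu> (assoc_proj Q) = \<nu>"
  proof -
    have "distr \<mu> \<nu> (assoc_proj Q) = distr m \<nu> (assoc_proj Q \<circ> q)"
      unfolding \<mu>_def by (rule distr_distr[OF flag_proj_measurable qm])
    also have "\<dots> = distr m \<nu> (proj Q)"
      by (rule distr_cong) (simp_all add: m(1) flag_pt_def assoc_proj_pt)
    finally show ?thesis unfolding m(8) .
  qed
  have one: "measure \<mu> st = 1"
  proof -
    have "AE p in m. q p \<in> st" using m(9) by eventually_elim (use st(2) in blast)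
    then have "AE p in m. p \<in> q -` st \<inter> space m" by (rule AE_mp) (intro AE_I2 impI, simp)
    then have "measure m (q -` st \<inter> space m) = 1"
      using m.prob_eq_1[OF measurable_sets[OF qm st(1)]] by simp
    then show ?thesis using meas[of st] st(1) s\<mu> by simp
  qed
  obtain B where B: "\<forall>p\<in>E. norm (aE 1 (q p)) \<le> B" using aE1_bounded by blast
  have aEm0: "aE 1 \<in> borel_measurable (borel_of FE)"
    using continuous_map_measurable[OF aE1_continuous] measurable_cong_sets[OF refl borel_of_euclidean] by blast
  have int1: "integrable m (\<lambda>p. aE 1 (q p))"
    by (rule m.integrable_const_bound[of _ B]) (use B m(1) measurable_compose[OF qm aEm0] in auto)
  \<comment> \<open>The pointwise bound \<open>real n * B\<close> is carried through the induction
    because it dominates the averages in the limit below.\<close>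
  have k: "integrable m (\<lambda>p. aE n (q p)) \<and> (\<integral>p. aE n (q p) \<partial>m) = real n *\<^sub>R (\<integral>p. aE 1 (q p) \<partial>m) \<and>
      (\<forall>p\<in>E. norm (aE n (q p)) \<le> real n * B)" for n
  proof (induction n)
    case 0
    have z: "aE 0 (q p) = 0" if "p \<in> E" for p using aE_q[OF that, of 0] by simp
    have "integrable m (\<lambda>p. aE 0 (q p)) \<longleftrightarrow> integrable m (\<lambda>p. 0 :: 'l)"
      by (rule Bochner_Integration.integrable_cong) (use z m(1) in auto)
    moreover have "(\<integral>p. aE 0 (q p) \<partial>m) = (\<integral>p. 0 \<partial>m)"
      by (rule Bochner_Integration.integral_cong) (use z m(1) in auto)
    ultimately show ?case using z by simp
  next
    case (Suc n)
    let ?g = "\<lambda>p. aE n (q p)"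
    have gi: "integrable m ?g" using Suc by blast
    have i: "integrable m (\<lambda>p. ?g (\<phi> p))"
      using integrable_distr[OF m(4), of ?g] gi unfolding m(5) by simp
    have e: "(\<integral>p. ?g (\<phi> p) \<partial>m) = (\<integral>p. ?g p \<partial>m)"
      using integral_distr[OF m(4), of ?g] borel_measurable_integrable[OF gi] unfolding m(5) by simp
    have s: "aE (Suc n) (q p) = ?g (\<phi> p) + aE 1 (q p)" if "p \<in> E" for p by (rule aE_Suc[OF that])
    have "integrable m (\<lambda>p. aE (Suc n) (q p)) \<longleftrightarrow> integrable m (\<lambda>p. ?g (\<phi> p) + aE 1 (q p))"
      by (rule Bochner_Integration.integrable_cong) (use s m(1) in auto)
    moreover have "integrable m (\<lambda>p. ?g (\<phi> p) + aE 1 (q p))" by (rule Bochner_Integration.integrable_add[OF i int1])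
    moreover have "(\<integral>p. aE (Suc n) (q p) \<partial>m) = (\<integral>p. ?g (\<phi> p) + aE 1 (q p) \<partial>m)"
      by (rule Bochner_Integration.integral_cong) (use s m(1) in auto)
    moreover have "(\<integral>p. ?g (\<phi> p) + aE 1 (q p) \<partial>m) = (\<integral>p. ?g (\<phi> p) \<partial>m) + (\<integral>p. aE 1 (q p) \<partial>m)"
      by (rule Bochner_Integration.integral_add[OF i int1])
    moreover have "(\<integral>p. ?g p \<partial>m) = real n *\<^sub>R (\<integral>p. aE 1 (q p) \<partial>m)" using Suc by blast
    moreover have "norm (aE (Suc n) (q p)) \<le> real (Suc n) * B" if p: "p \<in> E" for p
    proof -
      have "norm (?g (\<phi> p)) \<le> real n * B" using Suc p by simp
      then have "norm (?g (\<phi> p) + aE 1 (q p)) \<le> real n * B + B"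
        using B p by (intro order.trans[OF norm_triangle_ineq] add_mono) auto
      then show ?thesis unfolding s[OF p] by (simp add: algebra_simps)
    qed
    ultimately show ?case using e by (simp add: algebra_simps)
  qed
  have "(\<lambda>n. \<integral>p. (1 / real n) *\<^sub>R aE n (q p) \<partial>m) \<longlonglongrightarrow> (\<integral>p. L \<partial>m)"
  proof (rule integral_dominated_convergence[where w="\<lambda>p. \<bar>B\<bar>"])
    show "(\<lambda>p. (1 / real n) *\<^sub>R aE n (q p)) \<in> borel_measurable m" for n
      using k borel_measurable_integrable by (intro borel_measurable_scaleR) auto
    show "AE p in m. (\<lambda>n. (1 / real n) *\<^sub>R aE n (q p)) \<longlonglongrightarrow> L"
      using m(9) by eventually_elim (use lim in blast)
    show "AE p in m. norm ((1 / real n) *\<^sub>R aE n (q p)) \<le> \<bar>B\<bar>" for n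
    proof (intro AE_I2)
      fix p assume "p \<in> space m"
      then have "norm (aE n (q p)) \<le> real n * B" using k[of n] m(1) by blast
      then have "(1 / real n) * norm (aE n (q p)) \<le> (1 / real n) * (real n * B)" by (rule mult_left_mono) simp
      also have "\<dots> \<le> \<bar>B\<bar>" using abs_ge_self[of B] by simp
      finally show "norm ((1 / real n) *\<^sub>R aE n (q p)) \<le> \<bar>B\<bar>" by simp
    qed
  qed auto
  moreover have "(\<integral>p. L \<partial>m) = L" using m.prob_space by simp
  \<comment> \<open>At index 0 the average is 0 by the convention for division by zero, so constancy
    is stated from index 1 on.\<close>
  moreover have "(\<integral>p. (1 / real (Suc n)) *\<^sub>R aE (Suc n) (q p) \<partial>m) = (\<integral>p. aE 1 (q p) \<partial>m)" for n
    using k[of "Suc n"] by (simp del: of_nat_Suc)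
  ultimately have "(\<lambda>n. \<integral>p. aE 1 (q p) \<partial>m) \<longlonglongrightarrow> L" using LIMSEQ_Suc by fastforce
  then have I: "(\<integral>p. aE 1 (q p) \<partial>m) = L" by (simp add: LIMSEQ_const_iff)
  have "has_bochner_integral \<mu> (aE 1) L"
    unfolding has_bochner_integral_iff
  proof
    show "integrable \<mu> (aE 1)" unfolding \<mu>_def by (subst integrable_distr_eq[OF qm aEm0]) (rule int1)
    show "integral\<^sup>L \<mu> (aE 1) = L" unfolding \<mu>_def by (subst integral_distr[OF qm aEm0]) (rule I)
  qed
  moreover have "ergodic_measure FE (assoc_map \<phi>) \<mu>"
    unfolding ergodic_measure_def using p\<mu> s\<mu> am inv erg\<mu> by blast
  ultimately show ?thesis using proj one by blast
qed

end

theorem proposition5p3: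
  fixes G :: "('g, 'l::euclidean_space) cartan_data"
    and Q :: "('x, 'q, 'g) bundle_data"
    and \<phi> :: "'q \<Rightarrow> 'q"
    and R :: "'q set"
    and aE :: "nat \<Rightarrow> ('q \<times> 'g set) set \<Rightarrow> 'l"
    and \<nu> :: "'x measure"
    and \<Omega> :: "'x set"
    and H_Ly :: 'l
    and chi_Ly :: "'x \<Rightarrow> ('q \<times> 'l) set"
    and w :: "'g set"
  assumes "reductive_lie_group G"
    and "iwasawa_decomposition G"
    and "compact_space (base Q)" and "metrizable_space (base Q)"
    and "principal_bundle G (topol G) Q"
    and "bundle_automorphism G Q \<phi>"
    and "ergodic_measure (base Q) (base_map Q \<phi>) \<nu>"
    and "K_subbundle G Q R"
    and "iwasawa_cocycle G Q \<phi> R aE"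
    and "lyapunov_data G Q \<phi> R aE \<nu> \<Omega> H_Ly chi_Ly"
    and "w \<in> carrier (weyl_group G)"
  shows "\<exists>\<mu>. ergodic_measure (flag_bundle G Q) (assoc_map \<phi>) \<mu> \<and>
           distr \<mu> \<nu> (assoc_proj Q) = \<nu> \<and>
           has_bochner_integral \<mu> (aE 1) (weyl_act G (inv\<^bsub>weyl_group G\<^esub> w) H_Ly) \<and>
           measure \<mu> (st_total G Q \<Omega> H_Ly chi_Ly w) = 1"
proof -
  interpret red_grp G using assms(1,2) by unfold_locales
  have lyap: "\<Omega> \<in> sets \<nu>" "measure \<nu> \<Omega> = 1" "base_map Q \<phi> ` \<Omega> = \<Omega>" "H_Ly \<in> closure (weyl_chamber G)"
    "chi_Ly \<in> restrict_space \<nu> \<Omega> \<rightarrow>\<^sub>M borel_of (adjoint_orbit_bundle G Q H_Ly)"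
    "\<forall>x\<in>\<Omega>. assoc_proj Q (chi_Ly x) = x \<and> chi_Ly (base_map Q \<phi> x) = assoc_map \<phi> (chi_Ly x)"
    "\<forall>x\<in>\<Omega>. \<forall>w\<in>carrier (weyl_group G). \<forall>\<xi>\<in>st_fiber G Q H_Ly (chi_Ly x) w.
        (\<lambda>k. (1 / real k) *\<^sub>R aE k \<xi>) \<longlonglongrightarrow> weyl_act G (inv\<^bsub>weyl_group G\<^esub> w) H_Ly"
    using assms(10) unfolding lyapunov_data_def by - (elim conjE, assumption)+
  obtain k0 where k0: "k0 \<in> norm_M" "w = {m \<otimes>\<^bsub>G\<^esub> k0 | m. m \<in> cent_M}" by (rule weyl_carrier[OF assms(11)])
  have k0c: "k0 \<in> carrier G" using k0(1) K_closed unfolding norm_M_def by blast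
  \<comment> \<open>This is the inverse of \<open>w\<close> applied to the polar exponent, computed
    with the representative \<open>k0\<close>, so that \<open>p \<cdot> H\<close> is
    \<open>(p \<triangleleft> inv k0) \<cdot> H_Ly\<close>.\<close>
  define H where "H = Ad G (inv\<^bsub>G\<^esub> k0) H_Ly"
  have H0: "H_Ly = Ad G k0 H" unfolding H_def using k0c by simp
  have H: "H \<in> aa G" unfolding H_def by (rule norm_M_aa[OF k0(1) chamber_aa[OF lyap(4)]])
  \<comment> \<open>\<open>H\<close> lies on the orbit of \<open>H_Ly\<close>, so
    \<open>chi_Ly\<close> is a section of the same bundle whichever of the two serves as reference
    point of the orbit.\<close>
  have "Ad_orbit G H_Ly = Ad_orbit G H"
  proof -
    have "(\<lambda>g. Ad G g H_Ly) ` carrier G = (\<lambda>g. Ad G g H) ` carrier G"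
    proof (intro equalityI image_subsetI)
      fix g assume g: "g \<in> carrier G"
      show "Ad G g H_Ly \<in> (\<lambda>g. Ad G g H) ` carrier G"
        by (rule image_eqI[of _ _ "g \<otimes>\<^bsub>G\<^esub> k0"]) (use g k0c in \<open>simp_all add: H0 Ad_mult\<close>)
      show "Ad G g H \<in> (\<lambda>g. Ad G g H_Ly) ` carrier G"
        by (rule image_eqI[of _ _ "g \<otimes>\<^bsub>G\<^esub> inv\<^bsub>G\<^esub> k0"]) (use g k0c in \<open>simp_all add: H_def Ad_mult\<close>)
    qed
    then show ?thesis unfolding Ad_orbit_def .
  qed
  then have orb: "adjoint_orbit_bundle G Q H_Ly = adjoint_orbit_bundle G Q H" unfolding adjoint_orbit_bundle_def by simp
  interpret lyap G Q H \<phi> R aE \<nu> \<Omega> chi_Ly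
    by unfold_locales (use assms H lyap(1-3,5,6) orb in auto)
  have wp: "weyl_point G w = k0 <#\<^bsub>G\<^esub> min_parabolic G" by (rule weyl_point_coset[OF k0])
  show ?thesis
  proof (rule exists_ergodic_on_flags)
    show "st_total G Q \<Omega> H_Ly chi_Ly w \<in> sets (borel_of (flag_bundle G Q))"
      by (rule st_total_measurable[OF k0c wp H0])
    fix x p assume x: "x \<in> \<Omega>" "p \<in> fib x"
    have s: "flag_pt G Q p (min_parabolic G) \<in> st_fiber G Q H_Ly (chi_Ly x) w" by (rule fib_st_fiber[OF k0c wp H0 x])
    then show "flag_pt G Q p (min_parabolic G) \<in> st_total G Q \<Omega> H_Ly chi_Ly w" unfolding st_total_def using x(1) by blast
    \<comment> \<open>\<open>lyapunov_data\<close> supplies the limit in exactly this form, with the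
      choice of representative made in \<open>weyl_act\<close>.\<close>
    show "(\<lambda>k. (1 / real k) *\<^sub>R aE k (flag_pt G Q p (min_parabolic G))) \<longlonglongrightarrow> weyl_act G (inv\<^bsub>weyl_group G\<^esub> w) H_Ly"
      using lyap(7) x(1) assms(11) s by blast
  qed
qed

end
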